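(* (The Prime Orbit Theorem with Error Term.) Let $\mathcal F_{\mathfrak w}$ be a suspended flow that satisfies conditions (H$_1$) and (H$_2$) described in the context. Then we have the following equality between distributions: $$\psi_{\mathfrak w}(x)=\frac{x^D}{D}+\sum_{\omega\in\mathcal D_{\mathfrak w}\setminus\{D,0\}}-\operatorname{ord}(\zeta_{\mathfrak w};\omega)\frac{x^\omega}{\omega}+\operatorname{res}\left(-\frac{x^s\zeta_{\mathfrak w}'(s)}{s\,\zeta_{\mathfrak w}(s)};0\right)+R(x),$$ where $\operatorname{ord}(\zeta_{\mathfrak w};\omega)<0$ denotes the order of $\zeta_{\mathfrak w}$ at $\omega$, and $$R(x)=-\frac1{2\pi i}\int_S\frac{\zeta_{\mathfrak w}'}{\zeta_{\mathfrak w}}(s)\,x^s\,\frac{ds}{s}=O\left(x^{\sup S}\right)\quad\text{as }x\to\infty.$$ If $0$ is not a complex dimension of the flow, then the third term on the right-hand side of the formula for $\psi_{\mathfrak w}$ simplifies to $-\frac{\zeta_{\mathfrak w}'}{\zeta_{\mathfrak w}}(0)$. In general, this term is of the form $p+q\log x$, for some constants $p$ and $q$. If $D$ is the only complex dimension on the line $\operatorname{Re}s=D$, then the error term $$\sum_{\omega\in\mathcal D_{\mathfrak w}\setminus\{D,0\}}-\operatorname{ord}(\zeta_{\mathfrak w};\omega)\frac{x^\omega}{\omega}+\operatorname{res}\left(-\frac{x^s\zeta_{\mathfrak w}'(s)}{s\,\zeta_{\mathfrak w}(s)};0\right)+R(x)$$ is estimated by $o(x^D)$ as $x\to\infty$.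 If this is the case, then we obtain a Prime Orbit Theorem for $\mathcal F_{\mathfrak w}$: $$\psi_{\mathfrak w}(x)=\frac{x^D}{D}+o(x^D)\quad\text{as }x\to\infty.$$
   Context: Suspended flow. Let $N\ge 0$ be an integer, $\Omega=\{1,\dots,N\}^{\mathbb N}$, $\sigma$ the left shift on $\Omega$, and $\mathfrak w:\Omega\to(0,\infty]$ a function (the weight), with the convention $e^{-s\infty}=0$. The suspended flow $\mathcal F_{\mathfrak w}$ on $[0,\infty)\times\Omega$ is $\mathcal F_{\mathfrak w}(t,a)=(t,a)$ if $0\le t<\mathfrak w(a)$ and $\mathcal F_{\mathfrak w}(t,a)=\mathcal F_{\mathfrak w}(t-\mathfrak w(a),\sigma a)$ if $t\ge\mathfrak w(a)$. For a finite sequence $\mathfrak x=a_1,\dots,a_l$ of length $l(\mathfrak x)=l\ge1$, let $a$ be the periodic sequence obtained by repeating $\mathfrak x$, and put $\mathfrak w_t(\mathfrak x)=\sum_{i=0}^{l-1}\mathfrak w(\sigma^i a)$. The dynamical zeta function is $\zeta_{\mathfrak w}(s)=\exp\left(\sum_{\mathfrak x}\frac1{l(\mathfrak x)}e^{-s\mathfrak w_t(\mathfrak x)}\right)$, the sum being over all finite sequences of positive length, and $$-\frac{\zeta_{\mathfrak w}'}{\zeta_{\mathfrak w}}(s)=\sum_{\mathfrak x}\frac{\mathfrak w_t(\mathfrak x)}{l(\mathfrak x)}e^{-s\mathfrak w_t(\mathfrak x)}.$$ This series is assumed to converge for some $s>0$; $D\ge0$ denotes its abscissa of convergence (the dimension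 of the flow). For a periodic orbit $\mathfrak p$ of $\sigma$ (a finite set $\{a,\sigma a,\dots\}\subset\Omega$), put $\mathfrak w_t(\mathfrak p)=\sum_{a\in\mathfrak p}\mathfrak w(a)$, and $$\psi_{\mathfrak w}(x)=\sum_{k\mathfrak w_t(\mathfrak p)\le\log x}\mathfrak w_t(\mathfrak p),$$ the sum over all pairs of a periodic orbit $\mathfrak p$ and an integer $k\ge1$ with $k\mathfrak w_t(\mathfrak p)\le\log x$. Screen and window. $S:\mathbb R\to\mathbb R$ is a bounded Lipschitz continuous function with $S(t)<D$ for all $t$; the screen, also denoted $S$, is the curve $\{S(t)+it:t\in\mathbb R\}$, and $\sup S=\sup_tS(t)$. The window is $W=\{\sigma+it:\sigma\ge S(t)\}$. It is assumed that $-\zeta_{\mathfrak w}'/\zeta_{\mathfrak w}$ has a meromorphic extension to a neighborhood of $W$, with simple poles. The complex dimensions of the flow are the poles of $-\zeta_{\mathfrak w}'/\zeta_{\mathfrak w}$ in $W$; their set is $\mathcal D_{\mathfrak w}=\mathcal D_{\mathfrak w}(W)$. One writes $\operatorname{ord}(\zeta_{\mathfrak w};\omega)=\operatorname{res}(\zeta_{\mathfrak w}'/\zeta_{\mathfrak w};\omega)$, which is the order of $\zeta_{\mathfrak w}$ at $\omega$ if $\zeta_{\mathfrak w}$ is meromorphic there; the notation is used even if the residue is not an integer. Here $\operatorname{res}(g;\omega)$ is the residue of $g$ at $\omega$. Growth conditions. There exist constants $\kappa\ge0$, $C>0$ and real numbers $\{T_n\}_{n\in\mathbb Z}$ with $T_n\to\pm\infty$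 as $n\to\pm\infty$, $T_{-n}<0<T_n$ for $n\ge1$, $\lim_{n\to\infty}T_n/|T_{-n}|=1$, such that, with $\zeta_\eta=-\zeta_{\mathfrak w}'/\zeta_{\mathfrak w}$: (H$_1$) $|\zeta_\eta(\sigma+iT_n)|\le C|T_n|^\kappa$ for all $n\in\mathbb Z$ and all $\sigma\ge S(T_n)$; (H$_2$) $|\zeta_\eta(S(t)+it)|\le C|t|^\kappa$ for all $t\in\mathbb R$ with $|t|\ge1$. Distributions. Distributions act on test functions $\varphi$ on $(0,\infty)$; a function $F$ acts by $\langle F,\varphi\rangle=\int_0^\infty F(x)\varphi(x)\,dx$, and $R$ acts by $\langle R,\varphi\rangle=-\frac1{2\pi i}\int_S\frac{\zeta_{\mathfrak w}'}{\zeta_{\mathfrak w}}(s)\,\widetilde\varphi(s+1)\frac{ds}{s}$, where $\widetilde\varphi(s)=\int_0^\infty\varphi(x)x^{s-1}dx$. A distribution $F$ is $O(x^\alpha)$ (respectively $o(x^\alpha)$) as $x\to\infty$ if for every test function $\varphi$, with $\varphi_a(x)=a^{-1}\varphi(x/a)$, one has $\langle F,\varphi_a\rangle=O(a^\alpha)$ (respectively $o(a^\alpha)$) as $a\to\infty$; the estimates in the claim are understood in this sense.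
   Formalization: Assumes ord(ζ;D) = −1 (otherwise the leading term x^D/D is wrong) and that the screen avoids 0 and all poles (so R is defined); the residue term at 0 and its simplification are taken only if 0 lies in the window; ord(ζ;ω) < 0 is not asserted, being false in general. *)

theory Defs
  imports
    "HOL-Complex_Analysis.Complex_Analysis"
    "HOL-Library.Landau_Symbols"
begin

text \<open>
  Points of \<open>{1..N}\<^sup>\<nat>\<close> are functions \<^typ>\<open>nat \<Rightarrow> nat\<close>; a weight is a function into
  \<^typ>\<open>ereal\<close> of which only the values (in \<open>(0,\<infinity>]\<close>) on this space matter.
\<close>

definition seq_space :: "nat \<Rightarrow> (nat \<Rightarrow> nat) set" where
  "seq_space N = {a. \<forall>i. a i \<in> {1..N}}"

definition shift :: "(nat \<Rightarrow> nat) \<Rightarrow> nat \<Rightarrow> nat" where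
  "shift a = (\<lambda>i. a (Suc i))"

definition words :: "nat \<Rightarrow> nat list set" where
  "words N = lists {1..N} - {[]}"

definition periodic_seq :: "nat list \<Rightarrow> nat \<Rightarrow> nat" where
  "periodic_seq x = (\<lambda>i. x ! (i mod length x))"

definition word_weight :: "((nat \<Rightarrow> nat) \<Rightarrow> ereal) \<Rightarrow> nat list \<Rightarrow> ereal" where
  "word_weight w x = (\<Sum>i<length x. w ((shift ^^ i) (periodic_seq x)))"

definition periodic_orbits :: "nat \<Rightarrow> (nat \<Rightarrow> nat) set set" where
  "periodic_orbits N =
     {range (\<lambda>i. (shift ^^ i) a) | a. a \<in> seq_space N \<and> (\<exists>n\<ge>1. (shift ^^ n) a = a)}"

definition orbit_weight :: "((nat \<Rightarrow> nat) \<Rightarrow> ereal) \<Rightarrow> (nat \<Rightarrow> nat) set \<Rightarrow> ereal" where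
  "orbit_weight w p = (\<Sum>a\<in>p. w a)"

definition exp_weight :: "complex \<Rightarrow> ereal \<Rightarrow> complex" where
  "exp_weight s v = (if v = \<infinity> then 0 else exp (- s * of_real (real_of_ereal v)))"

definition dyn_zeta :: "nat \<Rightarrow> ((nat \<Rightarrow> nat) \<Rightarrow> ereal) \<Rightarrow> complex \<Rightarrow> complex" where
  "dyn_zeta N w s =
     exp (\<Sum>\<^sub>\<infinity>x\<in>words N. 1 / of_nat (length x) * exp_weight s (word_weight w x))"

text \<open>
  The terms of the series for the negative logarithmic derivative. Words of infinite weight contribute
  \<open>0\<close>.
\<close>

definition log_deriv_term :: "((nat \<Rightarrow> nat) \<Rightarrow> ereal) \<Rightarrow> complex \<Rightarrow> nat list \<Rightarrow> complex" where
  "log_deriv_term w s x =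
     of_real (real_of_ereal (word_weight w x)) / of_nat (length x) * exp_weight s (word_weight w x)"

text \<open>
  The series has nonnegative terms at real arguments, so unordered summability is ordinary convergence.
\<close>

definition series_converges :: "nat \<Rightarrow> ((nat \<Rightarrow> nat) \<Rightarrow> ereal) \<Rightarrow> real \<Rightarrow> bool" where
  "series_converges N w \<sigma> \<longleftrightarrow> log_deriv_term w (of_real \<sigma>) summable_on words N"

definition abscissa :: "nat \<Rightarrow> ((nat \<Rightarrow> nat) \<Rightarrow> ereal) \<Rightarrow> ereal" where
  "abscissa N w = Inf (ereal ` {\<sigma>. series_converges N w \<sigma>})"

text \<open>
  The index set is finite for every \<open>x\<close> as soon as the series converges somewhere.
\<close>

definition psi :: "nat \<Rightarrow> ((nat \<Rightarrow> nat) \<Rightarrow> ereal) \<Rightarrow> real \<Rightarrow> real" where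
  "psi N w x =
     (\<Sum>(p, k) \<in> {(p, k). p \<in> periodic_orbits N \<and> 1 \<le> k \<and>
                        ereal (real k) * orbit_weight w p \<le> ereal (ln x)}.
        real_of_ereal (orbit_weight w p))"

text \<open>
  Below, \<open>Z\<close> stands for the meromorphic extension of the negative logarithmic
  derivative \<open>-\<zeta>'/\<zeta>\<close>. A screen is Lipschitz, hence differentiable almost everywhere, which gives
  the meaning of \<open>ds\<close> in the integral along it.
\<close>

definition screen :: "(real \<Rightarrow> real) \<Rightarrow> real \<Rightarrow> complex" where
  "screen S t = Complex (S t) t"

definition window :: "(real \<Rightarrow> real) \<Rightarrow> complex set" where
  "window S = {s. S (Im s) \<le> Re s}"

definition screen_integrand :: "(real \<Rightarrow> real) \<Rightarrow> (complex \<Rightarrow> complex) \<Rightarrow> real \<Rightarrow> complex" where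
  "screen_integrand S f t = f (screen S t) * vector_derivative (screen S) (at t)"

definition screen_integral :: "(real \<Rightarrow> real) \<Rightarrow> (complex \<Rightarrow> complex) \<Rightarrow> complex" where
  "screen_integral S f = (LINT t|lebesgue. screen_integrand S f t)"

definition complex_dims :: "(complex \<Rightarrow> complex) \<Rightarrow> (real \<Rightarrow> real) \<Rightarrow> complex set" where
  "complex_dims Z S = {\<omega> \<in> window S. is_pole Z \<omega>}"

definition ord_zeta :: "(complex \<Rightarrow> complex) \<Rightarrow> complex \<Rightarrow> complex" where
  "ord_zeta Z \<omega> = residue (\<lambda>s. - Z s) \<omega>"

text \<open>
  Nicely meromorphic means that removable singularities are removed, so that values of \<open>Z\<close> at points
  which are not poles are the values of the extension.
\<close>

definition meromorphic_extension ::
    "nat \<Rightarrow> ((nat \<Rightarrow> nat) \<Rightarrow> ereal) \<Rightarrow> real \<Rightarrow> (complex \<Rightarrow> complex) \<Rightarrow> complex set \<Rightarrow> bool" where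
  "meromorphic_extension N w D Z W \<longleftrightarrow>
     (\<exists>U. open U \<and> W \<subseteq> U \<and> Z nicely_meromorphic_on U) \<and>
     (\<forall>s. Re s > D \<longrightarrow> Z s = - deriv (dyn_zeta N w) s / dyn_zeta N w s)"

definition admissible_heights :: "(int \<Rightarrow> real) \<Rightarrow> bool" where
  "admissible_heights T \<longleftrightarrow>
     filterlim (\<lambda>n. T (int n)) at_top sequentially \<and>
     filterlim (\<lambda>n. T (- int n)) at_bot sequentially \<and>
     (\<forall>n\<ge>1. T (- n) < 0 \<and> 0 < T n) \<and>
     (\<lambda>n. T (int n) / \<bar>T (- int n)\<bar>) \<longlonglongrightarrow> 1"

definition growth_H1 ::
    "(complex \<Rightarrow> complex) \<Rightarrow> (real \<Rightarrow> real) \<Rightarrow> (int \<Rightarrow> real) \<Rightarrow> real \<Rightarrow> real \<Rightarrow> bool" where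
  "growth_H1 Z S T C \<kappa> \<longleftrightarrow>
     (\<forall>n \<sigma>. S (T n) \<le> \<sigma> \<longrightarrow> norm (Z (Complex \<sigma> (T n))) \<le> C * \<bar>T n\<bar> powr \<kappa>)"

definition growth_H2 ::
    "(complex \<Rightarrow> complex) \<Rightarrow> (real \<Rightarrow> real) \<Rightarrow> real \<Rightarrow> real \<Rightarrow> bool" where
  "growth_H2 Z S C \<kappa> \<longleftrightarrow>
     (\<forall>t. 1 \<le> \<bar>t\<bar> \<longrightarrow> norm (Z (screen S t)) \<le> C * \<bar>t\<bar> powr \<kappa>)"

text \<open>
  Test functions are the smooth complex-valued functions with compact
  support in \<open>(0,\<infinity>)\<close>, extended by \<open>0\<close> to the real line.
\<close>

definition test_function :: "(real \<Rightarrow> complex) \<Rightarrow> bool" where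
  "test_function \<phi> \<longleftrightarrow>
     (\<forall>n x. ((\<lambda>f u. vector_derivative f (at u)) ^^ n) \<phi> differentiable (at x)) \<and>
     (\<exists>a b. 0 < a \<and> a \<le> b \<and> (\<forall>x. x \<notin> {a..b} \<longrightarrow> \<phi> x = 0))"

type_synonym distr = "(real \<Rightarrow> complex) \<Rightarrow> complex"

definition distr_of :: "(real \<Rightarrow> complex) \<Rightarrow> distr" where
  "distr_of F \<phi> = (LINT x:{0<..}|lebesgue. F x * \<phi> x)"

definition mellin :: "(real \<Rightarrow> complex) \<Rightarrow> complex \<Rightarrow> complex" where
  "mellin \<phi> s = (LINT x:{0<..}|lebesgue. \<phi> x * of_real x powr (s - 1))"

definition dilate :: "real \<Rightarrow> (real \<Rightarrow> complex) \<Rightarrow> real \<Rightarrow> complex" where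
  "dilate a \<phi> = (\<lambda>x. \<phi> (x / a) / of_real a)"

definition distr_bigo :: "distr \<Rightarrow> real \<Rightarrow> bool" where
  "distr_bigo F \<alpha> \<longleftrightarrow>
     (\<forall>\<phi>. test_function \<phi> \<longrightarrow> (\<lambda>a. norm (F (dilate a \<phi>))) \<in> O[at_top](\<lambda>a. a powr \<alpha>))"

definition distr_smallo :: "distr \<Rightarrow> real \<Rightarrow> bool" where
  "distr_smallo F \<alpha> \<longleftrightarrow>
     (\<forall>\<phi>. test_function \<phi> \<longrightarrow> (\<lambda>a. norm (F (dilate a \<phi>))) \<in> o[at_top](\<lambda>a. a powr \<alpha>))"

definition power_term :: "complex \<Rightarrow> real \<Rightarrow> complex" where
  "power_term \<omega> x = of_real x powr \<omega> / \<omega>"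

text \<open>
  The sum over the complex dimensions is the limit, in the sense of distributions, of its partial sums
  over the (finitely many) complex dimensions in the window truncated at the heights \<open>T (-n)\<close> and
  \<open>T n\<close>; there is no reason for it to converge unconditionally.
\<close>

definition dims_partial_sum ::
    "(complex \<Rightarrow> complex) \<Rightarrow> (real \<Rightarrow> real) \<Rightarrow> real \<Rightarrow> (int \<Rightarrow> real) \<Rightarrow> nat \<Rightarrow> distr" where
  "dims_partial_sum Z S D T n =
     distr_of (\<lambda>x. \<Sum>\<omega> \<in> {\<omega> \<in> complex_dims Z S - {of_real D, 0}.
                            T (- int n) \<le> Im \<omega> \<and> Im \<omega> \<le> T (int n)}.
                     - ord_zeta Z \<omega> * power_term \<omega> x)"

definition dims_sum ::
    "(complex \<Rightarrow> complex) \<Rightarrow> (real \<Rightarrow> real) \<Rightarrow> real \<Rightarrow> (int \<Rightarrow> real) \<Rightarrow> distr" where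
  "dims_sum Z S D T \<phi> = lim (\<lambda>n. dims_partial_sum Z S D T n \<phi>)"

text \<open>
  If \<open>0\<close> lies outside the window, the function is not given at \<open>0\<close> and there is no residue to collect.
\<close>

definition residue_term :: "(complex \<Rightarrow> complex) \<Rightarrow> (real \<Rightarrow> real) \<Rightarrow> real \<Rightarrow> complex" where
  "residue_term Z S x =
     (if 0 \<in> window S then residue (\<lambda>s. of_real x powr s * Z s / s) 0 else 0)"

text \<open>
  The two minus signs, in front of the integral and in \<open>-\<zeta>'/\<zeta> = Z\<close>, cancel.
\<close>

definition R_integrand :: "(complex \<Rightarrow> complex) \<Rightarrow> (real \<Rightarrow> complex) \<Rightarrow> complex \<Rightarrow> complex" where
  "R_integrand Z \<phi> s = Z s * mellin \<phi> (s + 1) / s"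

definition R_distr :: "(complex \<Rightarrow> complex) \<Rightarrow> (real \<Rightarrow> real) \<Rightarrow> distr" where
  "R_distr Z S \<phi> = 1 / (2 * of_real pi * \<i>) * screen_integral S (R_integrand Z \<phi>)"

definition error_term ::
    "(complex \<Rightarrow> complex) \<Rightarrow> (real \<Rightarrow> real) \<Rightarrow> real \<Rightarrow> (int \<Rightarrow> real) \<Rightarrow> distr" where
  "error_term Z S D T \<phi> =
     dims_sum Z S D T \<phi> + distr_of (residue_term Z S) \<phi> + R_distr Z S \<phi>"

end

theory Submission
  imports Defs "HOL-Probability.Sinc_Integral" "HOL-Real_Asymp.Real_Asymp"
begin

text \<open>
  Grouping the finite words by the periodic orbits they run through turns \<open>-\<zeta>'/\<zeta>\<close> into a Dirichlet
  series with nonnegative coefficients, indexed by the pairs of an orbit and a multiplicity, whose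
  summatory function is \<open>\<psi>\<close>. By Perron's formula the pairing of \<open>\<psi>\<close> with a test function \<open>\<phi>\<close> is the integral
  of \<open>Z s * mellin \<phi> (s + 1) / s\<close> along a line to the right of \<open>D\<close>. The Mellin transform decays faster than
  any power on vertical strips, so the polynomial bounds on \<open>Z\<close> let one move the line to the screen along
  the heights \<open>T n\<close>; the residues give the sum over the complex dimensions. Dilating \<open>\<phi>\<close> by \<open>a\<close> multiplies
  the integrand by \<open>a powr s\<close>, whence the bound on \<open>R\<close>.

  The prime orbit theorem follows from the Wiener-Ikehara theorem applied to \<open>exp (- D * u) * \<psi> (exp u)\<close>. For
  \<open>D = 0\<close> its hypothesis is never satisfied: residue \<open>1\<close> at \<open>0\<close> forces a single orbit of finite weight \<open>l\<close>,
  so \<open>Z s = l / (exp (s * l) - 1)\<close> has another pole \<open>2 * pi * \<i> / l\<close> on the imaginary axis.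
\<close>

subsection \<open>Lipschitz functions are differentiable almost everywhere\<close>

text \<open>The screen is merely Lipschitz, so \<open>ds\<close> has a meaning only almost
  everywhere and contour theorems for piecewise smooth paths do not apply to it. This is why
  differentiability almost everywhere and a fundamental theorem of calculus along the screen come
  before any residue, and why residues are collected by comparing two branches of the logarithm
  rather than through winding numbers. The Perron kernel \<open>1 / s\<close> is not absolutely
  integrable on a vertical line; one integration by parts in the Mellin transform replaces it by
  \<open>1 / (s * (s + 1))\<close>, and the exchange of integrals is then absolutely convergent. At
  0 the factor \<open>1 / s\<close> may meet a pole of \<open>Z\<close>, so the residue formula has
  to admit poles of order two. The estimate o(x^D) cannot be read off term by term from the explicit
  formula, because complex dimensions may come arbitrarily close to the line Re s = D without lying
  on it. It is proved for \<psi> itself, and the explicit formula then identifies the error term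
  with \<psi> minus its leading term.\<close>

lemma emeasure_interval_measure_Ioo:
  fixes F :: "real \<Rightarrow> real"
  assumes ab: "a < b" and mono: "\<And>x y. x \<le> y \<Longrightarrow> F x \<le> F y" and cont: "continuous_on UNIV F"
  shows "emeasure (interval_measure F) {a<..<b} = F b - F a"
proof -
  have rc: "continuous (at_right x) F" for x
    using cont by (meson UNIV_I continuous_on_eq_continuous_within continuous_within_subset subset_UNIV)
  have "{a<..b} = {a<..<b} \<union> {b}" using ab by auto
  hence "emeasure (interval_measure F) {a<..b} =
      emeasure (interval_measure F) {a<..<b} + emeasure (interval_measure F) {b}"
    using plus_emeasure[of "{a<..<b}" "interval_measure F" "{b}"] by auto
  moreover have "emeasure (interval_measure F) {b} = 0"
    using emeasure_interval_measure_Icc[of b b F] mono cont by simp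
  moreover have "emeasure (interval_measure F) {a<..b} = F b - F a"
    by (rule emeasure_interval_measure_Ioc) (use ab mono rc in auto)
  ultimately show ?thesis by simp
qed

definition slope :: "(real \<Rightarrow> real) \<Rightarrow> real \<Rightarrow> real \<Rightarrow> real" where
  "slope g x y = (g y - g x) / (y - x)"

text \<open>A point y near x whose slope has property \<open>Q\<close> yields the interval with
  endpoints x and y, inside \<open>U\<close> and as short as desired. These intervals form a Vitali
  cover of \<open>E \<inter> U\<close>, so a countable disjoint family of them exhausts
  \<open>E\<close> up to a null set. Staying inside a prescribed open \<open>U\<close> is what
  allows the selection to be repeated.\<close>

lemma Vitali_slope_step:
  fixes g :: "real \<Rightarrow> real" and Q :: "real \<Rightarrow> bool"
  assumes U: "open U" "negligible (E - U)"
    and E: "\<And>x d. x \<in> E \<Longrightarrow> 0 < d \<Longrightarrow> \<exists>y. y \<noteq> x \<and> \<bar>y - x\<bar> < d \<and> Q (slope g x y)"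
  obtains C where "countable C" "C \<subseteq> UNIV \<times> {0<..}" "disjoint_family_on (\<lambda>(c,r). ball c r) C"
    "\<And>c r. (c,r) \<in> C \<Longrightarrow> Q ((g (c + r) - g (c - r)) / (2 * r))"
    "(\<Union>(c,r)\<in>C. ball c r) \<subseteq> U" "negligible (E - (\<Union>(c,r)\<in>C. ball c r))"
proof -
  define K where "K = {(c, r). 0 < r \<and> cball c r \<subseteq> U \<and> Q ((g (c + r) - g (c - r)) / (2 * r))}"
  have 1: "0 < snd i" if "i \<in> K" for i using that by (auto simp: K_def)
  have 2: "\<exists>i. i \<in> K \<and> x \<in> cball (fst i) (snd i) \<and> snd i < d" if x: "x \<in> E \<inter> U" and d: "0 < d" for x d
  proof -
    obtain e where e: "e > 0" "cball x e \<subseteq> U" using U x by (meson Int_iff open_contains_cball)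
    obtain y where y: "y \<noteq> x" "\<bar>y - x\<bar> < min d e" "Q (slope g x y)" using E[of x "min d e"] x e d by auto
    define c where "c = (x + y) / 2"
    define r where "r = \<bar>y - x\<bar> / 2"
    have r: "0 < r" "r < d" using y by (auto simp: r_def)
    have xc: "x \<in> cball c r" by (auto simp: c_def r_def dist_real_def field_simps)
    have sub: "cball c r \<subseteq> U"
    proof -
      have "cball c r \<subseteq> cball x e"
      proof
        fix z assume "z \<in> cball c r"
        hence "\<bar>c - z\<bar> \<le> r" by (simp add: dist_real_def)
        hence "\<bar>x - z\<bar> \<le> \<bar>y - x\<bar>" unfolding c_def r_def by (auto simp: abs_if field_simps split: if_splits)
        thus "z \<in> cball x e" using y by (simp add: dist_real_def)
      qed
      thus ?thesis using e by blast
    qed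
    have "(g (c + r) - g (c - r)) / (2 * r) = slope g x y"
    proof (cases "x < y")
      case True
      hence "c + r = y" "c - r = x" "2 * r = y - x" by (auto simp: c_def r_def field_simps)
      thus ?thesis by (simp only: slope_def)
    next
      case False
      hence "c + r = x" "c - r = y" "2 * r = x - y" using y by (auto simp: c_def r_def field_simps)
      thus ?thesis by (simp only: slope_def) (metis minus_diff_eq minus_divide_divide)
    qed
    hence "(c, r) \<in> K" using r sub y by (simp add: K_def)
    thus ?thesis using xc r by (intro exI[of _ "(c,r)"]) auto
  qed
  obtain C where C: "countable C" "C \<subseteq> K"
    "pairwise (\<lambda>i j. disjnt (cball (fst i) (snd i)) (cball (fst j) (snd j))) C"
    "negligible (E \<inter> U - (\<Union>i\<in>C. cball (fst i) (snd i)))"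
    by (rule Vitali_covering_theorem_cballs[of K snd "E \<inter> U" fst]) (use 1 2 in auto)
  have eq: "(\<Union>(c,r)\<in>C. ball c r) = (\<Union>i\<in>C. ball (fst i) (snd i))" by (auto simp: case_prod_beta)
  show ?thesis
  proof (rule that)
    show "countable C" by fact
    show "C \<subseteq> UNIV \<times> {0<..}" using C(2) by (auto simp: K_def)
    show "disjoint_family_on (\<lambda>(c,r). ball c r) C"
      unfolding disjoint_family_on_def
    proof (intro ballI impI)
      fix i j assume "i \<in> C" "j \<in> C" "i \<noteq> j"
      hence "disjnt (cball (fst i) (snd i)) (cball (fst j) (snd j))" using C(3) by (auto simp: pairwise_def)
      moreover have "ball (fst i) (snd i) \<subseteq> cball (fst i) (snd i)" "ball (fst j) (snd j) \<subseteq> cball (fst j) (snd j)"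
        using ball_subset_cball by blast+
      ultimately show "(case i of (c, r) \<Rightarrow> ball c r) \<inter> (case j of (c, r) \<Rightarrow> ball c r) = {}"
        unfolding disjnt_def case_prod_beta by blast
    qed
    show "Q ((g (c + r) - g (c - r)) / (2 * r))" if "(c, r) \<in> C" for c r
      using that C(2) by (auto simp: K_def)
    show "(\<Union>(c,r)\<in>C. ball c r) \<subseteq> U" using C(2) ball_subset_cball by (fastforce simp: K_def)
    \<comment> \<open>Vitali's theorem covers by closed balls, while open ones are wanted. On the
      line a sphere consists of two points, so the countable family loses only a null set.\<close>
    have "negligible (\<Union>i\<in>C. sphere (fst i) (snd i))"
      by (auto intro!: negligible_countable_Union negligible_sphere \<open>countable C\<close>)
    hence "negligible ((E - U) \<union> (E \<inter> U - (\<Union>i\<in>C. cball (fst i) (snd i))) \<union> (\<Union>i\<in>C. sphere (fst i) (snd i)))"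
      using U C by (intro negligible_Un) auto
    thus "negligible (E - (\<Union>(c,r)\<in>C. ball c r))"
      by (rule negligible_subset) (force simp: eq)
  qed
qed

text \<open>
  Lebesgue's argument, with the two covers applied alternately: one shrinks \<open>\<nu>\<close> relative to Lebesgue
  measure, the other shrinks Lebesgue measure relative to \<open>\<nu>\<close>.
\<close>

lemma negligible_slope_gap:
  fixes g :: "real \<Rightarrow> real"
  assumes mono: "\<And>x y. x \<le> y \<Longrightarrow> g x \<le> g y" and cont: "continuous_on UNIV g"
    and pq: "0 < p" "p < q" and bdd: "bounded E"
    and E1: "\<And>x d. x \<in> E \<Longrightarrow> 0 < d \<Longrightarrow> \<exists>y. y \<noteq> x \<and> \<bar>y - x\<bar> < d \<and> slope g x y < p"
    and E2: "\<And>x d. x \<in> E \<Longrightarrow> 0 < d \<Longrightarrow> \<exists>y. y \<noteq> x \<and> \<bar>y - x\<bar> < d \<and> slope g x y > q"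
  shows "negligible E"
proof -
  let ?\<nu> = "interval_measure g"
  have ball_nu: "emeasure ?\<nu> (ball c r) = g (c + r) - g (c - r)" if "0 < r" for c r
    unfolding ball_eq_greaterThanLessThan by (rule emeasure_interval_measure_Ioo) (use that mono cont in auto)
  have ball_leb: "emeasure lborel (ball c r) = 2 * r" if "0 < r" for c r :: real
    unfolding ball_eq_greaterThanLessThan using that by simp
  \<comment> \<open>One round of the iteration. Writing |X| for the length of X, the two covers
    satisfy q |U2| <= \<nu>(U2) <= \<nu>(U1) <= p |U1| <= p |U|, so the length shrinks by the factor
    \<open>p / q\<close>.\<close>
  have step: "\<exists>U'. open U' \<and> U' \<subseteq> U \<and> negligible (E - U') \<and> ennreal q * emeasure lborel U' \<le> ennreal p * emeasure lborel U"
    if U: "open U" "negligible (E - U)" for U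
  proof -
    obtain C where C: "countable C" "C \<subseteq> UNIV \<times> {0<..}" "disjoint_family_on (\<lambda>(c,r). ball c r) C"
      "\<And>c r. (c,r) \<in> C \<Longrightarrow> (g (c + r) - g (c - r)) / (2 * r) < p"
      "(\<Union>(c,r)\<in>C. ball c r) \<subseteq> U" "negligible (E - (\<Union>(c,r)\<in>C. ball c r))"
      using Vitali_slope_step[OF U, of "\<lambda>s. s < p" g] E1 by metis
    define U1 where "U1 = (\<Union>(c,r)\<in>C. ball c r)"
    have U1: "open U1" "negligible (E - U1)" using C by (auto simp: U1_def)
    obtain B where B: "countable B" "B \<subseteq> UNIV \<times> {0<..}" "disjoint_family_on (\<lambda>(c,r). ball c r) B"
      "\<And>c r. (c,r) \<in> B \<Longrightarrow> (g (c + r) - g (c - r)) / (2 * r) > q"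
      "(\<Union>(c,r)\<in>B. ball c r) \<subseteq> U1" "negligible (E - (\<Union>(c,r)\<in>B. ball c r))"
      using Vitali_slope_step[OF U1, of "\<lambda>s. s > q" g] E2 by metis
    define U2 where "U2 = (\<Union>(c,r)\<in>B. ball c r)"
    have e1: "emeasure M (\<Union>(c,r)\<in>X. ball c r) = (\<integral>\<^sup>+(c,r). emeasure M (ball c r) \<partial>count_space X)"
      if "countable X" "disjoint_family_on (\<lambda>(c,r). ball c r) X" "sets M = sets borel" for X and M :: "real measure"
      using emeasure_UN_countable[of X "\<lambda>(c,r). ball c r" M] that by (simp add: case_prod_unfold)
    have "emeasure ?\<nu> U1 = (\<integral>\<^sup>+(c,r). emeasure ?\<nu> (ball c r) \<partial>count_space C)"
      unfolding U1_def using C by (intro e1) auto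
    also have "\<dots> \<le> (\<integral>\<^sup>+(c,r). ennreal p * emeasure lborel (ball c r) \<partial>count_space C)"
    proof (rule nn_integral_mono, clarsimp)
      fix c r assume cr: "(c, r) \<in> C"
      hence r: "0 < r" using C by auto
      have "g (c + r) - g (c - r) \<le> p * (2 * r)" using C(4)[OF cr] r by (simp add: field_simps)
      thus "emeasure ?\<nu> (ball c r) \<le> ennreal p * emeasure lborel (ball c r)"
        unfolding ball_nu[OF r] ball_leb[OF r] using pq r by (simp add: ennreal_mult' [symmetric] ennreal_leI)
    qed
    also have "\<dots> = ennreal p * emeasure lborel U1"
      unfolding U1_def using C by (subst e1) (auto simp: nn_integral_cmult case_prod_unfold)
    finally have le1: "emeasure ?\<nu> U1 \<le> ennreal p * emeasure lborel U1" .
    have "ennreal q * emeasure lborel U2 = (\<integral>\<^sup>+(c,r). ennreal q * emeasure lborel (ball c r) \<partial>count_space B)"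
      unfolding U2_def using B by (subst e1) (auto simp: nn_integral_cmult case_prod_unfold)
    also have "\<dots> \<le> (\<integral>\<^sup>+(c,r). emeasure ?\<nu> (ball c r) \<partial>count_space B)"
    proof (rule nn_integral_mono, clarsimp)
      fix c r assume cr: "(c, r) \<in> B"
      hence r: "0 < r" using B by auto
      have "g (c + r) - g (c - r) \<ge> q * (2 * r)" using B(4)[OF cr] r by (simp add: field_simps)
      thus "ennreal q * emeasure lborel (ball c r) \<le> emeasure ?\<nu> (ball c r)"
        unfolding ball_nu[OF r] ball_leb[OF r] using pq r by (simp add: ennreal_mult' [symmetric] ennreal_leI)
    qed
    also have "\<dots> = emeasure ?\<nu> U2"
      unfolding U2_def using B by (intro e1[symmetric]) auto
    also have "\<dots> \<le> emeasure ?\<nu> U1"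
      using B(5) U1(1) unfolding U2_def by (intro emeasure_mono) auto
    also note le1
    also have "ennreal p * emeasure lborel U1 \<le> ennreal p * emeasure lborel U"
      using C(5) U unfolding U1_def by (intro mult_left_mono emeasure_mono) auto
    finally have "ennreal q * emeasure lborel U2 \<le> ennreal p * emeasure lborel U" .
    moreover have "open U2" unfolding U2_def by (intro open_UN) auto
    moreover have "U2 \<subseteq> U" using B(5) C(5) by (auto simp: U2_def U1_def)
    ultimately show ?thesis using B(6) unfolding U2_def[symmetric] by blast
  qed
  obtain b where b: "E \<subseteq> ball 0 b" "0 < b" using bdd bounded_subset_ballD by blast
  have iter: "\<exists>U. open U \<and> negligible (E - U) \<and> emeasure lborel U \<le> ennreal ((p / q) ^ n * (2 * b))" for n
  proof (induction n)
    case 0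
    show ?case using b ball_leb[of b 0] by (intro exI[of _ "ball 0 b"]) (auto simp: Diff_eq_empty_iff[THEN iffD2])
  next
    case (Suc n)
    then obtain U where U: "open U" "negligible (E - U)" "emeasure lborel U \<le> ennreal ((p / q) ^ n * (2 * b))" by blast
    obtain U' where U': "open U'" "negligible (E - U')" "ennreal q * emeasure lborel U' \<le> ennreal p * emeasure lborel U"
      using step[OF U(1,2)] by blast
    have "emeasure lborel U' = ennreal (1 / q) * (ennreal q * emeasure lborel U')"
      using pq by (simp add: mult.assoc[symmetric] ennreal_mult'[symmetric])
    also have "\<dots> \<le> ennreal (1 / q) * (ennreal p * ennreal ((p / q) ^ n * (2 * b)))"
      using U' U(3) by (meson dual_order.trans mult_left_mono zero_le)
    also have "\<dots> = ennreal ((p / q) ^ Suc n * (2 * b))"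
      using pq b by (simp add: ennreal_mult'[symmetric])
    finally show ?case using U' by blast
  qed
  show ?thesis
    unfolding negligible_outer
  proof (intro allI impI)
    fix e :: real assume e: "0 < e"
    have "(\<lambda>n. (p / q) ^ n * (2 * b)) \<longlonglongrightarrow> 0 * (2 * b)"
      using pq by (intro tendsto_intros LIMSEQ_power_zero) auto
    hence "eventually (\<lambda>n. (p / q) ^ n * (2 * b) < e) sequentially" using e by (auto dest!: order_tendstoD(2)[of _ _ _ e])
    then obtain n where n: "(p / q) ^ n * (2 * b) < e" by (auto simp: eventually_sequentially)
    obtain U where U: "open U" "negligible (E - U)" "emeasure lborel U \<le> ennreal ((p / q) ^ n * (2 * b))"
      using iter by blast
    \<comment> \<open>\<open>U\<close> covers \<open>E\<close> only up to a null set; adding the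
      exceptional part back gives the measurable superset of \<open>E\<close> that outer
      negligibility asks for.\<close>
    have lt: "emeasure lebesgue (U \<union> (E - U)) < ennreal e"
    proof -
      have "emeasure lebesgue (U \<union> (E - U)) \<le> emeasure lebesgue U + emeasure lebesgue (E - U)"
        using U by (intro emeasure_subadditive) (auto simp: negligible_imp_sets)
      also have "emeasure lebesgue (E - U) = 0" using U(2) by (meson negligible_iff_null_sets null_setsD1)
      also have "emeasure lebesgue U = emeasure lborel U" using U by simp
      finally show ?thesis using U(3) n e
        by (metis (no_types, lifting) add.right_neutral dual_order.strict_trans2 ennreal_less_iff leD le_less_linear
            less_le_trans order.trans ennreal_lessI)
    qed
    have fm: "U \<union> (E - U) \<in> lmeasurable"
    proof (rule fmeasurableI)
      show "U \<union> (E - U) \<in> sets lebesgue" using U by (intro sets.Un) (auto simp: negligible_imp_sets)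
      show "emeasure lebesgue (U \<union> (E - U)) < \<infinity>" using lt by (rule less_trans) simp
    qed
    have "measure lebesgue (U \<union> (E - U)) < e"
      using lt fm e by (metis emeasure_eq_measure2 ennreal_less_iff measure_nonneg)
    thus "\<exists>T. E \<subseteq> T \<and> T \<in> lmeasurable \<and> measure lebesgue T < e" using fm by (intro exI[of _ "U \<union> (E - U)"]) auto
  qed
qed

text \<open>Adding \<open>(L + 1) * x\<close> makes the function increasing with slopes between 1
  and \<open>2 * L + 1\<close>, so that it defines an interval measure and all thresholds can be
  taken positive. Where the derivative fails to exist, the lower and upper limits of the slopes
  differ, and two rationals between them place the point in one of countably many negligible gap
  sets.\<close>

lemma lipschitz_imp_differentiable_ae:
  fixes g :: "real \<Rightarrow> real"
  assumes lip: "L-lipschitz_on UNIV g"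
  shows "negligible {x. \<not> g differentiable (at x)}"
proof -
  define h where "h x = g x + (L + 1) * x" for x
  have L0: "0 \<le> L" using lip by (auto simp: lipschitz_on_def)
  have glip: "\<bar>g y - g x\<bar> \<le> L * \<bar>y - x\<bar>" for x y
    using lipschitz_onD[OF lip, of y x] by (simp add: dist_real_def)
  have slope_h: "1 \<le> slope h x y \<and> slope h x y \<le> 2 * L + 1" if "y \<noteq> x" for x y
  proof -
    have "slope h x y = (g y - g x) / (y - x) + (L + 1)"
      using that by (simp add: slope_def h_def field_simps)
    moreover have "\<bar>(g y - g x) / (y - x)\<bar> \<le> L"
      using glip[of y x] that by (simp add: abs_divide pos_divide_le_eq)
    ultimately show ?thesis by linarith
  qed
  have mono: "h x \<le> h y" if "x \<le> y" for x y
  proof (cases "x = y")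
    case False
    hence "0 < y - x" using that by simp
    thus ?thesis using slope_h[of y x] False by (simp add: slope_def field_simps)
  qed simp
  have cont: "continuous_on UNIV h"
    unfolding h_def using lip by (intro continuous_intros lipschitz_on_continuous_on) auto
  \<comment> \<open>The cutoff at n supplies the boundedness demanded by the gap lemma; rational p
    and q keep the family countable.\<close>
  define E where "E p q n = {x. \<bar>x\<bar> \<le> real n \<and> (\<forall>d>0. \<exists>y. y \<noteq> x \<and> \<bar>y - x\<bar> < d \<and> slope h x y < of_rat p) \<and>
     (\<forall>d>0. \<exists>y. y \<noteq> x \<and> \<bar>y - x\<bar> < d \<and> slope h x y > of_rat q)}" for p q n
  have neg: "negligible (\<Union>n. \<Union>p. \<Union>q\<in>{q. 0 < p \<and> p < q}. E p q n)"
  proof -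
    have "negligible (E p q n)" if pq: "0 < p" "p < q" for n :: nat and p q :: rat
      by (rule negligible_slope_gap[of h "of_rat p" "of_rat q"])
         (use mono cont pq in \<open>auto simp: E_def of_rat_less bounded_real\<close>)
    hence 1: "negligible (\<Union>q\<in>{q. 0 < p \<and> p < q}. E p q n)" for n :: nat and p :: rat
      by (intro negligible_countable_Union) auto
    have 2: "negligible (\<Union>p. \<Union>q\<in>{q. 0 < p \<and> p < q}. E p q n)" for n :: nat
      by (intro negligible_countable_Union) (use 1 in auto)
    show ?thesis by (intro negligible_countable_Union) (use 2 in auto)
  qed
  show ?thesis
  proof (rule negligible_subset[OF neg], rule subsetI, rule ccontr)
    fix x assume x: "x \<in> {x. \<not> g differentiable (at x)}" and nx: "x \<notin> (\<Union>n. \<Union>p. \<Union>q\<in>{q. 0 < p \<and> p < q}. E p q n)"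
    let ?s = "\<lambda>y. ereal (slope h x y)"
    have freq: "\<forall>d>0. \<exists>y. y \<noteq> x \<and> \<bar>y - x\<bar> < d \<and> P y" if "\<not> eventually (\<lambda>y. \<not> P y) (at x)" for P
      using that by (auto simp: eventually_at dist_real_def)
    have "Limsup (at x) ?s \<le> Liminf (at x) ?s"
    proof (rule ccontr)
      assume "\<not> ?thesis"
      then obtain q where q: "Liminf (at x) ?s < ereal (of_rat q)" "ereal (of_rat q) < Limsup (at x) ?s"
        using ereal_dense3[of "Liminf (at x) ?s" "Limsup (at x) ?s"] by (auto simp: not_le)
      obtain p where p: "Liminf (at x) ?s < ereal (of_rat p)" "ereal (of_rat p) < ereal (of_rat q)"
        using ereal_dense3[OF q(1)] by auto
      have "\<not> eventually (\<lambda>y. \<not> slope h x y < of_rat p) (at x)"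
      proof
        assume "eventually (\<lambda>y. \<not> slope h x y < of_rat p) (at x)"
        hence "ereal (of_rat p) \<le> Liminf (at x) ?s"
          by (intro Liminf_bounded) (auto elim: eventually_mono)
        thus False using p by simp
      qed
      note f1 = freq[OF this]
      have "\<not> eventually (\<lambda>y. \<not> slope h x y > of_rat q) (at x)"
      proof
        assume "eventually (\<lambda>y. \<not> slope h x y > of_rat q) (at x)"
        hence "Limsup (at x) ?s \<le> ereal (of_rat q)"
          by (intro Limsup_bounded) (auto elim: eventually_mono)
        thus False using q by simp
      qed
      note f2 = freq[OF this]
      \<comment> \<open>Slopes of \<open>h\<close> are at least 1, so a threshold lying above one of
        them is positive, as the gap lemma requires.\<close>
      obtain y where "y \<noteq> x" "slope h x y < of_rat p" using f1 zero_less_one by blast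
      hence "0 < (of_rat p :: real)" using slope_h[of y x] by linarith
      hence p0: "0 < p" by simp
      have pq: "p < q" using p(2) by (simp add: of_rat_less)
      obtain n where "\<bar>x\<bar> \<le> real n" using real_arch_simple by blast
      hence "x \<in> E p q n" using f1 f2 by (simp add: E_def)
      thus False using nx p0 pq by blast
    qed
    hence eq: "Liminf (at x) ?s = Limsup (at x) ?s" using Liminf_le_Limsup[of "at x" ?s] by (simp add: antisym)
    \<comment> \<open>The limit of the slopes is taken in \<open>ereal\<close>; these two bounds
      make it finite.\<close>
    have ev: "eventually (\<lambda>y. 1 \<le> ?s y \<and> ?s y \<le> ereal (2 * L + 1)) (at x)"
      using slope_h by (auto simp: eventually_at_filter one_ereal_def)
    define l where "l = Limsup (at x) ?s"
    have lim: "(?s \<longlongrightarrow> l) (at x)" by (simp add: tendsto_iff_Liminf_eq_Limsup l_def eq)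
    have "1 \<le> l" by (rule tendsto_lowerbound[OF lim]) (use ev in \<open>auto elim: eventually_mono\<close>)
    moreover have "l \<le> ereal (2 * L + 1)" by (rule tendsto_upperbound[OF lim]) (use ev in \<open>auto elim: eventually_mono\<close>)
    ultimately obtain m where m: "l = ereal m" by (cases l) auto
    have "((\<lambda>y. (h y - h x) / (y - x)) \<longlongrightarrow> m) (at x)"
      using lim unfolding m by (simp add: slope_def)
    hence "(h has_field_derivative m) (at x)" by (simp add: has_field_derivative_iff)
    hence "((\<lambda>y. h y - (L + 1) * y) has_field_derivative (m - (L + 1))) (at x)"
      by (auto intro!: derivative_eq_intros)
    moreover have "(\<lambda>y. h y - (L + 1) * y) = g" by (auto simp: h_def)
    ultimately show False using x by (auto simp: real_differentiable_def)
  qed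
qed

subsection \<open>Integration along the screen\<close>

lemma screen_dist:
  assumes lip: "L-lipschitz_on UNIV S"
  shows "norm (screen S x - screen S y) \<le> (L + 1) * \<bar>x - y\<bar>"
proof -
  have "norm (screen S x - screen S y) \<le> \<bar>S x - S y\<bar> + \<bar>x - y\<bar>"
    using cmod_le[of "screen S x - screen S y"] by (simp add: screen_def)
  moreover have "\<bar>S x - S y\<bar> \<le> L * \<bar>x - y\<bar>"
    using lipschitz_onD[OF lip, of x y] by (simp add: dist_real_def)
  ultimately show ?thesis by (simp add: algebra_simps)
qed

lemma continuous_on_screen:
  assumes "continuous_on A S"
  shows "continuous_on A (screen S)"
  unfolding screen_def using assms by (intro continuous_intros)

lemma screen_has_vector_derivative:
  assumes "S differentiable (at t)"
  shows "(screen S has_vector_derivative vector_derivative (screen S) (at t)) (at t)"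
proof -
  obtain s where s: "(S has_real_derivative s) (at t)" using assms by (auto simp: real_differentiable_def)
  have "((\<lambda>t. Complex (S t) t) has_vector_derivative Complex s 1) (at t)"
    using s by (simp add: has_real_derivative_iff_has_vector_derivative has_vector_derivative_complex_iff)
  thus ?thesis unfolding screen_def by (simp add: vector_derivative_at)
qed

lemma screen_differentiable_AE:
  assumes lip: "L-lipschitz_on UNIV S"
  shows "AE t in lebesgue. (screen S has_vector_derivative vector_derivative (screen S) (at t)) (at t)"
proof -
  have "AE t in lebesgue. S differentiable (at t)"
    using lipschitz_imp_differentiable_ae[OF lip] by (simp add: completion.AE_iff_null_sets negligible_iff_null_sets)
  thus ?thesis by (rule AE_mp) (auto intro!: AE_I2 screen_has_vector_derivative)
qed

lemma has_vector_derivative_imp_tendsto: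
  fixes f :: "real \<Rightarrow> 'a::real_normed_vector"
  assumes "(f has_vector_derivative d) (at t within A)"
  shows "((\<lambda>y. (f y - f t) /\<^sub>R (y - t)) \<longlongrightarrow> d) (at t within A)"
proof -
  have "((\<lambda>y. norm ((f y - f t) - (y - t) *\<^sub>R d) / norm (y - t)) \<longlongrightarrow> 0) (at t within A)"
    using assms by (simp add: has_vector_derivative_def has_derivative_iff_norm)
  hence "((\<lambda>y. norm ((f y - f t) /\<^sub>R (y - t) - d)) \<longlongrightarrow> 0) (at t within A)"
  proof (rule Lim_transform_eventually)
    show "\<forall>\<^sub>F y in at t within A. norm ((f y - f t) - (y - t) *\<^sub>R d) / norm (y - t) = norm ((f y - f t) /\<^sub>R (y - t) - d)"
      unfolding eventually_at_filter
    proof (intro always_eventually allI impI)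
      fix y assume "y \<noteq> t"
      hence "(f y - f t) /\<^sub>R (y - t) - d = ((f y - f t) - (y - t) *\<^sub>R d) /\<^sub>R (y - t)"
        by (simp add: scaleR_diff_right)
      thus "norm ((f y - f t) - (y - t) *\<^sub>R d) / norm (y - t) = norm ((f y - f t) /\<^sub>R (y - t) - d)"
        by (simp add: divide_inverse mult.commute)
    qed
  qed
  thus ?thesis by (simp add: tendsto_norm_zero_iff LIM_zero_iff)
qed

text \<open>Along the fixed steps \<open>1 / Suc n\<close> the derivative becomes the limit of a
  single sequence of continuous functions. The bound on the derivative of the screen, its
  measurability and the dominated convergence argument along the screen all rest on this
  sequence.\<close>

lemma LIMSEQ_difference_quotient:
  fixes f :: "real \<Rightarrow> 'a::real_normed_vector"
  assumes "(f has_vector_derivative d) (at t)"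
  shows "(\<lambda>n. real (Suc n) *\<^sub>R (f (t + 1 / real (Suc n)) - f t)) \<longlonglongrightarrow> d"
proof -
  have "(\<lambda>n. t + 1 / real (Suc n)) \<longlonglongrightarrow> t + 0" by (intro tendsto_intros LIMSEQ_Suc lim_1_over_n)
  hence "filterlim (\<lambda>n. t + 1 / real (Suc n)) (at t) sequentially"
    by (auto simp: filterlim_at intro!: always_eventually)
  from filterlim_compose[OF has_vector_derivative_imp_tendsto[OF assms] this]
  show ?thesis by (simp add: field_simps)
qed

lemma vector_derivative_screen_AE_bound:
  assumes lip: "L-lipschitz_on UNIV S"
  shows "AE t in lebesgue. norm (vector_derivative (screen S) (at t)) \<le> L + 1"
proof (rule AE_mp[OF screen_differentiable_AE[OF lip]], rule AE_I2, rule impI)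
  fix t assume "(screen S has_vector_derivative vector_derivative (screen S) (at t)) (at t)"
  from tendsto_norm[OF LIMSEQ_difference_quotient[OF this]]
  show "norm (vector_derivative (screen S) (at t)) \<le> L + 1"
  proof (rule tendsto_upperbound)
    show "\<forall>\<^sub>F n in sequentially. norm (real (Suc n) *\<^sub>R (screen S (t + 1 / real (Suc n)) - screen S t)) \<le> L + 1"
    proof (intro always_eventually allI)
      fix n
      have "norm (screen S (t + 1 / real (Suc n)) - screen S t) \<le> (L + 1) * (1 / real (Suc n))"
        using screen_dist[OF lip, of "t + 1 / real (Suc n)" t] by simp
      hence "real (Suc n) * norm (screen S (t + 1 / real (Suc n)) - screen S t) \<le> real (Suc n) * ((L + 1) * (1 / real (Suc n)))"
        by (rule mult_left_mono) simp
      thus "norm (real (Suc n) *\<^sub>R (screen S (t + 1 / real (Suc n)) - screen S t)) \<le> L + 1"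
        by (simp del: of_nat_Suc scaleR_diff_right)
    qed
  qed auto
qed

text \<open>The difference quotients are continuous, and their pointwise \<open>lim\<close> is
  measurable whatever value it takes where they diverge. It agrees with the derivative almost
  everywhere, which is enough because Lebesgue measure is complete.\<close>

lemma vector_derivative_screen_measurable:
  assumes lip: "L-lipschitz_on UNIV S"
  shows "(\<lambda>t. vector_derivative (screen S) (at t)) \<in> borel_measurable lebesgue"
proof -
  have c: "continuous_on UNIV (screen S)"
    using lip by (intro continuous_on_screen lipschitz_on_continuous_on)
  let ?q = "\<lambda>n t. real (Suc n) *\<^sub>R (screen S (t + 1 / real (Suc n)) - screen S t)"
  have m: "?q n \<in> borel_measurable lebesgue" for n
  proof -
    have "continuous_on UNIV (?q n)"
      by (intro continuous_intros continuous_on_compose2[OF c]) auto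
    thus ?thesis by (intro measurable_completion) (simp add: borel_measurable_continuous_onI)
  qed
  show ?thesis
  proof (rule borel_measurable_AE)
    show "(\<lambda>t. lim (\<lambda>n. ?q n t)) \<in> borel_measurable lebesgue"
      using m by (rule borel_measurable_lim_metric)
    show "AE t in lebesgue. lim (\<lambda>n. ?q n t) = vector_derivative (screen S) (at t)"
      using screen_differentiable_AE[OF lip]
      by eventually_elim (rule limI, rule LIMSEQ_difference_quotient)
  qed
qed

lemma set_integrable_screen_integrand:
  assumes lip: "L-lipschitz_on UNIV S" and cont: "continuous_on {a..b} (\<lambda>t. f (screen S t))"
  shows "set_integrable lebesgue {a..b} (screen_integrand S f)"
proof -
  obtain M where M: "\<And>t. t \<in> {a..b} \<Longrightarrow> norm (f (screen S t)) \<le> M"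
    using compact_continuous_image[OF cont] by (metis compact_Icc compact_imp_bounded bounded_iff imageI)
  show ?thesis
    unfolding set_integrable_def
  proof (rule Bochner_Integration.integrable_bound)
    show "integrable lebesgue (\<lambda>t. indicator {a..b} t *\<^sub>R (\<bar>M\<bar> * (L + 1)))"
      by (intro integrable_completion[THEN iffD2] integrable_scaleR_left integrable_real_indicator)
         (auto simp: emeasure_lborel_Icc_eq)
    have "(\<lambda>t. indicator {a..b} t *\<^sub>R f (screen S t)) \<in> borel_measurable borel"
      using cont by (rule borel_measurable_continuous_on_indicator[rotated]) auto
    hence "(\<lambda>t. indicator {a..b} t *\<^sub>R f (screen S t)) \<in> borel_measurable lebesgue"
      by (intro measurable_completion) simp
    hence "(\<lambda>t. (indicator {a..b} t *\<^sub>R f (screen S t)) * vector_derivative (screen S) (at t)) \<in> borel_measurable lebesgue"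
      using vector_derivative_screen_measurable[OF lip] by (rule borel_measurable_times)
    thus "(\<lambda>t. indicator {a..b} t *\<^sub>R screen_integrand S f t) \<in> borel_measurable lebesgue"
      by (simp add: screen_integrand_def)
    show "AE t in lebesgue. norm (indicator {a..b} t *\<^sub>R screen_integrand S f t)
        \<le> norm (indicator {a..b} t *\<^sub>R (\<bar>M\<bar> * (L + 1)))"
    proof (rule AE_mp[OF vector_derivative_screen_AE_bound[OF lip]], rule AE_I2, rule impI)
      fix t assume "norm (vector_derivative (screen S) (at t)) \<le> L + 1"
      thus "norm (indicator {a..b} t *\<^sub>R screen_integrand S f t) \<le> norm (indicator {a..b} t *\<^sub>R (\<bar>M\<bar> * (L + 1)))"
        using M[of t] by (auto simp: screen_integrand_def norm_mult abs_mult indicator_def intro!: mult_mono)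
    qed
  qed
qed

text \<open>
  The composition \<open>F \<circ> screen S\<close> is Lipschitz on \<open>{a..b}\<close>, so its difference quotients are bounded and
  their integrals, which telescope, converge by dominated convergence.
\<close>

lemma screen_integral_primitive:
  assumes lip: "L-lipschitz_on UNIV S" and ab: "a \<le> b" and V: "open V" "\<And>t. t \<in> {a..b} \<Longrightarrow> screen S t \<in> V"
    and F: "\<And>z. z \<in> V \<Longrightarrow> (F has_field_derivative f z) (at z)" and contf: "continuous_on V f"
  shows "(LINT t:{a..b}|lebesgue. screen_integrand S f t) = F (screen S b) - F (screen S a)"
proof -
  let ?\<gamma> = "screen S"
  have cg: "continuous_on UNIV ?\<gamma>" using lip by (intro continuous_on_screen lipschitz_on_continuous_on)
  have L0: "0 \<le> L" using lip by (auto simp: lipschitz_on_def)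
  have cfg: "continuous_on {a..b} (\<lambda>t. f (?\<gamma> t))"
    by (rule continuous_on_compose2[OF contf continuous_on_subset[OF cg]]) (use V in auto)
  have contF: "continuous_on V F" using F by (meson DERIV_continuous_on has_field_derivative_at_within)
  \<comment> \<open>Stopping the curve at b keeps the shifted arguments t + h on the curve, hence in
    \<open>V\<close>, when t + h passes b.\<close>
  define G where "G t = F (?\<gamma> (min t b))" for t
  have cG: "continuous_on {a..b+1} G"
    unfolding G_def
  proof (rule continuous_on_compose2[OF contF])
    show "continuous_on {a..b + 1} (\<lambda>t. ?\<gamma> (min t b))"
      by (intro continuous_on_compose2[OF cg] continuous_intros) auto
  qed (use V ab in auto)
  have compg: "compact (?\<gamma> ` {a..b})"
    by (intro compact_continuous_image continuous_on_subset[OF cg]) auto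
  obtain \<rho> where \<rho>: "\<rho> > 0" "(\<Union>x\<in>?\<gamma> ` {a..b}. cball x \<rho>) \<subseteq> V"
    using compact_subset_open_imp_cball_epsilon_subset[OF compg V(1)] V(2) by blast
  \<comment> \<open>The closed \<rho>-neighbourhood of the arc is a compact subset of
    \<open>V\<close>. There \<open>f\<close> has a bound \<open>M\<close>, which is a local
    Lipschitz constant of \<open>F\<close> and thus bounds the difference quotients.\<close>
  define W where "W = (\<Union>x\<in>?\<gamma> ` {a..b}. \<Union>y\<in>cball 0 \<rho>. {x + y})"
  have "compact W" unfolding W_def by (intro compact_sums' compg compact_cball)
  moreover have WV: "W \<subseteq> V"
  proof
    fix z assume "z \<in> W"
    then obtain x y where "x \<in> ?\<gamma> ` {a..b}" "y \<in> cball 0 \<rho>" "z = x + y" unfolding W_def by blast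
    hence "z \<in> cball x \<rho>" by (simp add: dist_norm)
    thus "z \<in> V" using \<rho>(2) \<open>x \<in> _\<close> by blast
  qed
  ultimately have "compact (f ` W)" using contf by (meson compact_continuous_image continuous_on_subset)
  then obtain M where M: "\<And>z. z \<in> W \<Longrightarrow> norm (f z) \<le> M" by (metis bounded_iff compact_imp_bounded imageI)
  have ballW: "ball (?\<gamma> t) \<rho> \<subseteq> W" if "t \<in> {a..b}" for t
  proof
    fix z assume "z \<in> ball (?\<gamma> t) \<rho>"
    hence "z = ?\<gamma> t + (z - ?\<gamma> t)" "z - ?\<gamma> t \<in> cball 0 \<rho>" by (auto simp: dist_norm norm_minus_commute)
    thus "z \<in> W" unfolding W_def using that by blast
  qed
  define q where "q n t = real (Suc n) *\<^sub>R (G (t + 1 / real (Suc n)) - G t)" for n t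
  have M0: "0 \<le> M" using M ballW[of a] ab \<rho> by (metis atLeastAtMost_iff centre_in_ball norm_ge_zero order.refl order_trans subsetD)
  obtain n0 where n0: "\<And>n. n \<ge> n0 \<Longrightarrow> (L + 1) * (1 / real (Suc n)) < \<rho>"
  proof -
    have "(\<lambda>n. (L + 1) * (1 / real (Suc n))) \<longlonglongrightarrow> (L + 1) * 0"
      by (intro tendsto_intros LIMSEQ_Suc lim_1_over_n)
    hence "eventually (\<lambda>n. (L + 1) * (1 / real (Suc n)) < \<rho>) sequentially"
      using \<rho> by (auto dest!: order_tendstoD(2)[of _ _ _ \<rho>])
    thus ?thesis using that by (auto simp: eventually_sequentially)
  qed
  have qbound: "norm (q n t) \<le> M * (L + 1)" if n: "n \<ge> n0" and t: "t \<in> {a..b}" for n t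
  proof -
    define t' where "t' = min (t + 1 / real (Suc n)) b"
    have t': "t' \<in> {a..b}" "\<bar>t' - t\<bar> \<le> 1 / real (Suc n)" using t by (auto simp: t'_def min_def intro: add_increasing2)
    have "norm (?\<gamma> t' - ?\<gamma> t) \<le> (L + 1) * \<bar>t' - t\<bar>" by (rule screen_dist[OF lip])
    also have "\<dots> \<le> (L + 1) * (1 / real (Suc n))" using t' L0 by (intro mult_left_mono) auto
    finally have d: "norm (?\<gamma> t' - ?\<gamma> t) \<le> (L + 1) * (1 / real (Suc n))" .
    have "norm (F (?\<gamma> t') - F (?\<gamma> t)) \<le> M * norm (?\<gamma> t' - ?\<gamma> t)"
    proof (rule field_differentiable_bound[where S = "ball (?\<gamma> t) \<rho>" and f' = f])
      show "(F has_field_derivative f z) (at z within ball (?\<gamma> t) \<rho>)" if "z \<in> ball (?\<gamma> t) \<rho>" for z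
        using that ballW[OF t] WV F by (blast intro: has_field_derivative_at_within)
      show "norm (f z) \<le> M" if "z \<in> ball (?\<gamma> t) \<rho>" for z using that ballW[OF t] M by blast
      show "?\<gamma> t' \<in> ball (?\<gamma> t) \<rho>" using d n0[OF n] by (simp add: dist_norm norm_minus_commute)
    qed (use \<rho> in auto)
    also have "\<dots> \<le> M * ((L + 1) * (1 / real (Suc n)))" using d M0 by (rule mult_left_mono)
    finally have "norm (F (?\<gamma> t') - F (?\<gamma> t)) \<le> M * (L + 1) / real (Suc n)" by simp
    moreover have "q n t = real (Suc n) *\<^sub>R (F (?\<gamma> t') - F (?\<gamma> t))"
      using t by (simp add: q_def G_def t'_def min_def)
    ultimately show ?thesis by (simp add: pos_le_divide_eq mult.commute del: of_nat_Suc)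
  qed
  have cq: "continuous_on {a..b} (q n)" for n
  proof -
    define h where "h = 1 / real (Suc n)"
    have h: "0 < h" "h \<le> 1" by (auto simp: h_def)
    show ?thesis
      unfolding q_def h_def[symmetric]
      by (intro continuous_intros continuous_on_compose2[OF cG] continuous_on_subset[OF cG]) (use h in auto)
  qed
  \<comment> \<open>The integral of \<open>G\<close> over the overlap of {a..b} and its translate
    cancels, and only two end pieces of length \<open>1 / Suc n\<close> survive.\<close>
  have qint: "integral {a..b} (q n) = real (Suc n) *\<^sub>R (integral {b..b + 1 / real (Suc n)} G - integral {a..a + 1 / real (Suc n)} G)" for n
  proof -
    define h where "h = 1 / real (Suc n)"
    have h: "0 < h" "h \<le> 1" by (auto simp: h_def)
    have io: "G integrable_on {x..y}" if "a \<le> x" "y \<le> b + 1" for x y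
      by (rule integrable_continuous_interval[OF continuous_on_subset[OF cG]]) (use that in auto)
    have e1: "integral {a..a+h} G + integral {a+h..b+h} G = integral {a..b+h} G"
      by (rule Henstock_Kurzweil_Integration.integral_combine) (use h ab io in auto)
    have e2: "integral {a..b} G + integral {b..b+h} G = integral {a..b+h} G"
      by (rule Henstock_Kurzweil_Integration.integral_combine) (use h ab io in auto)
    have e3: "integral {a..b} (\<lambda>t. G (t + h)) = integral {a+h..b+h} G"
      using integral_shift_real_ivl[of "a+h" h "b+h" G] by simp
    have e4: "integral {a..b} (\<lambda>t. G (t + h) - G t) = integral {a..b} (\<lambda>t. G (t + h)) - integral {a..b} G"
    proof (rule Henstock_Kurzweil_Integration.integral_diff)
      show "(\<lambda>t. G (t + h)) integrable_on {a..b}"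
        by (intro integrable_continuous_interval continuous_on_compose2[OF cG] continuous_intros) (use h in auto)
    qed (use io in auto)
    have "integral {a+h..b+h} G = integral {a..b+h} G - integral {a..a+h} G"
      "integral {a..b} G = integral {a..b+h} G - integral {b..b+h} G"
      using e1 e2 by (simp_all add: eq_diff_eq add.commute)
    hence e5: "integral {a..b} (\<lambda>t. G (t + h) - G t) = integral {b..b+h} G - integral {a..a+h} G"
      unfolding e4 e3 by simp
    show ?thesis unfolding q_def h_def[symmetric] integral_cmul e5 ..
  qed
  have lim1: "(\<lambda>n. integral {a..b} (q n)) \<longlonglongrightarrow> F (?\<gamma> b) - F (?\<gamma> a)"
  proof -
    \<comment> \<open>After scaling, the left end piece is a difference quotient of the indefinite
      integral at a. The right one equals \<open>F (?\<gamma> b)\<close> exactly, since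
      \<open>G\<close> is constant beyond b.\<close>
    have "((\<lambda>x. integral {a..x} G) has_vector_derivative G a) (at a within {a..b+1})"
      by (rule integral_has_vector_derivative[OF cG]) (use ab in auto)
    hence l: "((\<lambda>y. (integral {a..y} G - integral {a..a} G) /\<^sub>R (y - a)) \<longlongrightarrow> G a) (at a within {a..b+1})"
      by (rule has_vector_derivative_imp_tendsto)
    have "filterlim (\<lambda>n. a + 1 / real (Suc n)) (at a within {a..b+1}) sequentially"
      unfolding filterlim_at
    proof
      show "\<forall>\<^sub>F n in sequentially. a + 1 / real (Suc n) \<in> {a..b+1} \<and> a + 1 / real (Suc n) \<noteq> a"
      proof (intro always_eventually allI)
        fix n
        have "0 < 1 / real (Suc n)" "1 / real (Suc n) \<le> 1" by auto
        thus "a + 1 / real (Suc n) \<in> {a..b+1} \<and> a + 1 / real (Suc n) \<noteq> a"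
          using ab unfolding atLeastAtMost_iff by linarith
      qed
      have "(\<lambda>n. a + 1 / real (Suc n)) \<longlonglongrightarrow> a + 0" by (intro tendsto_intros LIMSEQ_Suc lim_1_over_n)
      thus "(\<lambda>n. a + 1 / real (Suc n)) \<longlonglongrightarrow> a" by simp
    qed
    from filterlim_compose[OF l this]
    have l1: "(\<lambda>n. real (Suc n) *\<^sub>R integral {a..a + 1 / real (Suc n)} G) \<longlonglongrightarrow> F (?\<gamma> a)"
      using ab by (simp add: G_def)
    have l2: "real (Suc n) *\<^sub>R integral {b..b + 1 / real (Suc n)} G = F (?\<gamma> b)" for n
    proof -
      have "integral {b..b + 1 / real (Suc n)} G = integral {b..b + 1 / real (Suc n)} (\<lambda>_. F (?\<gamma> b))"
        by (intro Henstock_Kurzweil_Integration.integral_cong) (auto simp: G_def)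
      thus ?thesis by (simp del: of_nat_Suc)
    qed
    show ?thesis unfolding qint scaleR_diff_right l2 by (intro tendsto_intros l1)
  qed
  have conv: "AE t in lebesgue. (\<lambda>n. indicator {a..b} t *\<^sub>R q n t) \<longlonglongrightarrow> indicator {a..b} t *\<^sub>R screen_integrand S f t"
  proof -
    \<comment> \<open>At b the stopped function \<open>G\<close> may have a corner, so this one
      point is discarded.\<close>
    have "AE t in lebesgue. t \<noteq> b"
      by (rule AE_completion) (rule AE_lborel_singleton)
    with screen_differentiable_AE[OF lip] show ?thesis
    proof eventually_elim
      fix t assume d: "(?\<gamma> has_vector_derivative vector_derivative ?\<gamma> (at t)) (at t)" and tb: "t \<noteq> b"
      show "(\<lambda>n. indicator {a..b} t *\<^sub>R q n t) \<longlonglongrightarrow> indicator {a..b} t *\<^sub>R screen_integrand S f t"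
      proof (cases "t \<in> {a..b}")
        case True
        have "((F \<circ> ?\<gamma>) has_vector_derivative vector_derivative ?\<gamma> (at t) * f (?\<gamma> t)) (at t)"
          by (rule field_vector_diff_chain_at[OF d F]) (use V True in auto)
        hence "(G has_vector_derivative vector_derivative ?\<gamma> (at t) * f (?\<gamma> t)) (at t)"
        proof (rule has_vector_derivative_transform_within_open[where S = "{..<b}"])
          show "(F \<circ> ?\<gamma>) x = G x" if "x \<in> {..<b}" for x using that by (simp add: G_def)
        qed (use True tb in auto)
        from LIMSEQ_difference_quotient[OF this] show ?thesis
          using True by (simp add: q_def screen_integrand_def mult.commute)
      qed simp
    qed
  qed
  have "(\<lambda>n. LINT t|lebesgue. indicator {a..b} t *\<^sub>R q (n + n0) t) \<longlonglongrightarrow> (LINT t|lebesgue. indicator {a..b} t *\<^sub>R screen_integrand S f t)"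
  proof (rule integral_dominated_convergence)
    show "(\<lambda>t. indicator {a..b} t *\<^sub>R screen_integrand S f t) \<in> borel_measurable lebesgue"
      using set_integrable_screen_integrand[OF lip cfg] unfolding set_integrable_def by (rule borel_measurable_integrable)
    show "(\<lambda>t. indicator {a..b} t *\<^sub>R q (n + n0) t) \<in> borel_measurable lebesgue" for n
    proof (rule measurable_completion)
      show "(\<lambda>t. indicator {a..b} t *\<^sub>R q (n + n0) t) \<in> borel_measurable lborel"
        using borel_measurable_continuous_on_indicator[OF _ cq] by simp
    qed
    show "integrable lebesgue (\<lambda>t. indicator {a..b} t *\<^sub>R (M * (L + 1)))"
      by (intro integrable_completion[THEN iffD2] integrable_scaleR_left integrable_real_indicator)
         (auto simp: emeasure_lborel_Icc_eq)
    show "AE t in lebesgue. norm (indicator {a..b} t *\<^sub>R q (n + n0) t) \<le> indicator {a..b} t *\<^sub>R (M * (L + 1))" for n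
      using qbound by (intro AE_I2) (auto simp: indicator_def)
    show "AE t in lebesgue. (\<lambda>n. indicator {a..b} t *\<^sub>R q (n + n0) t) \<longlonglongrightarrow> indicator {a..b} t *\<^sub>R screen_integrand S f t"
      using conv by (rule AE_mp) (auto intro!: AE_I2 LIMSEQ_ignore_initial_segment)
  qed
  moreover have "(LINT t|lebesgue. indicator {a..b} t *\<^sub>R q n t) = integral {a..b} (q n)" for n
  proof -
    have "q n absolutely_integrable_on {a..b}" by (rule absolutely_integrable_continuous_real[OF cq])
    thus ?thesis using set_lebesgue_integral_eq_integral(2) by (simp add: set_lebesgue_integral_def)
  qed
  moreover have "(\<lambda>n. integral {a..b} (q (n + n0))) \<longlonglongrightarrow> F (?\<gamma> b) - F (?\<gamma> a)"
    using lim1 by (rule LIMSEQ_ignore_initial_segment)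
  ultimately show ?thesis unfolding set_lebesgue_integral_def by (simp add: LIMSEQ_unique)
qed

subsection \<open>Residues between the screen and a vertical line\<close>

definition right_of_graph :: "(real \<Rightarrow> real) \<Rightarrow> real \<Rightarrow> real \<Rightarrow> real \<Rightarrow> complex set" where
  "right_of_graph S \<epsilon> u v = {s. u < Im s \<and> Im s < v \<and> S (Im s) - \<epsilon> < Re s}"

lemma open_right_of_graph:
  assumes "continuous_on UNIV S"
  shows "open (right_of_graph S \<epsilon> u v)"
  unfolding right_of_graph_def
  by (intro open_Collect_conj open_Collect_less continuous_intros continuous_on_compose2[OF assms]) auto

text \<open>The shear adding \<open>S (Im s)\<close> to the real part straightens the graph into a
  vertical line. It maps a convex half-strip homeomorphically onto the region, and simple
  connectedness is what provides global primitives there.\<close>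

lemma simply_connected_right_of_graph:
  assumes S: "continuous_on UNIV S"
  shows "simply_connected (right_of_graph S \<epsilon> u v)"
proof -
  let ?C = "{s. u < Im s \<and> Im s < v \<and> - \<epsilon> < Re s}"
  have "?C = {s. Im s > u} \<inter> {s. Im s < v} \<inter> {s. Re s > - \<epsilon>}" by auto
  hence "convex ?C"
    by (simp add: convex_Int convex_halfspace_Im_lt convex_halfspace_Im_gt convex_halfspace_Re_gt)
  moreover have "?C homeomorphic right_of_graph S \<epsilon> u v"
    unfolding homeomorphic_def homeomorphism_def
  proof (intro exI conjI ballI)
    let ?f = "\<lambda>s. s + of_real (S (Im s))" and ?g = "\<lambda>s. s - of_real (S (Im s))"
    show "continuous_on ?C ?f" "continuous_on (right_of_graph S \<epsilon> u v) ?g"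
      by (intro continuous_intros continuous_on_compose2[OF S]; simp)+
    show "?g (?f s) = s" "?f (?g s) = s" for s by auto
    show 1: "?f ` ?C = right_of_graph S \<epsilon> u v"
    proof
      show "right_of_graph S \<epsilon> u v \<subseteq> ?f ` ?C"
      proof
        fix s assume "s \<in> right_of_graph S \<epsilon> u v"
        thus "s \<in> ?f ` ?C"
          by (intro image_eqI[of _ _ "?g s"]) (auto simp: right_of_graph_def)
      qed
    qed (auto simp: right_of_graph_def)
    show "?g ` right_of_graph S \<epsilon> u v = ?C"
    proof
      show "?C \<subseteq> ?g ` right_of_graph S \<epsilon> u v"
      proof
        fix s assume "s \<in> ?C"
        thus "s \<in> ?g ` right_of_graph S \<epsilon> u v"
          by (intro image_eqI[of _ _ "?f s"]) (auto simp: right_of_graph_def)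
      qed
    qed (auto simp: right_of_graph_def)
  qed
  ultimately show ?thesis
    using convex_imp_simply_connected homeomorphic_simply_connected by blast
qed

lemma right_of_graph_primitive:
  assumes S: "continuous_on UNIV S" and f: "f holomorphic_on right_of_graph S \<epsilon> u v"
  obtains F where "\<And>z. z \<in> right_of_graph S \<epsilon> u v \<Longrightarrow> (F has_field_derivative f z) (at z)"
  using simply_connected_eq_global_primitive[OF open_right_of_graph[OF S]] simply_connected_right_of_graph[OF S] f
  by metis

lemma Ln_minus_Ln_uminus:
  assumes "Im z \<noteq> 0"
  shows "Ln z - Ln (- z) = of_real (sgn (Im z)) * of_real pi * \<i>"
proof -
  have "z \<noteq> 0" using assms by auto
  thus ?thesis using assms Ln_minus[of z] by (cases "Im z > 0") (auto simp: algebra_simps)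
qed

lemma closed_segment_horizontal:
  assumes "z \<in> closed_segment (Complex x1 y) (Complex x2 y)" "x1 \<le> x2"
  shows "Im z = y" "x1 \<le> Re z" "Re z \<le> x2"
proof -
  obtain t where t: "0 \<le> t" "t \<le> 1" "z = (1 - t) *\<^sub>R Complex x1 y + t *\<^sub>R Complex x2 y"
    using assms by (auto simp: in_segment)
  have "Im z = (1 - t) * y + t * y" using t by simp
  thus "Im z = y" by (simp add: algebra_simps)
  have R: "Re z = (1 - t) * x1 + t * x2" using t by simp
  show "x1 \<le> Re z" using mult_left_mono[OF assms(2) t(1)] R by (simp add: algebra_simps)
  have "(1 - t) * x1 \<le> (1 - t) * x2" using t assms(2) by (intro mult_left_mono) auto
  thus "Re z \<le> x2" using R by (simp add: algebra_simps)
qed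

text \<open>
  On the right part of the boundary \<open>Ln (s - \<omega>)\<close> is a primitive of \<open>1 / (s - \<omega>)\<close>, on the screen
  \<open>Ln (\<omega> - s)\<close> is one; the two differ by \<open>\<plusminus> \<i> \<pi>\<close> at the two points where they meet.
\<close>

lemma screen_residue_formula_principal_parts:
  fixes q r :: "complex \<Rightarrow> complex"
  assumes lip: "L-lipschitz_on UNIV S" and u: "u < v" and \<epsilon>: "0 < \<epsilon>"
    and c: "\<And>t. t \<in> {u..v} \<Longrightarrow> S t \<le> c"
    and P: "finite P" "\<And>\<omega>. \<omega> \<in> P \<Longrightarrow> u < Im \<omega> \<and> Im \<omega> < v \<and> S (Im \<omega>) < Re \<omega> \<and> Re \<omega> < c"
    and g: "g holomorphic_on right_of_graph S \<epsilon> (u - \<epsilon>) (v + \<epsilon>)"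
    and f: "\<And>s. s \<in> right_of_graph S \<epsilon> (u - \<epsilon>) (v + \<epsilon>) - P \<Longrightarrow>
              f s = g s + (\<Sum>\<omega>\<in>P. r \<omega> / (s - \<omega>) + q \<omega> / (s - \<omega>)^2)"
  shows "(LINT t:{u..v}|lebesgue. screen_integrand (\<lambda>_. c) f t) - (LINT t:{u..v}|lebesgue. screen_integrand S f t)
    = 2 * of_real pi * \<i> * (\<Sum>\<omega>\<in>P. r \<omega>)
      + contour_integral (linepath (screen S v) (Complex c v)) f
      - contour_integral (linepath (screen S u) (Complex c u)) f"
proof -
  let ?V = "right_of_graph S \<epsilon> (u - \<epsilon>) (v + \<epsilon>)"
  have cS: "continuous_on UNIV S" using lip by (rule lipschitz_on_continuous_on)
  have oV: "open ?V" by (rule open_right_of_graph[OF cS])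
  obtain G where G: "\<And>z. z \<in> ?V \<Longrightarrow> (G has_field_derivative g z) (at z)"
    using right_of_graph_primitive[OF cS g] by blast
  \<comment> \<open>\<open>Vr\<close> removes from each pole the horizontal ray to its left and
    still contains the vertical line and both horizontal edges. \<open>Vl\<close> removes the rays
    to the right and still contains the screen.\<close>
  define Vr where "Vr = ?V \<inter> (\<Inter>\<omega>\<in>P. {s. s - \<omega> \<notin> \<real>\<^sub>\<le>\<^sub>0})"
  define Vl where "Vl = ?V \<inter> (\<Inter>\<omega>\<in>P. {s. \<omega> - s \<notin> \<real>\<^sub>\<le>\<^sub>0})"
  define Fr where "Fr s = G s + (\<Sum>\<omega>\<in>P. r \<omega> * Ln (s - \<omega>) - q \<omega> / (s - \<omega>))" for s
  define Fl where "Fl s = G s + (\<Sum>\<omega>\<in>P. r \<omega> * Ln (\<omega> - s) - q \<omega> / (s - \<omega>))" for s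
  have op1: "open {s. s - \<omega> \<notin> \<real>\<^sub>\<le>\<^sub>0}" and op2: "open {s. \<omega> - s \<notin> \<real>\<^sub>\<le>\<^sub>0}" for \<omega> :: complex
  proof -
    have "open ((\<lambda>s. s - \<omega>) -` (- \<real>\<^sub>\<le>\<^sub>0))" "open ((\<lambda>s. \<omega> - s) -` (- \<real>\<^sub>\<le>\<^sub>0))"
      by (intro open_vimage continuous_intros open_Compl closed_nonpos_Reals_complex)+
    thus "open {s. s - \<omega> \<notin> \<real>\<^sub>\<le>\<^sub>0}" "open {s. \<omega> - s \<notin> \<real>\<^sub>\<le>\<^sub>0}" by (simp_all add: vimage_def Compl_eq)
  qed
  have oVr: "open Vr" and oVl: "open Vl"
    unfolding Vr_def Vl_def using P(1) op1 op2 oV by (auto intro!: open_Int open_INT)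
  have neVr: "s \<notin> P" if "s \<in> Vr" for s using that by (auto simp: Vr_def)
  have neVl: "s \<notin> P" if "s \<in> Vl" for s using that by (auto simp: Vl_def)
  have Fr: "(Fr has_field_derivative f s) (at s)" if s: "s \<in> Vr" for s
  proof -
    have ne: "s - \<omega> \<noteq> 0" "s - \<omega> \<notin> \<real>\<^sub>\<le>\<^sub>0" if "\<omega> \<in> P" for \<omega> using s that neVr[OF s] by (auto simp: Vr_def)
    have "((\<lambda>s. r \<omega> * Ln (s - \<omega>) - q \<omega> / (s - \<omega>)) has_field_derivative r \<omega> / (s - \<omega>) + q \<omega> / (s - \<omega>)^2) (at s)"
      if "\<omega> \<in> P" for \<omega>
      using ne[OF that] by (auto intro!: derivative_eq_intros simp: field_simps power2_eq_square)
    hence "(Fr has_field_derivative g s + (\<Sum>\<omega>\<in>P. r \<omega> / (s - \<omega>) + q \<omega> / (s - \<omega>)^2)) (at s)"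
      unfolding Fr_def using G s by (intro DERIV_add DERIV_sum) (auto simp: Vr_def)
    thus ?thesis using f[of s] s neVr[OF s] by (simp add: Vr_def)
  qed
  have Fl: "(Fl has_field_derivative f s) (at s)" if s: "s \<in> Vl" for s
  proof -
    have ne: "s - \<omega> \<noteq> 0" "\<omega> - s \<noteq> 0" "\<omega> - s \<notin> \<real>\<^sub>\<le>\<^sub>0" if "\<omega> \<in> P" for \<omega> using s that neVl[OF s] by (auto simp: Vl_def)
    have "((\<lambda>s. r \<omega> * Ln (\<omega> - s) - q \<omega> / (s - \<omega>)) has_field_derivative r \<omega> / (s - \<omega>) + q \<omega> / (s - \<omega>)^2) (at s)"
      if "\<omega> \<in> P" for \<omega>
    proof -
      have "- (inverse (\<omega> - s) * r \<omega>) = r \<omega> / (s - \<omega>)" using ne[OF that] by (simp add: field_simps)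
      thus ?thesis using ne[OF that] by (auto intro!: derivative_eq_intros simp: power2_eq_square)
    qed
    hence "(Fl has_field_derivative g s + (\<Sum>\<omega>\<in>P. r \<omega> / (s - \<omega>) + q \<omega> / (s - \<omega>)^2)) (at s)"
      unfolding Fl_def using G s by (intro DERIV_add DERIV_sum) (auto simp: Vl_def)
    thus ?thesis using f[of s] s neVl[OF s] by (simp add: Vl_def)
  qed
  have holg: "continuous_on ?V g" using g by (rule holomorphic_on_imp_continuous_on)
  have contf: "continuous_on A f" if "A \<subseteq> ?V - P" for A
  proof -
    have "continuous_on A (\<lambda>s. g s + (\<Sum>\<omega>\<in>P. r \<omega> / (s - \<omega>) + q \<omega> / (s - \<omega>)^2))"
      by (intro continuous_intros continuous_on_subset[OF holg]) (use that in auto)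
    thus ?thesis by (rule continuous_on_eq) (use that f in auto)
  qed
  have contr: "continuous_on Vr f" and contl: "continuous_on Vl f"
  proof -
    have "Vr \<subseteq> ?V - P" "Vl \<subseteq> ?V - P" using neVr neVl unfolding Vr_def Vl_def by blast+
    thus "continuous_on Vr f" "continuous_on Vl f" by (simp_all add: contf)
  qed
  have nonpos: "Im z = 0" "Re z \<le> 0" if "z \<in> \<real>\<^sub>\<le>\<^sub>0" for z :: complex
    using that by (auto simp: complex_nonpos_Reals_iff)
  have right: "Complex c t \<in> Vr" if "t \<in> {u..v}" for t
  proof -
    have "Complex c t \<in> ?V" using that c[OF that] \<epsilon> by (auto simp: right_of_graph_def)
    moreover have "Complex c t - \<omega> \<notin> \<real>\<^sub>\<le>\<^sub>0" if "\<omega> \<in> P" for \<omega>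
      using P(2)[OF that] nonpos[of "Complex c t - \<omega>"] by auto
    ultimately show ?thesis unfolding Vr_def by blast
  qed
  have left: "screen S t \<in> Vl" if "t \<in> {u..v}" for t
  proof -
    have "screen S t \<in> ?V" using that \<epsilon> by (auto simp: right_of_graph_def screen_def)
    moreover have "\<omega> - screen S t \<notin> \<real>\<^sub>\<le>\<^sub>0" if "\<omega> \<in> P" for \<omega>
      using P(2)[OF that] nonpos[of "\<omega> - screen S t"] by (auto simp: screen_def)
    ultimately show ?thesis unfolding Vl_def by blast
  qed
  have horiz: "closed_segment (screen S t) (Complex c t) \<subseteq> Vr" if t: "t = u \<or> t = v" for t
  proof
    fix z assume z: "z \<in> closed_segment (screen S t) (Complex c t)"
    have ct: "S t \<le> c" using c t u by auto
    have z': "Im z = t" "S t \<le> Re z" using closed_segment_horizontal[OF z[unfolded screen_def] ct] by auto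
    hence "z \<in> ?V" using t u \<epsilon> by (auto simp: right_of_graph_def)
    moreover have "z - \<omega> \<notin> \<real>\<^sub>\<le>\<^sub>0" if "\<omega> \<in> P" for \<omega>
      using P(2)[OF that] nonpos[of "z - \<omega>"] z' t by auto
    ultimately show "z \<in> Vr" unfolding Vr_def by blast
  qed
  have i1: "(LINT t:{u..v}|lebesgue. screen_integrand (\<lambda>_. c) f t) = Fr (Complex c v) - Fr (Complex c u)"
    using screen_integral_primitive[OF lipschitz_on_constant[of UNIV c], of u v Vr Fr f] u oVr right Fr contr
    by (simp add: screen_def)
  have i2: "(LINT t:{u..v}|lebesgue. screen_integrand S f t) = Fl (screen S v) - Fl (screen S u)"
    using screen_integral_primitive[OF lip, of u v Vl Fl f] u oVl left Fl contl by simp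
  have i3: "contour_integral (linepath (screen S t) (Complex c t)) f = Fr (Complex c t) - Fr (screen S t)"
    if "t = u \<or> t = v" for t
  proof -
    have "(f has_contour_integral (Fr (pathfinish (linepath (screen S t) (Complex c t))) - Fr (pathstart (linepath (screen S t) (Complex c t)))))
       (linepath (screen S t) (Complex c t))"
      by (rule contour_integral_primitive[of Vr]) (use Fr horiz[OF that] in \<open>auto intro: has_field_derivative_at_within\<close>)
    thus ?thesis by (simp add: contour_integral_unique)
  qed
  \<comment> \<open>The terms \<open>q \<omega> / (s - \<omega>)\<close> are single-valued and agree
    in the two primitives, so only the logarithms jump. The height v lies above every pole and u
    below, hence the signs at the two corners are opposite and add up to
    \<open>2 * of_real pi * \<i>\<close> per residue.\<close>
  have jump: "Fr (screen S t) - Fl (screen S t) = (\<Sum>\<omega>\<in>P. r \<omega> * (of_real (sgn (t - Im \<omega>)) * of_real pi * \<i>))"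
    if t: "t = u \<or> t = v" for t
  proof -
    have "Fr (screen S t) - Fl (screen S t) = (\<Sum>\<omega>\<in>P. r \<omega> * (Ln (screen S t - \<omega>) - Ln (\<omega> - screen S t)))"
      unfolding Fr_def Fl_def by (simp add: sum_subtractf algebra_simps)
    also have "\<dots> = (\<Sum>\<omega>\<in>P. r \<omega> * (of_real (sgn (t - Im \<omega>)) * of_real pi * \<i>))"
    proof (rule sum.cong[OF refl])
      fix \<omega> assume "\<omega> \<in> P"
      hence "t - Im \<omega> \<noteq> 0" using P(2) t by force
      thus "r \<omega> * (Ln (screen S t - \<omega>) - Ln (\<omega> - screen S t)) = r \<omega> * (of_real (sgn (t - Im \<omega>)) * of_real pi * \<i>)"
        using Ln_minus_Ln_uminus[of "screen S t - \<omega>"] by (simp add: screen_def)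
    qed
    finally show ?thesis .
  qed
  have jv: "Fr (screen S v) - Fl (screen S v) = (\<Sum>\<omega>\<in>P. r \<omega>) * (of_real pi * \<i>)"
    unfolding jump[of v, simplified] sum_distrib_right using P(2) by (intro sum.cong) (auto simp: sgn_if)
  have ju: "Fr (screen S u) - Fl (screen S u) = - (\<Sum>\<omega>\<in>P. r \<omega>) * (of_real pi * \<i>)"
    unfolding jump[of u, simplified] sum_distrib_right sum_negf[symmetric]
    by (intro sum.cong refl) (force simp: sgn_if dest: P(2))
  have fl: "Fl (screen S v) = Fr (screen S v) - (\<Sum>\<omega>\<in>P. r \<omega>) * (of_real pi * \<i>)"
    "Fl (screen S u) = Fr (screen S u) + (\<Sum>\<omega>\<in>P. r \<omega>) * (of_real pi * \<i>)"
    using jv ju by (auto simp: algebra_simps)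
  have i3': "contour_integral (linepath (screen S u) (Complex c u)) f = Fr (Complex c u) - Fr (screen S u)"
    "contour_integral (linepath (screen S v) (Complex c v)) f = Fr (Complex c v) - Fr (screen S v)"
    by (rule i3; simp)+
  show ?thesis unfolding i1 i2 i3' fl by (simp add: algebra_simps)
qed

text \<open>At each point of \<open>P\<close> subtracting the two possible polar terms leaves a
  removable singularity, and \<open>remove_sings\<close> fills all of these at once. Order two is
  the largest that can arise: \<open>Z\<close> has simple poles and the factor \<open>1 / s\<close>
  adds one more order at 0.\<close>

lemma principal_parts:
  assumes V: "open V" and P: "finite P" and f: "f holomorphic_on V - P"
    and dp: "\<And>\<omega>. \<omega> \<in> P \<Longrightarrow> \<exists>F. F analytic_on {\<omega>} \<and> (\<forall>\<^sub>F s in at \<omega>. f s = F s / (s - \<omega>)^2)"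
  obtains g q where "g holomorphic_on V"
    "\<And>s. s \<in> V - P \<Longrightarrow> f s = g s + (\<Sum>\<omega>\<in>P. residue f \<omega> / (s - \<omega>) + q \<omega> / (s - \<omega>)^2)"
proof -
  have loc: "\<exists>q l. ((\<lambda>s. f s - (residue f \<omega> / (s - \<omega>) + q / (s - \<omega>)^2)) \<longlongrightarrow> l) (at \<omega>)" if \<omega>: "\<omega> \<in> P" for \<omega>
  proof -
    obtain F where F: "F analytic_on {\<omega>}" "\<forall>\<^sub>F s in at \<omega>. f s = F s / (s - \<omega>)^2" using dp[OF \<omega>] by blast
    obtain A where A: "open A" "\<omega> \<in> A" "F holomorphic_on A" using F(1) by (auto simp: analytic_at)
    have "residue f \<omega> = residue (\<lambda>s. F s / (s - \<omega>)^2) \<omega>" using F(2) refl by (rule residue_cong)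
    also have "\<dots> = deriv F \<omega>"
      using residue_holomorphic_over_power[OF A(1,2,3), of 1] by (simp add: numeral_2_eq_2)
    finally have res: "residue f \<omega> = deriv F \<omega>" .
    \<comment> \<open>\<open>H1\<close> and \<open>H2\<close> are the first and second divided
      differences of \<open>F\<close> at \<omega>. Off \<omega>, \<open>H2\<close> is
      \<open>f\<close> minus its polar terms, so its continuity at \<omega> gives the limit.\<close>
    define H1 where "H1 z = (if z = \<omega> then deriv F \<omega> else (F z - F \<omega>) / (z - \<omega>))" for z
    have "H1 holomorphic_on A" unfolding H1_def using A by (intro pole_lemma_open)
    define H2 where "H2 z = (if z = \<omega> then deriv H1 \<omega> else (H1 z - H1 \<omega>) / (z - \<omega>))" for z
    have "H2 holomorphic_on A" unfolding H2_def using \<open>H1 holomorphic_on A\<close> A by (intro pole_lemma_open)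
    hence "continuous_on A H2" by (rule holomorphic_on_imp_continuous_on)
    hence "isCont H2 \<omega>" using A by (simp add: continuous_on_eq_continuous_at)
    hence "(H2 \<longlongrightarrow> H2 \<omega>) (at \<omega>)" by (rule isContD)
    moreover have "\<forall>\<^sub>F s in at \<omega>. H2 s = f s - (residue f \<omega> / (s - \<omega>) + F \<omega> / (s - \<omega>)^2)"
    proof -
      have alg: "((a - b) / x - d) / x = a / x^2 - (d / x + b / x^2)" if "x \<noteq> 0" for a b d x :: complex
        using that by (simp add: field_simps power2_eq_square)
      have "\<forall>\<^sub>F s in at \<omega>. s \<noteq> \<omega>" by (simp add: eventually_at_filter)
      with F(2) show ?thesis
        by eventually_elim (simp add: H1_def H2_def res alg)
    qed
    ultimately have "((\<lambda>s. f s - (residue f \<omega> / (s - \<omega>) + F \<omega> / (s - \<omega>)^2)) \<longlongrightarrow> H2 \<omega>) (at \<omega>)"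
      by (rule Lim_transform_eventually)
    thus ?thesis by blast
  qed
  then obtain q where q: "\<And>\<omega>. \<omega> \<in> P \<Longrightarrow> \<exists>l. ((\<lambda>s. f s - (residue f \<omega> / (s - \<omega>) + q \<omega> / (s - \<omega>)^2)) \<longlongrightarrow> l) (at \<omega>)"
    by metis
  define h where "h s = f s - (\<Sum>\<omega>\<in>P. residue f \<omega> / (s - \<omega>) + q \<omega> / (s - \<omega>)^2)" for s
  have oVP: "open (V - P)" using V P by (simp add: open_Diff finite_imp_closed)
  have h: "h holomorphic_on V - P"
    unfolding h_def by (intro holomorphic_intros f) auto
  have "remove_sings h analytic_on {z}" if z: "z \<in> V" for z
  proof (cases "z \<in> P")
    case False
    thus ?thesis using h oVP z by (intro remove_sings_analytic_on) (auto simp: analytic_at)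
  next
    case True
    obtain l where l: "((\<lambda>s. f s - (residue f z / (s - z) + q z / (s - z)^2)) \<longlongrightarrow> l) (at z)"
      using q[OF True] by blast
    have "((\<lambda>s. (f s - (residue f z / (s - z) + q z / (s - z)^2))
        - (\<Sum>\<omega>\<in>P-{z}. residue f \<omega> / (s - \<omega>) + q \<omega> / (s - \<omega>)^2)) \<longlongrightarrow>
       l - (\<Sum>\<omega>\<in>P-{z}. residue f \<omega> / (z - \<omega>) + q \<omega> / (z - \<omega>)^2)) (at z)"
      by (intro tendsto_intros l) auto
    hence "(h \<longlongrightarrow> l - (\<Sum>\<omega>\<in>P-{z}. residue f \<omega> / (z - \<omega>) + q \<omega> / (z - \<omega>)^2)) (at z)"
      unfolding h_def using P True by (simp add: sum.remove algebra_simps)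
    moreover have "isolated_singularity_at h z"
    proof -
      have "open (V - (P - {z}))" using V P by (simp add: open_Diff finite_imp_closed)
      moreover have "h holomorphic_on V - (P - {z}) - {z}" by (rule holomorphic_on_subset[OF h]) auto
      moreover have "z \<in> V - (P - {z})" using z by auto
      ultimately show ?thesis
        by (meson analytic_on_open isolated_singularity_at_iff_analytic_nhd open_Diff closed_singleton)
    qed
    ultimately show ?thesis by (intro remove_sings_analytic_at)
  qed
  hence "remove_sings h holomorphic_on V"
    by (meson analytic_imp_holomorphic analytic_on_analytic_at)
  moreover have "f s = remove_sings h s + (\<Sum>\<omega>\<in>P. residue f \<omega> / (s - \<omega>) + q \<omega> / (s - \<omega>)^2)" if "s \<in> V - P" for s
  proof -
    have "h analytic_on {s}" using h oVP that analytic_at by blast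
    thus ?thesis by (simp add: h_def)
  qed
  ultimately show ?thesis by (rule that)
qed

text \<open>The window is unbounded to the right, so it is the bound \<open>c\<close> on the real
  parts of the singular points that makes the relevant slice compact; a sparse set meets a compact
  set in finitely many points.\<close>

lemma finite_window_sing:
  assumes cS: "continuous_on UNIV S" and U: "window S \<subseteq> U" and sp: "A sparse_in U"
    and c: "\<And>\<omega>. \<omega> \<in> A \<Longrightarrow> \<omega> \<in> window S \<Longrightarrow> Re \<omega> \<le> c"
  shows "compact {s. u \<le> Im s \<and> Im s \<le> v \<and> S (Im s) \<le> Re s \<and> Re s \<le> c}"
    and "finite {\<omega> \<in> A. \<omega> \<in> window S \<and> u \<le> Im \<omega> \<and> Im \<omega> \<le> v}"
proof -
  let ?K = "{s. u \<le> Im s \<and> Im s \<le> v \<and> S (Im s) \<le> Re s \<and> Re s \<le> c}"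
  have "compact (S ` {u..v})" by (intro compact_continuous_image continuous_on_subset[OF cS]) auto
  then obtain m where m: "\<And>t. t \<in> {u..v} \<Longrightarrow> \<bar>S t\<bar> \<le> m"
    by (metis bounded_iff compact_imp_bounded imageI real_norm_def)
  have "closed ?K"
    by (intro closed_Collect_conj closed_Collect_le continuous_intros continuous_on_compose2[OF cS]) auto
  moreover have "?K \<subseteq> cbox (Complex (- m) u) (Complex c v)"
    using m by (fastforce simp: in_cbox_complex_iff abs_le_iff)
  ultimately show cK: "compact ?K"
    by (meson bounded_cbox bounded_subset compact_eq_bounded_closed)
  have "?K \<subseteq> U" using U by (auto simp: window_def)
  hence "A sparse_in ?K" using sp sparse_in_subset by blast
  hence "finite (?K \<inter> A)" using cK by (rule sparse_in_compact_finite)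
  moreover have "{\<omega> \<in> A. \<omega> \<in> window S \<and> u \<le> Im \<omega> \<and> Im \<omega> \<le> v} \<subseteq> ?K \<inter> A"
    using c by (auto simp: window_def)
  ultimately show "finite {\<omega> \<in> A. \<omega> \<in> window S \<and> u \<le> Im \<omega> \<and> Im \<omega> \<le> v}" by (rule finite_subset[rotated])
qed

text \<open>The function may have singular points just left of the screen or just outside the two
  heights. Compactness of the slice gives a distance that separates those from it, and the Lipschitz
  constant of \<open>S\<close> turns this distance into a margin \<epsilon> around the slice within
  which only the poles in \<open>P\<close> occur.\<close>

lemma screen_residue_formula:
  assumes lip: "L-lipschitz_on UNIV S" and u: "u < v" and c: "\<And>t. S t \<le> c"
    and U: "open U" "window S \<subseteq> U" and sp: "A sparse_in U" and f: "f holomorphic_on U - A"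
    and dp: "\<And>\<omega>. \<omega> \<in> A \<Longrightarrow> \<omega> \<in> window S \<Longrightarrow> \<exists>F. F analytic_on {\<omega>} \<and> (\<forall>\<^sub>F s in at \<omega>. f s = F s / (s - \<omega>)^2)"
    and A: "\<And>\<omega>. \<omega> \<in> A \<Longrightarrow> \<omega> \<in> window S \<Longrightarrow> S (Im \<omega>) < Re \<omega> \<and> Re \<omega> < c"
    and uv: "\<And>\<omega>. \<omega> \<in> A \<Longrightarrow> \<omega> \<in> window S \<Longrightarrow> Im \<omega> \<noteq> u \<and> Im \<omega> \<noteq> v"
  shows "(LINT t:{u..v}|lebesgue. screen_integrand (\<lambda>_. c) f t) - (LINT t:{u..v}|lebesgue. screen_integrand S f t)
    = 2 * of_real pi * \<i> * (\<Sum>\<omega>\<in>{\<omega> \<in> A. \<omega> \<in> window S \<and> u \<le> Im \<omega> \<and> Im \<omega> \<le> v}. residue f \<omega>)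
      + contour_integral (linepath (screen S v) (Complex c v)) f
      - contour_integral (linepath (screen S u) (Complex c u)) f"
proof -
  have cS: "continuous_on UNIV S" using lip by (rule lipschitz_on_continuous_on)
  have L0: "0 \<le> L" using lip by (auto simp: lipschitz_on_def)
  have Re_le: "Re \<omega> \<le> c" if "\<omega> \<in> A" "\<omega> \<in> window S" for \<omega> using A that less_imp_le by blast
  let ?K = "{s. u \<le> Im s \<and> Im s \<le> v \<and> S (Im s) \<le> Re s \<and> Re s \<le> c}"
  define P where "P = {\<omega> \<in> A. \<omega> \<in> window S \<and> u \<le> Im \<omega> \<and> Im \<omega> \<le> v}"
  have cK: "compact ?K" and finP: "finite P"
    unfolding P_def using finite_window_sing[OF cS U(2) sp Re_le] by blast+
  have "A - P sparse_in U" using sp by (rule sparse_in_subset2) auto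
  hence oU: "open (U - (A - P))" using U(1) open_diff_sparse_pts by blast
  have "?K \<subseteq> U - (A - P)" using U(2) by (auto simp: P_def window_def)
  then obtain \<rho> where \<rho>: "\<rho> > 0" "(\<Union>x\<in>?K. ball x \<rho>) \<subseteq> U - (A - P)"
    using compact_subset_open_imp_ball_epsilon_subset[OF cK oU] by blast
  \<comment> \<open>Moving a point of the enlarged region to an admissible height and then right to
    the graph costs at most \<open>(L + 2) * \<epsilon>\<close>, which is below \<rho>.\<close>
  define \<epsilon> where "\<epsilon> = \<rho> / (L + 3)"
  have \<epsilon>: "0 < \<epsilon>" using \<rho> L0 by (simp add: \<epsilon>_def)
  have sub: "right_of_graph S \<epsilon> (u - \<epsilon>) (v + \<epsilon>) \<subseteq> U - (A - P)"
  proof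
    fix s assume s: "s \<in> right_of_graph S \<epsilon> (u - \<epsilon>) (v + \<epsilon>)"
    show "s \<in> U - (A - P)"
    \<comment> \<open>The compact slice stops at real part \<open>c\<close>. Beyond it the point
      lies in the window, and every singular point of the window has real part less than
      \<open>c\<close>.\<close>
    proof (cases "c \<le> Re s")
      case True
      have "S (Im s) \<le> Re s" using c[of "Im s"] True by linarith
      hence "s \<in> window S" by (simp add: window_def)
      moreover have "s \<notin> A" using A[of s] calculation True by auto
      ultimately show ?thesis using U(2) by blast
    next
      case False
      define t where "t = max u (min v (Im s))"
      define s0 where "s0 = Complex (max (S t) (Re s)) t"
      have t: "u \<le> t" "t \<le> v" "\<bar>Im s - t\<bar> \<le> \<epsilon>" using s u \<epsilon> by (auto simp: t_def right_of_graph_def)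
      have "s0 \<in> ?K" using t c[of t] False by (simp add: s0_def)
      moreover have "norm (s0 - s) < \<rho>"
      proof -
        have "\<bar>S t - S (Im s)\<bar> \<le> L * \<bar>Im s - t\<bar>"
          using lipschitz_onD[OF lip, of t "Im s"] by (simp add: dist_real_def abs_minus_commute)
        also have "\<dots> \<le> L * \<epsilon>" using t L0 by (intro mult_left_mono)
        finally have "\<bar>S t - S (Im s)\<bar> \<le> L * \<epsilon>" .
        hence "\<bar>max (S t) (Re s) - Re s\<bar> \<le> L * \<epsilon> + \<epsilon>"
          using s L0 \<epsilon> by (auto simp: right_of_graph_def max_def)
        moreover have "\<bar>Re (s0 - s)\<bar> + \<bar>Im (s0 - s)\<bar> = \<bar>max (S t) (Re s) - Re s\<bar> + \<bar>Im s - t\<bar>"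
          by (simp add: s0_def abs_minus_commute)
        ultimately have "\<bar>Re (s0 - s)\<bar> + \<bar>Im (s0 - s)\<bar> \<le> L * \<epsilon> + \<epsilon> + \<epsilon>"
          using t(3) by linarith
        hence "\<bar>Re (s0 - s)\<bar> + \<bar>Im (s0 - s)\<bar> \<le> (L + 2) * \<epsilon>"
          by (simp add: algebra_simps)
        hence "norm (s0 - s) \<le> (L + 2) * \<epsilon>" using cmod_le[of "s0 - s"] by linarith
        also have "\<dots> < (L + 3) * \<epsilon>" using \<epsilon> by simp
        also have "\<dots> = \<rho>" using L0 by (simp add: \<epsilon>_def)
        finally show ?thesis .
      qed
      hence "s \<in> ball s0 \<rho>" by (simp add: dist_norm)
      ultimately show ?thesis using \<rho>(2) by blast
    qed
  qed
  have dp': "\<exists>F. F analytic_on {\<omega>} \<and> (\<forall>\<^sub>F s in at \<omega>. f s = F s / (s - \<omega>)^2)" if "\<omega> \<in> P" for \<omega>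
    using dp that by (auto simp: P_def)
  have hol: "f holomorphic_on (U - (A - P)) - P" by (rule holomorphic_on_subset[OF f]) auto
  obtain g q where g: "g holomorphic_on U - (A - P)"
    "\<And>s. s \<in> U - (A - P) - P \<Longrightarrow> f s = g s + (\<Sum>\<omega>\<in>P. residue f \<omega> / (s - \<omega>) + q \<omega> / (s - \<omega>)^2)"
    using principal_parts[OF oU finP hol dp'] by blast
  show ?thesis
    unfolding P_def[symmetric]
  proof (rule screen_residue_formula_principal_parts[OF lip u \<epsilon> c finP])
    show "u < Im \<omega> \<and> Im \<omega> < v \<and> S (Im \<omega>) < Re \<omega> \<and> Re \<omega> < c" if "\<omega> \<in> P" for \<omega>
      using that A[of \<omega>] uv[of \<omega>] by (auto simp: P_def)
    show "g holomorphic_on right_of_graph S \<epsilon> (u - \<epsilon>) (v + \<epsilon>)" using g(1) sub by (rule holomorphic_on_subset)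
    show "f s = g s + (\<Sum>\<omega>\<in>P. residue f \<omega> / (s - \<omega>) + q \<omega> / (s - \<omega>)^2)"
      if "s \<in> right_of_graph S \<epsilon> (u - \<epsilon>) (v + \<epsilon>) - P" for s
      using that sub g(2) by blast
  qed
qed

section \<open>Letting the heights tend to infinity\<close>

lemma tendsto_set_integral_exhaust:
  fixes h :: "real \<Rightarrow> complex"
  assumes h: "integrable lebesgue h" and u: "filterlim u at_bot sequentially" and v: "filterlim v at_top sequentially"
  shows "(\<lambda>n. LINT t:{u n..v n}|lebesgue. h t) \<longlonglongrightarrow> (LINT t|lebesgue. h t)"
  unfolding set_lebesgue_integral_def
proof (rule integral_dominated_convergence)
  show "h \<in> borel_measurable lebesgue" using h by simp
  show "(\<lambda>t. indicator {u n..v n} t *\<^sub>R h t) \<in> borel_measurable lebesgue" for n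
    using h by (intro borel_measurable_scaleR borel_measurable_indicator) auto
  show "integrable lebesgue (\<lambda>t. norm (h t))" using h by (rule integrable_norm)
  show "AE t in lebesgue. norm (indicator {u n..v n} t *\<^sub>R h t) \<le> norm (h t)" for n
    by (intro AE_I2) (auto simp: indicator_def)
  show "AE t in lebesgue. (\<lambda>n. indicator {u n..v n} t *\<^sub>R h t) \<longlonglongrightarrow> h t"
  proof (rule AE_I2)
    fix t
    have "eventually (\<lambda>n. u n \<le> t) sequentially" "eventually (\<lambda>n. t \<le> v n) sequentially"
      using u v by (auto simp: filterlim_at_bot filterlim_at_top)
    hence "eventually (\<lambda>n. h t = indicator {u n..v n} t *\<^sub>R h t) sequentially" by eventually_elim auto
    thus "(\<lambda>n. indicator {u n..v n} t *\<^sub>R h t) \<longlonglongrightarrow> h t"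
      by (rule Lim_transform_eventually[OF tendsto_const])
  qed
qed

lemma contour_integral_horizontal_tendsto_0:
  assumes B: "\<And>t. \<bar>S t\<bar> \<le> B" and c: "\<And>t. S t \<le> c"
    and b: "b \<longlonglongrightarrow> 0" and f: "\<forall>\<^sub>F n in sequentially. \<forall>\<sigma>\<in>{S (v n)..c}. norm (f (Complex \<sigma> (v n))) \<le> b n"
  shows "(\<lambda>n. contour_integral (linepath (screen S (v n)) (Complex c (v n))) f) \<longlonglongrightarrow> 0"
proof (rule Lim_null_comparison)
  show "(\<lambda>n. b n * (\<bar>c\<bar> + B)) \<longlonglongrightarrow> 0" using tendsto_mult_right[OF b, of "\<bar>c\<bar> + B"] by simp
  show "\<forall>\<^sub>F n in sequentially. norm (contour_integral (linepath (screen S (v n)) (Complex c (v n))) f) \<le> b n * (\<bar>c\<bar> + B)"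
    using f
  proof eventually_elim
    case (elim n)
    have b0: "0 \<le> b n" using elim c[of "v n"] by (meson atLeastAtMost_iff norm_ge_zero order.refl order_trans)
    have d: "norm (Complex c (v n) - screen S (v n)) \<le> \<bar>c\<bar> + B"
    proof -
      have "Complex c (v n) - screen S (v n) = of_real (c - S (v n))" by (simp add: screen_def complex_eq_iff)
      hence "norm (Complex c (v n) - screen S (v n)) = \<bar>c - S (v n)\<bar>" by (metis norm_of_real)
      thus ?thesis using B[of "v n"] by linarith
    qed
    show ?case
    proof (cases "f contour_integrable_on linepath (screen S (v n)) (Complex c (v n))")
      case True
      have "norm (contour_integral (linepath (screen S (v n)) (Complex c (v n))) f) \<le> b n * norm (Complex c (v n) - screen S (v n))"
      proof (rule contour_integral_bound_linepath[OF True b0])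
        fix z assume z: "z \<in> closed_segment (screen S (v n)) (Complex c (v n))"
        from closed_segment_horizontal[OF z[unfolded screen_def] c[of "v n"]]
        have "z = Complex (Re z) (v n)" "Re z \<in> {S (v n)..c}" by (auto simp: complex_eq_iff)
        thus "norm (f z) \<le> b n" using elim by metis
      qed
      also have "\<dots> \<le> b n * (\<bar>c\<bar> + B)" using d b0 by (rule mult_left_mono)
      finally show ?thesis .
    next
      \<comment> \<open>For a function that is not integrable on the segment
        \<open>contour_integral\<close> is 0 by convention, so the bound holds in this case as
        well.\<close>
      case False
      have "0 \<le> B" using B[of 0] by linarith
      thus ?thesis using b0 False by (simp add: not_integrable_contour_integral)
    qed
  qed
qed

text \<open>The horizontal edges have length at most \<open>\<bar>c\<bar> + B\<close>, so a uniform
  bound tending to 0 on them kills their contribution. The integrand is left general because the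
  result serves twice: with constant screens for the Perron kernel, and with the actual screen for
  the flow.\<close>

lemma screen_residue_limit:
  assumes lip: "L-lipschitz_on UNIV S" and B: "\<And>t. \<bar>S t\<bar> \<le> B" and c: "\<And>t. S t \<le> c"
    and U: "open U" "window S \<subseteq> U" and sp: "A sparse_in U" and f: "f holomorphic_on U - A"
    and dp: "\<And>\<omega>. \<omega> \<in> A \<Longrightarrow> \<omega> \<in> window S \<Longrightarrow> \<exists>F. F analytic_on {\<omega>} \<and> (\<forall>\<^sub>F s in at \<omega>. f s = F s / (s - \<omega>)^2)"
    and A: "\<And>\<omega>. \<omega> \<in> A \<Longrightarrow> \<omega> \<in> window S \<Longrightarrow> S (Im \<omega>) < Re \<omega> \<and> Re \<omega> < c"
    and u: "filterlim u at_bot sequentially" and v: "filterlim v at_top sequentially"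
    and uv: "\<forall>\<^sub>F n in sequentially. \<forall>\<omega>\<in>A. \<omega> \<in> window S \<longrightarrow> Im \<omega> \<noteq> u n \<and> Im \<omega> \<noteq> v n"
    and b: "b \<longlonglongrightarrow> 0" "b' \<longlonglongrightarrow> 0"
    and fu: "\<forall>\<^sub>F n in sequentially. \<forall>\<sigma>\<in>{S (u n)..c}. norm (f (Complex \<sigma> (u n))) \<le> b n"
    and fv: "\<forall>\<^sub>F n in sequentially. \<forall>\<sigma>\<in>{S (v n)..c}. norm (f (Complex \<sigma> (v n))) \<le> b' n"
    and int: "integrable lebesgue (screen_integrand S f)" "integrable lebesgue (screen_integrand (\<lambda>_. c) f)"
  shows "(\<lambda>n. \<Sum>\<omega>\<in>{\<omega> \<in> A. \<omega> \<in> window S \<and> u n \<le> Im \<omega> \<and> Im \<omega> \<le> v n}. residue f \<omega>)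
     \<longlonglongrightarrow> (screen_integral (\<lambda>_. c) f - screen_integral S f) / (2 * of_real pi * \<i>)"
proof -
  let ?hu = "\<lambda>n. contour_integral (linepath (screen S (u n)) (Complex c (u n))) f"
  let ?hv = "\<lambda>n. contour_integral (linepath (screen S (v n)) (Complex c (v n))) f"
  let ?R = "\<lambda>n. \<Sum>\<omega>\<in>{\<omega> \<in> A. \<omega> \<in> window S \<and> u n \<le> Im \<omega> \<and> Im \<omega> \<le> v n}. residue f \<omega>"
  let ?I = "\<lambda>n. (LINT t:{u n..v n}|lebesgue. screen_integrand (\<lambda>_. c) f t) - (LINT t:{u n..v n}|lebesgue. screen_integrand S f t)"
  have "(\<lambda>n. (?I n - ?hv n + ?hu n) / (2 * of_real pi * \<i>)) \<longlonglongrightarrow>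
      ((screen_integral (\<lambda>_. c) f - screen_integral S f) - 0 + 0) / (2 * of_real pi * \<i>)"
    unfolding screen_integral_def
    by (intro tendsto_intros tendsto_set_integral_exhaust int u v
        contour_integral_horizontal_tendsto_0[OF B c b(1) fu] contour_integral_horizontal_tendsto_0[OF B c b(2) fv]) auto
  moreover have "\<forall>\<^sub>F n in sequentially. (?I n - ?hv n + ?hu n) / (2 * of_real pi * \<i>) = ?R n"
  proof -
    have "\<forall>\<^sub>F n in sequentially. u n \<le> - 1" "\<forall>\<^sub>F n in sequentially. 1 \<le> v n"
      using u v by (auto simp: filterlim_at_bot filterlim_at_top)
    with uv show ?thesis
    proof eventually_elim
      case (elim n)
      have "?I n = 2 * of_real pi * \<i> * ?R n + ?hv n - ?hu n"
        by (rule screen_residue_formula[OF lip _ c U sp f dp A]) (use elim in auto)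
      thus ?case by simp
    qed
  qed
  ultimately show ?thesis by (auto dest: Lim_transform_eventually)
qed

text \<open>A vertical line is the screen of a constant function, on which \<open>ds\<close> is
  \<open>\<i>\<close> times \<open>dt\<close>; lines and screens thus share one notion of
  integral.\<close>

lemma screen_integrand_const [simp]: "screen_integrand (\<lambda>_. c) f t = f (Complex c t) * \<i>"
proof -
  have e: "screen (\<lambda>_. c) = Complex c" "Complex 0 1 = \<i>" by (auto simp: screen_def fun_eq_iff complex_eq_iff)
  have "((\<lambda>t. Complex c t) has_vector_derivative Complex 0 1) (at t)"
    by (simp add: has_vector_derivative_complex_iff)
  hence "vector_derivative (Complex c) (at t) = \<i>" unfolding e by (rule vector_derivative_at)
  thus ?thesis by (simp add: screen_integrand_def e)
qed

subsection \<open>Perron's formula\<close>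

lemma integrable_inverse_1_plus_square_UNIV: "integrable lborel (\<lambda>t::real. inverse (1 + t^2))"
  using integrable_inverse_1_plus_square by (simp add: set_integrable_def)

lemma integrable_vertical_line:
  fixes f :: "complex \<Rightarrow> complex"
  assumes cont: "continuous_on UNIV (\<lambda>t. f (Complex c t))"
    and bd: "\<And>t. norm (f (Complex c t)) \<le> M * inverse (1 + t^2)"
  shows "integrable lborel (\<lambda>t. f (Complex c t))"
    and "integrable lebesgue (screen_integrand (\<lambda>_. c) f)"
    and "screen_integral (\<lambda>_. c) f = \<i> * (LINT t|lborel. f (Complex c t))"
proof -
  have m: "(\<lambda>t. f (Complex c t)) \<in> borel_measurable lborel"
    using cont by (simp add: borel_measurable_continuous_onI)
  show i: "integrable lborel (\<lambda>t. f (Complex c t))"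
  proof (rule Bochner_Integration.integrable_bound)
    show "integrable lborel (\<lambda>t::real. M * inverse (1 + t^2))"
      using integrable_inverse_1_plus_square_UNIV by simp
    show "AE t in lborel. norm (f (Complex c t)) \<le> norm (M * inverse (1 + t^2))"
      using bd by (intro AE_I2) (metis abs_ge_self order_trans real_norm_def)
  qed (use m in auto)
  hence "integrable lborel (\<lambda>t. f (Complex c t) * \<i>)" by simp
  moreover have e: "screen_integrand (\<lambda>_. c) f = (\<lambda>t. f (Complex c t) * \<i>)" by (simp add: fun_eq_iff)
  ultimately have 1: "integrable lborel (screen_integrand (\<lambda>_. c) f)" by simp
  show "integrable lebesgue (screen_integrand (\<lambda>_. c) f)"
    using 1 by (subst integrable_completion) (auto simp del: screen_integrand_const)
  have "screen_integral (\<lambda>_. c) f = (LINT t|lborel. screen_integrand (\<lambda>_. c) f t)"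
    unfolding screen_integral_def using 1 by (intro integral_completion) (auto simp del: screen_integrand_const)
  also have "\<dots> = \<i> * (LINT t|lborel. f (Complex c t))"
    using i by (simp add: mult.commute)
  finally show "screen_integral (\<lambda>_. c) f = \<i> * (LINT t|lborel. f (Complex c t))" .
qed

lemma norm_Complex_ge: "\<bar>y\<bar> \<le> norm (Complex x y)" "\<bar>x\<bar> \<le> norm (Complex x y)"
  using abs_Im_le_cmod[of "Complex x y"] abs_Re_le_cmod[of "Complex x y"] by simp_all

text \<open>The factor \<open>s + 1\<close> in the denominator makes the kernel absolutely
  integrable on vertical lines. The price is that its Perron integral is the truncated ramp
  \<open>max 0 (1 - exp (- y))\<close> instead of a step function of y.\<close>

definition perron_kernel :: "real \<Rightarrow> complex \<Rightarrow> complex" where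
  "perron_kernel y s = exp (s * of_real y) / (s * (s + 1))"

lemma norm_perron_kernel_le:
  assumes "0 < d" "d \<le> \<bar>\<sigma>\<bar>" "d \<le> \<bar>\<sigma> + 1\<bar>"
  shows "norm (perron_kernel y (Complex \<sigma> t)) \<le> exp (\<sigma> * y) * inverse (d^2 + t^2)"
proof -
  have sq: "sqrt (d^2 + t^2) \<le> norm (Complex x t)" if "d \<le> \<bar>x\<bar>" for x
  proof -
    have "d^2 \<le> \<bar>x\<bar>^2" using assms(1) that by (intro power_mono) auto
    thus ?thesis by (simp add: cmod_def)
  qed
  have e: "Complex \<sigma> t + 1 = Complex (\<sigma> + 1) t" by (simp add: complex_eq_iff)
  have pos: "0 < d^2 + t^2" using assms(1) by (simp add: add_pos_nonneg)
  have "d^2 + t^2 = sqrt (d^2 + t^2) * sqrt (d^2 + t^2)" using pos by simp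
  also have "\<dots> \<le> norm (Complex \<sigma> t) * norm (Complex (\<sigma> + 1) t)"
    using sq[of \<sigma>] sq[of "\<sigma> + 1"] assms pos by (intro mult_mono) auto
  finally have le: "d^2 + t^2 \<le> norm (Complex \<sigma> t) * norm (Complex (\<sigma> + 1) t)" .
  have "norm (perron_kernel y (Complex \<sigma> t)) = exp (\<sigma> * y) / (norm (Complex \<sigma> t) * norm (Complex (\<sigma> + 1) t))"
    unfolding perron_kernel_def e by (simp add: norm_divide norm_mult)
  also have "\<dots> \<le> exp (\<sigma> * y) / (d^2 + t^2)" using le pos by (intro divide_left_mono mult_pos_pos) auto
  finally show ?thesis by (simp add: divide_inverse)
qed

lemma continuous_on_perron_kernel:
  assumes "\<sigma> \<noteq> 0" "\<sigma> \<noteq> - 1"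
  shows "continuous_on UNIV (\<lambda>t. perron_kernel y (Complex \<sigma> t))"
proof -
  have ne: "Complex \<sigma> t \<noteq> 0" "Complex \<sigma> t + 1 \<noteq> 0" for t
    using assms by (auto simp: complex_eq_iff)
  have "continuous_on UNIV (\<lambda>t. Complex \<sigma> t)" by (intro continuous_intros)
  thus ?thesis unfolding perron_kernel_def using ne by (intro continuous_intros) auto
qed

lemma perron_kernel_line:
  assumes "1 \<le> d" "d \<le> \<bar>\<sigma>\<bar>" "d \<le> \<bar>\<sigma> + 1\<bar>" "exp (\<sigma> * y) \<le> 1"
  shows "norm (perron_kernel y (Complex \<sigma> t)) \<le> inverse (d^2 + t^2)"
  using norm_perron_kernel_le[of d \<sigma> y t] assms
  by (meson dual_order.trans inverse_nonnegative_iff_nonnegative less_le_trans mult_left_le_one_le sum_power2_ge_zero zero_less_one exp_ge_zero)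

lemma tendsto_integral_inverse_square:
  "(\<lambda>n. LINT t|lborel. inverse ((1 + real n)^2 + t^2)) \<longlonglongrightarrow> 0"
proof -
  have "(\<lambda>n. LINT t|lborel. inverse ((1 + real n)^2 + t^2)) \<longlonglongrightarrow> integral\<^sup>L lborel (\<lambda>_::real. 0::real)"
  proof (rule integral_dominated_convergence[where w = "\<lambda>t::real. inverse (1 + t^2)"])
    show "integrable lborel (\<lambda>t::real. inverse (1 + t^2))" by (rule integrable_inverse_1_plus_square_UNIV)
    show "AE t in lborel. norm (inverse ((1 + real n)^2 + t^2)) \<le> inverse (1 + t^2)" for n
    proof (rule AE_I2)
      fix t :: real
      have "1 + t^2 \<le> (1 + real n)^2 + t^2" by simp
      hence "inverse ((1 + real n)^2 + t^2) \<le> inverse (1 + t^2)" by (intro le_imp_inverse_le) (auto simp: add_pos_nonneg)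
      thus "norm (inverse ((1 + real n)^2 + t^2)) \<le> inverse (1 + t^2)" by simp
    qed
    show "AE t in lborel. (\<lambda>n. inverse ((1 + real n)^2 + t^2)) \<longlonglongrightarrow> 0"
    proof (rule AE_I2)
      fix t :: real
      show "(\<lambda>n. inverse ((1 + real n)^2 + t^2)) \<longlonglongrightarrow> 0" by real_asymp
    qed
  qed auto
  thus ?thesis by simp
qed

text \<open>The lines run off to the side on which \<open>exp (\<sigma> * y)\<close> stays at most
  1. There the integral is dominated by that of \<open>inverse ((1 + n)^2 + t^2)\<close>, which
  tends to 0.\<close>

lemma perron_kernel_line_tendsto_0:
  assumes "\<And>n. 1 + real n \<le> \<bar>\<sigma> n\<bar>" "\<And>n. 1 + real n \<le> \<bar>\<sigma> n + 1\<bar>" "\<And>n. exp (\<sigma> n * y) \<le> 1"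
  shows "(\<lambda>n. screen_integral (\<lambda>_. \<sigma> n) (perron_kernel y)) \<longlonglongrightarrow> 0"
proof (rule Lim_null_comparison[OF _ tendsto_integral_inverse_square], rule always_eventually, rule allI)
  fix n
  have le: "norm (perron_kernel y (Complex (\<sigma> n) t)) \<le> inverse ((1 + real n)^2 + t^2)" for t
    by (rule perron_kernel_line) (use assms in auto)
  have "1 + real n > 0" by simp
  hence ne: "\<sigma> n \<noteq> 0" "\<sigma> n \<noteq> - 1" using assms(1)[of n] assms(2)[of n] by auto
  have le1: "inverse ((1 + real n)^2 + t^2) \<le> 1 * inverse (1 + t^2)" for t :: real
    by (simp add: add_pos_nonneg)
  have int: "integrable lborel (\<lambda>t. perron_kernel y (Complex (\<sigma> n) t))"
    "screen_integral (\<lambda>_. \<sigma> n) (perron_kernel y) = \<i> * (LINT t|lborel. perron_kernel y (Complex (\<sigma> n) t))"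
    using integrable_vertical_line[OF continuous_on_perron_kernel[OF ne], of y 1] order_trans[OF le le1] by blast+
  have "norm (screen_integral (\<lambda>_. \<sigma> n) (perron_kernel y)) \<le> (LINT t|lborel. norm (perron_kernel y (Complex (\<sigma> n) t)))"
    unfolding int(2) using integral_norm_bound by (simp add: norm_mult)
  also have "\<dots> \<le> (LINT t|lborel. inverse ((1 + real n)^2 + t^2))"
  proof (rule integral_mono)
    show "integrable lborel (\<lambda>t. inverse ((1 + real n)^2 + t^2))"
      by (rule Bochner_Integration.integrable_bound[OF integrable_inverse_1_plus_square_UNIV])
         (use le1 in \<open>auto simp: add_pos_nonneg\<close>)
  qed (use int le in auto)
  finally show "norm (screen_integral (\<lambda>_. \<sigma> n) (perron_kernel y)) \<le> (LINT t|lborel. inverse ((1 + real n)^2 + t^2))" .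
qed

lemma perron_kernel_holomorphic: "perron_kernel y holomorphic_on UNIV - {0, - 1}"
  unfolding perron_kernel_def by (intro holomorphic_intros) (auto simp: add_eq_0_iff2)

text \<open>Both poles are simple. Multiplying numerator and denominator by the vanishing factor
  presents them in the quadratic shape in which the residue formula expects every
  singularity.\<close>

lemma perron_kernel_poles:
  "residue (perron_kernel y) 0 = 1" "residue (perron_kernel y) (- 1) = - exp (- of_real y)"
  "\<And>\<omega>. \<omega> \<in> {0, -1} \<Longrightarrow> \<exists>F. F analytic_on {\<omega>} \<and> (\<forall>\<^sub>F s in at \<omega>. perron_kernel y s = F s / (s - \<omega>)^2)"
proof -
  let ?F0 = "\<lambda>s. exp (s * of_real y) / (s + 1)" and ?F1 = "\<lambda>s. exp (s * of_real y) / s"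
  have h0: "?F0 holomorphic_on ball 0 1" and h1: "?F1 holomorphic_on ball (- 1) 1"
    by (auto intro!: holomorphic_intros simp: dist_norm add_eq_0_iff2)
  have e0: "perron_kernel y = (\<lambda>s. ?F0 s / (s - 0))" and e1: "perron_kernel y = (\<lambda>s. ?F1 s / (s - (- 1)))"
    by (auto simp: perron_kernel_def fun_eq_iff)
  show "residue (perron_kernel y) 0 = 1"
    unfolding e0 by (subst residue_simple[OF _ _ h0]) auto
  show "residue (perron_kernel y) (- 1) = - exp (- of_real y)"
    unfolding e1 by (subst residue_simple[OF _ _ h1]) auto
  fix \<omega> :: complex assume "\<omega> \<in> {0, -1}"
  then consider "\<omega> = 0" | "\<omega> = - 1" by blast
  thus "\<exists>F. F analytic_on {\<omega>} \<and> (\<forall>\<^sub>F s in at \<omega>. perron_kernel y s = F s / (s - \<omega>)^2)"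
  proof cases
    case 1
    have "(\<lambda>s. ?F0 s * s) analytic_on {0}" using h0 by (intro analytic_intros) (auto simp: analytic_at intro!: exI[of _ "ball 0 1"])
    thus ?thesis unfolding 1 e0
      by (intro exI[of _ "\<lambda>s. ?F0 s * s"]) (auto simp: power2_eq_square)
  next
    case 2
    have "(\<lambda>s. ?F1 s * (s + 1)) analytic_on {-1}" using h1 by (intro analytic_intros) auto
    thus ?thesis unfolding 2 e1
      by (intro exI[of _ "\<lambda>s. ?F1 s * (s + 1)"]) (auto simp: power2_eq_square)
  qed
qed

text \<open>The contour shift for a screen that is itself a vertical line. The two alternatives for
  \<open>a\<close> place it to the right of both poles or to the left of both, so no line used
  passes through a pole.\<close>

lemma perron_kernel_shift:
  assumes ab: "a < c" and ac: "0 < a \<or> a < - 1 \<and> 0 < c"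
  shows "screen_integral (\<lambda>_. c) (perron_kernel y) - screen_integral (\<lambda>_. a) (perron_kernel y)
     = 2 * of_real pi * \<i> * (\<Sum>\<omega>\<in>{\<omega>\<in>{0,-1}. a \<le> Re \<omega>}. residue (perron_kernel y) \<omega>)"
proof -
  let ?f = "perron_kernel y"
  define M where "M = exp ((\<bar>a\<bar> + \<bar>c\<bar>) * \<bar>y\<bar>)"
  have bd: "norm (?f (Complex \<sigma> t)) \<le> M * inverse (t^2)" if "\<sigma> \<in> {a..c}" "t \<noteq> 0" for \<sigma> t
  proof -
    have "norm (?f (Complex \<sigma> t)) = exp (\<sigma> * y) / (norm (Complex \<sigma> t) * norm (Complex (\<sigma> + 1) t))"
    proof -
      have "Complex \<sigma> t + 1 = Complex (\<sigma> + 1) t" by (simp add: complex_eq_iff)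
      thus ?thesis unfolding perron_kernel_def by (simp add: norm_divide norm_mult)
    qed
    also have "\<dots> \<le> M / (\<bar>t\<bar> * \<bar>t\<bar>)"
    proof (intro frac_le mult_mono norm_Complex_ge)
      have "\<sigma> * y \<le> \<bar>\<sigma>\<bar> * \<bar>y\<bar>" by (metis abs_ge_self abs_mult)
      also have "\<dots> \<le> (\<bar>a\<bar> + \<bar>c\<bar>) * \<bar>y\<bar>" using that by (intro mult_right_mono) auto
      finally show "exp (\<sigma> * y) \<le> M" by (simp add: M_def)
    qed (use that in \<open>auto simp: M_def zero_less_mult_iff\<close>)
    finally show ?thesis by (simp add: divide_inverse power2_eq_square)
  qed
  have line: "integrable lebesgue (screen_integrand (\<lambda>_. x) ?f)" if "x \<notin> {0, -1}" for x
  proof -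
    \<comment> \<open>The distance of the line from the two poles, capped at 1 so that
      \<open>d^2 * (1 + t^2) \<le> d^2 + t^2\<close>.\<close>
    define d where "d = min 1 (min \<bar>x\<bar> \<bar>x + 1\<bar>)"
    have d: "0 < d" "d \<le> 1" "d \<le> \<bar>x\<bar>" "d \<le> \<bar>x + 1\<bar>" using that by (auto simp: d_def)
    have bd': "norm (?f (Complex x t)) \<le> (exp (x * y) / d^2) * inverse (1 + t^2)" for t
    proof -
      have d2: "d^2 \<le> 1" "0 < d^2" using d by (auto simp: power_le_one)
      have "d^2 * (1 + t^2) \<le> d^2 + t^2"
        using mult_right_mono[OF d2(1), of "t^2"] by (simp add: algebra_simps)
      hence "inverse (d^2 + t^2) \<le> inverse (d^2 * (1 + t^2))"
        using d2 by (intro le_imp_inverse_le) (auto intro!: mult_pos_pos add_pos_nonneg)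
      hence "exp (x * y) * inverse (d^2 + t^2) \<le> exp (x * y) * inverse (d^2 * (1 + t^2))"
        by (intro mult_left_mono) auto
      from order_trans[OF norm_perron_kernel_le[OF d(1,3,4), of y t] this]
      show ?thesis by (simp add: divide_inverse mult.assoc)
    qed
    show ?thesis by (rule integrable_vertical_line(2)[OF continuous_on_perron_kernel bd']) (use that in auto)
  qed
  have win: "\<omega> \<in> window (\<lambda>_. a) \<longleftrightarrow> a \<le> Re \<omega>" for \<omega> by (simp add: window_def)
  have inv0: "(\<lambda>n. M * inverse ((real n)^2)) \<longlonglongrightarrow> 0" by real_asymp
  have "(\<lambda>n. \<Sum>\<omega>\<in>{\<omega> \<in> {0, -1}. \<omega> \<in> window (\<lambda>_. a) \<and> - real n \<le> Im \<omega> \<and> Im \<omega> \<le> real n}. residue ?f \<omega>)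
     \<longlonglongrightarrow> (screen_integral (\<lambda>_. c) ?f - screen_integral (\<lambda>_. a) ?f) / (2 * of_real pi * \<i>)"
  proof (rule screen_residue_limit[OF lipschitz_on_constant, where U = UNIV and B = "\<bar>a\<bar>"])
    show "filterlim (\<lambda>n. - real n) at_bot sequentially" "filterlim real at_top sequentially" by real_asymp+
    show "perron_kernel y holomorphic_on UNIV - {0, - 1}" by (rule perron_kernel_holomorphic)
    show "\<forall>\<^sub>F n in sequentially. \<forall>\<sigma>\<in>{a..c}. norm (?f (Complex \<sigma> (- real n))) \<le> M * inverse ((real n)^2)"
      using eventually_gt_at_top[of 0] by eventually_elim (use bd[of _ "- real n" for n] in auto)
    show "\<forall>\<^sub>F n in sequentially. \<forall>\<sigma>\<in>{a..c}. norm (?f (Complex \<sigma> (real n))) \<le> M * inverse ((real n)^2)"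
      using eventually_gt_at_top[of 0] by eventually_elim (use bd in auto)
    show "\<forall>\<^sub>F n in sequentially. \<forall>\<omega>\<in>{0, -1}. \<omega> \<in> window (\<lambda>_. a) \<longrightarrow> Im \<omega> \<noteq> - real n \<and> Im \<omega> \<noteq> real n"
      using eventually_gt_at_top[of 0] by eventually_elim auto
    show "integrable lebesgue (screen_integrand (\<lambda>_. a) ?f)" "integrable lebesgue (screen_integrand (\<lambda>_. c) ?f)"
      using ab ac by (auto intro!: line simp del: screen_integrand_const)
    show "a < Re \<omega> \<and> Re \<omega> < c" if "\<omega> \<in> {0, - 1}" "\<omega> \<in> window (\<lambda>_. a)" for \<omega>
      using that ac by (auto simp: win)
  qed (use ab inv0 perron_kernel_poles(3) in \<open>auto intro: finite_imp_sparse\<close>)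
  moreover have "{\<omega> \<in> {0, -1}. \<omega> \<in> window (\<lambda>_. a) \<and> - real n \<le> Im \<omega> \<and> Im \<omega> \<le> real n} = {\<omega>\<in>{0,-1}. a \<le> Re \<omega>}" for n
    by (auto simp: win)
  ultimately have "(\<Sum>\<omega>\<in>{\<omega>\<in>{0,-1}. a \<le> Re \<omega>}. residue ?f \<omega>)
     = (screen_integral (\<lambda>_. c) ?f - screen_integral (\<lambda>_. a) ?f) / (2 * of_real pi * \<i>)"
    by (simp only: LIMSEQ_const_iff)
  thus ?thesis by simp
qed

text \<open>The line is shifted to \<open>+\<infinity>\<close> if \<open>y \<le> 0\<close> and to \<open>-\<infinity>\<close> if \<open>y \<ge> 0\<close>.\<close>

lemma perron_formula:
  assumes c: "0 < c"
  shows "screen_integral (\<lambda>_. c) (perron_kernel y) = 2 * of_real pi * \<i> * of_real (max 0 (1 - exp (- y)))"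
proof (cases "y \<le> 0")
  case True
  define \<sigma> where "\<sigma> n = c + 1 + real n" for n
  have e: "{\<omega>\<in>{0,-1}. c \<le> Re \<omega>} = {}" using c by auto
  have "screen_integral (\<lambda>_. \<sigma> n) (perron_kernel y) = screen_integral (\<lambda>_. c) (perron_kernel y)" for n
    using perron_kernel_shift[of c "\<sigma> n" y] c unfolding e by (simp add: \<sigma>_def)
  moreover have "(\<lambda>n. screen_integral (\<lambda>_. \<sigma> n) (perron_kernel y)) \<longlonglongrightarrow> 0"
    using c True by (intro perron_kernel_line_tendsto_0) (auto simp: \<sigma>_def mult_nonneg_nonpos)
  ultimately have "screen_integral (\<lambda>_. c) (perron_kernel y) = 0" by (simp add: LIMSEQ_const_iff)
  thus ?thesis using True by simp
next
  case False
  \<comment> \<open>The start at -2 keeps \<open>\<bar>\<sigma> n + 1\<bar>\<close>, and not only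
    \<open>\<bar>\<sigma> n\<bar>\<close>, at least \<open>1 + real n\<close>.\<close>
  define \<sigma> where "\<sigma> n = - 2 - real n" for n
  have e: "{\<omega>\<in>{0,-1}. \<sigma> n \<le> Re \<omega>} = {0, -1}" for n by (auto simp: \<sigma>_def)
  have "screen_integral (\<lambda>_. \<sigma> n) (perron_kernel y) = screen_integral (\<lambda>_. c) (perron_kernel y) - 2 * of_real pi * \<i> * (1 - exp (- of_real y))" for n
    using perron_kernel_shift[of "\<sigma> n" c y] c unfolding e by (simp add: \<sigma>_def perron_kernel_poles algebra_simps)
  moreover have "(\<lambda>n. screen_integral (\<lambda>_. \<sigma> n) (perron_kernel y)) \<longlonglongrightarrow> 0"
    using False by (intro perron_kernel_line_tendsto_0) (auto simp: \<sigma>_def mult_nonpos_nonneg)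
  ultimately have "screen_integral (\<lambda>_. c) (perron_kernel y) = 2 * of_real pi * \<i> * (1 - exp (- of_real y))"
    by (simp add: LIMSEQ_const_iff)
  thus ?thesis using False by (simp add: exp_of_real[symmetric])
qed

subsection \<open>Mellin transforms of test functions\<close>

definition vderiv :: "(real \<Rightarrow> complex) \<Rightarrow> real \<Rightarrow> complex" where
  "vderiv f = (\<lambda>u. vector_derivative f (at u))"

lemma test_function_alt:
  "test_function \<phi> \<longleftrightarrow> (\<forall>n x. (vderiv ^^ n) \<phi> differentiable (at x)) \<and>
     (\<exists>a b. 0 < a \<and> a \<le> b \<and> (\<forall>x. x \<notin> {a..b} \<longrightarrow> \<phi> x = 0))"
proof -
  have "vderiv = (\<lambda>f u. vector_derivative f (at u))" by (simp add: vderiv_def fun_eq_iff)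
  thus ?thesis by (simp add: test_function_def)
qed

lemma test_function_has_vector_derivative:
  assumes "test_function \<phi>"
  shows "(\<phi> has_vector_derivative vderiv \<phi> x) (at x)"
proof -
  have "(vderiv ^^ 0) \<phi> differentiable (at x)" using assms test_function_alt by blast
  thus ?thesis by (simp add: vderiv_def vector_derivative_works)
qed

lemma test_function_continuous: "test_function \<phi> \<Longrightarrow> continuous_on A \<phi>"
  by (meson continuous_at_imp_continuous_on has_vector_derivative_continuous test_function_has_vector_derivative)

text \<open>The support interval is enlarged a little so that \<phi> vanishes at both endpoints,
  which removes the boundary terms of every integration by parts below.\<close>

lemma test_function_support:
  assumes "test_function \<phi>"
  obtains a b where "0 < a" "a < b" "\<And>x. x \<notin> {a<..<b} \<Longrightarrow> \<phi> x = 0"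
proof -
  obtain a b where "0 < a" "a \<le> b" "\<And>x. x \<notin> {a..b} \<Longrightarrow> \<phi> x = 0" using assms test_function_alt by blast
  thus ?thesis by (intro that[of "a / 2" "b + 1"]) auto
qed

lemma vderiv_outside:
  assumes "\<And>x. x \<notin> {a..b} \<Longrightarrow> \<phi> x = 0" "x \<notin> {a..b}"
  shows "vderiv \<phi> x = 0"
proof -
  have "((\<lambda>_. 0) has_vector_derivative 0) (at x)" by simp
  hence "(\<phi> has_vector_derivative 0) (at x)"
    by (rule has_vector_derivative_transform_within_open[where S = "- {a..b}"]) (use assms in auto)
  thus ?thesis unfolding vderiv_def by (rule vector_derivative_at)
qed

lemma test_function_vderiv:
  assumes "test_function \<phi>"
  shows "test_function (vderiv \<phi>)"
  unfolding test_function_alt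
proof
  have "(vderiv ^^ n) (vderiv \<phi>) = (vderiv ^^ Suc n) \<phi>" for n by (simp add: funpow_swap1)
  thus "\<forall>n x. (vderiv ^^ n) (vderiv \<phi>) differentiable (at x)" using assms test_function_alt by metis
  show "\<exists>a b. 0 < a \<and> a \<le> b \<and> (\<forall>x. x \<notin> {a..b} \<longrightarrow> vderiv \<phi> x = 0)"
    using assms vderiv_outside unfolding test_function_alt by metis
qed

lemma vderiv_funpow_dilate:
  assumes "test_function \<phi>" "0 < a"
  shows "(vderiv ^^ n) (dilate a \<phi>) = (\<lambda>x. (vderiv ^^ n) \<phi> (x / a) / of_real a ^ Suc n)"
    and "(vderiv ^^ n) (dilate a \<phi>) differentiable (at x)"
proof -
  have d: "((\<lambda>x. (vderiv ^^ n) \<phi> (x / a) / of_real a ^ Suc n) has_vector_derivative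
       (vderiv ^^ Suc n) \<phi> (x / a) / of_real a ^ Suc (Suc n)) (at x)" for n x
  proof -
    have "(vderiv ^^ n) \<phi> differentiable (at (x / a))" using assms test_function_alt by blast
    hence "((vderiv ^^ n) \<phi> has_vector_derivative (vderiv ^^ Suc n) \<phi> (x / a)) (at (x / a))"
      by (simp add: vderiv_def vector_derivative_works)
    moreover have "((\<lambda>x. x / a) has_real_derivative 1 / a) (at x)"
      using assms(2) by (auto intro!: derivative_eq_intros)
    ultimately have "((vderiv ^^ n) \<phi> \<circ> (\<lambda>x. x / a) has_vector_derivative (1 / a) *\<^sub>R (vderiv ^^ Suc n) \<phi> (x / a)) (at x)"
      by (intro vector_diff_chain_at) (auto simp: has_real_derivative_iff_has_vector_derivative)
    hence "((\<lambda>x. (vderiv ^^ n) \<phi> (x / a) / of_real a ^ Suc n) has_vector_derivative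
       ((1 / a) *\<^sub>R (vderiv ^^ Suc n) \<phi> (x / a)) / of_real a ^ Suc n) (at x)"
      by (auto simp: o_def intro: has_vector_derivative_divide)
    thus ?thesis using assms(2) by (simp add: scaleR_conv_of_real field_simps)
  qed
  show 1: "(vderiv ^^ n) (dilate a \<phi>) = (\<lambda>x. (vderiv ^^ n) \<phi> (x / a) / of_real a ^ Suc n)" for n
  proof (induction n)
    case 0
    show ?case by (simp add: dilate_def)
  next
    case (Suc n)
    have "(vderiv ^^ Suc n) (dilate a \<phi>) = vderiv (\<lambda>x. (vderiv ^^ n) \<phi> (x / a) / of_real a ^ Suc n)"
      using Suc by simp
    also have "\<dots> = (\<lambda>x. (vderiv ^^ Suc n) \<phi> (x / a) / of_real a ^ Suc (Suc n))"
      using vector_derivative_at[OF d[of n]] by (intro ext) (simp only: vderiv_def[of "\<lambda>x. _ x / _"])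
    finally show ?case .
  qed
  show "(vderiv ^^ n) (dilate a \<phi>) differentiable (at x)"
    unfolding 1 using d by (rule differentiableI_vector)
qed

lemma test_function_dilate:
  assumes "test_function \<phi>" "0 < a"
  shows "test_function (dilate a \<phi>)"
proof -
  obtain u v where "0 < u" "u \<le> v" "\<And>x. x \<notin> {u..v} \<Longrightarrow> \<phi> x = 0" using assms test_function_alt by blast
  hence "0 < a * u \<and> a * u \<le> a * v \<and> (\<forall>x. x \<notin> {a * u..a * v} \<longrightarrow> dilate a \<phi> x = 0)"
    using assms(2) by (auto simp: dilate_def field_simps)
  thus ?thesis unfolding test_function_alt using vderiv_funpow_dilate(2)[OF assms] by blast
qed

lemma of_real_powr_exp: "0 < x \<Longrightarrow> (of_real x :: complex) powr s = exp (s * of_real (ln x))"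
  by (simp add: powr_def Ln_of_real)

lemma norm_of_real_powr: "0 < x \<Longrightarrow> norm ((of_real x :: complex) powr s) = x powr Re s"
  by (simp add: of_real_powr_exp powr_def)

lemma set_lebesgue_integral_support:
  fixes f :: "real \<Rightarrow> complex"
  assumes "0 < a" "\<And>x. 0 < x \<Longrightarrow> x \<notin> {a..b} \<Longrightarrow> f x = 0" "f absolutely_integrable_on {a..b}"
  shows "(LINT x:{0<..}|lebesgue. f x) = integral {a..b} f" "set_integrable lebesgue {0<..} f"
proof -
  have eq: "(\<lambda>x. indicator {0<..} x *\<^sub>R f x) = (\<lambda>x. indicator {a..b} x *\<^sub>R f x)"
    using assms(1,2) by (force simp: indicator_def fun_eq_iff)
  have "(LINT x:{0<..}|lebesgue. f x) = (LINT x:{a..b}|lebesgue. f x)"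
    unfolding set_lebesgue_integral_def eq ..
  also have "\<dots> = integral {a..b} f" by (rule set_lebesgue_integral_eq_integral[OF assms(3)])
  finally show "(LINT x:{0<..}|lebesgue. f x) = integral {a..b} f" .
  show "set_integrable lebesgue {0<..} f" using assms(3) unfolding set_integrable_def eq .
qed

lemma distr_of_eq_integral:
  assumes "0 < a" "\<And>x. x \<notin> {a..b} \<Longrightarrow> \<phi> x = 0" "continuous_on {a..b} (\<lambda>x. F x * \<phi> x)"
  shows "distr_of F \<phi> = integral {a..b} (\<lambda>x. F x * \<phi> x)" "set_integrable lebesgue {0<..} (\<lambda>x. F x * \<phi> x)"
proof -
  have "(\<lambda>x. F x * \<phi> x) absolutely_integrable_on {a..b}" using assms(3) by (rule absolutely_integrable_continuous_real)
  from set_lebesgue_integral_support[OF assms(1) _ this]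
  show "distr_of F \<phi> = integral {a..b} (\<lambda>x. F x * \<phi> x)" "set_integrable lebesgue {0<..} (\<lambda>x. F x * \<phi> x)"
    using assms(2) by (auto simp: distr_of_def)
qed

lemma continuous_on_powr_arg:
  assumes "0 < a"
  shows "continuous_on {a..b} (\<lambda>x. (of_real x :: complex) powr s)"
  by (rule continuous_on_eq[of _ "\<lambda>x. exp (s * of_real (ln x))"])
     (use assms in \<open>auto simp: of_real_powr_exp intro!: continuous_intros\<close>)

lemma mellin_eq_integral:
  assumes tf: "test_function \<phi>" and a: "0 < a" "\<And>x. x \<notin> {a..b} \<Longrightarrow> \<phi> x = 0"
  shows "mellin \<phi> s = integral {a..b} (\<lambda>x. \<phi> x * of_real x powr (s - 1))"
proof -
  have "continuous_on {a..b} (\<lambda>x. of_real x powr (s - 1) * \<phi> x)"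
    by (intro continuous_intros continuous_on_powr_arg a test_function_continuous[OF tf])
  from distr_of_eq_integral(1)[OF a this] show ?thesis by (simp add: mellin_def distr_of_def mult.commute)
qed

lemma mellin_conv_distr_of: "mellin \<phi> (s + 1) = distr_of (\<lambda>x. of_real x powr s) \<phi>"
  by (simp add: mellin_def distr_of_def mult.commute)

text \<open>Compact support inside the positive axis leaves no boundary terms. Each application
  trades one derivative of the test function for one factor \<open>1 / s\<close>, which is the
  source of all decay in vertical strips.\<close>

lemma mellin_by_parts:
  assumes tf: "test_function \<phi>" and s: "s \<noteq> 0"
  shows "mellin \<phi> s = - mellin (vderiv \<phi>) (s + 1) / s"
proof -
  obtain a b where ab: "0 < a" "a < b" "\<And>x. x \<notin> {a<..<b} \<Longrightarrow> \<phi> x = 0" using test_function_support[OF tf] by blast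
  have ab': "\<phi> x = 0" if "x \<notin> {a..b}" for x using that ab(3) by auto
  have "((\<lambda>x. vderiv \<phi> x * of_real x powr s + s * (\<phi> x * of_real x powr (s - 1))) has_integral
      \<phi> b * of_real b powr s - \<phi> a * of_real a powr s) {a..b}"
  proof (rule fundamental_theorem_of_calculus)
    fix x assume x: "x \<in> {a..b}"
    have "((\<lambda>x. (of_real x :: complex) powr s) has_vector_derivative s * of_real x powr (s - 1)) (at x)"
    proof -
      have "((\<lambda>z. z powr s) has_field_derivative s * of_real x powr (s - 1)) (at (of_real x))"
        using x ab by (intro has_field_derivative_powr) (auto simp: complex_nonpos_Reals_iff)
      from has_vector_derivative_real_field[OF this] show ?thesis by simp
    qed
    from has_vector_derivative_mult[OF test_function_has_vector_derivative[OF tf] this]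
    have "((\<lambda>x. \<phi> x * of_real x powr s) has_vector_derivative
        vderiv \<phi> x * of_real x powr s + s * (\<phi> x * of_real x powr (s - 1))) (at x)"
      by (simp add: algebra_simps)
    thus "((\<lambda>x. \<phi> x * of_real x powr s) has_vector_derivative
        vderiv \<phi> x * of_real x powr s + s * (\<phi> x * of_real x powr (s - 1))) (at x within {a..b})"
      by (rule has_vector_derivative_at_within)
  qed (use ab in auto)
  hence "integral {a..b} (\<lambda>x. vderiv \<phi> x * of_real x powr s + s * (\<phi> x * of_real x powr (s - 1))) = 0"
    using ab by (simp add: integral_unique)
  moreover have "integral {a..b} (\<lambda>x. vderiv \<phi> x * of_real x powr s + s * (\<phi> x * of_real x powr (s - 1)))
     = integral {a..b} (\<lambda>x. vderiv \<phi> x * of_real x powr s) + integral {a..b} (\<lambda>x. s * (\<phi> x * of_real x powr (s - 1)))"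
    by (intro Henstock_Kurzweil_Integration.integral_add integrable_continuous_interval continuous_intros
        continuous_on_powr_arg ab test_function_continuous tf test_function_vderiv)
  moreover have "mellin (vderiv \<phi>) (s + 1) = integral {a..b} (\<lambda>x. vderiv \<phi> x * of_real x powr s)"
    using mellin_eq_integral[OF test_function_vderiv[OF tf] ab(1) vderiv_outside[OF ab']] by simp
  moreover have "mellin \<phi> s = integral {a..b} (\<lambda>x. \<phi> x * of_real x powr (s - 1))"
    by (rule mellin_eq_integral[OF tf ab(1) ab'])
  ultimately have "mellin (vderiv \<phi>) (s + 1) + s * mellin \<phi> s = 0" by simp
  thus ?thesis using s by (simp add: field_simps eq_neg_iff_add_eq_0 add.commute)
qed

lemma mellin_bounded_strip:
  assumes tf: "test_function \<phi>"
  obtains M where "0 \<le> M" "\<And>s. \<sigma>1 \<le> Re s \<Longrightarrow> Re s \<le> \<sigma>2 \<Longrightarrow> norm (mellin \<phi> s) \<le> M"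
proof -
  obtain a b where ab: "0 < a" "a < b" "\<And>x. x \<notin> {a<..<b} \<Longrightarrow> \<phi> x = 0" using test_function_support[OF tf] by blast
  have ab': "\<phi> x = 0" if "x \<notin> {a..b}" for x using that ab(3) by auto
  \<comment> \<open>An intermediate power of x is dominated by the larger extreme power if x >= 1
    and by the smaller if x < 1; the sum covers both cases.\<close>
  define h where "h x = norm (\<phi> x) * (x powr (\<sigma>1 - 1) + x powr (\<sigma>2 - 1))" for x
  have ch: "continuous_on {a..b} h"
    unfolding h_def using ab by (intro continuous_intros test_function_continuous[OF tf]) auto
  have me: "mellin \<phi> s = integral {a..b} (\<lambda>x. \<phi> x * of_real x powr (s - 1))" for s
    by (rule mellin_eq_integral[OF tf ab(1) ab'])
  have bd: "norm (mellin \<phi> s) \<le> integral {a..b} h" if s: "\<sigma>1 \<le> Re s" "Re s \<le> \<sigma>2" for s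
    unfolding me
  proof (rule integral_norm_bound_integral)
    show "(\<lambda>x. \<phi> x * of_real x powr (s - 1)) integrable_on {a..b}"
      by (intro integrable_continuous_interval continuous_intros continuous_on_powr_arg ab test_function_continuous[OF tf])
    show "h integrable_on {a..b}" using ch by (rule integrable_continuous_interval)
    fix x assume "x \<in> {a..b}"
    hence x: "0 < x" using ab by auto
    have "x powr (Re s - 1) \<le> x powr (\<sigma>1 - 1) + x powr (\<sigma>2 - 1)"
    proof (cases "1 \<le> x")
      case True
      hence "x powr (Re s - 1) \<le> x powr (\<sigma>2 - 1)" using s by (intro powr_mono) auto
      thus ?thesis by (simp add: add_increasing)
    next
      case False
      hence "x powr (Re s - 1) \<le> x powr (\<sigma>1 - 1)" using s x by (intro powr_mono') auto
      thus ?thesis by (simp add: add_increasing2)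
    qed
    thus "norm (\<phi> x * of_real x powr (s - 1)) \<le> h x"
      using x by (simp add: h_def norm_mult norm_of_real_powr mult_left_mono)
  qed
  show ?thesis by (rule that[of "\<bar>integral {a..b} h\<bar>"]) (use bd in \<open>auto intro: order_trans[OF _ abs_ge_self]\<close>)
qed

text \<open>Induction on \<open>k\<close>, integrating by parts once per step. The argument moves
  right by 1 each time, so the strip has to be generalised together with \<phi>.\<close>

lemma mellin_decay:
  assumes "test_function \<phi>"
  shows "\<exists>M\<ge>0. \<forall>s. \<sigma>1 \<le> Re s \<longrightarrow> Re s \<le> \<sigma>2 \<longrightarrow> norm (mellin \<phi> s) * \<bar>Im s\<bar> ^ k \<le> M"
  using assms
proof (induction k arbitrary: \<phi> \<sigma>1 \<sigma>2)
  case 0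
  obtain M where "0 \<le> M" "\<And>s. \<sigma>1 \<le> Re s \<Longrightarrow> Re s \<le> \<sigma>2 \<Longrightarrow> norm (mellin \<phi> s) \<le> M"
    using mellin_bounded_strip[OF 0] by blast
  thus ?case by auto
next
  case (Suc k)
  obtain M where M: "0 \<le> M" "\<And>s. \<sigma>1 + 1 \<le> Re s \<Longrightarrow> Re s \<le> \<sigma>2 + 1 \<Longrightarrow> norm (mellin (vderiv \<phi>) s) * \<bar>Im s\<bar> ^ k \<le> M"
    using Suc.IH[OF test_function_vderiv[OF Suc.prems], of "\<sigma>1 + 1" "\<sigma>2 + 1"] by blast
  have "norm (mellin \<phi> s) * \<bar>Im s\<bar> ^ Suc k \<le> M" if s: "\<sigma>1 \<le> Re s" "Re s \<le> \<sigma>2" for s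
  proof (cases "Im s = 0")
    case True
    thus ?thesis using M by simp
  next
    case False
    hence s0: "s \<noteq> 0" by auto
    have "norm (mellin \<phi> s) * \<bar>Im s\<bar> \<le> norm (mellin \<phi> s) * norm s"
      by (intro mult_left_mono abs_Im_le_cmod) auto
    also have "\<dots> = norm (mellin (vderiv \<phi>) (s + 1))"
      using s0 by (simp add: mellin_by_parts[OF Suc.prems s0] norm_divide)
    finally have "norm (mellin \<phi> s) * \<bar>Im s\<bar> * \<bar>Im s\<bar> ^ k \<le> norm (mellin (vderiv \<phi>) (s + 1)) * \<bar>Im s\<bar> ^ k"
      by (rule mult_right_mono) simp
    also have "\<dots> \<le> M" using M(2)[of "s + 1"] s by simp
    finally show ?thesis by (simp add: mult.assoc)
  qed
  thus ?case using M(1) by blast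
qed

text \<open>Differentiation under the integral sign over the compact support. Besides holomorphy,
  the value at 1 matters: it is the pairing with \<open>ln x\<close> that produces the logarithm in
  the residue at 0.\<close>

lemma mellin_has_field_derivative:
  assumes tf: "test_function \<phi>"
  shows "(mellin \<phi> has_field_derivative distr_of (\<lambda>x. of_real (ln x) * of_real x powr (s - 1)) \<phi>) (at s)"
proof -
  obtain a b where ab: "0 < a" "a < b" "\<And>x. x \<notin> {a<..<b} \<Longrightarrow> \<phi> x = 0" using test_function_support[OF tf] by blast
  have ab': "\<phi> x = 0" if "x \<notin> {a..b}" for x using that ab(3) by auto
  define f where "f s x = \<phi> x * exp ((s - 1) * of_real (ln x))" for s :: complex and x
  define fx where "fx s x = \<phi> x * (of_real (ln x) * exp ((s - 1) * of_real (ln x)))" for s :: complex and x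
  have me: "mellin \<phi> s = integral {a..b} (\<lambda>x. \<phi> x * of_real x powr (s - 1))" for s
    by (rule mellin_eq_integral[OF tf ab(1) ab'])
  have eq: "mellin \<phi> s = integral (cbox a b) (f s)" for s
    unfolding me f_def cbox_interval
    by (intro Henstock_Kurzweil_Integration.integral_cong) (use ab in \<open>auto simp: of_real_powr_exp\<close>)
  have "((\<lambda>s. integral (cbox a b) (f s)) has_field_derivative integral (cbox a b) (fx s)) (at s within UNIV)"
  proof (rule leibniz_rule_field_derivative)
    show "((\<lambda>s. f s x) has_field_derivative fx s x) (at s within UNIV)" for s x
      unfolding f_def fx_def by (auto intro!: derivative_eq_intros)
    show "f s integrable_on cbox a b" for s
      unfolding f_def cbox_interval using ab
      by (intro integrable_continuous_interval continuous_intros test_function_continuous[OF tf]) auto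
    show "continuous_on (UNIV \<times> cbox a b) (\<lambda>(s, x). fx s x)"
      unfolding fx_def case_prod_unfold using ab
      by (intro continuous_intros continuous_on_compose2[OF test_function_continuous[OF tf, of UNIV]]) auto
  qed auto
  moreover have "integral (cbox a b) (fx s) = distr_of (\<lambda>x. of_real (ln x) * of_real x powr (s - 1)) \<phi>"
  proof -
    have "distr_of (\<lambda>x. of_real (ln x) * of_real x powr (s - 1)) \<phi>
        = integral {a..b} (\<lambda>x. of_real (ln x) * of_real x powr (s - 1) * \<phi> x)"
      by (rule distr_of_eq_integral(1)[OF ab(1) ab'])
         (use ab in \<open>auto intro!: continuous_intros continuous_on_powr_arg test_function_continuous[OF tf]\<close>)
    also have "\<dots> = integral {a..b} (fx s)"
      by (intro Henstock_Kurzweil_Integration.integral_cong) (use ab in \<open>auto simp: fx_def of_real_powr_exp\<close>)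
    finally show ?thesis by simp
  qed
  moreover have "mellin \<phi> = (\<lambda>s. integral (cbox a b) (f s))" using eq by auto
  ultimately show ?thesis by simp
qed

lemma mellin_holomorphic: "test_function \<phi> \<Longrightarrow> mellin \<phi> holomorphic_on A"
  using mellin_has_field_derivative
  by (meson field_differentiable_at_within field_differentiable_def holomorphic_onI)

lemma mellin_shift_holomorphic: "test_function \<phi> \<Longrightarrow> (\<lambda>s. mellin \<phi> (s + 1)) holomorphic_on A"
  by (intro holomorphic_on_compose_gen[of "\<lambda>s. s + 1" _ "mellin \<phi>" UNIV, unfolded o_def] holomorphic_intros
      mellin_holomorphic) auto

lemma mellin_dilate:
  assumes tf: "test_function \<phi>" and a: "0 < a"
  shows "mellin (dilate a \<phi>) (s + 1) = of_real a powr s * mellin \<phi> (s + 1)"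
proof -
  let ?g = "\<lambda>x. indicator {0<..} x *\<^sub>R (of_real x powr s * \<phi> x)"
  have gm: "(\<lambda>x. indicator {0<..} x *\<^sub>R (of_real x powr s * \<psi> x)) \<in> borel_measurable lborel"
    if "test_function \<psi>" for \<psi>
  proof -
    have "\<psi> \<in> borel_measurable borel" using that by (simp add: borel_measurable_continuous_onI test_function_continuous)
    moreover have "(\<lambda>x. indicator {0<..} x *\<^sub>R (of_real x powr s * \<psi> x)) =
        (\<lambda>x. indicator {0<..} x *\<^sub>R (exp (s * of_real (ln x)) * \<psi> x))"
      by (auto simp: fun_eq_iff indicator_def of_real_powr_exp)
    ultimately show ?thesis by simp
  qed
  have m: "mellin \<psi> (s + 1) = (LINT x|lborel. indicator {0<..} x *\<^sub>R (of_real x powr s * \<psi> x))"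
    if "test_function \<psi>" for \<psi>
    unfolding mellin_conv_distr_of distr_of_def set_lebesgue_integral_def
    by (rule integral_completion[OF gm[OF that]])
  have "mellin (dilate a \<phi>) (s + 1) = (LINT x|lborel. indicator {0<..} x *\<^sub>R (of_real x powr s * dilate a \<phi> x))"
    by (rule m[OF test_function_dilate[OF tf a]])
  also have "\<dots> = a *\<^sub>R (LINT x|lborel. indicator {0<..} (0 + a * x) *\<^sub>R (of_real (0 + a * x) powr s * dilate a \<phi> (0 + a * x)))"
    using lborel_integral_real_affine[of a "\<lambda>x. indicator {0<..} x *\<^sub>R (of_real x powr s * dilate a \<phi> x)" 0] a
    by simp
  also have "\<dots> = a *\<^sub>R (LINT x|lborel. (of_real a powr s / of_real a) * ?g x)"
  proof -
    have "indicator {0<..} (0 + a * x) *\<^sub>R (of_real (0 + a * x) powr s * dilate a \<phi> (0 + a * x))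
        = (of_real a powr s / of_real a) * ?g x" for x
      using a by (auto simp: indicator_def dilate_def zero_less_mult_iff of_real_powr_exp ln_mult exp_add ring_distribs
          simp flip: of_real_mult)
    thus ?thesis by simp
  qed
  also have "\<dots> = of_real a powr s * (LINT x|lborel. ?g x)"
    using a by (simp add: scaleR_conv_of_real)
  also have "\<dots> = of_real a powr s * mellin \<phi> (s + 1)" by (simp add: m[OF tf])
  finally show ?thesis .
qed

text \<open>One order of decay comes from the Mellin transform and one from \<open>1 / s\<close>; on
  lines with c >= 1 each is controlled by \<open>1 / sqrt (1 + t^2)\<close>, up to a
  constant.\<close>

lemma mellin_over_s_bound:
  assumes tf: "test_function \<phi>" and c: "1 \<le> c"
  obtains M where "0 \<le> M" "\<And>t. norm (mellin \<phi> (Complex c t + 1) / Complex c t) \<le> M * inverse (1 + t^2)"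
proof -
  obtain M0 where M0: "0 \<le> M0" "\<And>s. c + 1 \<le> Re s \<Longrightarrow> Re s \<le> c + 1 \<Longrightarrow> norm (mellin \<phi> s) * \<bar>Im s\<bar> ^ 0 \<le> M0"
    using mellin_decay[OF tf, of "c + 1" "c + 1" 0] by blast
  obtain M1 where M1: "0 \<le> M1" "\<And>s. c + 1 \<le> Re s \<Longrightarrow> Re s \<le> c + 1 \<Longrightarrow> norm (mellin \<phi> s) * \<bar>Im s\<bar> ^ 1 \<le> M1"
    using mellin_decay[OF tf, of "c + 1" "c + 1" 1] by blast
  have "norm (mellin \<phi> (Complex c t + 1) / Complex c t) \<le> (M0 + M1) * inverse (1 + t^2)" for t
  proof -
    let ?q = "sqrt (1 + t^2)"
    have pos: "0 < 1 + t^2" by (simp add: add_pos_nonneg)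
    have qt: "?q \<le> 1 + \<bar>t\<bar>"
    proof (rule real_le_lsqrt)
      show "1 + t\<^sup>2 \<le> (1 + \<bar>t\<bar>)\<^sup>2" by (simp add: power2_eq_square algebra_simps)
    qed auto
    have "norm (mellin \<phi> (Complex c t + 1)) * (1 + \<bar>t\<bar>) \<le> M0 + M1"
      using M0(2)[of "Complex c t + 1"] M1(2)[of "Complex c t + 1"] by (simp add: algebra_simps)
    moreover have "norm (mellin \<phi> (Complex c t + 1)) * ?q \<le> norm (mellin \<phi> (Complex c t + 1)) * (1 + \<bar>t\<bar>)"
      using qt by (intro mult_left_mono) auto
    ultimately have "norm (mellin \<phi> (Complex c t + 1)) * ?q \<le> M0 + M1" by linarith
    hence 1: "norm (mellin \<phi> (Complex c t + 1)) \<le> (M0 + M1) / ?q"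
      using pos by (subst pos_le_divide_eq) auto
    have "1 \<le> c^2" using c by simp
    hence 2: "?q \<le> norm (Complex c t)" by (simp add: cmod_def)
    have "norm (mellin \<phi> (Complex c t + 1) / Complex c t) \<le> ((M0 + M1) / ?q) / ?q"
      unfolding norm_divide using 1 2 pos M0(1) M1(1) by (intro frac_le) auto
    also have "\<dots> = (M0 + M1) * inverse (1 + t^2)" using pos by (simp add: divide_inverse mult.assoc inverse_mult_distrib[symmetric])
    finally show ?thesis .
  qed
  thus ?thesis using M0(1) M1(1) by (intro that[of "M0 + M1"]) auto
qed

lemma continuous_mellin_over_s:
  assumes tf: "test_function \<phi>" and c: "c \<noteq> 0"
  shows "continuous_on UNIV (\<lambda>t. mellin \<phi> (Complex c t + 1) / Complex c t)"
proof -
  have ct: "continuous_on UNIV (\<lambda>t. Complex c t)" by (intro continuous_intros)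
  have "continuous_on UNIV (mellin \<phi>)" using mellin_holomorphic[OF tf] by (rule holomorphic_on_imp_continuous_on)
  hence "continuous_on UNIV (\<lambda>t. mellin \<phi> (Complex c t + 1))"
    by (rule continuous_on_compose2) (auto intro!: continuous_intros)
  thus ?thesis using c ct by (intro continuous_intros) (auto simp: complex_eq_iff)
qed

text \<open>The ramp \<open>max 0 (x - Y)\<close> has the unit step at \<open>Y\<close> as its
  derivative, so integration by parts undoes the smoothing that the factor \<open>s + 1\<close>
  brought into the Perron kernel.\<close>

lemma integral_vderiv_ramp:
  assumes tf: "test_function \<phi>" and ab: "0 < a" "a < b" "\<And>x. x \<notin> {a<..<b} \<Longrightarrow> \<phi> x = 0" and Y: "0 < Y"
  shows "integral {a..b} (\<lambda>x. vderiv \<phi> x * of_real (max 0 (x - Y))) = - distr_of (\<lambda>x. if ln Y \<le> ln x then 1 else 0) \<phi>"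
proof -
  define Y' where "Y' = max a Y"
  have cv: "continuous_on A (vderiv \<phi>)" for A by (intro test_function_continuous test_function_vderiv tf)
  have c: "continuous_on A \<phi>" for A by (intro test_function_continuous tf)
  have "distr_of (\<lambda>x. if ln Y \<le> ln x then 1 else 0) \<phi> = (LINT x:{Y'..b}|lebesgue. \<phi> x)"
    unfolding distr_of_def set_lebesgue_integral_def
  proof (rule Bochner_Integration.integral_cong[OF refl])
    fix x
    show "indicat_real {0<..} x *\<^sub>R ((if ln Y \<le> ln x then 1 else 0) * \<phi> x) = indicat_real {Y'..b} x *\<^sub>R \<phi> x"
      using ab Y by (cases "x \<in> {a<..<b}") (auto simp: Y'_def indicator_def)
  qed
  also have "\<dots> = integral {Y'..b} \<phi>"
    by (rule set_lebesgue_integral_eq_integral) (intro absolutely_integrable_continuous_real c)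
  finally have 1: "distr_of (\<lambda>x. if ln Y \<le> ln x then 1 else 0) \<phi> = integral {Y'..b} \<phi>" .
  have 2: "integral {Y'..b} (\<lambda>x. vderiv \<phi> x * of_real (x - Y)) = - integral {Y'..b} \<phi>"
  proof (cases "Y' \<le> b")
    case True
    have "((\<lambda>x. \<phi> x * 1 + vderiv \<phi> x * of_real (x - Y)) has_integral
         (\<phi> b * of_real (b - Y) - \<phi> Y' * of_real (Y' - Y))) {Y'..b}"
    proof (rule fundamental_theorem_of_calculus[OF True])
      fix x assume "x \<in> {Y'..b}"
      have "((\<lambda>x. of_real (x - Y) :: complex) has_vector_derivative 1) (at x)"
        by (auto intro!: derivative_eq_intros simp: has_real_derivative_iff_has_vector_derivative[symmetric])
      thus "((\<lambda>x. \<phi> x * of_real (x - Y)) has_vector_derivative \<phi> x * 1 + vderiv \<phi> x * of_real (x - Y)) (at x within {Y'..b})"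
        by (intro has_vector_derivative_at_within[OF has_vector_derivative_mult] test_function_has_vector_derivative[OF tf])
    qed
    \<comment> \<open>At the lower end one factor always vanishes: the ramp if
      \<open>Y' = Y\<close>, the test function if \<open>Y' = a\<close>.\<close>
    moreover have "\<phi> b = 0" "\<phi> Y' * of_real (Y' - Y) = 0" using ab by (auto simp: Y'_def max_def)
    ultimately have "integral {Y'..b} (\<lambda>x. \<phi> x * 1 + vderiv \<phi> x * of_real (x - Y)) = 0"
      by (metis diff_self integral_unique mult_zero_left)
    moreover have "integral {Y'..b} (\<lambda>x. \<phi> x * 1 + vderiv \<phi> x * of_real (x - Y)) =
        integral {Y'..b} (\<lambda>x. \<phi> x * 1) + integral {Y'..b} (\<lambda>x. vderiv \<phi> x * of_real (x - Y))"
      by (intro Henstock_Kurzweil_Integration.integral_add integrable_continuous_interval continuous_intros c cv)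
    ultimately show ?thesis by (simp add: eq_neg_iff_add_eq_0 add.commute)
  qed auto
  have 3: "integral {a..b} (\<lambda>x. vderiv \<phi> x * of_real (max 0 (x - Y))) = integral {Y'..b} (\<lambda>x. vderiv \<phi> x * of_real (x - Y))"
  proof -
    have "integral {Y'..b} (\<lambda>x. vderiv \<phi> x * of_real (x - Y)) = integral {Y'..b} (\<lambda>x. vderiv \<phi> x * of_real (max 0 (x - Y)))"
      by (intro Henstock_Kurzweil_Integration.integral_cong) (auto simp: Y'_def)
    also have "\<dots> = integral {a..b} (\<lambda>x. vderiv \<phi> x * of_real (max 0 (x - Y)))"
    proof -
      let ?f = "\<lambda>x. vderiv \<phi> x * of_real (max 0 (x - Y))"
      have "integral {a..b} ?f = integral {a..b} (\<lambda>x. if x \<in> {Y'..b} then ?f x else 0)"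
        by (intro Henstock_Kurzweil_Integration.integral_cong) (auto simp: Y'_def max_def)
      also have "\<dots> = integral ({Y'..b} \<inter> {a..b}) ?f" by (rule Henstock_Kurzweil_Integration.integral_restrict_Int)
      also have "{Y'..b} \<inter> {a..b} = {Y'..b}" by (auto simp: Y'_def)
      finally show ?thesis ..
    qed
    finally show ?thesis by simp
  qed
  show ?thesis unfolding 3 2 1 ..
qed

text \<open>One integration by parts gives the denominator \<open>s * (s + 1)\<close>, and
  \<open>x powr (s + 1)\<close> splits into x times an exponential in \<open>ln x\<close>. The
  damped Mellin transform is therefore a superposition of Perron kernels, to which Perron's formula
  can be applied under the integral.\<close>

lemma mellin_eq_perron_average:
  assumes tf: "test_function \<phi>" and ab: "0 < a" "a < b" "\<And>x. x \<notin> {a<..<b} \<Longrightarrow> \<phi> x = 0" and s: "0 < Re s"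
  shows "exp (- s * of_real y) * (mellin \<phi> (s + 1) / s) =
    - (LINT x|lborel. indicator {a..b} x *\<^sub>R (vderiv \<phi> x * of_real x * perron_kernel (ln x - y) s))"
proof -
  have ab': "\<phi> x = 0" if "x \<notin> {a..b}" for x using that ab(3) by auto
  have s0: "s \<noteq> 0" "s + 1 \<noteq> 0" using s by (auto simp: complex_eq_iff)
  have cv: "continuous_on A (vderiv \<phi>)" for A by (intro test_function_continuous test_function_vderiv tf)
  have cp: "continuous_on {a..b} (\<lambda>x. vderiv \<phi> x * of_real x * perron_kernel (ln x - y) s)"
    unfolding perron_kernel_def using ab s0 by (intro continuous_intros cv) auto
  have v0: "vderiv \<phi> x = 0" if "x \<notin> {a..b}" for x using vderiv_outside[OF ab' that] by simp
  have "mellin (vderiv \<phi>) (s + 1 + 1) = integral {a..b} (\<lambda>x. vderiv \<phi> x * of_real x powr (s + 1))"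
    by (subst mellin_eq_integral[OF test_function_vderiv[OF tf] ab(1) v0]) (simp_all add: add.commute)
  hence "exp (- s * of_real y) * (mellin \<phi> (s + 1) / s) =
     - (exp (- s * of_real y) / (s * (s + 1))) * integral {a..b} (\<lambda>x. vderiv \<phi> x * of_real x powr (s + 1))"
    using mellin_by_parts[OF tf s0(2)] by (simp add: divide_inverse mult_ac)
  also have "\<dots> = - integral {a..b} (\<lambda>x. (exp (- s * of_real y) / (s * (s + 1))) * (vderiv \<phi> x * of_real x powr (s + 1)))"
    by simp
  also have "integral {a..b} (\<lambda>x. (exp (- s * of_real y) / (s * (s + 1))) * (vderiv \<phi> x * of_real x powr (s + 1)))
     = integral {a..b} (\<lambda>x. vderiv \<phi> x * of_real x * perron_kernel (ln x - y) s)"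
  proof (rule Henstock_Kurzweil_Integration.integral_cong)
    fix x assume "x \<in> {a..b}"
    hence x: "0 < x" using ab by auto
    have "(of_real x :: complex) powr (s + 1) = of_real x * exp (s * of_real (ln x))"
      using x by (simp add: of_real_powr_exp ring_distribs exp_add exp_of_real)
    moreover have "exp (- s * of_real y) * exp (s * of_real (ln x)) = exp (s * of_real (ln x - y))"
      by (simp add: exp_add[symmetric] algebra_simps)
    ultimately show "(exp (- s * of_real y) / (s * (s + 1))) * (vderiv \<phi> x * of_real x powr (s + 1)) =
        vderiv \<phi> x * of_real x * perron_kernel (ln x - y) s"
      by (simp add: perron_kernel_def divide_inverse mult_ac)
  qed
  also have "\<dots> = (LINT x:{a..b}|lborel. vderiv \<phi> x * of_real x * perron_kernel (ln x - y) s)"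
    using set_borel_integral_eq_integral(2)[OF borel_integrable_atLeastAtMost'[OF cp]] by simp
  finally show ?thesis unfolding set_lebesgue_integral_def .
qed

text \<open>Fubini exchanges the integral along the line with the average over x. The inner integral
  is Perron's formula and gives a ramp; integrating by parts back turns the ramp into the step at
  \<open>exp y\<close>.\<close>

lemma perron_test_function:
  assumes tf: "test_function \<phi>" and c: "1 \<le> c"
  shows "screen_integral (\<lambda>_. c) (\<lambda>s. exp (- s * of_real y) * (mellin \<phi> (s + 1) / s)) =
    2 * of_real pi * \<i> * distr_of (\<lambda>x. if y \<le> ln x then 1 else 0) \<phi>"
proof -
  obtain a b where ab: "0 < a" "a < b" "\<And>x. x \<notin> {a<..<b} \<Longrightarrow> \<phi> x = 0" using test_function_support[OF tf] by blast
  have cv: "continuous_on A (vderiv \<phi>)" for A by (intro test_function_continuous test_function_vderiv tf)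
  have vm [measurable]: "vderiv \<phi> \<in> borel_measurable borel" using cv by (rule borel_measurable_continuous_onI)
  have ct: "continuous_on UNIV (\<lambda>t. Complex c t)" by (intro continuous_intros)
  let ?h = "\<lambda>s. exp (- s * of_real y) * (mellin \<phi> (s + 1) / s)"
  define G where "G t x = indicator {a..b} x *\<^sub>R (vderiv \<phi> x * of_real x * perron_kernel (ln x - y) (Complex c t))" for t x
  obtain M where M: "0 \<le> M" "\<And>t. norm (mellin \<phi> (Complex c t + 1) / Complex c t) \<le> M * inverse (1 + t^2)"
    using mellin_over_s_bound[OF tf c] by blast
  have conth: "continuous_on UNIV (\<lambda>t. ?h (Complex c t))"
    using c by (intro continuous_on_mult continuous_mellin_over_s[OF tf] continuous_intros ct) auto
  have bdh: "norm (?h (Complex c t)) \<le> (exp (- c * y) * M) * inverse (1 + t^2)" for t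
  proof -
    have "norm (?h (Complex c t)) = exp (- c * y) * norm (mellin \<phi> (Complex c t + 1) / Complex c t)"
      unfolding norm_mult by simp
    also have "\<dots> \<le> exp (- c * y) * (M * inverse (1 + t^2))" using M(2) by (intro mult_left_mono) auto
    finally show ?thesis by (simp add: mult.assoc)
  qed
  have P: "norm (perron_kernel z (Complex c t)) \<le> exp (c * z) * inverse (1 + t^2)" for z t
    using norm_perron_kernel_le[of 1 c z t] c by simp
  have contP: "continuous_on UNIV (\<lambda>t. perron_kernel z (Complex c t))" for z
    using c by (intro continuous_on_perron_kernel) auto
  have intP: "(LINT t|lborel. perron_kernel z (Complex c t)) = 2 * of_real pi * of_real (max 0 (1 - exp (- z)))"
    "integrable lborel (\<lambda>t. perron_kernel z (Complex c t))" for z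
    using integrable_vertical_line(1,3)[OF contP P, of z] perron_formula[of c z] c by (auto simp: mult.assoc)
  \<comment> \<open>The integrand is dominated by the product of \<open>inverse (1 + t^2)\<close>
    and \<open>H x\<close>, both integrable; this justifies Fubini.\<close>
  define H where "H x = indicator {a..b} x *\<^sub>R (norm (vderiv \<phi> x) * \<bar>x\<bar> * exp (c * (ln x - y)))" for x
  have Hint: "integrable lborel H"
  proof -
    have "continuous_on {a..b} (\<lambda>x. norm (vderiv \<phi> x) * \<bar>x\<bar> * exp (c * (ln x - y)))"
      using ab by (intro continuous_intros cv) auto
    from borel_integrable_atLeastAtMost'[OF this] show ?thesis unfolding H_def[abs_def] set_integrable_def .
  qed
  have GH: "norm (G t x) \<le> inverse (1 + t^2) * H x" for t x
  proof -
    have "norm (vderiv \<phi> x * of_real x * perron_kernel (ln x - y) (Complex c t))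
       \<le> norm (vderiv \<phi> x) * \<bar>x\<bar> * (exp (c * (ln x - y)) * inverse (1 + t^2))"
      unfolding norm_mult using P[of "ln x - y" t] by (intro mult_mono) auto
    thus ?thesis unfolding G_def H_def by (auto simp: indicator_def mult_ac)
  qed
  have Gm [measurable]: "(\<lambda>z. G (fst z) (snd z)) \<in> borel_measurable (lborel \<Otimes>\<^sub>M lborel)"
    unfolding G_def perron_kernel_def Complex_eq by measurable
  have Gx: "integrable lborel (G t)" for t
  proof (rule Bochner_Integration.integrable_bound)
    show "integrable lborel (\<lambda>x. inverse (1 + t^2) * H x)" using Hint by simp
    show "G t \<in> borel_measurable lborel" unfolding G_def perron_kernel_def by measurable
    show "AE x in lborel. norm (G t x) \<le> norm (inverse (1 + t^2) * H x)"
      using GH by (intro AE_I2) (metis abs_ge_self order_trans real_norm_def)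
  qed
  have Gint: "integrable (lborel \<Otimes>\<^sub>M lborel) (\<lambda>z. G (fst z) (snd z))"
  proof (rule lborel_pair.Fubini_integrable)
    show "integrable lborel (\<lambda>t. LINT x|lborel. norm (G (fst (t, x)) (snd (t, x))))"
    proof (rule Bochner_Integration.integrable_bound)
      show "integrable lborel (\<lambda>t::real. inverse (1 + t^2) * (LINT x|lborel. H x))"
        using integrable_inverse_1_plus_square_UNIV by simp
      show "(\<lambda>t. LINT x|lborel. norm (G (fst (t, x)) (snd (t, x)))) \<in> borel_measurable lborel" by measurable
      show "AE t in lborel. norm (LINT x|lborel. norm (G (fst (t, x)) (snd (t, x)))) \<le> norm (inverse (1 + t^2) * (LINT x|lborel. H x))"
      proof (rule AE_I2)
        fix t
        have "(LINT x|lborel. norm (G t x)) \<le> (LINT x|lborel. inverse (1 + t^2) * H x)"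
          using GH Gx Hint by (intro integral_mono) auto
        thus "norm (LINT x|lborel. norm (G (fst (t, x)) (snd (t, x)))) \<le> norm (inverse (1 + t^2) * (LINT x|lborel. H x))"
          by (simp add: abs_le_iff)
      qed
    qed
  qed (use Gx in auto)
  have hG: "?h (Complex c t) = - (LINT x|lborel. G t x)" for t
    unfolding G_def by (rule mellin_eq_perron_average[OF tf ab]) (use c in auto)
  have "screen_integral (\<lambda>_. c) ?h = \<i> * (LINT t|lborel. ?h (Complex c t))"
    by (rule integrable_vertical_line(3)[OF conth bdh])
  also have "(LINT t|lborel. ?h (Complex c t)) = - (LINT t|lborel. LINT x|lborel. G t x)"
    unfolding hG by simp
  also have "(LINT t|lborel. LINT x|lborel. G t x) = (LINT x|lborel. LINT t|lborel. G t x)"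
    using lborel_pair.Fubini_integral[of G] Gint by (simp add: case_prod_unfold)
  also have "\<dots> = (LINT x|lborel. indicator {a..b} x *\<^sub>R (2 * of_real pi * (vderiv \<phi> x * of_real (max 0 (x - exp y)))))"
  proof (rule Bochner_Integration.integral_cong[OF refl])
    fix x
    have "(LINT t|lborel. G t x) = indicator {a..b} x *\<^sub>R (vderiv \<phi> x * of_real x * (2 * of_real pi * of_real (max 0 (1 - exp (- (ln x - y))))))"
      unfolding G_def using intP by simp
    also have "\<dots> = indicator {a..b} x *\<^sub>R (2 * of_real pi * (vderiv \<phi> x * of_real (max 0 (x - exp y))))"
    proof (cases "x \<in> {a..b}")
      case True
      hence x: "0 < x" using ab by auto
      \<comment> \<open>The weight x from the average rescales the truncated ramp in
        \<open>ln x - y\<close> to a ramp in x that starts at \<open>exp y\<close>.\<close>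
      have "x * (1 - exp (- (ln x - y))) = x - exp y" using x by (simp add: exp_diff algebra_simps)
      moreover have "x * max 0 (1 - exp (- (ln x - y))) = max 0 (x * (1 - exp (- (ln x - y))))"
        using x by (simp add: max_mult_distrib_left)
      ultimately have "x * max 0 (1 - exp (- (ln x - y))) = max 0 (x - exp y)" by simp
      hence "complex_of_real x * of_real (max 0 (1 - exp (- (ln x - y)))) = of_real (max 0 (x - exp y))"
        by (metis of_real_mult)
      thus ?thesis by (simp add: mult_ac)
    qed simp
    finally show "(LINT t|lborel. G t x) = indicator {a..b} x *\<^sub>R (2 * of_real pi * (vderiv \<phi> x * of_real (max 0 (x - exp y))))" .
  qed
  also have "\<dots> = integral {a..b} (\<lambda>x. 2 * of_real pi * (vderiv \<phi> x * of_real (max 0 (x - exp y))))"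
  proof -
    have "continuous_on {a..b} (\<lambda>x. 2 * of_real pi * (vderiv \<phi> x * of_real (max 0 (x - exp y))))"
      by (intro continuous_intros cv)
    from set_borel_integral_eq_integral(2)[OF borel_integrable_atLeastAtMost'[OF this]]
    show ?thesis unfolding set_lebesgue_integral_def .
  qed
  also have "\<dots> = - 2 * of_real pi * distr_of (\<lambda>x. if y \<le> ln x then 1 else 0) \<phi>"
    using integral_vderiv_ramp[OF tf ab, of "exp y"] by simp
  finally show ?thesis by simp
qed

subsection \<open>Dirichlet series with nonnegative coefficients\<close>

lemma set_integrable_step_test_function:
  assumes tf: "test_function \<phi>"
  shows "set_integrable lebesgue {0<..} (\<lambda>x. (if y \<le> ln x then 1 else 0) * \<phi> x)"
proof -
  obtain a b where ab: "0 < a" "a < b" "\<And>x. x \<notin> {a<..<b} \<Longrightarrow> \<phi> x = 0" using test_function_support[OF tf] by blast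
  have "indicat_real {0<..} x *\<^sub>R ((if y \<le> ln x then 1 else 0) * \<phi> x) = indicat_real {max a (exp y)..b} x *\<^sub>R \<phi> x" for x
    using ab by (cases "x \<in> {a<..<b}") (auto simp: indicator_def ln_ge_iff)
  moreover have "\<phi> absolutely_integrable_on {max a (exp y)..b}"
    by (intro absolutely_integrable_continuous_real test_function_continuous tf)
  ultimately show ?thesis unfolding set_integrable_def by simp
qed

text \<open>With \<open>r\<close> half the distance of s from the line of abscissa \<open>D\<close>,
  the disc of radius \<open>r\<close> about s stays to the right of \<open>D + r\<close>. The series
  at the real point \<open>D + r\<close> is then a Weierstrass majorant, and locally uniform limits
  may be differentiated termwise.\<close>

lemma has_field_derivative_infsum_exp:
  fixes a l :: "'i \<Rightarrow> real"
  assumes a: "\<And>i. i \<in> I \<Longrightarrow> 0 \<le> a i" and l: "\<And>i. i \<in> I \<Longrightarrow> 0 \<le> l i"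
    and sum: "\<And>\<sigma>. D < \<sigma> \<Longrightarrow> (\<lambda>i. a i * exp (- \<sigma> * l i)) summable_on I" and s: "D < Re s"
  shows "((\<lambda>s. \<Sum>\<^sub>\<infinity>i\<in>I. of_real (a i) * exp (- s * of_real (l i))) has_field_derivative
      - (\<Sum>\<^sub>\<infinity>i\<in>I. of_real (a i * l i) * exp (- s * of_real (l i)))) (at s)"
proof -
  define r where "r = (Re s - D) / 2"
  have r: "0 < r" using s by (simp add: r_def)
  let ?f = "\<lambda>F s. \<Sum>i\<in>F. of_real (a i) * exp (- s * of_real (l i))"
  let ?f' = "\<lambda>F s. \<Sum>i\<in>F. - (of_real (a i * l i) * exp (- s * of_real (l i)))"
  let ?g = "\<lambda>s. \<Sum>\<^sub>\<infinity>i\<in>I. of_real (a i) * exp (- s * of_real (l i))"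
  have "uniform_limit (cball s r) ?f ?g (finite_subsets_at_top I)"
  proof (rule Weierstrass_m_test_general)
    show "(\<lambda>i. a i * exp (- (D + r) * l i)) summable_on I" using r by (intro sum) simp
    fix i z assume i: "i \<in> I" and z: "z \<in> cball s r"
    have "\<bar>Re (s - z)\<bar> \<le> r" using z abs_Re_le_cmod[of "s - z"] by (simp add: dist_norm)
    hence "Re s - Re z \<le> r" by simp
    hence "D + r \<le> Re z" by (simp add: r_def field_simps)
    hence "- Re z * l i \<le> - (D + r) * l i" using l[OF i] by (intro mult_right_mono) auto
    thus "norm (of_real (a i) * exp (- z * of_real (l i)) :: complex) \<le> a i * exp (- (D + r) * l i)"
      using a[OF i] by (simp add: norm_mult mult_left_mono)
  qed
  moreover have "\<forall>\<^sub>F F in finite_subsets_at_top I. continuous_on (cball s r) (?f F) \<and>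
      (\<forall>w \<in> ball s r. (?f F has_field_derivative ?f' F w) (at w))"
    by (intro eventually_finite_subsets_at_top_weakI conjI ballI)
       (auto intro!: continuous_intros derivative_eq_intros simp: mult_ac)
  ultimately obtain g' where g': "\<And>w. w \<in> ball s r \<Longrightarrow> (?g has_field_derivative (g' w)) (at w) \<and>
      ((\<lambda>F. ?f' F w) \<longlongrightarrow> g' w) (finite_subsets_at_top I)"
    using has_complex_derivative_uniform_limit[of s r ?f ?f' "finite_subsets_at_top I" ?g] r by force
  have "((\<lambda>i. - (of_real (a i * l i) * exp (- s * of_real (l i)))) has_sum g' s) I"
    using g'[of s] r unfolding has_sum_def by simp
  hence "g' s = - (\<Sum>\<^sub>\<infinity>i\<in>I. of_real (a i * l i) * exp (- s * of_real (l i)))"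
    by (metis infsumI infsum_uminus)
  thus ?thesis using g'[of s] r by simp
qed

text \<open>The abstract shape of the series for the flow: \<open>i\<close> stands for an orbit with
  a multiplicity, \<open>l i\<close> for the total length and \<open>m i\<close> for the primitive
  length. Discreteness of the lengths is kept apart from summability, so that the counting function
  is a finite sum.\<close>

locale weighted_spectrum =
  fixes I :: "'i set" and m l :: "'i \<Rightarrow> real" and D :: real
  assumes m_nonneg: "i \<in> I \<Longrightarrow> 0 \<le> m i" and l_pos: "i \<in> I \<Longrightarrow> 0 < l i"
    and summ: "D < \<sigma> \<Longrightarrow> (\<lambda>i. m i * exp (- \<sigma> * l i)) summable_on I"
    and fin: "finite {i \<in> I. l i \<le> y}"
begin

definition dirichlet :: "complex \<Rightarrow> complex" where
  "dirichlet s = (\<Sum>\<^sub>\<infinity>i\<in>I. of_real (m i) * exp (- s * of_real (l i)))"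

definition count :: "real \<Rightarrow> real" where
  "count x = (\<Sum>i\<in>{i \<in> I. l i \<le> ln x}. m i)"

lemma dirichlet_holomorphic: "dirichlet holomorphic_on {s. D < Re s}"
proof -
  have "dirichlet field_differentiable (at s)" if "D < Re s" for s
    using has_field_derivative_infsum_exp[OF m_nonneg less_imp_le[OF l_pos] summ that]
    unfolding dirichlet_def[abs_def] field_differentiable_def by blast
  hence "dirichlet field_differentiable (at s within A)" if "D < Re s" for s A
    using that by (blast intro: field_differentiable_at_within)
  thus ?thesis by (simp add: holomorphic_on_def)
qed

lemma dirichlet_uniform_on_line:
  assumes c: "D < c"
  shows "uniform_limit UNIV (\<lambda>F t. \<Sum>i\<in>F. of_real (m i) * exp (- Complex c t * of_real (l i)))
      (\<lambda>t. dirichlet (Complex c t)) (finite_subsets_at_top I)"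
    and "norm (dirichlet (Complex c t)) \<le> (\<Sum>\<^sub>\<infinity>i\<in>I. m i * exp (- c * l i))"
proof -
  have n: "norm (of_real (m i) * exp (- Complex c t * of_real (l i)) :: complex) = m i * exp (- c * l i)" if "i \<in> I" for i t
    using m_nonneg[OF that] by (simp add: norm_mult)
  show "uniform_limit UNIV (\<lambda>F t. \<Sum>i\<in>F. of_real (m i) * exp (- Complex c t * of_real (l i)))
      (\<lambda>t. dirichlet (Complex c t)) (finite_subsets_at_top I)"
    unfolding dirichlet_def
    by (rule Weierstrass_m_test_general[where M = "\<lambda>i. m i * exp (- c * l i)"]) (use n summ[OF c] in auto)
  have "(\<lambda>i. norm (of_real (m i) * exp (- Complex c t * of_real (l i)) :: complex)) summable_on I"
    using summ[OF c] n by (simp cong: summable_on_cong)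
  from norm_infsum_bound[OF this]
  show "norm (dirichlet (Complex c t)) \<le> (\<Sum>\<^sub>\<infinity>i\<in>I. m i * exp (- c * l i))"
    unfolding dirichlet_def using n by (simp cong: infsum_cong)
qed

text \<open>Jumps beyond \<open>ln b\<close> are invisible to \<phi>, so any finite set containing
  the earlier ones gives the same value. This freedom lets the inversion enlarge \<open>F\<close>
  until a partial sum is uniformly close to the series.\<close>

lemma distr_of_count:
  assumes tf: "test_function \<phi>" and b: "0 < b" "\<And>x. b \<le> x \<Longrightarrow> \<phi> x = 0" and F: "finite F" "{i \<in> I. l i \<le> ln b} \<subseteq> F" "F \<subseteq> I"
  shows "distr_of (\<lambda>x. of_real (count x)) \<phi> =
     (\<Sum>i\<in>F. of_real (m i) * distr_of (\<lambda>x. if l i \<le> ln x then 1 else 0) \<phi>)"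
proof -
  have "distr_of (\<lambda>x. of_real (count x)) \<phi> =
      (LINT x:{0<..}|lebesgue. \<Sum>i\<in>F. of_real (m i) * ((if l i \<le> ln x then 1 else 0) * \<phi> x))"
    unfolding distr_of_def
  proof (rule set_lebesgue_integral_cong, simp, clarsimp)
    fix x :: real assume x: "0 < x"
    show "of_real (count x) * \<phi> x = (\<Sum>i\<in>F. of_real (m i) * ((if l i \<le> ln x then 1 else 0) * \<phi> x))"
    proof (cases "b \<le> x")
      case False
      hence "ln x \<le> ln b" using x b(1) by simp
      hence "{i \<in> I. l i \<le> ln x} = {i \<in> F. l i \<le> ln x}" using F by auto
      hence "count x = (\<Sum>i\<in>F. if l i \<le> ln x then m i else 0)"
        unfolding count_def using F(1) by (simp add: sum.inter_filter)
      hence "of_real (count x) = (\<Sum>i\<in>F. of_real (m i) * (if l i \<le> ln x then 1 else 0) :: complex)"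
        by (simp add: if_distrib cong: if_cong sum.cong)
      thus ?thesis by (simp add: sum_distrib_right mult.assoc)
    qed (use b in auto)
  qed
  also have "\<dots> = (\<Sum>i\<in>F. LINT x:{0<..}|lebesgue. of_real (m i) * ((if l i \<le> ln x then 1 else 0) * \<phi> x))"
  proof -
    have "set_integrable lebesgue {0<..} (\<lambda>x. of_real (m i) * ((if l i \<le> ln x then 1 else 0) * \<phi> x))" for i
      by (intro set_integrable_mult_right set_integrable_step_test_function[OF tf])
    thus ?thesis
      unfolding set_lebesgue_integral_def set_integrable_def scaleR_sum_right by (intro Bochner_Integration.integral_sum)
  qed
  also have "\<dots> = (\<Sum>i\<in>F. of_real (m i) * distr_of (\<lambda>x. if l i \<le> ln x then 1 else 0) \<phi>)"
    unfolding distr_of_def by simp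
  finally show ?thesis .
qed

text \<open>For finite partial sums the formula is Perron's, term by term, and their pairing with
  \<phi> is already the exact value once the jumps below the support are included. Only the integral
  of the series has to be approximated, and for that uniform convergence on the line against an
  integrable factor suffices.\<close>

lemma dirichlet_inversion:
  assumes tf: "test_function \<phi>" and c: "1 \<le> c" "D < c"
  shows "integrable lebesgue (screen_integrand (\<lambda>_. c) (\<lambda>s. dirichlet s * (mellin \<phi> (s + 1) / s)))"
    and "screen_integral (\<lambda>_. c) (\<lambda>s. dirichlet s * (mellin \<phi> (s + 1) / s)) =
       2 * of_real pi * \<i> * distr_of (\<lambda>x. of_real (count x)) \<phi>"
proof -
  let ?h = "\<lambda>t. mellin \<phi> (Complex c t + 1) / Complex c t"
  let ?e = "\<lambda>i s. exp (- s * of_real (l i)) :: complex"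
  let ?ZF = "\<lambda>F t. \<Sum>i\<in>F. of_real (m i) * ?e i (Complex c t)"
  obtain M where M: "0 \<le> M" "\<And>t. norm (?h t) \<le> M * inverse (1 + t^2)" using mellin_over_s_bound[OF tf c(1)] by blast
  have ch: "continuous_on UNIV ?h" using c(1) by (intro continuous_mellin_over_s[OF tf]) auto
  have ct: "continuous_on A (\<lambda>t. Complex c t)" for A by (intro continuous_intros)
  have "continuous_on {s. D < Re s} dirichlet" using dirichlet_holomorphic by (rule holomorphic_on_imp_continuous_on)
  hence cd: "continuous_on UNIV (\<lambda>t. dirichlet (Complex c t))"
    by (rule continuous_on_compose2[OF _ ct]) (use c in auto)
  define Mc where "Mc = (\<Sum>\<^sub>\<infinity>i\<in>I. m i * exp (- c * l i))"
  have Mc: "norm (dirichlet (Complex c t)) \<le> Mc" for t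
    unfolding Mc_def by (rule dirichlet_uniform_on_line(2)[OF c(2)])
  have bd: "norm (dirichlet (Complex c t) * ?h t) \<le> (Mc * M) * inverse (1 + t^2)" for t
  proof -
    have "norm (dirichlet (Complex c t) * ?h t) \<le> Mc * (M * inverse (1 + t^2))"
      unfolding norm_mult using Mc[of t] M(2)[of t] by (intro mult_mono) (auto intro: order_trans[OF norm_ge_zero])
    thus ?thesis by (simp add: mult.assoc)
  qed
  note line = integrable_vertical_line[of "\<lambda>s. dirichlet s * (mellin \<phi> (s + 1) / s)" c, OF continuous_on_mult[OF cd ch] bd]
  show "integrable lebesgue (screen_integrand (\<lambda>_. c) (\<lambda>s. dirichlet s * (mellin \<phi> (s + 1) / s)))" by (rule line(2))
  have hint: "integrable lborel ?h"
    using integrable_vertical_line(1)[of "\<lambda>s. mellin \<phi> (s + 1) / s" c M] ch M(2) by simp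
  have trm: "integrable lborel (\<lambda>t. ?e i (Complex c t) * ?h t)"
    "(LINT t|lborel. ?e i (Complex c t) * ?h t) = 2 * of_real pi * distr_of (\<lambda>x. if l i \<le> ln x then 1 else 0) \<phi>" for i
  proof -
    have c1: "continuous_on UNIV (\<lambda>t. ?e i (Complex c t) * ?h t)"
      by (intro continuous_on_mult[OF _ ch] continuous_intros ct)
    have b1: "norm (?e i (Complex c t) * ?h t) \<le> (exp (- c * l i) * M) * inverse (1 + t^2)" for t
    proof -
      have "norm (?e i (Complex c t) * ?h t) = exp (- c * l i) * norm (?h t)" unfolding norm_mult by simp
      also have "\<dots> \<le> exp (- c * l i) * (M * inverse (1 + t^2))" using M(2) by (intro mult_left_mono) auto
      finally show ?thesis by (simp add: mult.assoc)
    qed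
    note v = integrable_vertical_line[of "\<lambda>s. ?e i s * (mellin \<phi> (s + 1) / s)" c, OF c1 b1]
    show "integrable lborel (\<lambda>t. ?e i (Complex c t) * ?h t)" by (rule v(1))
    have "\<i> * (LINT t|lborel. ?e i (Complex c t) * ?h t) = \<i> * (2 * of_real pi * distr_of (\<lambda>x. if l i \<le> ln x then 1 else 0) \<phi>)"
      using v(3) perron_test_function[OF tf c(1), of "l i"] by (simp add: mult_ac)
    thus "(LINT t|lborel. ?e i (Complex c t) * ?h t) = 2 * of_real pi * distr_of (\<lambda>x. if l i \<le> ln x then 1 else 0) \<phi>"
      by simp
  qed
  have ZFi: "integrable lborel (\<lambda>t. ?ZF F t * ?h t)"
    "(LINT t|lborel. ?ZF F t * ?h t) = 2 * of_real pi * (\<Sum>i\<in>F. of_real (m i) * distr_of (\<lambda>x. if l i \<le> ln x then 1 else 0) \<phi>)" for F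
  proof -
    have e: "?ZF F t * ?h t = (\<Sum>i\<in>F. of_real (m i) * (?e i (Complex c t) * ?h t))" for t
      unfolding sum_distrib_right by (simp add: mult.assoc)
    show "integrable lborel (\<lambda>t. ?ZF F t * ?h t)"
      unfolding e by (intro Bochner_Integration.integrable_sum integrable_mult_right trm(1))
    have "(LINT t|lborel. ?ZF F t * ?h t) = (\<Sum>i\<in>F. LINT t|lborel. of_real (m i) * (?e i (Complex c t) * ?h t))"
      unfolding e by (intro Bochner_Integration.integral_sum integrable_mult_right trm(1))
    also have "\<dots> = (\<Sum>i\<in>F. of_real (m i) * (2 * of_real pi * distr_of (\<lambda>x. if l i \<le> ln x then 1 else 0) \<phi>))"
      unfolding integral_mult_right_zero trm(2) ..
    finally show "(LINT t|lborel. ?ZF F t * ?h t) = 2 * of_real pi * (\<Sum>i\<in>F. of_real (m i) * distr_of (\<lambda>x. if l i \<le> ln x then 1 else 0) \<phi>)"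
      by (simp add: sum_distrib_left mult_ac)
  qed
  let ?L = "LINT t|lborel. dirichlet (Complex c t) * ?h t"
  let ?V = "2 * of_real pi * distr_of (\<lambda>x. of_real (count x)) \<phi>"
  obtain a b where ab: "0 < a" "a < b" "\<And>x. x \<notin> {a<..<b} \<Longrightarrow> \<phi> x = 0" using test_function_support[OF tf] by blast
  have "norm (?L - ?V) \<le> \<epsilon>" if \<epsilon>: "0 < \<epsilon>" for \<epsilon> :: real
  proof -
    define B where "B = (LINT t|lborel. norm (?h t))"
    have B: "0 \<le> B" unfolding B_def by simp
    \<comment> \<open>The summand 1 keeps the denominator positive when \<open>B\<close> is
      0.\<close>
    define \<delta> where "\<delta> = \<epsilon> / (B + 1)"
    have \<delta>: "0 < \<delta>" using \<epsilon> B by (simp add: \<delta>_def)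
    define close where "close F \<longleftrightarrow> (\<forall>t\<in>UNIV. dist (?ZF F t) (dirichlet (Complex c t)) < \<delta>)" for F
    have "\<forall>\<^sub>F F in finite_subsets_at_top I. close F"
      using dirichlet_uniform_on_line(1)[OF c(2), unfolded uniform_limit_iff, rule_format, OF \<delta>]
      unfolding close_def by simp
    hence "\<exists>X. finite X \<and> X \<subseteq> I \<and> (\<forall>Y. finite Y \<and> X \<subseteq> Y \<and> Y \<subseteq> I \<longrightarrow> close Y)"
      by (simp only: eventually_finite_subsets_at_top)
    then obtain X where X: "finite X" "X \<subseteq> I" "\<forall>Y. finite Y \<and> X \<subseteq> Y \<and> Y \<subseteq> I \<longrightarrow> close Y"
      by (elim exE conjE) (rule that)
    \<comment> \<open>\<open>X\<close> guarantees uniform closeness on the line, the second set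
      exactness of the pairing with \<phi>.\<close>
    define F where "F = X \<union> {i \<in> I. l i \<le> ln b}"
    have F: "finite F" "X \<subseteq> F" "{i \<in> I. l i \<le> ln b} \<subseteq> F" "F \<subseteq> I" using X fin by (auto simp: F_def)
    have d: "norm (dirichlet (Complex c t) - ?ZF F t) \<le> \<delta>" for t
    proof -
      have "dist (?ZF F t) (dirichlet (Complex c t)) < \<delta>" using X(3) F unfolding close_def by simp
      thus ?thesis by (simp add: dist_norm norm_minus_commute)
    qed
    have V: "?V = (LINT t|lborel. ?ZF F t * ?h t)"
      unfolding ZFi(2) using distr_of_count[OF tf, of b F] ab F by simp
    have i1: "integrable lborel (\<lambda>t. dirichlet (Complex c t) * ?h t - ?ZF F t * ?h t)"
      using line(1) ZFi(1)[of F] by (rule Bochner_Integration.integrable_diff)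
    define g where "g t = dirichlet (Complex c t) * ?h t - ?ZF F t * ?h t" for t
    have gi: "integrable lborel g" unfolding g_def[abs_def] by (rule i1)
    have gd: "norm (g t) \<le> \<delta> * norm (?h t)" for t
    proof -
      have "norm (g t) = norm (dirichlet (Complex c t) - ?ZF F t) * norm (?h t)"
        by (simp only: g_def left_diff_distrib[symmetric] norm_mult)
      also have "\<dots> \<le> \<delta> * norm (?h t)" by (rule mult_right_mono[OF d]) simp
      finally show ?thesis .
    qed
    have "integrable lborel (\<lambda>t. \<delta> * norm (?h t))" using hint by (intro integrable_mult_right integrable_norm)
    from integral_mono[OF integrable_norm[OF gi] this gd]
    have i4: "(LINT t|lborel. norm (g t)) \<le> (LINT t|lborel. \<delta> * norm (?h t))" .
    have "?L - ?V = integral\<^sup>L lborel g"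
      unfolding V g_def[abs_def] by (rule Bochner_Integration.integral_diff[OF line(1) ZFi(1)[of F], symmetric])
    hence "norm (?L - ?V) \<le> (LINT t|lborel. norm (g t))" using integral_norm_bound by simp
    also note i4
    also have "(LINT t|lborel. \<delta> * norm (?h t)) = \<delta> * B" unfolding B_def by (rule integral_mult_right_zero)
    also have "\<delta> * B \<le> \<epsilon>" using \<epsilon> B by (simp add: \<delta>_def field_simps)
    finally show ?thesis .
  qed
  hence "norm (?L - ?V) \<le> 0" by (rule field_le_epsilon) simp
  hence "?L = ?V" by simp
  thus "screen_integral (\<lambda>_. c) (\<lambda>s. dirichlet s * (mellin \<phi> (s + 1) / s)) =
       2 * of_real pi * \<i> * distr_of (\<lambda>x. of_real (count x)) \<phi>"
    unfolding line(3) by (simp add: mult_ac)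
qed

end

subsection \<open>The Wiener-Ikehara theorem\<close>

lemma lborel_integral_scale:
  fixes g :: "real \<Rightarrow> 'a::{banach, second_countable_topology}"
  assumes R: "0 < R" and g: "integrable lborel g"
  shows "integrable lborel (\<lambda>y. g (R * (y - u)))" "(LINT y|lborel. g (R * (y - u))) = (LINT y|lborel. g y) /\<^sub>R R"
proof -
  have e: "(\<lambda>y. g (R * (y - u))) = (\<lambda>y. g (- (R * u) + R * y))" by (simp add: algebra_simps)
  show "integrable lborel (\<lambda>y. g (R * (y - u)))"
    unfolding e using R g by (intro lborel_integrable_real_affine) auto
  have "(LINT y|lborel. g y) = R *\<^sub>R (LINT y|lborel. g (R * (y - u)))"
    unfolding e using lborel_integral_real_affine[of R g "- (R * u)"] R by simp
  thus "(LINT y|lborel. g (R * (y - u))) = (LINT y|lborel. g y) /\<^sub>R R" using R by simp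
qed

text \<open>Translating by half a period of the oscillating factor changes its sign.\<close>

lemma Riemann_Lebesgue_compact_support:
  fixes g :: "real \<Rightarrow> complex"
  assumes g: "continuous_on UNIV g" "\<And>t. t \<notin> {-1..1} \<Longrightarrow> g t = 0"
  shows "((\<lambda>x. LINT t|lborel. g t * exp (- (\<i> * of_real (x * t)))) \<longlongrightarrow> 0) at_top"
proof -
  have gi: "integrable lborel (\<lambda>t. g t * exp (- (\<i> * of_real (x * t))))" for x
  proof -
    have "set_integrable lborel {-1..1} (\<lambda>t. g t * exp (- (\<i> * of_real (x * t))))"
      by (intro borel_integrable_atLeastAtMost' continuous_intros continuous_on_subset[OF g(1)]) auto
    thus ?thesis unfolding set_integrable_def
      by (rule Bochner_Integration.integrable_cong[THEN iffD1, rotated 2]) (use g(2) in \<open>auto simp: indicator_def\<close>)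
  qed
  have uc: "uniformly_continuous_on {-3..3} g"
    by (intro compact_uniformly_continuous continuous_on_subset[OF g(1)]) auto
  show ?thesis
  proof (rule tendstoI)
    fix e :: real assume e: "0 < e"
    obtain d where d: "0 < d" "\<And>s t. s \<in> {-3..3} \<Longrightarrow> t \<in> {-3..3} \<Longrightarrow> dist t s < d \<Longrightarrow> dist (g t) (g s) < e / 4"
      using uc e unfolding uniformly_continuous_on_def by (metis zero_less_divide_iff zero_less_numeral)
    \<comment> \<open>The half period \<open>pi / x\<close> must be smaller than \<open>d\<close>,
      for uniform continuity, and smaller than 1, so that the shifted support stays in a fixed
      interval.\<close>
    have "\<forall>\<^sub>F x in at_top. x > pi / min d 1" by (rule eventually_gt_at_top)
    thus "\<forall>\<^sub>F x in at_top. dist (LINT t|lborel. g t * exp (- (\<i> * of_real (x * t)))) 0 < e"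
    proof eventually_elim
      case (elim x)
      have "0 < pi / min d 1" using d by simp
      hence x: "0 < x" using elim by linarith
      define h where "h = pi / x"
      have "0 < min d 1" using d by simp
      hence "pi < x * min d 1" using elim by (simp only: pos_divide_less_eq)
      hence "h < min d 1" using x unfolding h_def by (simp only: pos_divide_less_eq mult.commute)
      hence h: "0 < h" "h < d" "h < 1" using x by (auto simp: h_def)
      let ?I = "LINT t|lborel. g t * exp (- (\<i> * of_real (x * t)))"
      have shift: "g (h + t) * exp (- (\<i> * of_real (x * (h + t)))) = - (g (h + t) * exp (- (\<i> * of_real (x * t))))" for t
      proof -
        have "x * (h + t) = pi + x * t" using x by (simp add: h_def field_simps)
        hence "exp (- (\<i> * of_real (x * (h + t)))) = exp (- (\<i> * of_real pi)) * exp (- (\<i> * of_real (x * t)))"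
          by (simp add: ring_distribs exp_add[symmetric])
        also have "exp (- (\<i> * of_real pi)) = - 1" by (simp add: exp_minus mult.commute)
        finally show ?thesis by simp
      qed
      define G where "G t = g t * exp (- (\<i> * of_real (x * t)))" for t
      have G: "G (h + t) = - (g (h + t) * exp (- (\<i> * of_real (x * t))))" for t
        unfolding G_def by (rule shift)
      have "integral\<^sup>L lborel G = (LINT t|lborel. G (h + t))"
        using lborel_integral_real_affine[of 1 G h] by simp
      hence I2: "?I = - (LINT t|lborel. g (h + t) * exp (- (\<i> * of_real (x * t))))"
        unfolding G by (simp add: G_def[abs_def])
      have gi2: "integrable lborel (\<lambda>t. g (h + t) * exp (- (\<i> * of_real (x * t))))"
      proof -
        have "integrable lborel G" unfolding G_def[abs_def] by (rule gi)
        from lborel_integrable_real_affine[OF this, of 1 h] show ?thesis by (simp add: G)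
      qed
      have "2 * ?I = ?I - (LINT t|lborel. g (h + t) * exp (- (\<i> * of_real (x * t))))" using I2 by simp
      also have "\<dots> = (LINT t|lborel. g t * exp (- (\<i> * of_real (x * t))) - g (h + t) * exp (- (\<i> * of_real (x * t))))"
        by (rule Bochner_Integration.integral_diff[OF gi gi2, symmetric])
      finally have I4: "2 * ?I = (LINT t|lborel. g t * exp (- (\<i> * of_real (x * t))) - g (h + t) * exp (- (\<i> * of_real (x * t))))" .
      have "norm (2 * ?I) \<le> (LINT t|lborel. norm (g t * exp (- (\<i> * of_real (x * t))) - g (h + t) * exp (- (\<i> * of_real (x * t)))))"
        unfolding I4 by (rule integral_norm_bound)
      \<comment> \<open>The support and its translate lie in an interval of length 4, which explains
        \<open>e / 4\<close>. The total e bounds twice the integral, leaving \<open>e / 2\<close>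
        for the integral itself.\<close>
      also have "\<dots> \<le> (LINT t|lborel. indicator {-2..2::real} t *\<^sub>R (e / 4))"
      proof (rule integral_mono)
        show "integrable lborel (\<lambda>t. norm (g t * exp (- (\<i> * of_real (x * t))) - g (h + t) * exp (- (\<i> * of_real (x * t)))))"
          using Bochner_Integration.integrable_diff[OF gi gi2] by (rule integrable_norm)
        show "integrable lborel (\<lambda>t. indicator {-2..2::real} t *\<^sub>R (e / 4))"
          by (intro integrable_scaleR_left integrable_real_indicator) (auto simp: emeasure_lborel_Icc_eq)
        fix t
        have "norm (g t * exp (- (\<i> * of_real (x * t))) - g (h + t) * exp (- (\<i> * of_real (x * t)))) = norm (g t - g (h + t))"
          by (simp add: left_diff_distrib[symmetric] norm_mult)
        also have "\<dots> \<le> indicator {-2..2::real} t *\<^sub>R (e / 4)"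
        proof (cases "t \<in> {-2..2}")
          case True
          hence "dist (g t) (g (h + t)) < e / 4" using h by (intro d(2)) (auto simp: dist_real_def)
          thus ?thesis using True by (simp add: dist_norm)
        next
          case False
          hence "t \<notin> {-1..1}" "h + t \<notin> {-1..1}" using h by auto
          thus ?thesis using False g(2) by simp
        qed
        finally show "norm (g t * exp (- (\<i> * of_real (x * t))) - g (h + t) * exp (- (\<i> * of_real (x * t)))) \<le> indicator {-2..2::real} t *\<^sub>R (e / 4)" .
      qed
      also have "\<dots> = e" by simp
      finally have "norm ?I \<le> e / 2" by (simp add: norm_mult)
      thus "dist ?I 0 < e" using e by (simp add: dist_norm)
    qed
  qed
qed

section \<open>The Fejer kernel, which is the square of sin (v/2) / (v/2), and the tent
  function\<close>

definition fejer :: "real \<Rightarrow> real" where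
  "fejer v = (if v = 0 then 1 else 2 * (1 - cos v) / v^2)"

lemma fejer_nonneg: "0 \<le> fejer v"
  by (simp add: fejer_def)

lemma fejer_measurable [measurable]: "fejer \<in> borel_measurable borel"
  unfolding fejer_def by measurable

text \<open>For v beyond 1 in absolute value the numerator is at most 4 and \<open>1 + v^2\<close>
  at most twice \<open>v^2\<close>, whence the constant 8. Near 0 the kernel is at most 1.\<close>

lemma fejer_le: "fejer v \<le> 8 * inverse (1 + v^2)"
proof (cases "\<bar>v\<bar> \<le> 1")
  case True
  have "fejer v \<le> 1"
  proof (cases "v = 0")
    case False
    have "1 - cos v = 2 * (sin (v / 2))^2" using cos_double_sin[of "v / 2"] by simp
    moreover have "(sin (v / 2))^2 \<le> (v / 2)^2"
      using abs_sin_x_le_abs_x[of "v / 2"] by (rule abs_le_square_iff[THEN iffD1])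
    ultimately have "2 * (1 - cos v) \<le> v^2" by (simp add: power_divide)
    thus ?thesis using False by (simp add: fejer_def)
  qed (simp add: fejer_def)
  also have "v^2 \<le> 1" using True by (simp add: abs_square_le_1)
  hence "1 \<le> 8 * inverse (1 + v^2)" by (simp add: field_simps add_pos_nonneg)
  finally show ?thesis .
next
  case False
  hence v: "1 < v^2" by (metis abs_square_le_1 linorder_not_le)
  have "2 * (1 - cos v) \<le> 2 * (1 - (- 1))"
    by (intro mult_left_mono diff_left_mono cos_ge_minus_one) simp
  hence "2 * (1 - cos v) \<le> 4" by simp
  hence "fejer v \<le> 4 / v^2" using False v by (auto simp: fejer_def intro!: divide_right_mono)
  also have "\<dots> \<le> 8 * inverse (1 + v^2)"
  proof -
    have "0 < v^2" using v by linarith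
    thus ?thesis using v by (simp add: field_simps add_pos_nonneg)
  qed
  finally show ?thesis .
qed

lemma fejer_integrable: "integrable lborel fejer"
proof (rule Bochner_Integration.integrable_bound)
  show "integrable lborel (\<lambda>v::real. 8 * inverse (1 + v^2))" using integrable_inverse_1_plus_square_UNIV by simp
  show "AE v in lborel. norm (fejer v) \<le> norm (8 * inverse (1 + v^2))"
    using fejer_le fejer_nonneg by (intro AE_I2) (metis abs_of_nonneg order_trans real_norm_def)
qed simp

lemma fejer_integral_pos: "0 < (LINT v|lborel. fejer v)"
proof -
  have "(LINT v|lborel. fejer v) \<noteq> 0"
  proof
    assume "(LINT v|lborel. fejer v) = 0"
    hence "AE v in lborel. fejer v = 0"
      using integral_nonneg_eq_0_iff_AE[OF fejer_integrable] fejer_nonneg by simp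
    hence "AE v in lborel. v \<notin> {0<..<1::real}"
    proof eventually_elim
      case (elim v)
      show ?case
      proof
        assume v: "v \<in> {0<..<1}"
        hence "cos v < cos 0" using pi_gt3 by (intro cos_monotone_0_pi) auto
        thus False using elim v by (simp add: fejer_def)
      qed
    qed
    hence "{0<..<1::real} \<in> null_sets lborel" by (simp add: AE_iff_null_sets)
    thus False by (simp add: null_sets_def)
  qed
  moreover have "0 \<le> (LINT v|lborel. fejer v)" using fejer_nonneg by simp
  ultimately show ?thesis by simp
qed

definition tent :: "real \<Rightarrow> real" where
  "tent t = max 0 (1 - \<bar>t\<bar>)"

lemma continuous_on_tent: "continuous_on A tent"
  unfolding tent_def by (intro continuous_intros)

lemma tent_measurable [measurable]: "tent \<in> borel_measurable borel"
  by (intro borel_measurable_continuous_onI continuous_on_tent)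

lemma tent_integrable: "integrable lborel tent"
proof -
  have "set_integrable lborel {-1..1} tent" by (intro borel_integrable_atLeastAtMost' continuous_on_tent)
  thus ?thesis unfolding set_integrable_def
    by (rule Bochner_Integration.integrable_cong[THEN iffD1, rotated 2]) (auto simp: indicator_def tent_def)
qed

text \<open>The kernel is the Fourier transform of a compactly supported function. Smoothing with it
  therefore sees the boundary values of a Laplace transform only on a bounded interval, so
  continuity on the boundary line is enough and no growth condition along it enters.\<close>

lemma fejer_eq_integral_tent: "complex_of_real (fejer v) = (LINT t|lborel. of_real (tent t) * exp (\<i> * of_real (t * v)))"
proof -
  have c: "continuous_on A (\<lambda>t. of_real (tent t) * exp (\<i> * of_real (t * v)))" for A
    by (intro continuous_intros continuous_on_compose2[OF continuous_on_tent]) auto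
  let ?f = "\<lambda>t. complex_of_real (tent t) * exp (\<i> * of_real (t * v))"
  have "(LINT t|lborel. ?f t) = (LINT t:{-1..1}|lborel. ?f t)"
    unfolding set_lebesgue_integral_def
    by (intro Bochner_Integration.integral_cong) (auto simp: indicator_def tent_def)
  also have "\<dots> = integral {-1..1} ?f"
    by (intro set_borel_integral_eq_integral borel_integrable_atLeastAtMost' c)
  also have "\<dots> = integral {-1..0} ?f + integral {0..1} ?f"
    by (intro Henstock_Kurzweil_Integration.integral_combine[symmetric] integrable_continuous_interval c) auto
  also have "\<dots> = of_real (fejer v)"
  proof (cases "v = 0")
    case True
    have "((\<lambda>t. 1 + t) has_integral ((0 + 0^2/2) - (- 1 + (-1)^2/2))) {-1..0::real}"
      by (rule fundamental_theorem_of_calculus)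
         (auto intro!: derivative_eq_intros simp: has_real_derivative_iff_has_vector_derivative[symmetric])
    from has_integral_linear[OF this bounded_linear_of_real[where 'a = complex]]
    have i1: "integral {-1..0} ?f = 1 / 2"
      using True by (subst integral_cong[of _ _ "\<lambda>t. complex_of_real (1 + t)"]) (auto simp: tent_def integral_unique o_def)
    have "((\<lambda>t. 1 - t) has_integral ((1 - 1^2/2) - (0 - 0^2/2))) {0..1::real}"
      by (rule fundamental_theorem_of_calculus)
         (auto intro!: derivative_eq_intros simp: has_real_derivative_iff_has_vector_derivative[symmetric])
    from has_integral_linear[OF this bounded_linear_of_real[where 'a = complex]]
    have i2: "integral {0..1} ?f = 1 / 2"
      using True by (subst integral_cong[of _ _ "\<lambda>t. complex_of_real (1 - t)"]) (auto simp: tent_def integral_unique o_def)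
    show ?thesis unfolding i1 i2 using True by (simp add: fejer_def)
  next
    case False
    define w where "w = \<i> * of_real v"
    have w: "w \<noteq> 0" "w^2 = - of_real (v^2)" using False by (auto simp: w_def power_mult_distrib)
    have E: "((\<lambda>t. exp (w * of_real t)) has_vector_derivative w * exp (w * of_real t)) (at t)" for t
    proof -
      have "((\<lambda>z. exp (w * z)) has_field_derivative w * exp (w * of_real t)) (at (of_real t))"
        by (auto intro!: derivative_eq_intros)
      from has_vector_derivative_real_field[OF this] show ?thesis by simp
    qed
    have T: "((\<lambda>t. complex_of_real t) has_vector_derivative 1) (at t)" for t
      by (auto intro!: derivative_eq_intros)
    have "((\<lambda>t. (1 + of_real t) * exp (w * of_real t)) has_integral
        (((1 + of_real 0) / w - 1 / w^2) * exp (w * of_real 0) - ((1 + of_real (-1)) / w - 1 / w^2) * exp (w * of_real (-1)))) {-1..0}"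
    proof (rule fundamental_theorem_of_calculus)
      fix t :: real
      have "((\<lambda>t. ((1 + of_real t) / w - 1 / w^2) * exp (w * of_real t)) has_vector_derivative
          ((1 + of_real t) / w - 1 / w^2) * (w * exp (w * of_real t)) + ((0 + 1) / w - 0) * exp (w * of_real t)) (at t)"
        by (intro has_vector_derivative_mult E has_vector_derivative_diff has_vector_derivative_divide
             has_vector_derivative_add T has_vector_derivative_const)
      also have "((1 + of_real t) / w - 1 / w^2) * (w * exp (w * of_real t)) + ((0 + 1) / w - 0) * exp (w * of_real t)
         = (1 + of_real t) * exp (w * of_real t)"
        using w(1) by (simp add: field_simps power2_eq_square)
      finally show "((\<lambda>t. ((1 + of_real t) / w - 1 / w^2) * exp (w * of_real t)) has_vector_derivative
          (1 + of_real t) * exp (w * of_real t)) (at t within {-1..0})"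
        by (rule has_vector_derivative_at_within)
    qed simp
    hence "integral {-1..0} (\<lambda>t. (1 + of_real t) * exp (w * of_real t)) = 1 / w - 1 / w^2 + exp (- w) / w^2"
      by (simp add: integral_unique)
    moreover have "integral {-1..0} ?f = integral {-1..0} (\<lambda>t. (1 + of_real t) * exp (w * of_real t))"
      by (intro Henstock_Kurzweil_Integration.integral_cong) (auto simp: tent_def w_def mult_ac)
    moreover have "((\<lambda>t. (1 - of_real t) * exp (w * of_real t)) has_integral
        (((1 - of_real 1) / w + 1 / w^2) * exp (w * of_real 1) - ((1 - of_real 0) / w + 1 / w^2) * exp (w * of_real 0))) {0..1}"
    proof (rule fundamental_theorem_of_calculus)
      fix t :: real
      have "((\<lambda>t. ((1 - of_real t) / w + 1 / w^2) * exp (w * of_real t)) has_vector_derivative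
          ((1 - of_real t) / w + 1 / w^2) * (w * exp (w * of_real t)) + ((0 - 1) / w + 0) * exp (w * of_real t)) (at t)"
        by (intro has_vector_derivative_mult E has_vector_derivative_diff has_vector_derivative_divide
             has_vector_derivative_add T has_vector_derivative_const)
      also have "((1 - of_real t) / w + 1 / w^2) * (w * exp (w * of_real t)) + ((0 - 1) / w + 0) * exp (w * of_real t)
         = (1 - of_real t) * exp (w * of_real t)"
        using w(1) by (simp add: field_simps power2_eq_square)
      finally show "((\<lambda>t. ((1 - of_real t) / w + 1 / w^2) * exp (w * of_real t)) has_vector_derivative
          (1 - of_real t) * exp (w * of_real t)) (at t within {0..1})"
        by (rule has_vector_derivative_at_within)
    qed simp
    hence "integral {0..1} (\<lambda>t. (1 - of_real t) * exp (w * of_real t)) = exp w / w^2 - 1 / w - 1 / w^2"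
      by (simp add: integral_unique)
    moreover have "integral {0..1} ?f = integral {0..1} (\<lambda>t. (1 - of_real t) * exp (w * of_real t))"
      by (intro Henstock_Kurzweil_Integration.integral_cong) (auto simp: tent_def w_def mult_ac)
    ultimately have "integral {-1..0} ?f + integral {0..1} ?f = (exp w + exp (- w) - 2) / w^2"
      by (simp add: diff_divide_distrib add_divide_distrib)
    also have "exp w + exp (- w) = 2 * of_real (cos v)"
      unfolding w_def by (simp add: cos_of_real[symmetric] cos_exp_eq)
    also have "(2 * of_real (cos v) - 2) / w^2 = of_real (fejer v)"
      unfolding w(2) using False by (simp add: fejer_def field_simps)
    finally show ?thesis .
  qed
  finally show ?thesis by simp
qed

text \<open>The identity behind the Wiener-Ikehara theorem.\<close>

lemma fejer_smoothing_damped: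
  fixes b :: "real \<Rightarrow> real" and H :: "complex \<Rightarrow> complex"
  assumes \<epsilon>: "0 < \<epsilon>" and bi: "integrable lborel (\<lambda>y. b y * exp (- \<epsilon> * y))" and bm [measurable]: "b \<in> borel_measurable borel"
    and H: "\<And>s. 0 < Re s \<Longrightarrow> (LINT y|lborel. of_real (b y) * exp (- s * of_real y)) = H s"
  shows "of_real (LINT y|lborel. b y * exp (- \<epsilon> * y) * fejer (R * (y - u))) =
    (LINT t|lborel. of_real (tent t) * (exp (- (\<i> * of_real (R * u * t))) * H (Complex \<epsilon> (- (R * t)))))"
proof -
  define G where "G t y = of_real (b y * exp (- \<epsilon> * y)) * (of_real (tent t) * exp (\<i> * of_real (t * (R * (y - u)))))" for t y
  have nG: "norm (G t y) = tent t * norm (b y * exp (- \<epsilon> * y))" for t y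
    unfolding G_def norm_mult norm_of_real by (simp add: tent_def abs_mult)
  have Gm [measurable]: "(\<lambda>z. G (fst z) (snd z)) \<in> borel_measurable (lborel \<Otimes>\<^sub>M lborel)"
    unfolding G_def by measurable
  have Gy: "integrable lborel (G t)" for t
  proof (rule Bochner_Integration.integrable_bound)
    show "integrable lborel (\<lambda>y. tent t * norm (b y * exp (- \<epsilon> * y)))" using bi by (intro integrable_mult_right integrable_norm)
    show "G t \<in> borel_measurable lborel" unfolding G_def by measurable
    show "AE y in lborel. norm (G t y) \<le> norm (tent t * norm (b y * exp (- \<epsilon> * y)))"
      unfolding nG by (intro AE_I2) (simp add: tent_def)
  qed
  have Gint: "integrable (lborel \<Otimes>\<^sub>M lborel) (\<lambda>z. G (fst z) (snd z))"
  proof (rule lborel_pair.Fubini_integrable)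
    have "integrable lborel (\<lambda>t. tent t * (LINT y|lborel. norm (b y * exp (- \<epsilon> * y))))"
      using tent_integrable by (rule integrable_mult_left)
    thus "integrable lborel (\<lambda>t. LINT y|lborel. norm (G (fst (t, y)) (snd (t, y))))"
      by (simp only: fst_conv snd_conv nG integral_mult_right_zero)
  qed (use Gy in auto)
  have 1: "(LINT t|lborel. G t y) = of_real (b y * exp (- \<epsilon> * y) * fejer (R * (y - u)))" for y
    unfolding G_def integral_mult_right_zero fejer_eq_integral_tent[symmetric] by simp
  have 2: "(LINT y|lborel. G t y) = of_real (tent t) * (exp (- (\<i> * of_real (R * u * t))) * H (Complex \<epsilon> (- (R * t))))" for t
  proof -
    have "G t y = (of_real (tent t) * exp (- (\<i> * of_real (R * u * t)))) * (of_real (b y) * exp (- Complex \<epsilon> (- (R * t)) * of_real y))" for y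
    proof -
      have "of_real (exp (- \<epsilon> * y)) * exp (\<i> * of_real (t * (R * (y - u)))) =
          exp (- (\<i> * of_real (R * u * t))) * exp (- Complex \<epsilon> (- (R * t)) * of_real y)"
        unfolding exp_of_real[symmetric] exp_add[symmetric] by (simp add: Complex_eq algebra_simps)
      thus ?thesis unfolding G_def of_real_mult by (simp add: mult_ac)
    qed
    hence "(LINT y|lborel. G t y) = (of_real (tent t) * exp (- (\<i> * of_real (R * u * t)))) * (LINT y|lborel. of_real (b y) * exp (- Complex \<epsilon> (- (R * t)) * of_real y))"
      by simp
    also have "(LINT y|lborel. of_real (b y) * exp (- Complex \<epsilon> (- (R * t)) * of_real y)) = H (Complex \<epsilon> (- (R * t)))"
      by (rule H) (use \<epsilon> in simp)
    finally show ?thesis by (simp add: mult.assoc)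
  qed
  have "(LINT t|lborel. LINT y|lborel. G t y) = (LINT y|lborel. LINT t|lborel. G t y)"
    using lborel_pair.Fubini_integral[of G] Gint by (simp add: case_prod_unfold)
  thus ?thesis unfolding 1 2 integral_complex_of_real by (rule sym)
qed

section \<open>The Tauberian argument\<close>

lemma integrable_damped_indicator: "0 < \<epsilon> \<Longrightarrow> integrable lborel (\<lambda>y. indicator {0..} y * exp (- \<epsilon> * y) :: real)"
proof -
  assume \<epsilon>: "0 < \<epsilon>"
  have "set_integrable lborel {0<..} (\<lambda>y. exp (- (y * \<epsilon>)))"
    using integrable_I0i_exp_mscale[OF \<epsilon>] by simp
  hence "integrable lborel (\<lambda>y. indicator {0<..} y *\<^sub>R exp (- (y * \<epsilon>)))" by (simp add: set_integrable_def)
  moreover have "AE y in lborel. y \<noteq> (0::real)" by (rule AE_lborel_singleton)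
  hence "AE y in lborel. indicator {0<..} y *\<^sub>R exp (- (y * \<epsilon>)) = indicator {0..} y * exp (- \<epsilon> * y)"
    by eventually_elim (auto simp: indicator_def mult.commute)
  ultimately show ?thesis
    by (subst integrable_cong_AE[symmetric]) auto
qed

text \<open>\<open>grow\<close> says that \<open>exp (D * y) * f y\<close> is nondecreasing for y >=
  0, which is the Tauberian condition. \<open>transform\<close> and \<open>contH\<close> say that
  the Laplace transform minus \<open>A / s\<close> extends continuously to the imaginary
  axis.\<close>

locale wiener_ikehara =
  fixes f :: "real \<Rightarrow> real" and A D :: real and H :: "complex \<Rightarrow> complex"
  assumes A: "0 \<le> A" and D: "0 \<le> D" and fm [measurable]: "f \<in> borel_measurable borel"
    and f_nonneg: "0 \<le> f y" and f_neg: "y < 0 \<Longrightarrow> f y = 0"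
    and grow: "0 \<le> x \<Longrightarrow> x \<le> y \<Longrightarrow> f x \<le> exp (D * (y - x)) * f y"
    and damped: "0 < \<epsilon> \<Longrightarrow> integrable lborel (\<lambda>y. f y * exp (- \<epsilon> * y))"
    and contH: "continuous_on {s. 0 \<le> Re s} H"
    and transform: "0 < Re s \<Longrightarrow> (LINT y|lborel. of_real (f y - A * indicator {0..} y) * exp (- s * of_real y)) = H s"
begin

text \<open>The tent-weighted Fourier integral of the boundary values of \<open>H\<close> on the
  segment of height \<open>R\<close>, at frequency \<open>R * u\<close>. It is the error of
  smoothing at scale \<open>1 / R\<close> around \<open>u\<close>.\<close>

definition remainder :: "real \<Rightarrow> real \<Rightarrow> real" where
  "remainder R u = Re (LINT t|lborel. of_real (tent t) * H (Complex 0 (- (R * t))) * exp (- (\<i> * of_real (R * u * t))))"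

lemma remainder_tendsto_0:
  assumes R: "0 < R"
  shows "(remainder R \<longlongrightarrow> 0) at_top"
proof -
  have "continuous_on UNIV (\<lambda>t. H (Complex 0 (- (R * t))))"
    by (rule continuous_on_compose2[OF contH]) (auto intro!: continuous_intros)
  hence "continuous_on UNIV (\<lambda>t. of_real (tent t) * H (Complex 0 (- (R * t))))"
    by (intro continuous_intros continuous_on_tent)
  moreover have "of_real (tent t) * H (Complex 0 (- (R * t))) = 0" if "t \<notin> {-1..1}" for t
    using that by (auto simp: tent_def max_def abs_if split: if_splits)
  ultimately have "((\<lambda>x. LINT t|lborel. of_real (tent t) * H (Complex 0 (- (R * t))) * exp (- (\<i> * of_real (x * t)))) \<longlongrightarrow> 0) at_top"
    by (rule Riemann_Lebesgue_compact_support)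
  moreover have "filterlim (\<lambda>u. R * u) at_top at_top" using R by (simp add: filterlim_tendsto_pos_mult_at_top[OF tendsto_const _ filterlim_ident])
  ultimately have "((\<lambda>u. LINT t|lborel. of_real (tent t) * H (Complex 0 (- (R * t))) * exp (- (\<i> * of_real (R * u * t)))) \<longlongrightarrow> 0) at_top"
    by (rule filterlim_compose)
  from tendsto_Re[OF this] show ?thesis by (simp add: remainder_def[abs_def])
qed

lemma fejer_scaled:
  assumes R: "0 < R"
  shows "integrable lborel (\<lambda>y. fejer (R * (y - u)))" "(LINT y|lborel. fejer (R * (y - u))) = (LINT v|lborel. fejer v) / R"
  using lborel_integral_scale[OF R fejer_integrable, of u] by (simp_all add: divide_inverse mult.commute)

text \<open>The damping tends to 0 in the damped identity. On the side of \<open>H\<close> and for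
  the indicator dominated convergence applies; for \<open>f\<close> monotone convergence is used,
  because integrability of \<open>f\<close> against the kernel is itself to be shown.\<close>

lemma smoothed_integral:
  assumes R: "0 < R"
  shows "integrable lborel (\<lambda>y. f y * fejer (R * (y - u)))"
    and "(LINT y|lborel. f y * fejer (R * (y - u))) = A * (LINT y|lborel. indicator {0..} y * fejer (R * (y - u))) + remainder R u"
proof -
  define \<epsilon> where "\<epsilon> n = 1 / real (Suc n)" for n
  have \<epsilon>: "0 < \<epsilon> n" "\<epsilon> n \<le> 1" for n by (auto simp: \<epsilon>_def)
  have \<epsilon>0: "\<epsilon> \<longlonglongrightarrow> 0" unfolding \<epsilon>_def by (intro LIMSEQ_Suc lim_1_over_n)
  let ?K = "\<lambda>y. fejer (R * (y - u))"
  have Kb: "?K y \<le> 8" for y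
  proof -
    have "?K y \<le> 8 * inverse (1 + (R * (y - u))^2)" by (rule fejer_le)
    also have "\<dots> \<le> 8 * inverse 1" by (intro mult_left_mono le_imp_inverse_le) auto
    finally show ?thesis by simp
  qed
  have Ki: "integrable lborel (\<lambda>y. g y * ?K y)" if "integrable lborel g" for g :: "real \<Rightarrow> real"
  proof (rule Bochner_Integration.integrable_bound)
    show "integrable lborel (\<lambda>y. 8 * g y)" using that by simp
    show "(\<lambda>y. g y * ?K y) \<in> borel_measurable lborel" using that by measurable
    have "\<bar>g y\<bar> * ?K y \<le> \<bar>g y\<bar> * 8" for y using Kb by (intro mult_left_mono) auto
    thus "AE y in lborel. norm (g y * ?K y) \<le> norm (8 * g y)"
      by (intro AE_I2) (simp add: abs_mult fejer_nonneg mult.commute)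
  qed
  let ?b = "\<lambda>y. f y - A * indicator {0..} y"
  have bi: "integrable lborel (\<lambda>y. ?b y * exp (- \<epsilon> n * y))" for n
    using Bochner_Integration.integrable_diff[OF damped[OF \<epsilon>(1)] integrable_mult_right[OF integrable_damped_indicator[OF \<epsilon>(1)], of A], of n n]
    by (simp add: left_diff_distrib mult.assoc)
  define J where "J n = (LINT t|lborel. of_real (tent t) * (exp (- (\<i> * of_real (R * u * t))) * H (Complex (\<epsilon> n) (- (R * t)))))" for n
  have J: "of_real (LINT y|lborel. ?b y * exp (- \<epsilon> n * y) * ?K y) = J n" for n
    unfolding J_def by (rule fejer_smoothing_damped[OF \<epsilon>(1) bi _ transform]) auto
  have split: "(LINT y|lborel. f y * exp (- \<epsilon> n * y) * ?K y) = A * (LINT y|lborel. indicator {0..} y * exp (- \<epsilon> n * y) * ?K y) + Re (J n)" for n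
  proof -
    have "(LINT y|lborel. ?b y * exp (- \<epsilon> n * y) * ?K y) =
       (LINT y|lborel. f y * exp (- \<epsilon> n * y) * ?K y - A * (indicator {0..} y * exp (- \<epsilon> n * y) * ?K y))"
      by (intro Bochner_Integration.integral_cong) (auto simp: algebra_simps)
    also have "\<dots> = (LINT y|lborel. f y * exp (- \<epsilon> n * y) * ?K y) - A * (LINT y|lborel. indicator {0..} y * exp (- \<epsilon> n * y) * ?K y)"
      using Bochner_Integration.integral_diff[OF Ki[OF damped[OF \<epsilon>(1)[of n]]]
          integrable_mult_right[OF Ki[OF integrable_damped_indicator[OF \<epsilon>(1)[of n]]], of A]]
      by (simp only: integral_mult_right_zero)
    finally show ?thesis using arg_cong[OF J[of n], of Re] by simp
  qed
  have e1: "exp (- \<epsilon> n * y) \<le> 1" if "0 \<le> y" for n y using that \<epsilon>[of n] by simp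
  have elim: "(\<lambda>n. exp (- \<epsilon> n * y)) \<longlonglongrightarrow> 1" for y
  proof -
    have "(\<lambda>n. exp (- \<epsilon> n * y)) \<longlonglongrightarrow> exp (- 0 * y)" by (intro tendsto_intros \<epsilon>0)
    thus ?thesis by simp
  qed
  have lim1: "(\<lambda>n. LINT y|lborel. indicator {0..} y * exp (- \<epsilon> n * y) * ?K y) \<longlonglongrightarrow> (LINT y|lborel. indicator {0..} y * ?K y)"
  proof (rule integral_dominated_convergence)
    show "integrable lborel ?K" by (rule fejer_scaled[OF R])
    show "AE y in lborel. (\<lambda>n. indicator {0..} y * exp (- \<epsilon> n * y) * ?K y) \<longlonglongrightarrow> indicator {0..} y * ?K y"
    proof (rule AE_I2)
      fix y
      have "(\<lambda>n. indicator {0..} y * exp (- \<epsilon> n * y) * ?K y) \<longlonglongrightarrow> indicator {0..} y * 1 * ?K y" by (intro tendsto_intros elim)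
      thus "(\<lambda>n. indicator {0..} y * exp (- \<epsilon> n * y) * ?K y) \<longlonglongrightarrow> indicator {0..} y * ?K y" by simp
    qed
    show "AE y in lborel. norm (indicator {0..} y * exp (- \<epsilon> n * y) * ?K y) \<le> ?K y" for n
    proof (rule AE_I2)
      fix y :: real
      show "norm (indicator {0..} y * exp (- \<epsilon> n * y) * ?K y) \<le> ?K y"
      proof (cases "0 \<le> y")
        case True
        thus ?thesis using e1[OF True, of n] fejer_nonneg[of "R * (y - u)"] by (simp add: abs_mult mult_left_le_one_le)
      qed (simp add: fejer_nonneg)
    qed
  qed auto
  have lim2: "(\<lambda>n. Re (J n)) \<longlonglongrightarrow> remainder R u"
  proof -
    \<comment> \<open>This rectangle contains every argument of \<open>H\<close> met for damping at
      most 1 and t in the support of the tent. Continuity up to the imaginary axis bounds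
      \<open>H\<close> on it.\<close>
    let ?C = "cbox (Complex 0 (- R)) (Complex 1 R)"
    have "continuous_on ?C H" by (rule continuous_on_subset[OF contH]) (auto simp: in_cbox_complex_iff)
    hence "compact (H ` ?C)" by (intro compact_continuous_image) auto
    then obtain M where M: "\<And>s. s \<in> ?C \<Longrightarrow> norm (H s) \<le> M" by (metis bounded_iff compact_imp_bounded imageI)
    have inC: "Complex \<sigma> (- (R * t)) \<in> ?C" if "0 \<le> \<sigma>" "\<sigma> \<le> 1" "\<bar>t\<bar> \<le> 1" for \<sigma> t
    proof -
      have "\<bar>R * t\<bar> \<le> R" using that R by (simp add: abs_mult mult_left_le)
      thus ?thesis using that by (auto simp: in_cbox_complex_iff abs_le_iff)
    qed
    have cH: "continuous_on UNIV (\<lambda>t. H (Complex \<sigma> (- (R * t))))" if "0 \<le> \<sigma>" for \<sigma>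
      by (rule continuous_on_compose2[OF contH]) (use that in \<open>auto intro!: continuous_intros\<close>)
    have Hm: "(\<lambda>t. H (Complex \<sigma> (- (R * t)))) \<in> borel_measurable borel" if "0 \<le> \<sigma>" for \<sigma>
      using cH[OF that] by (rule borel_measurable_continuous_onI)
    have "J \<longlonglongrightarrow> (LINT t|lborel. of_real (tent t) * (exp (- (\<i> * of_real (R * u * t))) * H (Complex 0 (- (R * t)))))"
      unfolding J_def
    proof (rule integral_dominated_convergence)
      show "integrable lborel (\<lambda>t. tent t * M)" using tent_integrable by (rule integrable_mult_left)
      show "(\<lambda>t. of_real (tent t) * (exp (- (\<i> * of_real (R * u * t))) * H (Complex 0 (- (R * t))))) \<in> borel_measurable lborel"
        using Hm[of 0] by measurable
      show "(\<lambda>t. of_real (tent t) * (exp (- (\<i> * of_real (R * u * t))) * H (Complex (\<epsilon> n) (- (R * t))))) \<in> borel_measurable lborel" for n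
        using Hm[OF less_imp_le[OF \<epsilon>(1)], of n] by measurable
      show "AE t in lborel. (\<lambda>n. of_real (tent t) * (exp (- (\<i> * of_real (R * u * t))) * H (Complex (\<epsilon> n) (- (R * t))))) \<longlonglongrightarrow>
          of_real (tent t) * (exp (- (\<i> * of_real (R * u * t))) * H (Complex 0 (- (R * t))))"
      proof (rule AE_I2)
        fix t
        have "(\<lambda>n. Complex (\<epsilon> n) (- (R * t))) \<longlonglongrightarrow> Complex 0 (- (R * t))"
          using \<epsilon>0 by (intro tendsto_Complex tendsto_const)
        hence "(\<lambda>n. H (Complex (\<epsilon> n) (- (R * t)))) \<longlonglongrightarrow> H (Complex 0 (- (R * t)))"
          by (rule continuous_on_tendsto_compose[OF contH]) (use \<epsilon>(1) in \<open>auto intro!: always_eventually less_imp_le\<close>)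
        thus "(\<lambda>n. of_real (tent t) * (exp (- (\<i> * of_real (R * u * t))) * H (Complex (\<epsilon> n) (- (R * t))))) \<longlonglongrightarrow>
          of_real (tent t) * (exp (- (\<i> * of_real (R * u * t))) * H (Complex 0 (- (R * t))))"
          by (intro tendsto_intros)
      qed
      show "AE t in lborel. norm (of_real (tent t) * (exp (- (\<i> * of_real (R * u * t))) * H (Complex (\<epsilon> n) (- (R * t))))) \<le> tent t * M" for n
      proof (rule AE_I2)
        fix t
        have "tent t * norm (H (Complex (\<epsilon> n) (- (R * t)))) \<le> tent t * M"
        proof (cases "\<bar>t\<bar> \<le> 1")
          case True
          thus ?thesis using M[OF inC[of "\<epsilon> n" t]] \<epsilon>[of n] by (intro mult_left_mono) (auto simp: tent_def less_imp_le)
        qed (simp add: tent_def)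
        thus "norm (of_real (tent t) * (exp (- (\<i> * of_real (R * u * t))) * H (Complex (\<epsilon> n) (- (R * t))))) \<le> tent t * M"
          by (simp add: norm_mult) (simp add: tent_def)
      qed
    qed
    from tendsto_Re[OF this] show ?thesis by (simp add: remainder_def mult_ac)
  qed
  have lim: "(\<lambda>n. LINT y|lborel. f y * exp (- \<epsilon> n * y) * ?K y) \<longlonglongrightarrow> A * (LINT y|lborel. indicator {0..} y * ?K y) + remainder R u"
    unfolding split by (intro tendsto_intros lim1 lim2)
  \<comment> \<open>The damping factor increases with n for y >= 0, and for y < 0 the function
    \<open>f\<close> vanishes.\<close>
  have mono: "AE y in lborel. mono (\<lambda>n. f y * exp (- \<epsilon> n * y) * ?K y)"
  proof (rule AE_I2)
    fix y
    show "mono (\<lambda>n. f y * exp (- \<epsilon> n * y) * ?K y)"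
    proof (cases "0 \<le> y")
      case True
      show ?thesis
      proof (rule monoI)
        fix n k :: nat assume "n \<le> k"
        hence "\<epsilon> k \<le> \<epsilon> n" by (simp add: \<epsilon>_def frac_le)
        hence "- \<epsilon> n * y \<le> - \<epsilon> k * y" using True by (simp add: mult_right_mono)
        thus "f y * exp (- \<epsilon> n * y) * ?K y \<le> f y * exp (- \<epsilon> k * y) * ?K y"
          using f_nonneg fejer_nonneg by (intro mult_right_mono mult_left_mono) auto
      qed
    qed (simp add: f_neg mono_def)
  qed
  have pt: "AE y in lborel. (\<lambda>n. f y * exp (- \<epsilon> n * y) * ?K y) \<longlonglongrightarrow> f y * ?K y"
  proof (rule AE_I2)
    fix y
    have "(\<lambda>n. f y * exp (- \<epsilon> n * y) * ?K y) \<longlonglongrightarrow> f y * 1 * ?K y" by (intro tendsto_intros elim)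
    thus "(\<lambda>n. f y * exp (- \<epsilon> n * y) * ?K y) \<longlonglongrightarrow> f y * ?K y" by simp
  qed
  show "integrable lborel (\<lambda>y. f y * ?K y)"
    "(LINT y|lborel. f y * ?K y) = A * (LINT y|lborel. indicator {0..} y * ?K y) + remainder R u"
    using integrable_monotone_convergence[OF Ki[OF damped[OF \<epsilon>(1)]] mono pt lim]
      integral_monotone_convergence[OF Ki[OF damped[OF \<epsilon>(1)]] mono pt lim] by auto
qed

definition mass :: real where
  "mass = (LINT v|lborel. fejer v)"

definition local_mass :: "real \<Rightarrow> real" where
  "local_mass X = (LINT v|lborel. indicator {-X..X} v * fejer v)"

lemma truncated_fejer_integrable: "integrable lborel (\<lambda>v. indicator {-X..X} v * fejer v)"
  using integrable_mult_indicator[OF _ fejer_integrable, of "{-X..X}"] by simp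

lemma mass_pos: "0 < mass"
  unfolding mass_def by (rule fejer_integral_pos)

lemma local_mass_nonneg: "0 \<le> local_mass X"
  unfolding local_mass_def by (intro Bochner_Integration.integral_nonneg) (auto simp: fejer_nonneg)

lemma local_mass_tendsto: "(\<lambda>n. local_mass (real n)) \<longlonglongrightarrow> mass"
  unfolding local_mass_def mass_def
proof (rule integral_dominated_convergence)
  show "integrable lborel fejer" by (rule fejer_integrable)
  show "AE v in lborel. norm (indicator {-real n..real n} v * fejer v) \<le> fejer v" for n
    by (intro AE_I2) (auto simp: indicator_def fejer_nonneg)
  show "AE v in lborel. (\<lambda>n. indicator {-real n..real n} v * fejer v) \<longlonglongrightarrow> fejer v"
  proof (rule AE_I2)
    fix v :: real
    obtain N where N: "\<bar>v\<bar> \<le> real N" using real_arch_simple by blast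
    have "\<forall>\<^sub>F n in sequentially. fejer v = indicator {-real n..real n} v * fejer v"
      using eventually_ge_at_top[of N]
    proof eventually_elim
      case (elim n)
      hence "\<bar>v\<bar> \<le> real n" using N by (meson of_nat_mono order_trans)
      hence "v \<in> {-real n..real n}" by (auto simp: abs_le_iff)
      thus ?case by simp
    qed
    thus "(\<lambda>n. indicator {-real n..real n} v * fejer v) \<longlonglongrightarrow> fejer v"
      by (rule Lim_transform_eventually[OF tendsto_const])
  qed
qed auto

text \<open>Within distance \<open>X / R\<close> of u the growth condition bounds f from below by
  its value at the left end, up to the exponential of D times the window length
  \<open>2 * (X / R)\<close>. The rest of the integral is nonnegative and is dropped.\<close>

lemma upper_bound:
  assumes X: "0 < X" and R: "0 < R" and u: "X / R \<le> u"
  shows "f (u - X / R) * local_mass X \<le> exp (2 * D * (X / R)) * (A * mass + R * remainder R u)"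
proof -
  define \<delta> where "\<delta> = X / R"
  have \<delta>: "0 < \<delta>" "R * \<delta> = X" "\<delta> \<le> u" using X R u by (auto simp: \<delta>_def)
  let ?K = "\<lambda>y. fejer (R * (y - u))" and ?I = "\<lambda>y. indicator {-X..X} (R * (y - u)) :: real"
  have sc: "integrable lborel (\<lambda>y. ?I y * ?K y)" "(LINT y|lborel. ?I y * ?K y) = local_mass X / R"
    using lborel_integral_scale[OF R truncated_fejer_integrable, of X u]
    by (simp_all add: local_mass_def divide_inverse mult.commute)
  have near: "\<bar>y - u\<bar> \<le> \<delta>" if "R * (y - u) \<in> {-X..X}" for y
  proof -
    have "\<bar>R * (y - u)\<bar> \<le> R * \<delta>" using that \<delta> by (auto simp: abs_le_iff)
    thus ?thesis using R by (simp add: abs_mult)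
  qed
  have "f (u - \<delta>) * (local_mass X / R) = (LINT y|lborel. f (u - \<delta>) * (?I y * ?K y))"
    unfolding sc(2)[symmetric] by simp
  also have "\<dots> \<le> (LINT y|lborel. exp (2 * D * \<delta>) * (f y * ?K y))"
  proof (rule integral_mono)
    show "integrable lborel (\<lambda>y. f (u - \<delta>) * (?I y * ?K y))" using sc(1) by (rule integrable_mult_right)
    show "integrable lborel (\<lambda>y. exp (2 * D * \<delta>) * (f y * ?K y))" by (intro integrable_mult_right smoothed_integral(1)[OF R])
    fix y
    show "f (u - \<delta>) * (?I y * ?K y) \<le> exp (2 * D * \<delta>) * (f y * ?K y)"
    proof (cases "R * (y - u) \<in> {-X..X}")
      case True
      have y: "u - \<delta> \<le> y" "y - (u - \<delta>) \<le> 2 * \<delta>" using near[OF True] by (auto simp: abs_le_iff)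
      have "f (u - \<delta>) \<le> exp (D * (y - (u - \<delta>))) * f y" using \<delta> y by (intro grow) auto
      also have "\<dots> \<le> exp (D * (2 * \<delta>)) * f y" using y D f_nonneg by (intro mult_right_mono) (auto intro: mult_left_mono)
      finally have "f (u - \<delta>) * ?K y \<le> exp (D * (2 * \<delta>)) * f y * ?K y" by (rule mult_right_mono) (rule fejer_nonneg)
      thus ?thesis using True by (simp add: mult_ac)
    next
      case False
      thus ?thesis using f_nonneg[of y] fejer_nonneg[of "R * (y - u)"] by simp
    qed
  qed
  also have "\<dots> = exp (2 * D * \<delta>) * (A * (LINT y|lborel. indicator {0..} y * ?K y) + remainder R u)"
    by (simp add: smoothed_integral(2)[OF R])
  also have "\<dots> \<le> exp (2 * D * \<delta>) * (A * (mass / R) + remainder R u)"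
  proof (intro mult_left_mono add_right_mono A)
    have "integrable lborel (\<lambda>y. indicator {0..} y * ?K y)"
      using integrable_mult_indicator[OF _ fejer_scaled(1)[OF R], of "{0..}"] by simp
    hence "(LINT y|lborel. indicator {0..} y * ?K y) \<le> (LINT y|lborel. ?K y)"
      by (intro integral_mono fejer_scaled(1)[OF R]) (auto simp: indicator_def fejer_nonneg)
    thus "(LINT y|lborel. indicator {0..} y * ?K y) \<le> mass / R" by (simp add: fejer_scaled(2)[OF R] mass_def)
  qed auto
  finally have "f (u - \<delta>) * (local_mass X / R) * R \<le> exp (2 * D * \<delta>) * (A * (mass / R) + remainder R u) * R"
    using R by (intro mult_right_mono) auto
  thus ?thesis using R unfolding \<delta>_def[symmetric] by (simp add: distrib_left distrib_right mult_ac)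
qed

text \<open>Inside the window the growth condition bounds f from above by its value at the right
  end. Outside nothing local is known, and a global bound \<open>M\<close> times the missing mass of
  the kernel is paid; hence boundedness must be established first, from the upper estimate.\<close>

lemma lower_bound:
  assumes X: "0 < X" and R: "0 < R" and u: "X / R \<le> u" and M: "\<And>y. f y \<le> M"
  shows "A * local_mass X + R * remainder R u \<le> exp (2 * D * (X / R)) * f (u + X / R) * local_mass X + M * (mass - local_mass X)"
proof -
  define \<delta> where "\<delta> = X / R"
  have \<delta>: "0 < \<delta>" "R * \<delta> = X" "\<delta> \<le> u" using X R u by (auto simp: \<delta>_def)
  let ?K = "\<lambda>y. fejer (R * (y - u))" and ?I = "\<lambda>y. indicator {-X..X} (R * (y - u)) :: real"
  have sc: "integrable lborel (\<lambda>y. ?I y * ?K y)" "(LINT y|lborel. ?I y * ?K y) = local_mass X / R"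
    using lborel_integral_scale[OF R truncated_fejer_integrable, of X u]
    by (simp_all add: local_mass_def divide_inverse mult.commute)
  have near: "\<bar>y - u\<bar> \<le> \<delta>" if "R * (y - u) \<in> {-X..X}" for y
  proof -
    have "\<bar>R * (y - u)\<bar> \<le> R * \<delta>" using that \<delta> by (auto simp: abs_le_iff)
    thus ?thesis using R by (simp add: abs_mult)
  qed
  have i0: "integrable lborel (\<lambda>y. indicator {0..} y * ?K y)"
    using integrable_mult_indicator[OF _ fejer_scaled(1)[OF R], of "{0..}"] by simp
  \<comment> \<open>Since \<open>X / R \<le> u\<close>, the whole window lies in the half-line y >=
    0.\<close>
  have "local_mass X / R \<le> (LINT y|lborel. indicator {0..} y * ?K y)"
    unfolding sc(2)[symmetric]
  proof (rule integral_mono[OF sc(1) i0])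
    fix y
    show "?I y * ?K y \<le> indicator {0..} y * ?K y"
    proof (cases "R * (y - u) \<in> {-X..X}")
      case True
      hence "0 \<le> y" using near[OF True] \<delta> by (auto simp: abs_le_iff)
      thus ?thesis by (simp add: fejer_nonneg indicator_def)
    qed (simp add: fejer_nonneg)
  qed
  hence "A * (local_mass X / R) + remainder R u \<le> A * (LINT y|lborel. indicator {0..} y * ?K y) + remainder R u"
    by (intro add_right_mono mult_left_mono A)
  also have "\<dots> = (LINT y|lborel. f y * ?K y)" by (simp add: smoothed_integral(2)[OF R])
  also have "\<dots> \<le> (LINT y|lborel. exp (2 * D * \<delta>) * f (u + \<delta>) * (?I y * ?K y) + M * (?K y - ?I y * ?K y))"
  proof (rule integral_mono)
    show "integrable lborel (\<lambda>y. f y * ?K y)" by (rule smoothed_integral(1)[OF R])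
    show "integrable lborel (\<lambda>y. exp (2 * D * \<delta>) * f (u + \<delta>) * (?I y * ?K y) + M * (?K y - ?I y * ?K y))"
      by (intro Bochner_Integration.integrable_add Bochner_Integration.integrable_diff integrable_mult_right sc(1) fejer_scaled(1)[OF R])
    fix y
    show "f y * ?K y \<le> exp (2 * D * \<delta>) * f (u + \<delta>) * (?I y * ?K y) + M * (?K y - ?I y * ?K y)"
    proof (cases "R * (y - u) \<in> {-X..X}")
      case True
      have y: "0 \<le> y" "y \<le> u + \<delta>" "u + \<delta> - y \<le> 2 * \<delta>" using near[OF True] \<delta> by (auto simp: abs_le_iff)
      have "f y \<le> exp (D * (u + \<delta> - y)) * f (u + \<delta>)" using y by (intro grow) auto
      also have "\<dots> \<le> exp (D * (2 * \<delta>)) * f (u + \<delta>)" using y D f_nonneg by (intro mult_right_mono) (auto intro: mult_left_mono)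
      finally have "f y * ?K y \<le> exp (D * (2 * \<delta>)) * f (u + \<delta>) * ?K y" by (rule mult_right_mono) (rule fejer_nonneg)
      thus ?thesis using True by (simp add: mult_ac)
    next
      case False
      thus ?thesis using mult_right_mono[OF M fejer_nonneg, of y "R * (y - u)"] by simp
    qed
  qed
  also have "\<dots> = exp (2 * D * \<delta>) * f (u + \<delta>) * (local_mass X / R) + M * (mass / R - local_mass X / R)"
    by (simp add: Bochner_Integration.integral_add Bochner_Integration.integral_diff sc fejer_scaled[OF R] mass_def)
  finally have "(A * (local_mass X / R) + remainder R u) * R \<le>
      (exp (2 * D * \<delta>) * f (u + \<delta>) * (local_mass X / R) + M * (mass / R - local_mass X / R)) * R"
    using R by (intro mult_right_mono) auto
  moreover have "(A * (local_mass X / R) + remainder R u) * R = A * local_mass X + R * remainder R u"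
    using R by (simp add: field_simps)
  moreover have "(exp (2 * D * \<delta>) * f (u + \<delta>) * (local_mass X / R) + M * (mass / R - local_mass X / R)) * R
      = exp (2 * D * \<delta>) * f (u + \<delta>) * local_mass X + M * (mass - local_mass X)"
    using R by (simp add: field_simps)
  ultimately show ?thesis unfolding \<delta>_def[symmetric] by simp
qed

lemma eventually_local_mass:
  assumes "m < mass"
  obtains X where "0 < X" "m < local_mass X"
proof -
  have "\<forall>\<^sub>F n in sequentially. m < local_mass (real n)" using local_mass_tendsto assms by (rule order_tendstoD(1))
  hence "\<forall>\<^sub>F n in sequentially. m < local_mass (real n) \<and> 0 < n" using eventually_gt_at_top[of 0] by eventually_elim auto
  then obtain n where "m < local_mass (real n)" "0 < n" by (auto simp: eventually_sequentially)
  thus ?thesis by (intro that[of "real n"]) auto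
qed

lemma exp_small_window: "((\<lambda>R. exp (2 * D * (X / R))) \<longlongrightarrow> 1) at_top"
proof -
  have "((\<lambda>R. exp (2 * D * (X / R))) \<longlongrightarrow> exp (2 * D * 0)) at_top"
    by (intro tendsto_intros tendsto_divide_0[OF tendsto_const filterlim_at_top_imp_at_infinity[OF filterlim_ident]])
  thus ?thesis by simp
qed

text \<open>The order of the choices matters: \<open>X\<close> so large that the window carries
  nearly all the mass of the kernel, then \<open>R\<close> so large that the exponential is nearly
  1, then u so large that the remainder is negligible.\<close>

lemma eventually_upper:
  assumes \<eta>: "A < \<eta>"
  shows "\<forall>\<^sub>F x in at_top. f x < \<eta>"
proof -
  have \<eta>0: "0 < \<eta>" using A \<eta> by simp
  have "A * mass / \<eta> < mass" using \<eta> \<eta>0 mass_pos by (simp add: pos_divide_less_eq mult.commute)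
  then obtain X where X: "0 < X" "A * mass / \<eta> < local_mass X" by (rule eventually_local_mass)
  have lm: "0 < local_mass X" using X(2) A mass_pos \<eta>0 by (meson divide_nonneg_pos le_less_trans less_imp_le mult_nonneg_nonneg)
  have X': "1 * (A * mass) < \<eta> * local_mass X" using X(2) \<eta>0 by (simp add: pos_divide_less_eq mult.commute)
  have "((\<lambda>R. exp (2 * D * (X / R)) * (A * mass)) \<longlongrightarrow> 1 * (A * mass)) at_top" by (intro tendsto_intros exp_small_window)
  hence "\<forall>\<^sub>F R in at_top. exp (2 * D * (X / R)) * (A * mass) < \<eta> * local_mass X" using X' by (rule order_tendstoD(2))
  hence "\<forall>\<^sub>F R in at_top. exp (2 * D * (X / R)) * (A * mass) < \<eta> * local_mass X \<and> 0 < R"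
    using eventually_gt_at_top[of 0] by eventually_elim auto
  then obtain R where R: "exp (2 * D * (X / R)) * (A * mass) < \<eta> * local_mass X" "0 < R"
    by (auto simp: eventually_at_top_linorder)
  have "((\<lambda>u. exp (2 * D * (X / R)) * (A * mass + R * remainder R u)) \<longlongrightarrow> exp (2 * D * (X / R)) * (A * mass + R * 0)) at_top"
    by (intro tendsto_intros remainder_tendsto_0 R)
  hence "\<forall>\<^sub>F u in at_top. exp (2 * D * (X / R)) * (A * mass + R * remainder R u) < \<eta> * local_mass X"
    using R(1) by (intro order_tendstoD(2)) auto
  moreover have "\<forall>\<^sub>F u in at_top. X / R \<le> u" by (rule eventually_ge_at_top)
  ultimately have "\<forall>\<^sub>F u in at_top. f (u - X / R) < \<eta>"
  proof eventually_elim
    case (elim u)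
    have "f (u - X / R) * local_mass X < \<eta> * local_mass X"
      using upper_bound[OF X(1) R(2) elim(2)] elim(1) by linarith
    thus ?case using lm by simp
  qed
  then obtain N where N: "\<And>u. N \<le> u \<Longrightarrow> f (u - X / R) < \<eta>" by (auto simp: eventually_at_top_linorder)
  show ?thesis unfolding eventually_at_top_linorder
  proof (intro exI allI impI)
    fix x assume "N \<le> x"
    moreover have "0 < X / R" using X R by simp
    ultimately have "N \<le> x + X / R" by linarith
    from N[OF this] show "f x < \<eta>" by simp
  qed
qed

text \<open>Far out the upper estimate applies. At earlier points the growth condition carries that
  bound back over a distance of at most \<open>N'\<close>.\<close>

lemma bounded_above: obtains M where "\<And>y. f y \<le> M" "0 \<le> M"
proof -
  have "\<forall>\<^sub>F x in at_top. f x < A + 1" by (rule eventually_upper) simp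
  then obtain N where N: "\<And>x. N \<le> x \<Longrightarrow> f x < A + 1" by (auto simp: eventually_at_top_linorder)
  define N' where "N' = max N 0"
  have "f y \<le> exp (D * N') * (A + 1)" for y
  proof (cases "y < 0")
    case True
    thus ?thesis using A f_neg by simp
  next
    case False
    define z where "z = max y N'"
    have "f y \<le> exp (D * (z - y)) * f z" using False by (intro grow) (auto simp: z_def)
    also have "\<dots> \<le> exp (D * N') * (A + 1)"
    proof (intro mult_mono)
      have "N \<le> z" by (auto simp: z_def N'_def)
      thus "f z \<le> A + 1" using N by (simp add: less_imp_le)
      have "z - y \<le> N'" using False by (auto simp: z_def N'_def)
      thus "exp (D * (z - y)) \<le> exp (D * N')" using D by (simp add: mult_left_mono)
    qed (use f_nonneg in auto)
    finally show ?thesis .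
  qed
  thus ?thesis using A by (intro that[of "exp (D * N') * (A + 1)"]) auto
qed

text \<open>The choices are made in the same order as for the upper estimate, but \<open>X\<close>
  must also make the tail cost \<open>M * (mass - local_mass X)\<close> small. Negative thresholds
  are trivial because f is nonnegative.\<close>

lemma eventually_lower:
  assumes \<eta>: "\<eta> < A"
  shows "\<forall>\<^sub>F x in at_top. \<eta> < f x"
proof (cases "\<eta> < 0")
  case True
  show ?thesis by (intro always_eventually allI) (use True f_nonneg in \<open>auto intro: less_le_trans\<close>)
next
  case False
  obtain M where M: "\<And>y. f y \<le> M" "0 \<le> M" using bounded_above by blast
  have "((\<lambda>n. A * local_mass (real n) - M * (mass - local_mass (real n)) - \<eta> * local_mass (real n)) \<longlongrightarrow>
      A * mass - M * (mass - mass) - \<eta> * mass) sequentially"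
    by (intro tendsto_intros local_mass_tendsto)
  moreover have "0 < A * mass - M * (mass - mass) - \<eta> * mass" using \<eta> mass_pos by simp
  ultimately have "\<forall>\<^sub>F n in sequentially. 0 < A * local_mass (real n) - M * (mass - local_mass (real n)) - \<eta> * local_mass (real n)"
    by (rule order_tendstoD(1))
  hence "\<forall>\<^sub>F n in sequentially. 0 < A * local_mass (real n) - M * (mass - local_mass (real n)) - \<eta> * local_mass (real n) \<and> 0 < n"
    using eventually_gt_at_top[of 0] by eventually_elim auto
  then obtain n where n: "0 < A * local_mass (real n) - M * (mass - local_mass (real n)) - \<eta> * local_mass (real n)" "0 < n"
    by (auto simp: eventually_sequentially)
  define X where "X = real n"
  have X: "0 < X" "\<eta> * local_mass X < A * local_mass X - M * (mass - local_mass X)" using n by (auto simp: X_def)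
  have X': "1 * (\<eta> * local_mass X) < A * local_mass X - M * (mass - local_mass X)" using X by simp
  have "((\<lambda>R. exp (2 * D * (X / R)) * (\<eta> * local_mass X)) \<longlongrightarrow> 1 * (\<eta> * local_mass X)) at_top" by (intro tendsto_intros exp_small_window)
  hence "\<forall>\<^sub>F R in at_top. exp (2 * D * (X / R)) * (\<eta> * local_mass X) < A * local_mass X - M * (mass - local_mass X)"
    using X' by (rule order_tendstoD(2))
  hence "\<forall>\<^sub>F R in at_top. exp (2 * D * (X / R)) * (\<eta> * local_mass X) < A * local_mass X - M * (mass - local_mass X) \<and> 0 < R"
    using eventually_gt_at_top[of 0] by eventually_elim auto
  then obtain R where R: "exp (2 * D * (X / R)) * (\<eta> * local_mass X) < A * local_mass X - M * (mass - local_mass X)" "0 < R"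
    by (auto simp: eventually_at_top_linorder)
  have "((\<lambda>u. A * local_mass X - M * (mass - local_mass X) + R * remainder R u) \<longlongrightarrow> A * local_mass X - M * (mass - local_mass X) + R * 0) at_top"
    by (intro tendsto_intros remainder_tendsto_0 R)
  hence "\<forall>\<^sub>F u in at_top. exp (2 * D * (X / R)) * (\<eta> * local_mass X) < A * local_mass X - M * (mass - local_mass X) + R * remainder R u"
    using R(1) by (intro order_tendstoD(1)) auto
  moreover have "\<forall>\<^sub>F u in at_top. X / R \<le> u" by (rule eventually_ge_at_top)
  ultimately have "\<forall>\<^sub>F u in at_top. \<eta> < f (u + X / R)"
  proof eventually_elim
    case (elim u)
    have "exp (2 * D * (X / R)) * local_mass X * \<eta> < exp (2 * D * (X / R)) * local_mass X * f (u + X / R)"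
      using lower_bound[OF X(1) R(2) elim(2) M(1)] elim(1) by (simp add: algebra_simps)
    thus ?case using local_mass_nonneg[of X] by (auto simp: mult_less_cancel_left zero_less_mult_iff)
  qed
  then obtain N where N: "\<And>u. N \<le> u \<Longrightarrow> \<eta> < f (u + X / R)" by (auto simp: eventually_at_top_linorder)
  show ?thesis unfolding eventually_at_top_linorder
  proof (intro exI allI impI)
    fix x assume "N + X / R \<le> x"
    thus "\<eta> < f x" using N[of "x - X / R"] by simp
  qed
qed

theorem wiener_ikehara: "(f \<longlongrightarrow> A) at_top"
  using eventually_lower eventually_upper by (rule order_tendstoI)

end

subsection \<open>Periodic orbits and words\<close>

lemma funpow_shift: "(shift ^^ n) a = (\<lambda>i. a (n + i))"
  by (induction n) (auto simp: shift_def fun_eq_iff)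

lemma funpow_shift_add: "(shift ^^ (i + j)) a = (shift ^^ i) ((shift ^^ j) a)"
  by (simp add: funpow_add)

definition shift_orbit :: "(nat \<Rightarrow> nat) \<Rightarrow> (nat \<Rightarrow> nat) set" where
  "shift_orbit a = range (\<lambda>i. (shift ^^ i) a)"

definition periodic :: "(nat \<Rightarrow> nat) \<Rightarrow> bool" where
  "periodic a \<longleftrightarrow> (\<exists>n\<ge>1. (shift ^^ n) a = a)"

definition period :: "(nat \<Rightarrow> nat) \<Rightarrow> nat" where
  "period a = (LEAST n. 1 \<le> n \<and> (shift ^^ n) a = a)"

lemma periodic_orbits_alt: "periodic_orbits N = shift_orbit ` {a \<in> seq_space N. periodic a}"
  by (auto simp: periodic_orbits_def shift_orbit_def periodic_def)

lemma period:
  assumes "periodic a"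
  shows "1 \<le> period a" "(shift ^^ period a) a = a" "\<And>n. 1 \<le> n \<Longrightarrow> (shift ^^ n) a = a \<Longrightarrow> period a \<le> n"
proof -
  have "1 \<le> period a \<and> (shift ^^ period a) a = a"
    unfolding period_def by (rule LeastI_ex) (use assms in \<open>auto simp: periodic_def\<close>)
  thus "1 \<le> period a" "(shift ^^ period a) a = a" by auto
  show "period a \<le> n" if "1 \<le> n" "(shift ^^ n) a = a" for n
    unfolding period_def by (rule Least_le) (use that in auto)
qed

lemma funpow_shift_multiple:
  assumes "(shift ^^ d) a = a"
  shows "(shift ^^ (d * q)) a = a"
proof (induction q)
  case (Suc q)
  have "d * Suc q = d + d * q" by simp
  thus ?case using Suc assms by (simp only: funpow_shift_add)
qed simp

lemma funpow_shift_mod: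
  assumes "(shift ^^ d) a = a"
  shows "(shift ^^ i) a = (shift ^^ (i mod d)) a"
proof -
  have "i = i mod d + d * (i div d)" by simp
  hence "(shift ^^ i) a = (shift ^^ (i mod d)) ((shift ^^ (d * (i div d))) a)" by (metis funpow_shift_add)
  thus ?thesis using funpow_shift_multiple[OF assms] by simp
qed

lemma funpow_shift_eq_iff:
  assumes "periodic a"
  shows "(shift ^^ n) a = a \<longleftrightarrow> period a dvd n"
proof
  assume n: "(shift ^^ n) a = a"
  have "(shift ^^ (n mod period a)) a = a" using funpow_shift_mod[OF period(2)[OF assms], of n] n by simp
  moreover have "n mod period a < period a" using period(1)[OF assms] by simp
  ultimately have "\<not> 1 \<le> n mod period a" using period(3)[OF assms, of "n mod period a"] by linarith
  thus "period a dvd n" by (simp add: dvd_eq_mod_eq_0)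
next
  assume "period a dvd n"
  thus "(shift ^^ n) a = a" using funpow_shift_multiple[OF period(2)[OF assms]] by (auto elim: dvdE)
qed

text \<open>If the iterates at i < j agreed, completing the period after j would return a to itself
  after \<open>period a - j + i\<close> steps, a positive number smaller than the period.\<close>

lemma inj_on_funpow_shift:
  assumes "periodic a"
  shows "inj_on (\<lambda>i. (shift ^^ i) a) {..<period a}"
proof (rule linorder_inj_onI)
  fix i j assume ij: "i < j" "j \<in> {..<period a}"
  show "(shift ^^ i) a \<noteq> (shift ^^ j) a"
  proof
    assume eq: "(shift ^^ i) a = (shift ^^ j) a"
    have "(shift ^^ (period a - j + i)) a = (shift ^^ (period a - j)) ((shift ^^ j) a)"
      by (simp add: funpow_shift_add eq)
    also have "\<dots> = (shift ^^ (period a - j + j)) a" by (simp only: funpow_shift_add)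
    also have "\<dots> = a" using ij period(2)[OF assms] by simp
    finally have "period a dvd period a - j + i" using funpow_shift_eq_iff[OF assms] by simp
    moreover have "0 < period a - j + i" "period a - j + i < period a" using ij by auto
    ultimately show False by (auto dest: nat_dvd_not_less)
  qed
qed auto

lemma shift_orbit_eq:
  assumes "periodic a"
  shows "shift_orbit a = (\<lambda>i. (shift ^^ i) a) ` {..<period a}"
proof -
  have "(shift ^^ i) a \<in> (\<lambda>i. (shift ^^ i) a) ` {..<period a}" for i
    using funpow_shift_mod[OF period(2)[OF assms], of i] period(1)[OF assms] by (intro image_eqI[of _ _ "i mod period a"]) auto
  thus ?thesis by (auto simp: shift_orbit_def)
qed

lemma card_shift_orbit:
  assumes "periodic a"
  shows "finite (shift_orbit a)" "card (shift_orbit a) = period a"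
  unfolding shift_orbit_eq[OF assms] using inj_on_funpow_shift[OF assms] by (auto simp: card_image)

lemma shift_orbit_self: "a \<in> shift_orbit a"
  unfolding shift_orbit_def by (intro image_eqI[of _ _ 0]) auto

lemma shift_orbit_mem:
  assumes a: "periodic a" and b: "b \<in> shift_orbit a"
  shows "periodic b" "shift_orbit b = shift_orbit a"
proof -
  obtain i where i: "b = (shift ^^ i) a" using b by (auto simp: shift_orbit_def)
  have comm: "(shift ^^ n) b = (shift ^^ i) ((shift ^^ n) a)" for n
    unfolding i by (simp add: funpow_shift_add[symmetric] add.commute)
  show "periodic b" using a comm i by (metis periodic_def)
  \<comment> \<open>The shift is not invertible, but on a periodic sequence i steps are undone by
    going on to the next multiple of the period.\<close>
  have "a = (shift ^^ (period a * i - i)) b"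
  proof -
    have "i \<le> period a * i" using period(1)[OF a] by simp
    hence "(shift ^^ (period a * i - i)) b = (shift ^^ (period a * i)) a"
      unfolding i by (simp add: funpow_shift_add[symmetric])
    thus ?thesis using funpow_shift_multiple[OF period(2)[OF a]] by simp
  qed
  hence "shift_orbit a \<subseteq> shift_orbit b"
    unfolding shift_orbit_def by (metis (no_types, lifting) funpow_shift_add image_subsetI rangeI)
  moreover have "shift_orbit b \<subseteq> shift_orbit a"
    unfolding shift_orbit_def i by (metis (no_types, lifting) funpow_shift_add image_subsetI rangeI)
  ultimately show "shift_orbit b = shift_orbit a" by blast
qed

lemma periodic_orbits_mem:
  assumes p: "p \<in> periodic_orbits N" and a: "a \<in> p"
  shows "a \<in> seq_space N" "periodic a" "shift_orbit a = p" "card p = period a"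
proof -
  obtain b where b: "b \<in> seq_space N" "periodic b" "p = shift_orbit b" using p by (auto simp: periodic_orbits_alt)
  show 1: "periodic a" "shift_orbit a = p" using shift_orbit_mem[OF b(2)] a b(3) by auto
  show "card p = period a" using card_shift_orbit(2)[OF 1(1)] 1(2) by simp
  obtain i where "a = (shift ^^ i) b" using a b(3) by (auto simp: shift_orbit_def)
  thus "a \<in> seq_space N" using b(1) by (auto simp: funpow_shift seq_space_def)
qed

lemma periodic_orbits_finite: "p \<in> periodic_orbits N \<Longrightarrow> finite p" "p \<in> periodic_orbits N \<Longrightarrow> p \<noteq> {}"
  using card_shift_orbit shift_orbit_self by (auto simp: periodic_orbits_alt)

lemma card_orbit_pos: "p \<in> periodic_orbits N \<Longrightarrow> 0 < card p"
  using periodic_orbits_finite by (auto simp: card_gt_0_iff)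

text \<open>Each block of \<open>d\<close> terms repeats the first one. The weights may be infinite,
  and nonnegativity is what permits distributivity in \<open>ereal\<close>.\<close>

lemma sum_periodic_blocks:
  fixes W :: "(nat \<Rightarrow> nat) \<Rightarrow> ereal"
  assumes a: "(shift ^^ d) a = a" and W: "\<And>i. 0 \<le> W ((shift ^^ i) a)"
  shows "(\<Sum>i<d * k. W ((shift ^^ i) a)) = ereal (real k) * (\<Sum>i<d. W ((shift ^^ i) a))"
proof (induction k)
  case 0
  show ?case by (simp add: zero_ereal_def[symmetric])
next
  case (Suc k)
  have "(\<Sum>i<d * Suc k. W ((shift ^^ i) a)) = (\<Sum>i<d * k. W ((shift ^^ i) a)) + (\<Sum>i=d * k..<d * k + d. W ((shift ^^ i) a))"
    unfolding lessThan_atLeast0 by (simp add: sum.atLeastLessThan_concat add.commute)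
  also have "(\<Sum>i=d * k..<d * k + d. W ((shift ^^ i) a)) = (\<Sum>i<d. W ((shift ^^ i) a))"
  proof -
    have "(\<Sum>i=d * k..<d * k + d. W ((shift ^^ i) a)) = (\<Sum>i=0..<d. W ((shift ^^ (i + d * k)) a))"
      using sum.shift_bounds_nat_ivl[of "\<lambda>i. W ((shift ^^ i) a)" 0 "d * k" d] by (simp add: add.commute)
    also have "\<dots> = (\<Sum>i<d. W ((shift ^^ i) a))"
      by (simp only: funpow_shift_add funpow_shift_multiple[OF a] lessThan_atLeast0)
    finally show ?thesis .
  qed
  also have "(\<Sum>i<d * k. W ((shift ^^ i) a)) = ereal (real k) * (\<Sum>i<d. W ((shift ^^ i) a))" by (rule Suc)
  also have "ereal (real k) * (\<Sum>i<d. W ((shift ^^ i) a)) + (\<Sum>i<d. W ((shift ^^ i) a)) = ereal (real (Suc k)) * (\<Sum>i<d. W ((shift ^^ i) a))"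
  proof -
    have "ereal (real (Suc k)) = ereal (real k) + 1" by (simp add: one_ereal_def)
    thus ?thesis by (simp only:) (subst ereal_left_distrib, auto)
  qed
  finally show ?case .
qed

lemma periodic_seq_periodic: "(shift ^^ length x) (periodic_seq x) = periodic_seq x"
  by (auto simp: funpow_shift periodic_seq_def)

lemma periodic_seq_word:
  assumes "x \<in> words N"
  shows "periodic_seq x \<in> seq_space N" "periodic (periodic_seq x)" "1 \<le> length x"
    "map (periodic_seq x) [0..<length x] = x"
proof -
  have x: "x \<noteq> []" "set x \<subseteq> {1..N}" using assms by (auto simp: words_def)
  show "1 \<le> length x" using x by (cases x) auto
  thus "periodic (periodic_seq x)" using periodic_seq_periodic unfolding periodic_def by blast
  have "x ! (i mod length x) \<in> set x" for i using x by simp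
  thus "periodic_seq x \<in> seq_space N" using x unfolding seq_space_def periodic_seq_def by blast
  show "map (periodic_seq x) [0..<length x] = x" by (intro nth_equalityI) (auto simp: periodic_seq_def)
qed

lemma periodic_seq_map:
  assumes a: "(shift ^^ n) a = a" and n: "1 \<le> n"
  shows "periodic_seq (map a [0..<n]) = a"
proof
  fix i
  have "a i = ((shift ^^ i) a) 0" by (simp add: funpow_shift)
  also have "\<dots> = ((shift ^^ (i mod n)) a) 0" using funpow_shift_mod[OF a] by metis
  also have "\<dots> = a (i mod n)" by (simp add: funpow_shift)
  finally show "periodic_seq (map a [0..<n]) i = a i" using n by (simp add: periodic_seq_def)
qed

definition orbit_pairs :: "nat \<Rightarrow> ((nat \<Rightarrow> nat) set \<times> nat) set" where
  "orbit_pairs N = periodic_orbits N \<times> {1..}"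

text \<open>A word is determined by its periodic sequence a and its length, and the length is a
  multiple k of the minimal period, which is the number of points of the orbit. Each pair of an
  orbit p and a multiplicity k thus comes from exactly \<open>card p\<close> words, one for every
  starting point in p.\<close>

lemma bij_betw_words:
  "bij_betw (\<lambda>((p, k), a). map a [0..<card p * k]) (Sigma (orbit_pairs N) fst) (words N)"
proof (rule bij_betw_byWitness[where f' = "\<lambda>x. ((shift_orbit (periodic_seq x), length x div period (periodic_seq x)), periodic_seq x)"])
  show "\<forall>z\<in>Sigma (orbit_pairs N) fst. (\<lambda>x. ((shift_orbit (periodic_seq x), length x div period (periodic_seq x)), periodic_seq x)) ((\<lambda>((p, k), a). map a [0..<card p * k]) z) = z"
  proof clarsimp
    fix p k a assume pk: "(p, k) \<in> orbit_pairs N" and a: "a \<in> p"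
    hence p: "p \<in> periodic_orbits N" and k: "1 \<le> k" by (auto simp: orbit_pairs_def)
    note o = periodic_orbits_mem[OF p a]
    have "(shift ^^ (card p * k)) a = a" unfolding o(4) by (rule funpow_shift_multiple[OF period(2)[OF o(2)]])
    moreover have "1 \<le> card p * k" using k card_orbit_pos[OF p] by simp
    ultimately have "periodic_seq (map a [0..<card p * k]) = a" by (rule periodic_seq_map)
    thus "shift_orbit (periodic_seq (map a [0..<card p * k])) = p \<and>
        card p * k div period (periodic_seq (map a [0..<card p * k])) = k \<and> periodic_seq (map a [0..<card p * k]) = a"
      using o card_orbit_pos[OF p] by simp
  qed
  show "\<forall>x\<in>words N. (\<lambda>((p, k), a). map a [0..<card p * k]) ((shift_orbit (periodic_seq x), length x div period (periodic_seq x)), periodic_seq x) = x"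
  proof
    fix x assume x: "x \<in> words N"
    note s = periodic_seq_word[OF x]
    have "period (periodic_seq x) dvd length x" using funpow_shift_eq_iff[OF s(2)] periodic_seq_periodic by blast
    thus "(\<lambda>((p, k), a). map a [0..<card p * k]) ((shift_orbit (periodic_seq x), length x div period (periodic_seq x)), periodic_seq x) = x"
      using card_shift_orbit(2)[OF s(2)] s(4) by simp
  qed
  show "(\<lambda>((p, k), a). map a [0..<card p * k]) ` Sigma (orbit_pairs N) fst \<subseteq> words N"
  proof clarsimp
    fix p k a assume pk: "(p, k) \<in> orbit_pairs N" and a: "a \<in> p"
    hence p: "p \<in> periodic_orbits N" and k: "1 \<le> k" by (auto simp: orbit_pairs_def)
    have "a i \<in> {1..N}" for i using periodic_orbits_mem(1)[OF p a] by (auto simp: seq_space_def)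
    thus "map a [0..<card p * k] \<in> words N" using k card_orbit_pos[OF p] by (auto simp: words_def)
  qed
  show "(\<lambda>x. ((shift_orbit (periodic_seq x), length x div period (periodic_seq x)), periodic_seq x)) ` words N \<subseteq> Sigma (orbit_pairs N) fst"
  proof clarsimp
    fix x assume x: "x \<in> words N"
    note s = periodic_seq_word[OF x]
    have "period (periodic_seq x) dvd length x" using funpow_shift_eq_iff[OF s(2)] periodic_seq_periodic by blast
    hence "1 \<le> length x div period (periodic_seq x)"
      using s(3) period(1)[OF s(2)] by (auto simp: dvd_def)
    thus "(shift_orbit (periodic_seq x), length x div period (periodic_seq x)) \<in> orbit_pairs N \<and> periodic_seq x \<in> shift_orbit (periodic_seq x)"
      using s shift_orbit_self by (auto simp: orbit_pairs_def periodic_orbits_alt)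
  qed
qed

lemma word_weight_map:
  assumes w: "\<forall>a\<in>seq_space N. 0 < w a" and p: "p \<in> periodic_orbits N" and a: "a \<in> p" and k: "1 \<le> k"
  shows "word_weight w (map a [0..<card p * k]) = ereal (real k) * orbit_weight w p"
proof -
  note o = periodic_orbits_mem[OF p a]
  have 1: "(shift ^^ (card p * k)) a = a" unfolding o(4) by (rule funpow_shift_multiple[OF period(2)[OF o(2)]])
  have "1 \<le> card p * k" using k card_orbit_pos[OF p] by simp
  hence e: "periodic_seq (map a [0..<card p * k]) = a" by (rule periodic_seq_map[OF 1])
  have nn: "0 \<le> w ((shift ^^ i) a)" for i
  proof -
    have "(shift ^^ i) a \<in> p" using o(3) by (auto simp: shift_orbit_def)
    thus ?thesis using w periodic_orbits_mem(1)[OF p] less_imp_le by blast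
  qed
  have "orbit_weight w p = (\<Sum>i<card p. w ((shift ^^ i) a))"
    unfolding orbit_weight_def o(3)[symmetric] shift_orbit_eq[OF o(2)] card_shift_orbit(2)[OF o(2), unfolded shift_orbit_eq[OF o(2)]]
    using inj_on_funpow_shift[OF o(2)] by (simp add: sum.reindex)
  moreover have "(shift ^^ card p) a = a" unfolding o(4) by (rule period(2)[OF o(2)])
  ultimately show ?thesis unfolding word_weight_def e using sum_periodic_blocks[of "card p" a w k] nn by simp
qed

lemma orbit_weight_pos:
  assumes w: "\<forall>a\<in>seq_space N. 0 < w a" and p: "p \<in> periodic_orbits N"
  shows "0 < orbit_weight w p"
proof -
  obtain a where a: "a \<in> p" using periodic_orbits_finite(2)[OF p] by blast
  have pos: "0 < w b" if "b \<in> p" for b using w periodic_orbits_mem(1)[OF p that] by blast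
  have "0 < w a" by (rule pos[OF a])
  also have "w a \<le> orbit_weight w p"
    unfolding orbit_weight_def using periodic_orbits_finite(1)[OF p] a pos
    using sum_mono2[of p "{a}" w] by (auto intro: less_imp_le)
  finally show ?thesis .
qed

lemma word_weight_nonneg:
  assumes w: "\<forall>a\<in>seq_space N. 0 < w a" and x: "x \<in> words N"
  shows "0 \<le> word_weight w x"
proof -
  have "(shift ^^ i) (periodic_seq x) \<in> seq_space N" for i
    using periodic_seq_word(1)[OF x] by (auto simp: funpow_shift seq_space_def)
  thus ?thesis unfolding word_weight_def using w by (intro sum_nonneg) (auto intro: less_imp_le)
qed

lemma norm_log_deriv_term_le:
  assumes w: "\<forall>a\<in>seq_space N. 0 < w a" and x: "x \<in> words N" and \<sigma>: "\<sigma> \<le> Re s"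
  shows "norm (log_deriv_term w s x) \<le> norm (log_deriv_term w (of_real \<sigma>) x)"
proof -
  define v where "v = real_of_ereal (word_weight w x)"
  have v: "0 \<le> v" unfolding v_def using word_weight_nonneg[OF w x] by (simp add: real_of_ereal_pos)
  have "exp (- Re s * v) \<le> exp (- \<sigma> * v)" using v \<sigma> by (simp add: mult_right_mono)
  hence "norm (exp_weight s (word_weight w x)) \<le> norm (exp_weight (of_real \<sigma>) (word_weight w x))"
    by (simp add: exp_weight_def v_def[symmetric])
  thus ?thesis unfolding log_deriv_term_def norm_mult by (rule mult_left_mono) simp
qed

section \<open>The Dirichlet series of the flow\<close>

definition flow_pairs :: "nat \<Rightarrow> ((nat \<Rightarrow> nat) \<Rightarrow> ereal) \<Rightarrow> ((nat \<Rightarrow> nat) set \<times> nat) set" where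
  "flow_pairs N w = {i \<in> orbit_pairs N. orbit_weight w (fst i) \<noteq> \<infinity>}"

text \<open>Defined on pairs, although it depends only on the orbit, so that it can serve as the
  coefficient function of a \<open>weighted_spectrum\<close>. Orbits of infinite weight are left out
  of \<open>flow_pairs\<close>: they contribute 0 to the series and never satisfy the bound in
  \<open>psi\<close>.\<close>

definition orbit_length :: "((nat \<Rightarrow> nat) \<Rightarrow> ereal) \<Rightarrow> (nat \<Rightarrow> nat) set \<times> nat \<Rightarrow> real" where
  "orbit_length w i = real_of_ereal (orbit_weight w (fst i))"

definition pair_length :: "((nat \<Rightarrow> nat) \<Rightarrow> ereal) \<Rightarrow> (nat \<Rightarrow> nat) set \<times> nat \<Rightarrow> real" where
  "pair_length w i = real (snd i) * orbit_length w i"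

locale suspended_flow =
  fixes N :: nat and w :: "(nat \<Rightarrow> nat) \<Rightarrow> ereal" and D :: real
  assumes weight_pos: "\<forall>a\<in>seq_space N. 0 < w a" and dimension: "abscissa N w = ereal D"
begin

lemma orbit_weight_cases:
  assumes "i \<in> flow_pairs N w"
  shows "0 < orbit_length w i" "orbit_weight w (fst i) = ereal (orbit_length w i)" "orbit_length w i \<le> pair_length w i" "1 \<le> snd i"
proof -
  have p: "fst i \<in> periodic_orbits N" and k: "1 \<le> snd i" and f: "orbit_weight w (fst i) \<noteq> \<infinity>"
    using assms by (auto simp: flow_pairs_def orbit_pairs_def)
  show e: "orbit_weight w (fst i) = ereal (orbit_length w i)"
    using orbit_weight_pos[OF weight_pos p] f by (cases "orbit_weight w (fst i)") (auto simp: orbit_length_def)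
  show pos: "0 < orbit_length w i" using orbit_weight_pos[OF weight_pos p] e by simp
  show "1 \<le> snd i" by (rule k)
  thus "orbit_length w i \<le> pair_length w i" using pos by (simp add: pair_length_def)
qed

lemma pair_length_pos: "i \<in> flow_pairs N w \<Longrightarrow> 0 < pair_length w i"
  using orbit_weight_cases by fastforce

lemma word_weight_eq:
  assumes i: "i \<in> orbit_pairs N" and a: "a \<in> fst i"
  shows "i \<notin> flow_pairs N w \<Longrightarrow> word_weight w (map a [0..<card (fst i) * snd i]) = \<infinity>"
    and "i \<in> flow_pairs N w \<Longrightarrow> word_weight w (map a [0..<card (fst i) * snd i]) = ereal (pair_length w i)"
proof -
  have p: "fst i \<in> periodic_orbits N" and k: "1 \<le> snd i" using i by (auto simp: orbit_pairs_def)
  note W = word_weight_map[OF weight_pos p a k]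
  show "word_weight w (map a [0..<card (fst i) * snd i]) = \<infinity>" if "i \<notin> flow_pairs N w"
  proof -
    have "orbit_weight w (fst i) = \<infinity>" using that i by (simp add: flow_pairs_def)
    thus ?thesis using W k by simp
  qed
  show "word_weight w (map a [0..<card (fst i) * snd i]) = ereal (pair_length w i)" if "i \<in> flow_pairs N w"
    using W orbit_weight_cases(2)[OF that] by (simp add: pair_length_def)
qed

definition pair_term :: "complex \<Rightarrow> (nat \<Rightarrow> nat) set \<times> nat \<Rightarrow> complex" where
  "pair_term s i = (if i \<in> flow_pairs N w then of_real (orbit_length w i) * exp (- s * of_real (pair_length w i)) else 0)"

text \<open>The word has weight k times the orbit length and length k times the number of points of
  the orbit, so the multiplicity cancels from the coefficient.\<close>

lemma log_deriv_term_eq: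
  assumes i: "i \<in> orbit_pairs N" and a: "a \<in> fst i"
  shows "log_deriv_term w s (map a [0..<card (fst i) * snd i]) = pair_term s i / of_nat (card (fst i))"
proof (cases "i \<in> flow_pairs N w")
  case True
  have k: "1 \<le> snd i" using i by (auto simp: orbit_pairs_def)
  thus ?thesis using True word_weight_eq(2)[OF i a True]
    by (simp add: log_deriv_term_def exp_weight_def pair_term_def pair_length_def field_simps)
next
  case False
  thus ?thesis using word_weight_eq(1)[OF i a] by (simp add: log_deriv_term_def exp_weight_def pair_term_def)
qed

text \<open>For a fixed pair, the terms of its \<open>card p\<close> words are equal and each
  carries the factor \<open>1 / card p\<close>, so the inner sum is one term per pair.\<close>

lemma log_deriv_sums:
  assumes "log_deriv_term w s summable_on words N"
  shows "pair_term s summable_on orbit_pairs N" "infsum (log_deriv_term w s) (words N) = infsum (pair_term s) (orbit_pairs N)"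
proof -
  let ?g = "\<lambda>((p, k), a). map a [0..<card p * k]"
  let ?f = "\<lambda>z. log_deriv_term w s (?g z)"
  have inner: "(\<Sum>\<^sub>\<infinity>a\<in>fst i. ?f (i, a)) = pair_term s i" if i: "i \<in> orbit_pairs N" for i
  proof -
    have p: "fst i \<in> periodic_orbits N" using i by (auto simp: orbit_pairs_def)
    have "(\<Sum>\<^sub>\<infinity>a\<in>fst i. ?f (i, a)) = (\<Sum>a\<in>fst i. ?f (i, a))" using periodic_orbits_finite(1)[OF p] by simp
    also have "\<dots> = (\<Sum>a\<in>fst i. pair_term s i / of_nat (card (fst i)))"
      by (intro sum.cong refl) (use log_deriv_term_eq[OF i] in \<open>simp add: case_prod_unfold\<close>)
    also have "\<dots> = pair_term s i" using card_orbit_pos[OF p] by simp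
    finally show ?thesis .
  qed
  have sg: "?f summable_on Sigma (orbit_pairs N) fst"
    using summable_on_reindex_bij_betw[OF bij_betw_words, of "log_deriv_term w s"] assms by simp
  have "(\<lambda>i. \<Sum>\<^sub>\<infinity>a\<in>fst i. ?f (i, a)) summable_on orbit_pairs N"
    using sg by (intro summable_on_Sigma_banach) (simp add: case_prod_unfold)
  thus "pair_term s summable_on orbit_pairs N" using inner by (simp cong: summable_on_cong)
  have "infsum (log_deriv_term w s) (words N) = infsum ?f (Sigma (orbit_pairs N) fst)"
    using infsum_reindex_bij_betw[OF bij_betw_words, of "log_deriv_term w s"] by simp
  also have "\<dots> = (\<Sum>\<^sub>\<infinity>i\<in>orbit_pairs N. \<Sum>\<^sub>\<infinity>a\<in>fst i. ?f (i, a))"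
    using infsum_Sigma_banach[OF sg] by simp
  also have "\<dots> = infsum (pair_term s) (orbit_pairs N)" using inner by (intro infsum_cong)
  finally show "infsum (log_deriv_term w s) (words N) = infsum (pair_term s) (orbit_pairs N)" .
qed

lemma log_deriv_abs_summable:
  assumes "D < Re s"
  shows "(\<lambda>x. norm (log_deriv_term w s x)) summable_on words N"
proof -
  have "Inf (ereal ` {\<sigma>. series_converges N w \<sigma>}) < ereal (Re s)"
    using dimension assms by (simp add: abscissa_def)
  then obtain \<sigma> where \<sigma>: "series_converges N w \<sigma>" "\<sigma> < Re s" by (auto simp: Inf_less_iff)
  have "(\<lambda>x. norm (log_deriv_term w (of_real \<sigma>) x)) summable_on words N"
    using \<sigma>(1) unfolding series_converges_def by (simp add: summable_on_iff_abs_summable_on_complex)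
  thus ?thesis
    by (rule Infinite_Sum.abs_summable_on_comparison_test[where g = "log_deriv_term w (of_real \<sigma>)"])
       (use norm_log_deriv_term_le[OF weight_pos] \<sigma>(2) in auto)
qed

lemma log_deriv_summable: "D < Re s \<Longrightarrow> log_deriv_term w s summable_on words N"
  using log_deriv_abs_summable by (simp add: summable_on_iff_abs_summable_on_complex)

lemma pair_summable:
  assumes \<sigma>: "D < \<sigma>"
  shows "(\<lambda>i. orbit_length w i * exp (- \<sigma> * pair_length w i)) summable_on flow_pairs N w"
proof -
  have "pair_term (of_real \<sigma>) summable_on orbit_pairs N"
    using log_deriv_sums(1)[OF log_deriv_summable[of "of_real \<sigma>"]] \<sigma> by simp
  hence "(\<lambda>i. norm (pair_term (of_real \<sigma>) i)) summable_on orbit_pairs N"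
    by (simp add: summable_on_iff_abs_summable_on_complex)
  also have "?this \<longleftrightarrow> ?thesis"
  proof (rule summable_on_cong_neutral)
    fix i assume "i \<in> orbit_pairs N \<inter> flow_pairs N w"
    thus "norm (pair_term (of_real \<sigma>) i) = orbit_length w i * exp (- \<sigma> * pair_length w i)"
      using orbit_weight_cases(1)[of i] by (simp add: pair_term_def norm_mult)
  qed (auto simp: pair_term_def flow_pairs_def)
  finally show ?thesis .
qed

text \<open>Discreteness is extracted from convergence alone. A short orbit of length r could
  contribute very little by a single term, so its multiples are counted: there are at least
  \<open>y / r\<close> multiplicities with total length at most \<open>2 * y\<close>, and together
  they contribute at least \<open>c\<close>. The sum being finite, only finitely many orbits have
  length at most y.\<close>

lemma pair_finite: "finite {i \<in> flow_pairs N w. pair_length w i \<le> y}"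
proof -
  \<comment> \<open>Besides convergence, positivity of \<sigma> is wanted, so that a bound on the
    length bounds the exponential from below.\<close>
  define \<sigma> where "\<sigma> = max D 0 + 1"
  have \<sigma>: "D < \<sigma>" "0 < \<sigma>" by (auto simp: \<sigma>_def)
  let ?t = "\<lambda>i. orbit_length w i * exp (- \<sigma> * pair_length w i)"
  define S where "S = infsum ?t (flow_pairs N w)"
  define P where "P = {p. (p, 1) \<in> flow_pairs N w \<and> orbit_length w (p, 1) \<le> y}"
  have len: "orbit_length w (p, k) = orbit_length w (p, 1)" for p k by (simp add: orbit_length_def)
  have "finite P"
  proof (cases "0 < y")
    case True
    define c where "c = y * exp (- (2 * \<sigma> * y))"
    have c: "0 < c" using True by (simp add: c_def)
    have card_le: "real (card Q) * c \<le> S" if Q: "finite Q" "Q \<subseteq> P" for Q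
    proof -
      define K where "K p = {1..nat \<lceil>y / orbit_length w (p, 1)\<rceil>}" for p
      have sub: "Sigma Q K \<subseteq> flow_pairs N w" using Q by (auto simp: P_def K_def flow_pairs_def orbit_pairs_def)
      have "c \<le> (\<Sum>k\<in>K p. ?t (p, k))" if "p \<in> Q" for p
      proof -
        define r where "r = orbit_length w (p, 1)"
        have r: "0 < r" "r \<le> y" using that Q orbit_weight_cases(1)[of "(p, 1)"] by (auto simp: P_def r_def)
        have "r * exp (- (2 * \<sigma> * y)) \<le> ?t (p, k)" if k: "k \<in> K p" for k
        proof -
          have "real k \<le> real (nat \<lceil>y / r\<rceil>)" using k by (simp add: K_def r_def)
          also have "\<dots> \<le> y / r + 1" using r True by (simp add: real_nat_ceiling_ge nat_le_real_less)
          finally have "real k * r \<le> (y / r + 1) * r" using r by (intro mult_right_mono) auto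
          also have "\<dots> = y + r" using r by (simp add: field_simps)
          also have "\<dots> \<le> 2 * y" using r by simp
          finally have "\<sigma> * (real k * r) \<le> \<sigma> * (2 * y)" using \<sigma> by (intro mult_left_mono) auto
          hence "exp (- (2 * \<sigma> * y)) \<le> exp (- \<sigma> * (real k * r))" by (simp add: mult_ac)
          hence "r * exp (- (2 * \<sigma> * y)) \<le> r * exp (- \<sigma> * (real k * r))" using r by (intro mult_left_mono) auto
          moreover have "orbit_length w (p, k) = r" unfolding r_def by (rule len)
          ultimately show ?thesis by (simp add: pair_length_def)
        qed
        hence "(\<Sum>k\<in>K p. r * exp (- (2 * \<sigma> * y))) \<le> (\<Sum>k\<in>K p. ?t (p, k))" by (rule sum_mono)
        moreover have "c \<le> (\<Sum>k\<in>K p. r * exp (- (2 * \<sigma> * y)))"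
        proof -
          have "y / r \<le> real (card (K p))" by (simp add: K_def r_def real_nat_ceiling_ge)
          hence "y / r * (r * exp (- (2 * \<sigma> * y))) \<le> real (card (K p)) * (r * exp (- (2 * \<sigma> * y)))"
            using r by (intro mult_right_mono) auto
          thus ?thesis using r by (simp add: c_def)
        qed
        ultimately show ?thesis by linarith
      qed
      hence "real (card Q) * c \<le> (\<Sum>p\<in>Q. \<Sum>k\<in>K p. ?t (p, k))"
        using sum_mono[of Q "\<lambda>_. c" "\<lambda>p. \<Sum>k\<in>K p. ?t (p, k)"] by simp
      also have "\<dots> = sum ?t (Sigma Q K)" using Q by (subst sum.Sigma) (auto simp: K_def)
      also have "\<dots> \<le> S"
        unfolding S_def using sub Q orbit_weight_cases(1)
        by (intro finite_sum_le_infsum pair_summable \<sigma>) (auto simp: K_def less_imp_le)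
      finally show ?thesis .
    qed
    show ?thesis
    proof (rule ccontr)
      assume "infinite P"
      then obtain Q where Q: "Q \<subseteq> P" "finite Q" "card Q = nat \<lceil>S / c\<rceil> + 1" by (metis infinite_arbitrarily_large)
      have "S / c < real (card Q)" using Q(3) by linarith
      hence "S < real (card Q) * c" using c by (simp add: pos_divide_less_eq)
      thus False using card_le[OF Q(2,1)] by simp
    qed
  next
    case False
    have "P = {}" using False orbit_weight_cases(1) by (fastforce simp: P_def)
    thus ?thesis by simp
  qed
  \<comment> \<open>Each of the finitely many orbits in \<open>P\<close> has positive length and so
    admits only finitely many multiplicities.\<close>
  moreover have "{i \<in> flow_pairs N w. pair_length w i \<le> y} \<subseteq> Sigma P (\<lambda>p. {..nat \<lceil>y / orbit_length w (p, 1)\<rceil>})"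
  proof
    fix i assume "i \<in> {i \<in> flow_pairs N w. pair_length w i \<le> y}"
    hence i: "i \<in> flow_pairs N w" "pair_length w i \<le> y" by auto
    obtain p k where pk: "i = (p, k)" by (cases i)
    note o = orbit_weight_cases[OF i(1)]
    have "p \<in> P" using i o(3) len[of p k] by (auto simp: pk P_def flow_pairs_def orbit_pairs_def)
    moreover have "real k \<le> y / orbit_length w (p, 1)"
      using i(2) o(1) len[of p k] by (simp add: pk pair_length_def pos_le_divide_eq)
    hence "k \<le> nat \<lceil>y / orbit_length w (p, 1)\<rceil>" by linarith
    ultimately show "i \<in> Sigma P (\<lambda>p. {..nat \<lceil>y / orbit_length w (p, 1)\<rceil>})" by (simp add: pk)
  qed
  ultimately show ?thesis by (meson finite_SigmaI finite_atMost finite_subset)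
qed

sublocale weighted_spectrum "flow_pairs N w" "orbit_length w" "pair_length w" D
  using orbit_weight_cases(1) pair_length_pos pair_summable pair_finite
  by unfold_locales (auto intro: less_imp_le)

lemma psi_eq_count: "psi N w x = count x"
proof -
  have "{(p, k). p \<in> periodic_orbits N \<and> 1 \<le> k \<and> ereal (real k) * orbit_weight w p \<le> ereal (ln x)}
      = {i \<in> flow_pairs N w. pair_length w i \<le> ln x}" (is "?L = ?R")
  proof (rule set_eqI)
    fix i :: "(nat \<Rightarrow> nat) set \<times> nat"
    show "i \<in> ?L \<longleftrightarrow> i \<in> ?R"
    proof (cases "i \<in> flow_pairs N w")
      case True
      thus ?thesis using orbit_weight_cases(2)[OF True]
        by (auto simp: flow_pairs_def orbit_pairs_def pair_length_def case_prod_unfold)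
    next
      case False
      thus ?thesis by (auto simp: flow_pairs_def orbit_pairs_def case_prod_unfold mem_Times_iff)
    qed
  qed
  thus ?thesis unfolding psi_def count_def by (auto simp: orbit_length_def case_prod_unfold intro!: sum.cong)
qed

lemma dirichlet_eq_log_deriv:
  assumes "D < Re s"
  shows "infsum (log_deriv_term w s) (words N) = dirichlet s"
proof -
  have "infsum (pair_term s) (orbit_pairs N) = dirichlet s"
    unfolding dirichlet_def by (rule infsum_cong_neutral) (auto simp: pair_term_def flow_pairs_def)
  thus ?thesis using log_deriv_sums(2)[OF log_deriv_summable[OF assms]] by simp
qed

text \<open>Only finitely many lengths are at most 1; the element 1 is inserted to have a minimum
  even when there are none. A positive lower bound makes it possible to divide by the weights of
  words.\<close>

lemma pair_length_lower_bound:
  obtains \<delta> where "0 < \<delta>" "\<And>i. i \<in> flow_pairs N w \<Longrightarrow> \<delta> \<le> pair_length w i"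
proof -
  define A where "A = insert 1 (pair_length w ` {i \<in> flow_pairs N w. pair_length w i \<le> 1})"
  have A: "finite A" "A \<noteq> {}" using pair_finite by (auto simp: A_def)
  have "0 < Min A" using A pair_length_pos by (subst Min_gr_iff) (auto simp: A_def)
  moreover have "Min A \<le> pair_length w i" if "i \<in> flow_pairs N w" for i
  proof (cases "pair_length w i \<le> 1")
    case True
    thus ?thesis using A that by (intro Min_le) (auto simp: A_def)
  next
    case False
    moreover have "Min A \<le> 1" using A by (intro Min_le) (auto simp: A_def)
    ultimately show ?thesis by linarith
  qed
  ultimately show ?thesis by (rule that)
qed

text \<open>The abscissa speaks about the differentiated series only. Since the weights are at least
  \<delta>, the terms of the series in the exponent of \<open>dyn_zeta\<close> are at most
  \<open>1 / \<delta>\<close> times the differentiated ones, so it converges too and may be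
  differentiated termwise.\<close>

lemma log_deriv_dyn_zeta:
  assumes s: "D < Re s"
  shows "- deriv (dyn_zeta N w) s / dyn_zeta N w s = dirichlet s"
proof -
  define X where "X = {x \<in> words N. word_weight w x \<noteq> \<infinity>}"
  define v where "v x = real_of_ereal (word_weight w x)" for x
  obtain \<delta> where \<delta>: "0 < \<delta>" "\<And>i. i \<in> flow_pairs N w \<Longrightarrow> \<delta> \<le> pair_length w i" using pair_length_lower_bound by blast
  have v: "\<delta> \<le> v x" if "x \<in> X" for x
  proof -
    have "x \<in> (\<lambda>((p, k), a). map a [0..<card p * k]) ` Sigma (orbit_pairs N) fst"
      using bij_betw_words[of N] that by (auto simp: bij_betw_def X_def)
    then obtain i a where ia: "i \<in> orbit_pairs N" "a \<in> fst i" "x = map a [0..<card (fst i) * snd i]" by auto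
    have "i \<in> flow_pairs N w" using word_weight_eq(1)[OF ia(1,2)] that ia(3) by (auto simp: X_def)
    thus ?thesis using \<delta>(2) word_weight_eq(2)[OF ia(1,2)] ia(3) by (simp add: v_def)
  qed
  have sumX: "(\<lambda>x. 1 / real (length x) * exp (- \<sigma> * v x)) summable_on X" if \<sigma>: "D < \<sigma>" for \<sigma>
  proof -
    have "(\<lambda>x. norm (log_deriv_term w (of_real \<sigma>) x)) summable_on X"
      by (rule summable_on_subset_banach[OF log_deriv_abs_summable]) (use \<sigma> in \<open>auto simp: X_def\<close>)
    hence "(\<lambda>x. (1 / \<delta>) * norm (log_deriv_term w (of_real \<sigma>) x)) summable_on X" by (rule summable_on_cmult_right)
    thus ?thesis
    proof (rule summable_on_comparison_test)
      fix x assume x: "x \<in> X"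
      have "norm (log_deriv_term w (of_real \<sigma>) x) = v x * (1 / real (length x) * exp (- \<sigma> * v x))"
        using x v[OF x] \<delta>(1) by (simp add: log_deriv_term_def exp_weight_def X_def v_def[symmetric] norm_mult norm_divide)
      hence "(1 / \<delta>) * norm (log_deriv_term w (of_real \<sigma>) x) = (v x / \<delta>) * (1 / real (length x) * exp (- \<sigma> * v x))" by simp
      moreover have "1 * (1 / real (length x) * exp (- \<sigma> * v x)) \<le> (v x / \<delta>) * (1 / real (length x) * exp (- \<sigma> * v x))"
        using v[OF x] \<delta>(1) by (intro mult_right_mono) (auto simp: pos_le_divide_eq)
      ultimately show "1 / real (length x) * exp (- \<sigma> * v x) \<le> (1 / \<delta>) * norm (log_deriv_term w (of_real \<sigma>) x)" by simp
    qed simp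
  qed
  let ?L = "\<lambda>s. \<Sum>\<^sub>\<infinity>x\<in>X. of_real (1 / real (length x)) * exp (- s * of_real (v x))"
  have zeta: "dyn_zeta N w s = exp (?L s)" for s
  proof -
    have "(\<Sum>\<^sub>\<infinity>x\<in>words N. 1 / of_nat (length x) * exp_weight s (word_weight w x)) = ?L s"
      by (rule infsum_cong_neutral) (auto simp: X_def exp_weight_def v_def)
    thus ?thesis by (simp add: dyn_zeta_def)
  qed
  have "(?L has_field_derivative - (\<Sum>\<^sub>\<infinity>x\<in>X. of_real (1 / real (length x) * v x) * exp (- s * of_real (v x)))) (at s)"
    by (rule has_field_derivative_infsum_exp[OF _ _ sumX s]) (use v \<delta>(1) in \<open>auto intro: order_trans less_imp_le\<close>)
  also have "(\<Sum>\<^sub>\<infinity>x\<in>X. of_real (1 / real (length x) * v x) * exp (- s * of_real (v x))) = infsum (log_deriv_term w s) (words N)"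
    by (rule infsum_cong_neutral) (auto simp: X_def log_deriv_term_def exp_weight_def v_def)
  also have "\<dots> = dirichlet s" by (rule dirichlet_eq_log_deriv[OF s])
  finally have "(?L has_field_derivative - dirichlet s) (at s)" .
  hence "((\<lambda>s. exp (?L s)) has_field_derivative exp (?L s) * (- dirichlet s)) (at s)"
    by (rule DERIV_chain2[OF DERIV_exp])
  hence "deriv (dyn_zeta N w) s = exp (?L s) * (- dirichlet s)"
    unfolding zeta[abs_def] by (rule DERIV_imp_deriv)
  thus ?thesis by (simp add: zeta)
qed

end

subsection \<open>The explicit formula\<close>

text \<open>\<open>L\<close> and \<open>U\<close> are fixed witnesses of the Lipschitz condition and
  of the neighbourhood in the meromorphic extension, so that all later facts refer to the same
  ones.\<close>

locale screened_flow = suspended_flow N w D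
  for N :: nat and w :: "(nat \<Rightarrow> nat) \<Rightarrow> ereal" and D :: real +
  fixes S :: "real \<Rightarrow> real" and Z :: "complex \<Rightarrow> complex" and T :: "int \<Rightarrow> real" and C \<kappa> L :: real
    and U :: "complex set"
  assumes D_nonneg: "0 \<le> D"
    and screen_bounded: "bounded (range S)" and screen_lipschitz: "L-lipschitz_on UNIV S"
    and screen_less: "S t < D"
    and U: "open U" "window S \<subseteq> U" and Z_meromorphic: "Z nicely_meromorphic_on U"
    and Z_extends: "D < Re s \<Longrightarrow> Z s = - deriv (dyn_zeta N w) s / dyn_zeta N w s"
    and simple_poles: "\<omega> \<in> complex_dims Z S \<Longrightarrow> zorder Z \<omega> = -1"
    and screen_avoids: "screen S t \<noteq> 0" "\<not> is_pole Z (screen S t)"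
    and ord_D: "ord_zeta Z (of_real D) = -1"
    and heights: "admissible_heights T"
    and C_pos: "0 < C"
    and H1: "growth_H1 Z S T C \<kappa>"
    and H2: "growth_H2 Z S C \<kappa>"
begin

lemma Z_eq_dirichlet: "D < Re s \<Longrightarrow> Z s = dirichlet s"
  using Z_extends log_deriv_dyn_zeta by simp

lemma Z_analytic: "s \<in> U \<Longrightarrow> \<not> is_pole Z s \<Longrightarrow> Z analytic_on {s}"
  using Z_meromorphic by (rule nicely_meromorphic_on_imp_analytic_at)

lemma half_plane_subset_window: "D \<le> Re s \<Longrightarrow> s \<in> window S"
  using screen_less[of "Im s"] by (simp add: window_def)

lemma no_pole_right: "D < Re s \<Longrightarrow> \<not> is_pole Z s"
proof -
  assume s: "D < Re s"
  have o: "open {s. D < Re s}" by (simp add: open_halfspace_Re_gt)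
  have "\<forall>\<^sub>F z in at s. dirichlet z = Z z"
    using eventually_at_in_open'[OF o, of s] s by (auto elim!: eventually_mono simp: Z_eq_dirichlet)
  moreover have "dirichlet analytic_on {s}"
    using dirichlet_holomorphic o s analytic_at by blast
  ultimately show ?thesis using analytic_at_imp_no_pole is_pole_cong by metis
qed

lemma isolated_singularity: "s \<in> U \<Longrightarrow> isolated_singularity_at Z s"
  using Z_meromorphic meromorphic_on_isolated_singularity meromorphic_on_subset
  unfolding nicely_meromorphic_on_def by blast

lemma poles_sparse: "{s. is_pole Z s} sparse_in U"
  using isolated_singularity not_islimpt_poles U(1) by (subst sparse_in_open) auto

lemma Z_holomorphic_punctured:
  assumes "\<omega> \<in> U"
  obtains r where "0 < r" "ball \<omega> r \<subseteq> U" "Z holomorphic_on ball \<omega> r - {\<omega>}"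
proof -
  obtain r where r: "0 < r" "Z analytic_on ball \<omega> r - {\<omega>}"
    using isolated_singularity[OF assms] unfolding isolated_singularity_at_def by blast
  obtain r' where r': "0 < r'" "ball \<omega> r' \<subseteq> U" using U(1) assms openE by blast
  show ?thesis
    by (rule that[of "min r r'"]) (use r r' in \<open>auto intro!: analytic_imp_holomorphic intro: analytic_on_subset\<close>)
qed

lemma ord_zeta_eq:
  assumes "\<omega> \<in> U"
  shows "ord_zeta Z \<omega> = - residue Z \<omega>"
proof -
  obtain r where "0 < r" "ball \<omega> r \<subseteq> U" "Z holomorphic_on ball \<omega> r - {\<omega>}" using Z_holomorphic_punctured[OF assms] by blast
  thus ?thesis unfolding ord_zeta_def by (intro residue_neg[of "ball \<omega> r"]) auto
qed

lemma D_in_window: "of_real D \<in> window S"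
  by (rule half_plane_subset_window) simp

lemma residue_D: "residue Z (of_real D) = 1"
  using ord_D ord_zeta_eq D_in_window U(2) by (metis add.inverse_inverse subsetD)

lemma D_complex_dim: "of_real D \<in> complex_dims Z S"
proof -
  have "is_pole Z (of_real D)"
  proof (rule ccontr)
    assume "\<not> ?thesis"
    hence "Z analytic_on {of_real D}" using Z_analytic D_in_window U(2) by blast
    then obtain s where "open s" "of_real D \<in> s" "Z holomorphic_on s" by (auto simp: analytic_at)
    hence "residue Z (of_real D) = 0" by (simp add: residue_holo)
    thus False using residue_D by simp
  qed
  thus ?thesis using D_in_window by (simp add: complex_dims_def)
qed

lemma Re_complex_dim_le: "\<omega> \<in> complex_dims Z S \<Longrightarrow> Re \<omega> \<le> D"
  using no_pole_right by (auto simp: complex_dims_def not_le[symmetric])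

text \<open>Poles and regular points are treated alike through \<open>G\<close>, the extension of
  \<open>Z s * (s - \<omega>)\<close>. At a regular point \<open>G\<close> vanishes and its
  derivative is the value of \<open>Z\<close>; this is what evaluates the residue at 0 when 0 is not
  a complex dimension.\<close>

lemma local_form:
  assumes \<omega>: "\<omega> \<in> window S"
  obtains r G where "0 < r" "ball \<omega> r \<subseteq> U" "G holomorphic_on ball \<omega> r"
    "\<And>s. s \<in> ball \<omega> r - {\<omega>} \<Longrightarrow> Z s = G s / (s - \<omega>)" "G \<omega> = residue Z \<omega>"
    "\<omega> \<notin> complex_dims Z S \<Longrightarrow> deriv G \<omega> = Z \<omega>" "\<omega> \<notin> complex_dims Z S \<Longrightarrow> G \<omega> = 0"
proof -
  obtain R where R: "0 < R" "ball \<omega> R \<subseteq> U" "Z holomorphic_on ball \<omega> R - {\<omega>}"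
    using Z_holomorphic_punctured \<omega> U(2) by blast
  show ?thesis
  proof (cases "is_pole Z \<omega>")
    case True
    hence d: "\<omega> \<in> complex_dims Z S" using \<omega> by (simp add: complex_dims_def)
    let ?G = "zor_poly Z \<omega>"
    obtain r where r: "0 < r" "cball \<omega> r \<subseteq> ball \<omega> R" "?G holomorphic_on cball \<omega> r"
        "\<And>s. s \<in> cball \<omega> r - {\<omega>} \<Longrightarrow> Z s = ?G s / (s - \<omega>)"
      using zorder_exist_pole[OF R(3) open_ball _ True] R(1) simple_poles[OF d] by auto
    have "ball \<omega> r \<subseteq> U" using r(2) R(2) ball_subset_cball by blast
    moreover have h: "?G holomorphic_on ball \<omega> r" using r(3) by (rule holomorphic_on_subset) auto
    moreover have "residue Z \<omega> = ?G \<omega>"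
      using isolated_singularity \<omega> U(2) True simple_poles[OF d] by (intro residue_simple_pole) auto
    ultimately show ?thesis
      by (intro that[of r ?G]) (use r(1,4) d in auto)
  next
    case False
    have d: "\<omega> \<notin> complex_dims Z S" using False by (simp add: complex_dims_def)
    have "Z analytic_on {\<omega>}" using Z_analytic False \<omega> U(2) by blast
    hence fd: "Z field_differentiable (at \<omega>)" by (rule analytic_on_imp_differentiable_at) simp
    have Zh: "Z holomorphic_on ball \<omega> R"
      unfolding holomorphic_on_def
    proof
      fix s assume s: "s \<in> ball \<omega> R"
      show "Z field_differentiable at s within ball \<omega> R"
      proof (cases "s = \<omega>")
        case True thus ?thesis using fd by (simp add: field_differentiable_at_within)
      next
        case False
        hence "s \<in> ball \<omega> R - {\<omega>}" using s by simp
        hence "Z field_differentiable at s"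
          using R(3) holomorphic_on_imp_differentiable_at[of Z "ball \<omega> R - {\<omega>}" s] by (simp add: open_delete)
        thus ?thesis by (simp add: field_differentiable_at_within)
      qed
    qed
    let ?G = "\<lambda>s. Z s * (s - \<omega>)"
    have "(Z has_field_derivative deriv Z \<omega>) (at \<omega>)" using fd by (simp add: field_differentiable_derivI)
    hence "(?G has_field_derivative Z \<omega>) (at \<omega>)" by (auto intro!: derivative_eq_intros)
    hence dG: "deriv ?G \<omega> = Z \<omega>" by (rule DERIV_imp_deriv)
    have "residue Z \<omega> = 0" using residue_holo[OF open_ball _ Zh] R(1) by simp
    thus ?thesis
      by (intro that[of R ?G]) (use R Zh d dG in \<open>auto intro!: holomorphic_intros\<close>)
  qed
qed

text \<open>Away from 0 the factor \<open>h s / s\<close> is holomorphic, so the simple polar part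
  of \<open>Z\<close> alone decides. The numerator receives an extra factor
  \<open>s - \<omega>\<close> to reach the quadratic shape used for every singular point.\<close>

lemma residue_form:
  assumes \<omega>: "\<omega> \<in> window S" "\<omega> \<noteq> 0" and h: "h holomorphic_on UNIV"
  shows "residue (\<lambda>s. Z s * h s / s) \<omega> = residue Z \<omega> * (h \<omega> / \<omega>)"
    and "\<exists>F. F analytic_on {\<omega>} \<and> (\<forall>\<^sub>F s in at \<omega>. Z s * h s / s = F s / (s - \<omega>)^2)"
proof -
  obtain r G where G: "0 < r" "G holomorphic_on ball \<omega> r" "\<And>s. s \<in> ball \<omega> r - {\<omega>} \<Longrightarrow> Z s = G s / (s - \<omega>)" "G \<omega> = residue Z \<omega>"
    using local_form[OF \<omega>(1)] by metis
  define B where "B = ball \<omega> (min r (norm \<omega>))"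
  have B: "open B" "\<omega> \<in> B" "0 \<notin> B" "B \<subseteq> ball \<omega> r" using G(1) \<omega>(2) by (auto simp: B_def dist_norm)
  have hG: "(\<lambda>s. G s * (h s / s)) holomorphic_on B"
    using B G(2) h by (intro holomorphic_intros) (auto intro: holomorphic_on_subset)
  have ev: "\<forall>\<^sub>F s in at \<omega>. s \<in> B - {\<omega>}" using eventually_at_in_open[OF B(1,2)] .
  have "residue (\<lambda>s. Z s * h s / s) \<omega> = residue (\<lambda>s. G s * (h s / s) / (s - \<omega>)) \<omega>"
    by (rule residue_cong) (use ev B(4) in \<open>auto elim!: eventually_mono simp: G(3)\<close>)
  also have "\<dots> = G \<omega> * (h \<omega> / \<omega>)" using residue_simple[OF B(1,2) hG] .
  finally show "residue (\<lambda>s. Z s * h s / s) \<omega> = residue Z \<omega> * (h \<omega> / \<omega>)" using G(4) by simp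
  have "(\<lambda>s. G s * (h s / s) * (s - \<omega>)) analytic_on {\<omega>}"
    unfolding analytic_at by (intro exI[of _ B] conjI B holomorphic_on_mult[OF hG] holomorphic_intros)
  moreover have "\<forall>\<^sub>F s in at \<omega>. Z s * h s / s = G s * (h s / s) * (s - \<omega>) / (s - \<omega>)^2"
    using ev by (rule eventually_mono) (use B(4) in \<open>auto simp: G(3) power2_eq_square\<close>)
  ultimately show "\<exists>F. F analytic_on {\<omega>} \<and> (\<forall>\<^sub>F s in at \<omega>. Z s * h s / s = F s / (s - \<omega>)^2)" by blast
qed

text \<open>Near 0 the function is \<open>G s * h s / s^2\<close>, whose residue is the derivative
  of \<open>G * h\<close> at 0. The constants \<open>p\<close> and \<open>q\<close> are the
  derivative and the value of \<open>G\<close> at 0. They do not depend on h, so the same pair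
  serves for the powers of x and for the Mellin transform.\<close>

lemma residue_form_0:
  assumes "0 \<in> window S"
  obtains p q where "\<And>h. h holomorphic_on UNIV \<Longrightarrow> residue (\<lambda>s. Z s * h s / s) 0 = p * h 0 + q * deriv h 0"
    "0 \<notin> complex_dims Z S \<Longrightarrow> p = Z 0 \<and> q = 0"
    "\<And>h. h holomorphic_on UNIV \<Longrightarrow> \<exists>F. F analytic_on {0} \<and> (\<forall>\<^sub>F s in at 0. Z s * h s / s = F s / (s - 0)^2)"
proof -
  obtain r G where G: "0 < r" "G holomorphic_on ball 0 r" "\<And>s. s \<in> ball 0 r - {0} \<Longrightarrow> Z s = G s / (s - 0)"
      "0 \<notin> complex_dims Z S \<Longrightarrow> deriv G 0 = Z 0" "0 \<notin> complex_dims Z S \<Longrightarrow> G 0 = 0"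
    using local_form[OF assms] by metis
  have ev: "\<forall>\<^sub>F s in at 0. s \<in> ball 0 r - {0}" using eventually_at_in_open[OF open_ball, of 0 0 r] G(1) by simp
  have e: "\<forall>\<^sub>F s in at 0. Z s * h s / s = G s * h s / (s - 0)^2" for h :: "complex \<Rightarrow> complex"
    using ev by (rule eventually_mono) (auto simp: G(3) power2_eq_square)
  have hG: "(\<lambda>s. G s * h s) holomorphic_on ball 0 r" if "h holomorphic_on UNIV" for h
    using that G(2) by (intro holomorphic_intros) (auto intro: holomorphic_on_subset)
  show ?thesis
  proof (rule that[of "deriv G 0" "G 0"])
    fix h assume h: "h holomorphic_on (UNIV :: complex set)"
    have "residue (\<lambda>s. Z s * h s / s) 0 = residue (\<lambda>s. G s * h s / (s - 0) ^ Suc 1) 0"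
      by (rule residue_cong) (use e[of h] in \<open>simp_all add: numeral_2_eq_2\<close>)
    also have "\<dots> = deriv (\<lambda>s. G s * h s) 0"
      using residue_holomorphic_over_power[OF open_ball _ hG[OF h], of 0 1] G(1) by simp
    also have "\<dots> = deriv G 0 * h 0 + G 0 * deriv h 0"
    proof -
      have "(G has_field_derivative deriv G 0) (at 0)" "(h has_field_derivative deriv h 0) (at 0)"
        using holomorphic_derivI[OF G(2) open_ball, of 0] holomorphic_derivI[OF h open_UNIV, of 0] G(1) by auto
      hence "((\<lambda>s. G s * h s) has_field_derivative deriv G 0 * h 0 + G 0 * deriv h 0) (at 0)"
        by (auto intro!: derivative_eq_intros)
      thus ?thesis by (rule DERIV_imp_deriv)
    qed
    finally show "residue (\<lambda>s. Z s * h s / s) 0 = deriv G 0 * h 0 + G 0 * deriv h 0" .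
    have "(\<lambda>s. G s * h s) analytic_on {0}" using hG[OF h] G(1) analytic_at[of "\<lambda>s. G s * h s" 0] centre_in_ball open_ball by blast
    thus "\<exists>F. F analytic_on {0} \<and> (\<forall>\<^sub>F s in at 0. Z s * h s / s = F s / (s - 0)^2)" using e[of h] by blast
  qed (use G in auto)
qed

text \<open>The point 0 is always included on account of the division by s in
  \<open>R_integrand\<close>.\<close>

definition singular_points :: "complex set" where
  "singular_points = insert 0 {s. is_pole Z s}"

lemma singular_points_sparse: "singular_points sparse_in U"
proof -
  have "{0} \<union> {s. is_pole Z s} sparse_in U" by (intro sparse_in_union' poles_sparse) simp
  thus ?thesis by (simp add: singular_points_def)
qed

lemma R_integrand_holomorphic:
  assumes "test_function \<phi>"
  shows "R_integrand Z \<phi> holomorphic_on U - singular_points"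
proof -
  have "Z holomorphic_on U - singular_points"
  proof (rule analytic_imp_holomorphic, rule analytic_on_analytic_at[THEN iffD2], rule ballI)
    fix s assume "s \<in> U - singular_points"
    thus "Z analytic_on {s}" by (intro Z_analytic) (auto simp: singular_points_def)
  qed
  moreover have "(\<lambda>s. mellin \<phi> (s + 1)) holomorphic_on U - singular_points"
    by (rule mellin_shift_holomorphic[OF assms])
  ultimately show ?thesis
    unfolding R_integrand_def by (intro holomorphic_intros) (auto simp: singular_points_def)
qed

lemma screen_not_singular: "screen S t \<in> U - singular_points"
  using screen_avoids U(2) by (auto simp: singular_points_def window_def screen_def)

lemma screen_continuous: "continuous_on A S"
  using lipschitz_on_continuous_on[OF screen_lipschitz] by (rule continuous_on_subset) simp

lemma R_integrand_screen_continuous: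
  "test_function \<phi> \<Longrightarrow> continuous_on A (\<lambda>t. R_integrand Z \<phi> (screen S t))"
  by (intro continuous_on_compose2[OF holomorphic_on_imp_continuous_on[OF R_integrand_holomorphic]]
      continuous_on_screen screen_continuous) (use screen_not_singular in auto)

lemma screen_bound: obtains B where "\<And>t. \<bar>S t\<bar> \<le> B"
  using screen_bounded by (metis bounded_iff rangeI real_norm_def)

text \<open>Rounds the growth exponent up to a natural number, the form in which
  \<open>mellin_decay\<close> supplies the compensating decay.\<close>

lemma powr_kappa_le: "1 \<le> y \<Longrightarrow> y powr \<kappa> \<le> y ^ nat \<lceil>\<kappa>\<rceil>" for y :: real
proof -
  assume y: "1 \<le> y"
  have "\<kappa> \<le> real (nat \<lceil>\<kappa>\<rceil>)" by linarith
  hence "y powr \<kappa> \<le> y powr real (nat \<lceil>\<kappa>\<rceil>)" using y by (intro powr_mono) auto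
  thus ?thesis using y by (simp add: powr_realpow)
qed

text \<open>For large t the growth of \<open>Z\<close> costs the power \<open>?k\<close>. The Mellin
  transform pays for that and one power more, and \<open>1 / s\<close> gives a second one. For |t|
  below 1, where (H2) is silent, continuity on a compact interval takes over.\<close>

lemma R_integrand_screen_bound:
  assumes tf: "test_function \<phi>"
  obtains K where "0 \<le> K" "\<And>t. norm (R_integrand Z \<phi> (screen S t)) \<le> K * inverse (1 + t^2)"
proof -
  let ?k = "nat \<lceil>\<kappa>\<rceil>" and ?f = "\<lambda>t. R_integrand Z \<phi> (screen S t)"
  obtain B where B: "\<And>t. \<bar>S t\<bar> \<le> B" using screen_bound by blast
  obtain M where M: "0 \<le> M" "\<And>s. - B + 1 \<le> Re s \<Longrightarrow> Re s \<le> B + 1 \<Longrightarrow> norm (mellin \<phi> s) * \<bar>Im s\<bar> ^ Suc ?k \<le> M"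
    using mellin_decay[OF tf] by blast
  have "bounded (?f ` {-1..1})"
    by (intro compact_imp_bounded compact_continuous_image R_integrand_screen_continuous tf) auto
  then obtain K0 where K0: "\<And>t. t \<in> {-1..1} \<Longrightarrow> norm (?f t) \<le> K0" unfolding bounded_iff by blast
  have K0p: "0 \<le> K0" using order_trans[OF norm_ge_zero K0[of 0]] by simp
  show ?thesis
  proof (rule that[of "2 * K0 + 2 * C * M"])
    fix t :: real
    show "norm (?f t) \<le> (2 * K0 + 2 * C * M) * inverse (1 + t^2)"
    proof (cases "1 \<le> \<bar>t\<bar>")
      case True
      let ?m = "norm (mellin \<phi> (screen S t + 1))"
      have e: "(C * y ^ ?k) * ?m / y = C * (?m * y ^ Suc ?k) / y^2" if "0 < y" for y :: real
        using that by (simp add: power2_eq_square)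
      have t1: "1 \<le> t^2" using True by (metis one_le_power power2_abs)
      have m: "?m * \<bar>t\<bar> ^ Suc ?k \<le> M" using M(2)[of "screen S t + 1"] B[of t] by (auto simp: screen_def abs_le_iff)
      have z: "norm (Z (screen S t)) \<le> C * \<bar>t\<bar> ^ ?k"
        using H2 True order_trans[OF _ mult_left_mono[OF powr_kappa_le[OF True]]] C_pos unfolding growth_H2_def by (meson less_imp_le)
      have s: "\<bar>t\<bar> \<le> norm (screen S t)" unfolding screen_def by (rule norm_Complex_ge)
      have "norm (?f t) = norm (Z (screen S t)) * ?m / norm (screen S t)" by (simp add: R_integrand_def norm_mult norm_divide)
      also have "\<dots> \<le> (C * \<bar>t\<bar> ^ ?k) * ?m / \<bar>t\<bar>"
        using z s True C_pos by (intro frac_le mult_mono) auto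
      also have "\<dots> = C * (?m * \<bar>t\<bar> ^ Suc ?k) / t^2"
        using e[of "\<bar>t\<bar>"] True by simp
      also have "\<dots> \<le> C * M / t^2" using m C_pos by (intro divide_right_mono mult_left_mono) auto
      also have "\<dots> = (2 * C * M) / (2 * t^2)" by simp
      also have "\<dots> \<le> (2 * K0 + 2 * C * M) / (1 + t^2)"
        using t1 K0p M(1) C_pos by (intro frac_le) auto
      finally show ?thesis by (simp add: divide_inverse)
    next
      case False
      have t: "- 1 \<le> t \<and> t \<le> 1" using False by linarith
      have "t^2 \<le> 1" using False by (simp add: abs_square_le_1)
      have "norm (?f t) \<le> 2 * K0 / 2" using K0[of t] t by simp
      also have "\<dots> \<le> (2 * K0 + 2 * C * M) / (1 + t^2)"
        using \<open>t^2 \<le> 1\<close> K0p M(1) C_pos by (intro frac_le) (auto simp: add_pos_nonneg)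
      finally show ?thesis by (simp add: divide_inverse)
    qed
  qed (use K0p M(1) C_pos in auto)
qed

lemma R_screen_integrable:
  assumes tf: "test_function \<phi>"
  shows "integrable lebesgue (screen_integrand S (R_integrand Z \<phi>))"
proof -
  obtain K where K: "0 \<le> K" "\<And>t. norm (R_integrand Z \<phi> (screen S t)) \<le> K * inverse (1 + t^2)"
    using R_integrand_screen_bound[OF tf] by blast
  have "integrable lebesgue (\<lambda>t. K * inverse (1 + t^2) * (L + 1))"
    using integrable_completion[of "\<lambda>t::real. inverse (1 + t^2)" lborel] integrable_inverse_1_plus_square_UNIV by auto
  thus ?thesis
  proof (rule Bochner_Integration.integrable_bound)
    have "(\<lambda>t. R_integrand Z \<phi> (screen S t)) \<in> borel_measurable lebesgue"
      using borel_measurable_continuous_onI[OF R_integrand_screen_continuous[OF tf]] by (simp add: measurable_completion)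
    thus "screen_integrand S (R_integrand Z \<phi>) \<in> borel_measurable lebesgue"
      unfolding screen_integrand_def using vector_derivative_screen_measurable[OF screen_lipschitz] by measurable
    show "AE t in lebesgue. norm (screen_integrand S (R_integrand Z \<phi>) t) \<le> norm (K * inverse (1 + t^2) * (L + 1))"
      using vector_derivative_screen_AE_bound[OF screen_lipschitz]
    proof eventually_elim
      case (elim t)
      have "norm (screen_integrand S (R_integrand Z \<phi>) t) \<le> K * inverse (1 + t^2) * (L + 1)"
        unfolding screen_integrand_def norm_mult using K elim by (intro mult_mono) auto
      thus ?case by simp
    qed
  qed
qed

text \<open>For a >= 1 every factor \<open>a powr S t\<close> is at most
  \<open>a powr (SUP t. S t)\<close>, and what remains is an integrable majorant that does not
  involve a. The bound holds only almost everywhere, since the derivative of the screen is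
  controlled only there.\<close>

lemma R_distr_dilate_bound:
  assumes tf: "test_function \<phi>"
  obtains K where "\<And>a. 1 \<le> a \<Longrightarrow> norm (R_distr Z S (dilate a \<phi>)) \<le> K * a powr (SUP t. S t)"
proof -
  obtain K where K: "0 \<le> K" "\<And>t. norm (R_integrand Z \<phi> (screen S t)) \<le> K * inverse (1 + t^2)"
    using R_integrand_screen_bound[OF tf] by blast
  have i: "integrable lebesgue (\<lambda>t::real. inverse (1 + t^2))"
    using integrable_completion[of "\<lambda>t::real. inverse (1 + t^2)" lborel] integrable_inverse_1_plus_square_UNIV by auto
  let ?J = "LINT t|lebesgue. K * inverse (1 + t^2) * (L + 1)"
  show ?thesis
  proof (rule that[of "?J / (2 * pi)"])
    fix a :: real assume a: "1 \<le> a"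
    let ?s = "a powr (SUP t. S t)"
    have bd: "AE t in lebesgue. norm (screen_integrand S (R_integrand Z (dilate a \<phi>)) t) \<le> K * inverse (1 + t^2) * (L + 1) * ?s"
      using vector_derivative_screen_AE_bound[OF screen_lipschitz]
    proof eventually_elim
      case (elim t)
      have "S t \<le> (SUP t. S t)" using screen_bounded by (intro cSUP_upper bounded_imp_bdd_above) auto
      hence p: "a powr S t \<le> ?s" using a by (intro powr_mono) auto
      have "norm (R_integrand Z (dilate a \<phi>) (screen S t)) = a powr S t * norm (R_integrand Z \<phi> (screen S t))"
        using a mellin_dilate[OF tf, of a "screen S t"] norm_of_real_powr[of a "screen S t"]
        by (simp add: R_integrand_def norm_mult norm_divide screen_def)
      also have "\<dots> \<le> ?s * (K * inverse (1 + t^2))" using p K by (intro mult_mono) auto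
      finally have "norm (R_integrand Z (dilate a \<phi>) (screen S t)) \<le> ?s * (K * inverse (1 + t^2))" .
      hence "norm (screen_integrand S (R_integrand Z (dilate a \<phi>)) t) \<le> ?s * (K * inverse (1 + t^2)) * (L + 1)"
        unfolding screen_integrand_def norm_mult using K(1) elim by (intro mult_mono) auto
      thus ?case by (simp add: mult_ac)
    qed
    have "norm (screen_integral S (R_integrand Z (dilate a \<phi>))) \<le> (LINT t|lebesgue. norm (screen_integrand S (R_integrand Z (dilate a \<phi>)) t))"
      unfolding screen_integral_def by (rule integral_norm_bound)
    also have "\<dots> \<le> (LINT t|lebesgue. K * inverse (1 + t^2) * (L + 1) * ?s)"
      using R_screen_integrable[OF test_function_dilate[OF tf]] a i bd by (intro integral_mono_AE) auto
    also have "\<dots> = ?J * ?s" by simp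
    finally show "norm (R_distr Z S (dilate a \<phi>)) \<le> ?J / (2 * pi) * ?s"
      by (simp add: R_distr_def norm_mult norm_divide divide_right_mono)
  qed
qed

lemma R_bigo: "distr_bigo (R_distr Z S) (SUP t. S t)"
  unfolding distr_bigo_def
proof (intro allI impI)
  fix \<phi> assume "test_function \<phi>"
  then obtain K where K: "\<And>a. 1 \<le> a \<Longrightarrow> norm (R_distr Z S (dilate a \<phi>)) \<le> K * a powr (SUP t. S t)"
    using R_distr_dilate_bound by blast
  show "(\<lambda>a. norm (R_distr Z S (dilate a \<phi>))) \<in> O(\<lambda>a. a powr (SUP t. S t))"
  proof (rule bigoI)
    show "\<forall>\<^sub>F a in at_top. norm (norm (R_distr Z S (dilate a \<phi>))) \<le> K * norm (a powr (SUP t. S t))"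
      using eventually_ge_at_top[of 1] by eventually_elim (use K in simp)
  qed
qed

text \<open>Condition (H1) bounds \<open>Z\<close> on the whole horizontal ray to the right of the
  screen at height \<open>T m\<close>, whereas approaching a pole along this ray from the right
  would make \<open>Z\<close> unbounded.\<close>

lemma no_pole_at_height:
  assumes "\<omega> \<in> complex_dims Z S"
  shows "Im \<omega> \<noteq> T m"
proof
  assume im: "Im \<omega> = T m"
  have w: "S (T m) \<le> Re \<omega>" and p: "is_pole Z \<omega>" using assms im by (auto simp: complex_dims_def window_def)
  let ?g = "\<lambda>\<sigma>. Complex \<sigma> (T m)"
  have gw: "?g (Re \<omega>) = \<omega>" using im by (simp add: complex_eq_iff)
  have "(?g \<longlongrightarrow> ?g (Re \<omega>)) (at_right (Re \<omega>))" by (intro tendsto_intros)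
  hence "filterlim ?g (at \<omega>) (at_right (Re \<omega>))"
    using eventually_at_right_less[of "Re \<omega>"] unfolding filterlim_at gw by (auto elim!: eventually_mono)
  hence "filterlim (\<lambda>\<sigma>. Z (?g \<sigma>)) at_infinity (at_right (Re \<omega>))"
    using p unfolding is_pole_def by (rule filterlim_compose[rotated])
  hence "\<forall>\<^sub>F \<sigma> in at_right (Re \<omega>). C * \<bar>T m\<bar> powr \<kappa> + 1 \<le> norm (Z (?g \<sigma>))"
    unfolding filterlim_at_infinity_conv_norm_at_top filterlim_at_top by blast
  moreover have "\<forall>\<^sub>F \<sigma> in at_right (Re \<omega>). Re \<omega> < \<sigma>" by (rule eventually_at_right_less)
  ultimately have "\<forall>\<^sub>F \<sigma> in at_right (Re \<omega>). False"
  proof eventually_elim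
    case (elim \<sigma>)
    have "norm (Z (?g \<sigma>)) \<le> C * \<bar>T m\<bar> powr \<kappa>" using H1 w elim(2) unfolding growth_H1_def by auto
    thus ?case using elim(1) by simp
  qed
  thus False by (simp add: trivial_limit_at_right_real)
qed

text \<open>Here the Mellin decay only has to cancel the growth allowed by (H1); the remaining
  \<open>1 / \<bar>T m\<bar>\<close> comes from the denominator s and already tends to 0.\<close>

lemma horizontal_bound:
  assumes tf: "test_function \<phi>"
  obtains M where "\<And>m \<sigma>. 1 \<le> \<bar>T m\<bar> \<Longrightarrow> S (T m) \<le> \<sigma> \<Longrightarrow> \<sigma> \<le> c \<Longrightarrow> norm (R_integrand Z \<phi> (Complex \<sigma> (T m))) \<le> M / \<bar>T m\<bar>"
proof -
  let ?k = "nat \<lceil>\<kappa>\<rceil>"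
  obtain B where B: "\<And>t. \<bar>S t\<bar> \<le> B" using screen_bound by blast
  obtain M where M: "0 \<le> M" "\<And>s. - B + 1 \<le> Re s \<Longrightarrow> Re s \<le> c + 1 \<Longrightarrow> norm (mellin \<phi> s) * \<bar>Im s\<bar> ^ ?k \<le> M"
    using mellin_decay[OF tf] by blast
  show ?thesis
  proof (rule that[of "C * M"])
    fix m \<sigma> assume t: "1 \<le> \<bar>T m\<bar>" and \<sigma>: "S (T m) \<le> \<sigma>" "\<sigma> \<le> c"
    let ?s = "Complex \<sigma> (T m)" let ?m = "norm (mellin \<phi> (?s + 1))"
    have m: "?m * \<bar>T m\<bar> ^ ?k \<le> M" using M(2)[of "?s + 1"] B[of "T m"] \<sigma> by (auto simp: abs_le_iff)
    have z: "norm (Z ?s) \<le> C * \<bar>T m\<bar> ^ ?k"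
      using H1 \<sigma>(1) order_trans[OF _ mult_left_mono[OF powr_kappa_le[OF t]]] C_pos unfolding growth_H1_def by (meson less_imp_le)
    have "norm (R_integrand Z \<phi> ?s) = norm (Z ?s) * ?m / norm ?s" by (simp add: R_integrand_def norm_mult norm_divide)
    also have "\<dots> \<le> (C * \<bar>T m\<bar> ^ ?k) * ?m / \<bar>T m\<bar>"
      using z t C_pos norm_Complex_ge(1)[of "T m" \<sigma>] by (intro frac_le mult_mono) auto
    also have "\<dots> = C * (?m * \<bar>T m\<bar> ^ ?k) / \<bar>T m\<bar>" by (simp add: mult_ac)
    also have "\<dots> \<le> C * M / \<bar>T m\<bar>" using m C_pos by (intro divide_right_mono mult_left_mono) auto
    finally show "norm (R_integrand Z \<phi> ?s) \<le> C * M / \<bar>T m\<bar>" .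
  qed
qed

end

section \<open>Pairing continuous functions with test functions\<close>

lemma distr_integrable:
  assumes tf: "test_function \<phi>" and F: "continuous_on {0<..} F"
  shows "set_integrable lebesgue {0<..} (\<lambda>x. F x * \<phi> x)"
proof -
  obtain a b where ab: "0 < a" "a < b" "\<And>x. x \<notin> {a<..<b} \<Longrightarrow> \<phi> x = 0" using test_function_support[OF tf] by blast
  show ?thesis
  proof (rule distr_of_eq_integral(2)[of a b])
    show "continuous_on {a..b} (\<lambda>x. F x * \<phi> x)"
      using ab(1) by (intro continuous_intros test_function_continuous[OF tf] continuous_on_subset[OF F]) auto
  qed (use ab in auto)
qed

lemma distr_of_sum:
  assumes tf: "test_function \<phi>" and F: "\<And>i. i \<in> I \<Longrightarrow> continuous_on {0<..} (F i)"
  shows "distr_of (\<lambda>x. \<Sum>i\<in>I. k i * F i x) \<phi> = (\<Sum>i\<in>I. k i * distr_of (F i) \<phi>)"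
proof -
  have "distr_of (\<lambda>x. \<Sum>i\<in>I. k i * F i x) \<phi> = (LINT x|lebesgue. (\<Sum>i\<in>I. k i * (indicat_real {0<..} x *\<^sub>R (F i x * \<phi> x))))"
    unfolding distr_of_def set_lebesgue_integral_def
    by (rule Bochner_Integration.integral_cong) (auto simp: sum_distrib_left mult_ac indicator_def)
  also have "\<dots> = (\<Sum>i\<in>I. LINT x|lebesgue. k i * (indicat_real {0<..} x *\<^sub>R (F i x * \<phi> x)))"
    by (rule Bochner_Integration.integral_sum)
       (intro integrable_mult_right distr_integrable[OF tf F, unfolded set_integrable_def])
  also have "\<dots> = (\<Sum>i\<in>I. k i * distr_of (F i) \<phi>)"
    by (simp only: distr_of_def set_lebesgue_integral_def Bochner_Integration.integral_mult_right_zero)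
  finally show ?thesis .
qed

lemma distr_of_cong:
  assumes "\<And>x. 0 < x \<Longrightarrow> F x = G x"
  shows "distr_of F \<phi> = distr_of G \<phi>"
  unfolding distr_of_def by (rule set_lebesgue_integral_cong) (use assms in auto)

lemma continuous_on_of_real_powr: "continuous_on {0<..} (\<lambda>x. (of_real x :: complex) powr s)"
proof -
  have "continuous_on {0<..} (\<lambda>x::real. exp (s * of_real (ln x)) :: complex)" by (intro continuous_intros) auto
  thus ?thesis by (rule continuous_on_cong[THEN iffD1, rotated 2]) (auto simp: of_real_powr_exp)
qed

lemma distr_of_power_term:
  shows "distr_of (power_term \<omega>) \<phi> = mellin \<phi> (\<omega> + 1) / \<omega>"
proof -
  have "distr_of (power_term \<omega>) \<phi> = distr_of (\<lambda>x. of_real x powr \<omega>) \<phi> / \<omega>"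
    by (simp add: distr_of_def power_term_def set_lebesgue_integral_def divide_inverse mult_ac
        flip: Bochner_Integration.integral_mult_right_zero)
  thus ?thesis by (simp add: mellin_conv_distr_of)
qed

context screened_flow
begin

text \<open>The residue at 0 is evaluated for two entire functions with the same p and q. For the
  powers of x it gives p + q ln x; for the Mellin transform the derivative brings
  \<open>ln x\<close> under the integral, so the result is the pairing of that same function with
  \<phi>.\<close>

lemma residue_term_form:
  assumes 0: "0 \<in> window S"
  obtains p q where "\<And>x. 0 < x \<Longrightarrow> residue_term Z S x = p + q * of_real (ln x)"
    "0 \<notin> complex_dims Z S \<Longrightarrow> p = Z 0 \<and> q = 0"
    "\<And>\<phi>. test_function \<phi> \<Longrightarrow> residue (R_integrand Z \<phi>) 0 = distr_of (residue_term Z S) \<phi>"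
proof -
  obtain p q where pq: "\<And>h. h holomorphic_on UNIV \<Longrightarrow> residue (\<lambda>s. Z s * h s / s) 0 = p * h 0 + q * deriv h 0"
    "0 \<notin> complex_dims Z S \<Longrightarrow> p = Z 0 \<and> q = 0"
    by (rule residue_form_0[OF 0], rule that; simp)
  have r: "residue_term Z S x = p + q * of_real (ln x)" if x: "0 < x" for x
  proof -
    let ?h = "\<lambda>s::complex. exp (s * of_real (ln x))"
    have "(?h has_field_derivative of_real (ln x)) (at 0)" by (auto intro!: derivative_eq_intros)
    hence d: "deriv ?h 0 = of_real (ln x)" by (rule DERIV_imp_deriv)
    have "residue_term Z S x = residue (\<lambda>s. Z s * ?h s / s) 0"
      using 0 x by (simp add: residue_term_def of_real_powr_exp mult_ac)
    also have "\<dots> = p * ?h 0 + q * deriv ?h 0" by (intro pq(1) holomorphic_intros)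
    finally show ?thesis using d by simp
  qed
  show ?thesis
  proof (rule that[of p q, OF r pq(2)])
    fix \<phi> assume tf: "test_function \<phi>"
    let ?h = "\<lambda>s. mellin \<phi> (s + 1)"
    have h: "?h holomorphic_on UNIV"
      by (rule mellin_shift_holomorphic[OF tf])
    have "(?h has_field_derivative distr_of (\<lambda>x. of_real (ln x) * of_real x powr (1 - 1)) \<phi>) (at 0)"
      using DERIV_shift[of "mellin \<phi>" _ 0 1] mellin_has_field_derivative[OF tf, of 1] by simp
    hence d: "deriv ?h 0 = distr_of (\<lambda>x. of_real (ln x) * of_real x powr (1 - 1)) \<phi>" by (rule DERIV_imp_deriv)
    have "residue (R_integrand Z \<phi>) 0 = p * ?h 0 + q * deriv ?h 0"
      using pq(1)[OF h] by (simp add: R_integrand_def[abs_def])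
    also have "\<dots> = p * distr_of (\<lambda>x. 1) \<phi> + q * distr_of (\<lambda>x. of_real (ln x)) \<phi>"
      unfolding d mellin_conv_distr_of[of \<phi> 0]
      by (intro arg_cong2[of _ _ _ _ "(+)"] arg_cong2[of _ _ _ _ "(*)"] refl distr_of_cong) (auto simp: of_real_powr_exp)
    \<comment> \<open>The two summands are indexed by the booleans so that linearity of the pairing
      for finite sums applies.\<close>
    also have "\<dots> = distr_of (\<lambda>x. \<Sum>b\<in>UNIV. (if b then p else q) * (if b then 1 else of_real (ln x))) \<phi>"
    proof (subst distr_of_sum[OF tf])
      show "continuous_on {0<..} (\<lambda>x. if b then 1 else of_real (ln x) :: complex)" for b
        by (cases b) (auto intro!: continuous_intros)
    qed (simp add: UNIV_bool)
    also have "\<dots> = distr_of (residue_term Z S) \<phi>"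
      by (rule distr_of_cong) (simp add: r UNIV_bool)
    finally show "residue (R_integrand Z \<phi>) 0 = distr_of (residue_term Z S) \<phi>" .
  qed auto
qed

lemma residue_term_outside: "0 \<notin> window S \<Longrightarrow> residue_term Z S x = 0"
  by (simp add: residue_term_def)

lemma residue_R_integrand:
  assumes tf: "test_function \<phi>" and \<omega>: "\<omega> \<in> window S" "\<omega> \<noteq> 0"
  shows "residue (R_integrand Z \<phi>) \<omega> = residue Z \<omega> * distr_of (power_term \<omega>) \<phi>"
proof -
  have "(\<lambda>s. mellin \<phi> (s + 1)) holomorphic_on UNIV"
    by (rule mellin_shift_holomorphic[OF tf])
  from residue_form(1)[OF \<omega> this] show ?thesis by (simp add: R_integrand_def[abs_def] distr_of_power_term)
qed

lemma singular_in_window: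
  assumes "\<omega> \<in> singular_points" "\<omega> \<in> window S"
  shows "S (Im \<omega>) < Re \<omega>" "Re \<omega> \<le> D"
proof -
  have "\<omega> \<noteq> screen S (Im \<omega>)" using assms(1) screen_not_singular[of "Im \<omega>"] by auto
  hence "Re \<omega> \<noteq> S (Im \<omega>)" by (auto simp: screen_def complex_eq_iff)
  thus "S (Im \<omega>) < Re \<omega>" using assms(2) by (simp add: window_def)
  show "Re \<omega> \<le> D"
    using assms Re_complex_dim_le D_nonneg by (auto simp: singular_points_def complex_dims_def)
qed

lemma dims_partial_sum_eq:
  assumes tf: "test_function \<phi>"
  shows "dims_partial_sum Z S D T n \<phi> =
    (\<Sum>\<omega>\<in>{\<omega> \<in> complex_dims Z S - {of_real D, 0}. T (- int n) \<le> Im \<omega> \<and> Im \<omega> \<le> T (int n)}. residue (R_integrand Z \<phi>) \<omega>)"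
proof -
  have "dims_partial_sum Z S D T n \<phi> =
    (\<Sum>\<omega>\<in>{\<omega> \<in> complex_dims Z S - {of_real D, 0}. T (- int n) \<le> Im \<omega> \<and> Im \<omega> \<le> T (int n)}. - ord_zeta Z \<omega> * distr_of (power_term \<omega>) \<phi>)"
    unfolding dims_partial_sum_def
    by (rule distr_of_sum[OF tf]) (auto simp: power_term_def[abs_def] intro!: continuous_intros continuous_on_of_real_powr)
  also have "\<dots> = (\<Sum>\<omega>\<in>{\<omega> \<in> complex_dims Z S - {of_real D, 0}. T (- int n) \<le> Im \<omega> \<and> Im \<omega> \<le> T (int n)}. residue (R_integrand Z \<phi>) \<omega>)"
    by (rule sum.cong) (use U(2) ord_zeta_eq residue_R_integrand[OF tf] in \<open>auto simp: complex_dims_def\<close>)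
  finally show ?thesis .
qed

text \<open>If D = 0 the two points coincide: \<open>power_term 0\<close> is 0 because division by 0
  gives 0, and \<open>residue_term\<close> carries the whole residue. If 0 is outside the window,
  both its place in the sum and \<open>residue_term\<close> are empty.\<close>

lemma residue_at_D_and_0:
  assumes tf: "test_function \<phi>"
  shows "(\<Sum>\<omega>\<in>insert (of_real D) ({0} \<inter> window S). residue (R_integrand Z \<phi>) \<omega>)
    = distr_of (power_term (of_real D)) \<phi> + distr_of (residue_term Z S) \<phi>"
proof -
  have 0: "residue (R_integrand Z \<phi>) 0 = distr_of (residue_term Z S) \<phi>" if "0 \<in> window S"
    using residue_term_form[OF that] tf by metis
  have n0: "distr_of (residue_term Z S) \<phi> = 0" if "0 \<notin> window S"
    using residue_term_outside[OF that] by (simp add: distr_of_def)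
  show ?thesis
  proof (cases "D = 0")
    case True
    have "distr_of (power_term 0) \<phi> = 0" by (simp add: distr_of_power_term)
    thus ?thesis using True D_in_window 0 by simp
  next
    case False
    have "residue (R_integrand Z \<phi>) (of_real D) = distr_of (power_term (of_real D)) \<phi>"
      using residue_R_integrand[OF tf D_in_window] False residue_D by simp
    thus ?thesis using False 0 n0 by (cases "0 \<in> window S") auto
  qed
qed

text \<open>The line at \<open>D + 1\<close> satisfies both c > D and c >= 1, as the inversion
  formula requires. Convergence of the partial sums over the complex dimensions is a by-product:
  every other quantity in the finite residue formula has a limit.\<close>

theorem explicit_formula:
  assumes tf: "test_function \<phi>"
  shows "convergent (\<lambda>n. dims_partial_sum Z S D T n \<phi>)"
    and "distr_of (\<lambda>x. of_real (psi N w x)) \<phi> =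
          distr_of (power_term (of_real D)) \<phi> + dims_sum Z S D T \<phi>
          + distr_of (residue_term Z S) \<phi> + R_distr Z S \<phi>"
proof -
  let ?f = "R_integrand Z \<phi>" and ?c = "D + 1" and ?u = "\<lambda>n. T (- int n)" and ?v = "\<lambda>n. T (int n)"
  let ?W = "\<lambda>n. {\<omega> \<in> singular_points. \<omega> \<in> window S \<and> ?u n \<le> Im \<omega> \<and> Im \<omega> \<le> ?v n}"
  let ?E = "\<lambda>n. {\<omega> \<in> complex_dims Z S - {of_real D, 0}. ?u n \<le> Im \<omega> \<and> Im \<omega> \<le> ?v n}"
  let ?X = "insert (of_real D) ({0} \<inter> window S)"
  have T: "filterlim ?v at_top sequentially" "filterlim ?u at_bot sequentially"
    "\<And>n. 1 \<le> n \<Longrightarrow> T (- n) < 0 \<and> 0 < T n"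
    using heights by (auto simp: admissible_heights_def)
  have Tn: "\<forall>\<^sub>F n in sequentially. ?u n < 0 \<and> 0 < ?v n"
    using eventually_ge_at_top[of 1] by eventually_elim (use T(3) in auto)
  obtain B where B: "\<And>t. \<bar>S t\<bar> \<le> B" using screen_bound by blast
  obtain M where M: "\<And>m \<sigma>. 1 \<le> \<bar>T m\<bar> \<Longrightarrow> S (T m) \<le> \<sigma> \<Longrightarrow> \<sigma> \<le> ?c \<Longrightarrow> norm (?f (Complex \<sigma> (T m))) \<le> M / \<bar>T m\<bar>"
    using horizontal_bound[OF tf] by metis
  have au: "filterlim (\<lambda>n. \<bar>?u n\<bar>) at_top sequentially" and av: "filterlim (\<lambda>n. \<bar>?v n\<bar>) at_top sequentially"
    using filterlim_at_infinity_imp_norm_at_top[OF filterlim_mono[OF T(2) at_bot_le_at_infinity order_refl]]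
      filterlim_at_infinity_imp_norm_at_top[OF filterlim_mono[OF T(1) at_top_le_at_infinity order_refl]] by simp_all
  have au1: "\<forall>\<^sub>F n in sequentially. 1 \<le> \<bar>?u n\<bar>" and av1: "\<forall>\<^sub>F n in sequentially. 1 \<le> \<bar>?v n\<bar>"
    using au av by (auto simp: filterlim_at_top)
  have line: "screen_integrand (\<lambda>_. ?c) ?f = screen_integrand (\<lambda>_. ?c) (\<lambda>s. dirichlet s * (mellin \<phi> (s + 1) / s))"
    by (rule ext) (simp add: R_integrand_def Z_eq_dirichlet)
  have h: "(\<lambda>s. mellin \<phi> (s + 1)) holomorphic_on UNIV"
    by (rule mellin_shift_holomorphic[OF tf])
  have c: "1 \<le> ?c" "D < ?c" using D_nonneg by auto
  have lim: "(\<lambda>n. \<Sum>\<omega>\<in>?W n. residue ?f \<omega>)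
     \<longlonglongrightarrow> (screen_integral (\<lambda>_. ?c) ?f - screen_integral S ?f) / (2 * of_real pi * \<i>)"
  proof (rule screen_residue_limit[OF screen_lipschitz B _ U singular_points_sparse R_integrand_holomorphic[OF tf] _ _ T(2,1)])
    show "S t \<le> ?c" for t using screen_less[of t] by simp
    show "\<exists>F. F analytic_on {\<omega>} \<and> (\<forall>\<^sub>F s in at \<omega>. ?f s = F s / (s - \<omega>)^2)" if "\<omega> \<in> window S" for \<omega>
    proof (cases "\<omega> = 0")
      case True
      show ?thesis using residue_form_0[of "\<exists>F. F analytic_on {0} \<and> (\<forall>\<^sub>F s in at 0. ?f s = F s / (s - 0)^2)"] h that
        unfolding True R_integrand_def by blast
    next
      case False
      show ?thesis using residue_form(2)[OF that False h] unfolding R_integrand_def .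
    qed
    show "S (Im \<omega>) < Re \<omega> \<and> Re \<omega> < ?c" if "\<omega> \<in> singular_points" "\<omega> \<in> window S" for \<omega>
      using singular_in_window[OF that] by simp
    show "\<forall>\<^sub>F n in sequentially. \<forall>\<omega>\<in>singular_points. \<omega> \<in> window S \<longrightarrow> Im \<omega> \<noteq> ?u n \<and> Im \<omega> \<noteq> ?v n"
      using Tn
    proof eventually_elim
      case (elim n)
      show ?case using elim no_pole_at_height by (auto simp: singular_points_def complex_dims_def)
    qed
    show "(\<lambda>n. M / \<bar>?u n\<bar>) \<longlonglongrightarrow> 0" "(\<lambda>n. M / \<bar>?v n\<bar>) \<longlonglongrightarrow> 0"
      by (intro tendsto_divide_0[OF tendsto_const] filterlim_mono[OF au at_top_le_at_infinity order_refl]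
          filterlim_mono[OF av at_top_le_at_infinity order_refl])+
    show "\<forall>\<^sub>F n in sequentially. \<forall>\<sigma>\<in>{S (?u n)..?c}. norm (?f (Complex \<sigma> (?u n))) \<le> M / \<bar>?u n\<bar>"
      using au1 by eventually_elim (use M in auto)
    show "\<forall>\<^sub>F n in sequentially. \<forall>\<sigma>\<in>{S (?v n)..?c}. norm (?f (Complex \<sigma> (?v n))) \<le> M / \<bar>?v n\<bar>"
      using av1 by eventually_elim (use M in auto)
    show "integrable lebesgue (screen_integrand S ?f)" by (rule R_screen_integrable[OF tf])
    show "integrable lebesgue (screen_integrand (\<lambda>_. ?c) ?f)" unfolding line by (rule dirichlet_inversion(1)[OF tf c])
  qed
  have "screen_integral (\<lambda>_. ?c) ?f = 2 * of_real pi * \<i> * distr_of (\<lambda>x. of_real (psi N w x)) \<phi>"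
    using dirichlet_inversion(2)[OF tf c] unfolding screen_integral_def line by (simp add: psi_eq_count)
  hence "(screen_integral (\<lambda>_. ?c) ?f - screen_integral S ?f) / (2 * of_real pi * \<i>)
      = distr_of (\<lambda>x. of_real (psi N w x)) \<phi> - R_distr Z S \<phi>"
    by (simp add: R_distr_def diff_divide_distrib)
  note lim = lim[unfolded this]
  have fin: "finite (?W n)" for n
    by (rule finite_window_sing(2)[OF screen_continuous U(2) singular_points_sparse singular_in_window(2)])
  \<comment> \<open>Once the two heights lie on either side of the real axis, D and 0 (if in the
    window) are enclosed; their residues are split off and the rest is the partial sum.\<close>
  have "\<forall>\<^sub>F n in sequentially. (\<Sum>\<omega>\<in>?W n. residue ?f \<omega>) - (\<Sum>\<omega>\<in>?X. residue ?f \<omega>) = dims_partial_sum Z S D T n \<phi>"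
    using Tn
  proof eventually_elim
    case (elim n)
    have "?W n = ?E n \<union> ?X" "?E n \<inter> ?X = {}"
      using elim D_complex_dim by (auto simp: singular_points_def complex_dims_def)
    moreover have "finite (?E n)" "finite ?X" using finite_subset[OF _ fin[of n]] calculation(1) by auto
    ultimately have "(\<Sum>\<omega>\<in>?W n. residue ?f \<omega>) = (\<Sum>\<omega>\<in>?E n. residue ?f \<omega>) + (\<Sum>\<omega>\<in>?X. residue ?f \<omega>)"
      by (simp only: sum.union_disjoint)
    thus ?case by (simp only: dims_partial_sum_eq[OF tf] add_diff_cancel_right')
  qed
  hence L: "(\<lambda>n. dims_partial_sum Z S D T n \<phi>) \<longlonglongrightarrow>
      distr_of (\<lambda>x. of_real (psi N w x)) \<phi> - R_distr Z S \<phi> - (\<Sum>\<omega>\<in>?X. residue ?f \<omega>)"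
    by (rule Lim_transform_eventually[OF tendsto_diff[OF lim tendsto_const]])
  show "convergent (\<lambda>n. dims_partial_sum Z S D T n \<phi>)" using L by (rule convergentI)
  show "distr_of (\<lambda>x. of_real (psi N w x)) \<phi> = distr_of (power_term (of_real D)) \<phi> + dims_sum Z S D T \<phi>
          + distr_of (residue_term Z S) \<phi> + R_distr Z S \<phi>"
    using limI[OF L] residue_at_D_and_0[OF tf] by (simp add: dims_sum_def)
qed

end

subsection \<open>The prime orbit theorem\<close>

context weighted_spectrum
begin

lemma count_exp: "count (exp u) = (\<Sum>i\<in>{i \<in> I. l i \<le> u}. m i)"
  by (simp add: count_def)

lemma count_exp_mono: "u \<le> v \<Longrightarrow> count (exp u) \<le> count (exp v)"
  unfolding count_exp by (intro sum_mono2 fin) (auto intro: m_nonneg)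

lemma count_exp_neg: "u < 0 \<Longrightarrow> count (exp u) = 0"
proof -
  assume "u < 0"
  hence "{i \<in> I. l i \<le> u} = {}" using l_pos by force
  thus ?thesis unfolding count_exp by (simp only: sum.empty)
qed

text \<open>Rankin's trick: for c >= 0 and \<open>l i \<le> u\<close>, the factor
  \<open>exp (- c * u)\<close> is at most \<open>exp (- c * l i)\<close>, so the count is majorised
  by the full Dirichlet series at c.\<close>

lemma count_exp_bound:
  assumes c: "D < c" "0 \<le> c"
  shows "count (exp u) \<le> exp (c * u) * (\<Sum>\<^sub>\<infinity>i\<in>I. m i * exp (- c * l i))"
proof -
  have "count (exp u) = (\<Sum>i\<in>{i \<in> I. l i \<le> u}. exp (c * u) * (m i * exp (- c * u)))"
    unfolding count_exp by (rule sum.cong) (auto simp: exp_minus)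
  also have "\<dots> \<le> (\<Sum>i\<in>{i \<in> I. l i \<le> u}. exp (c * u) * (m i * exp (- c * l i)))"
    using c m_nonneg by (intro sum_mono mult_left_mono) (auto intro: mult_left_mono)
  also have "\<dots> = exp (c * u) * (\<Sum>i\<in>{i \<in> I. l i \<le> u}. m i * exp (- c * l i))" by (simp add: sum_distrib_left)
  also have "\<dots> \<le> exp (c * u) * (\<Sum>\<^sub>\<infinity>i\<in>I. m i * exp (- c * l i))"
    using summ[OF c(1)] m_nonneg by (intro mult_left_mono finite_sum_le_infsum fin) auto
  finally show ?thesis .
qed

lemma count_exp_measurable [measurable]: "(\<lambda>u. count (exp u)) \<in> borel_measurable borel"
  by (rule borel_measurable_mono) (auto intro: monoI count_exp_mono)

lemma integrable_count_exp:
  assumes s: "D < Re s" "0 < Re s"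
  shows "integrable lborel (\<lambda>u. of_real (count (exp u)) * exp (- s * of_real u))"
proof -
  \<comment> \<open>Any c strictly between leaves the integrable factor
    \<open>exp (- (Re s - c) * u)\<close> after Rankin's bound.\<close>
  obtain c where c: "max D 0 < c" "c < Re s" using dense[of "max D 0" "Re s"] s by auto
  define K where "K = (\<Sum>\<^sub>\<infinity>i\<in>I. m i * exp (- c * l i))"
  have "integrable lborel (\<lambda>u. K * (indicator {0..} u * exp (- (Re s - c) * u)))"
    using c by (intro integrable_mult_right integrable_damped_indicator) simp
  hence "integrable lborel (\<lambda>u. K * (indicat_real {0..} u *\<^sub>R exp (- ((Re s - c) * u))))"
    by (simp only: real_scaleR_def mult_minus_left)
  thus ?thesis
  proof (rule Bochner_Integration.integrable_bound)
    show "AE u in lborel. norm (of_real (count (exp u)) * exp (- s * of_real u))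
        \<le> norm (K * (indicat_real {0..} u *\<^sub>R exp (- ((Re s - c) * u))))"
    proof (rule AE_I2)
      fix u :: real
      show "norm (of_real (count (exp u)) * exp (- s * of_real u)) \<le> norm (K * (indicat_real {0..} u *\<^sub>R exp (- ((Re s - c) * u))))"
      proof (cases "u < 0")
        case False
        have p: "0 \<le> count (exp u)" unfolding count_exp by (intro sum_nonneg) (auto intro: m_nonneg)
        have "norm (of_real (count (exp u)) * exp (- s * of_real u)) = count (exp u) * exp (- (Re s * u))"
          using p by (simp add: norm_mult)
        also have "\<dots> \<le> (exp (c * u) * K) * exp (- (Re s * u))"
          unfolding K_def using c by (intro mult_right_mono count_exp_bound) auto
        also have "\<dots> = K * exp (- ((Re s - c) * u))" by (simp add: exp_add[symmetric] algebra_simps)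
        finally show ?thesis using False by simp
      qed (simp add: count_exp_neg)
    qed
  qed simp
qed

text \<open>Abel summation. Integrals truncated at Y are exact finite sums with one boundary term;
  as Y grows the sums tend to the series and the boundary term to 0 by Rankin's bound with an
  exponent below Re s.\<close>

lemma laplace_count:
  assumes s: "D < Re s" "0 < Re s"
  shows "(LINT u|lborel. of_real (count (exp u)) * exp (- s * of_real u)) = dirichlet s / s"
proof -
  let ?h = "\<lambda>u. of_real (count (exp u)) * exp (- s * of_real u)" and ?F = "\<lambda>Y. {i \<in> I. l i \<le> Y}"
  have s0: "s \<noteq> 0" using s by auto
  have fin_part: "(LINT u|lborel. indicator {..Y} u *\<^sub>R ?h u)
      = ((\<Sum>i\<in>?F Y. of_real (m i) * exp (- s * of_real (l i))) - of_real (count (exp Y)) * exp (- s * of_real Y)) / s" for Y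
  proof -
    have piece: "has_bochner_integral lborel (\<lambda>u. of_real (m i) * (indicator {l i..Y} u *\<^sub>R exp (- s * of_real u)))
        (of_real (m i) * ((exp (- s * of_real (l i)) - exp (- s * of_real Y)) / s))" if "i \<in> ?F Y" for i
    proof -
      have "((\<lambda>u. - exp (- s * of_real u) / s) has_vector_derivative exp (- s * of_real u)) (at u within {l i..Y})" for u
        using s0 by (auto intro!: derivative_eq_intros has_vector_derivative_real_field)
      hence "has_bochner_integral lborel (\<lambda>u. indicator {l i..Y} u *\<^sub>R exp (- s * of_real u))
          (- exp (- s * of_real Y) / s - - exp (- s * of_real (l i)) / s)"
        using that by (intro has_bochner_integral_FTC_Icc) (auto intro!: continuous_intros)
      also have "- exp (- s * of_real Y) / s - - exp (- s * of_real (l i)) / s = (exp (- s * of_real (l i)) - exp (- s * of_real Y)) / s"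
        by (simp add: diff_divide_distrib)
      finally show ?thesis by (rule has_bochner_integral_mult_right)
    qed
    have "indicator {..Y} u *\<^sub>R ?h u = (\<Sum>i\<in>?F Y. of_real (m i) * (indicator {l i..Y} u *\<^sub>R exp (- s * of_real u)))" for u
    proof (cases "u \<le> Y")
      case True
      have "count (exp u) = (\<Sum>i\<in>?F Y. if l i \<le> u then m i else 0)"
        unfolding count_exp using True fin[of Y] by (subst sum.inter_filter[symmetric]) (auto intro!: sum.cong)
      thus ?thesis using True by (auto simp: sum_distrib_right indicator_def intro!: sum.cong)
    qed (simp add: indicator_def)
    hence "(LINT u|lborel. indicator {..Y} u *\<^sub>R ?h u)
        = (\<Sum>i\<in>?F Y. of_real (m i) * ((exp (- s * of_real (l i)) - exp (- s * of_real Y)) / s))"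
      using has_bochner_integral_sum[of "?F Y", OF piece] by (simp add: has_bochner_integral_iff)
    also have "\<dots> = ((\<Sum>i\<in>?F Y. of_real (m i) * exp (- s * of_real (l i))) - of_real (count (exp Y)) * exp (- s * of_real Y)) / s"
      unfolding count_exp of_real_sum sum_distrib_right sum_subtractf[symmetric] sum_divide_distrib
      by (rule sum.cong) (auto simp: algebra_simps)
    finally show ?thesis .
  qed
  have "((\<lambda>Y. \<Sum>i\<in>?F Y. of_real (m i) * exp (- s * of_real (l i))) \<longlongrightarrow> dirichlet s) at_top"
  proof -
    have "norm (of_real (m i) * exp (- s * of_real (l i)) :: complex) = m i * exp (- Re s * l i)" if "i \<in> I" for i
      using m_nonneg[OF that] by (simp add: norm_mult)
    hence "(\<lambda>i. norm (of_real (m i) * exp (- s * of_real (l i)) :: complex)) summable_on I"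
      using summ[OF s(1)] by (simp cong: summable_on_cong)
    hence "((\<lambda>i. of_real (m i) * exp (- s * of_real (l i))) has_sum dirichlet s) I"
      unfolding dirichlet_def by (rule has_sum_infsum[OF abs_summable_summable])
    \<comment> \<open>The sublevel sets of \<open>l\<close> are finite and eventually contain any
      given finite set, so ordering by length computes the unordered sum.\<close>
    moreover have "filterlim ?F (finite_subsets_at_top I) at_top"
      unfolding filterlim_finite_subsets_at_top
    proof (intro allI impI)
      fix X assume X: "finite X \<and> X \<subseteq> I"
      have "\<forall>\<^sub>F Y in at_top. \<forall>i\<in>X. l i \<le> Y"
        using X by (intro eventually_ball_finite) (auto intro: eventually_ge_at_top)
      thus "\<forall>\<^sub>F Y in at_top. finite (?F Y) \<and> X \<subseteq> ?F Y \<and> ?F Y \<subseteq> I"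
        by (rule eventually_mono) (use X fin in auto)
    qed
    ultimately show ?thesis unfolding has_sum_def by (rule filterlim_compose)
  qed
  moreover have "((\<lambda>Y. of_real (count (exp Y)) * exp (- s * of_real Y)) \<longlongrightarrow> 0) at_top"
  proof -
    obtain c where c: "max D 0 < c" "c < Re s" using dense[of "max D 0" "Re s"] s by auto
    define K where "K = (\<Sum>\<^sub>\<infinity>i\<in>I. m i * exp (- c * l i))"
    have e: "((\<lambda>Y. K * exp (- ((Re s - c) * Y))) \<longlongrightarrow> 0) at_top"
    proof -
      have "filterlim (\<lambda>Y. - ((Re s - c) * Y)) at_bot at_top"
        unfolding filterlim_uminus_at_bot minus_minus using c
        by (intro filterlim_tendsto_pos_mult_at_top[OF tendsto_const] filterlim_ident) auto
      thus ?thesis by (intro tendsto_mult_right_zero filterlim_compose[OF exp_at_bot])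
    qed
    show ?thesis
    proof (rule Lim_null_comparison[OF always_eventually e], rule allI)
      fix u
      have p: "0 \<le> count (exp u)" unfolding count_exp by (intro sum_nonneg) (auto intro: m_nonneg)
      have "norm (of_real (count (exp u)) * exp (- s * of_real u)) = count (exp u) * exp (- (Re s * u))"
        using p by (simp add: norm_mult)
      also have "\<dots> \<le> (exp (c * u) * K) * exp (- (Re s * u))"
        unfolding K_def using c by (intro mult_right_mono count_exp_bound) auto
      also have "\<dots> = K * exp (- ((Re s - c) * u))" by (simp add: exp_add[symmetric] algebra_simps)
      finally show "norm (of_real (count (exp u)) * exp (- s * of_real u)) \<le> K * exp (- ((Re s - c) * u))" .
    qed
  qed
  ultimately have "((\<lambda>Y. LINT u|lborel. indicator {..Y} u *\<^sub>R ?h u) \<longlongrightarrow> (dirichlet s - 0) / s) at_top"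
    unfolding fin_part using s0 by (intro tendsto_intros) auto
  moreover have "((\<lambda>Y. LINT u|lborel. indicator {..Y} u *\<^sub>R ?h u) \<longlongrightarrow> (LINT u|lborel. ?h u)) at_top"
    by (rule tendsto_integral_at_top[OF _ integrable_count_exp[OF s]]) simp
  ultimately show ?thesis using tendsto_unique[OF trivial_limit_at_top_linorder] by fastforce
qed

lemma count_test_integrable:
  assumes tf: "test_function \<phi>"
  shows "set_integrable lebesgue {0<..} (\<lambda>x. of_real (count x) * \<phi> x)"
proof -
  obtain a b where ab: "0 < a" "a < b" "\<And>x. x \<notin> {a<..<b} \<Longrightarrow> \<phi> x = 0" using test_function_support[OF tf] by blast
  let ?F = "{i \<in> I. l i \<le> ln b}"
  have "indicat_real {0<..} x *\<^sub>R (of_real (count x) * \<phi> x)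
      = indicat_real {0<..} x *\<^sub>R (\<Sum>i\<in>?F. of_real (m i) * ((if l i \<le> ln x then 1 else 0) * \<phi> x))" for x
  proof (cases "x \<in> {a<..<b}")
    case True
    hence "ln x \<le> ln b" using ab(1) by simp
    hence "count x = (\<Sum>i\<in>?F. if l i \<le> ln x then m i else 0)"
      unfolding count_def using fin[of "ln b"] by (subst sum.inter_filter[symmetric]) (auto intro!: sum.cong)
    hence "of_real (count x) = (\<Sum>i\<in>?F. of_real (m i) * (if l i \<le> ln x then 1 else 0) :: complex)"
      by (simp add: if_distrib cong: if_cong sum.cong)
    thus ?thesis by (simp add: sum_distrib_right mult.assoc)
  qed (use ab in simp)
  moreover have "set_integrable lebesgue {0<..} (\<lambda>x. of_real (m i) * ((if l i \<le> ln x then 1 else 0) * \<phi> x))" for i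
    by (intro set_integrable_mult_right set_integrable_step_test_function[OF tf])
  hence "set_integrable lebesgue {0<..} (\<lambda>x. \<Sum>i\<in>?F. of_real (m i) * ((if l i \<le> ln x then 1 else 0) * \<phi> x))"
    unfolding set_integrable_def scaleR_sum_right by (rule Bochner_Integration.integrable_sum)
  ultimately show ?thesis unfolding set_integrable_def by (simp only:)
qed

end

lemma laplace_indicator:
  assumes s: "0 < Re s"
  shows "integrable lborel (\<lambda>y. of_real (indicator {0..} y) * exp (- s * of_real y) :: complex)"
    and "(LINT y|lborel. of_real (indicator {0..} y) * exp (- s * of_real y)) = 1 / s"
proof -
  let ?h = "\<lambda>y. of_real (indicator {0..} y) * exp (- s * of_real y) :: complex"
  have s0: "s \<noteq> 0" using s by auto
  show i: "integrable lborel ?h"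
    by (rule Bochner_Integration.integrable_bound[OF integrable_damped_indicator[OF s]]) (auto simp: norm_mult)
  have partial: "(LINT y|lborel. indicator {..Y} y *\<^sub>R ?h y) = 1 / s - exp (- s * of_real Y) / s" if Y: "0 \<le> Y" for Y
  proof -
    have "((\<lambda>u. - exp (- s * of_real u) / s) has_vector_derivative exp (- s * of_real u)) (at u within {0..Y})" for u
      using s0 by (auto intro!: derivative_eq_intros has_vector_derivative_real_field)
    hence "(LINT y|lborel. indicator {0..Y} y *\<^sub>R exp (- s * of_real y)) = - exp (- s * of_real Y) / s - - exp (- s * of_real 0) / s"
      by (intro integral_FTC_Icc Y) (auto intro!: continuous_intros)
    moreover have "indicator {..Y} y *\<^sub>R ?h y = indicator {0..Y} y *\<^sub>R exp (- s * of_real y)" for y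
      by (auto simp: indicator_def)
    ultimately show ?thesis by simp
  qed
  have "\<forall>\<^sub>F Y in at_top. 1 / s - exp (- s * of_real Y) / s = (LINT y|lborel. indicator {..Y} y *\<^sub>R ?h y)"
    by (rule eventually_mono[OF eventually_ge_at_top[of 0]]) (rule partial[symmetric])
  moreover have "((\<lambda>Y. 1 / s - exp (- s * of_real Y) / s) \<longlongrightarrow> 1 / s - 0 / s) at_top"
  proof (intro tendsto_intros s0)
    have "filterlim (\<lambda>Y. - (Re s * Y)) at_bot at_top"
      unfolding filterlim_uminus_at_bot minus_minus using s
      by (intro filterlim_tendsto_pos_mult_at_top[OF tendsto_const] filterlim_ident) auto
    hence "((\<lambda>Y. norm (exp (- s * of_real Y))) \<longlongrightarrow> 0) at_top"
      using filterlim_compose[OF exp_at_bot] by simp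
    thus "((\<lambda>Y. exp (- s * of_real Y)) \<longlongrightarrow> 0) at_top" by (rule tendsto_norm_zero_cancel)
  qed
  ultimately have "((\<lambda>Y. LINT y|lborel. indicator {..Y} y *\<^sub>R ?h y) \<longlongrightarrow> 1 / s) at_top"
    using Lim_transform_eventually by fastforce
  moreover have "((\<lambda>Y. LINT y|lborel. indicator {..Y} y *\<^sub>R ?h y) \<longlongrightarrow> (LINT y|lborel. ?h y)) at_top"
    by (rule tendsto_integral_at_top[OF _ i]) simp
  ultimately show "(LINT y|lborel. ?h y) = 1 / s" using tendsto_unique[OF trivial_limit_at_top_linorder] by blast
qed

section \<open>From pointwise to distributional estimates\<close>

lemma distr_smallo_cong:
  assumes "\<And>\<phi>. test_function \<phi> \<Longrightarrow> F \<phi> = G \<phi>"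
  shows "distr_smallo F \<alpha> \<longleftrightarrow> distr_smallo G \<alpha>"
proof -
  have "(\<lambda>a. norm (F (dilate a \<phi>))) \<in> o(\<lambda>a. a powr \<alpha>) \<longleftrightarrow> (\<lambda>a. norm (G (dilate a \<phi>))) \<in> o(\<lambda>a. a powr \<alpha>)"
    if "test_function \<phi>" for \<phi>
    by (rule landau_o.small.in_cong, rule eventually_mono[OF eventually_gt_at_top[of 0]])
       (use assms test_function_dilate[OF that] in simp)
  thus ?thesis unfolding distr_smallo_def by blast
qed

text \<open>The dilated test function lives on an interval scaled by t and has size of order
  \<open>1 / t\<close>, so its total mass stays bounded. On that interval the pointwise bound is
  \<epsilon> times a constant multiple of \<open>t powr D\<close>.\<close>

lemma distr_smallo_of_pointwise:
  fixes g :: "real \<Rightarrow> real"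
  assumes int: "\<And>\<phi>. test_function \<phi> \<Longrightarrow> set_integrable lebesgue {0<..} (\<lambda>x. of_real (g x) * \<phi> x)"
    and small: "\<And>\<epsilon>. 0 < \<epsilon> \<Longrightarrow> \<forall>\<^sub>F x in at_top. \<bar>g x\<bar> \<le> \<epsilon> * x powr D" and D: "0 \<le> D"
  shows "distr_smallo (distr_of (\<lambda>x. of_real (g x))) D"
  unfolding distr_smallo_def
proof (intro allI impI)
  fix \<phi> assume tf: "test_function \<phi>"
  obtain a b where ab: "0 < a" "a < b" "\<And>x. x \<notin> {a<..<b} \<Longrightarrow> \<phi> x = 0" using test_function_support[OF tf] by blast
  have "bounded (\<phi> ` {a..b})" by (intro compact_imp_bounded compact_continuous_image test_function_continuous tf) auto
  then obtain M0 where M0: "\<And>x. x \<in> {a..b} \<Longrightarrow> norm (\<phi> x) \<le> M0" unfolding bounded_iff by blast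
  define M where "M = max M0 0"
  have M: "0 \<le> M" "norm (\<phi> x) \<le> M" for x
    using M0[of x] ab by (cases "x \<in> {a<..<b}"; auto simp: M_def)+
  \<comment> \<open>Collects the constants of the final estimate; the summand 1 keeps it positive
    when \<phi> is identically 0.\<close>
  define K where "K = b powr D * M * (b - a) + 1"
  have K: "0 < K" using ab M by (auto simp: K_def intro!: add_nonneg_pos mult_nonneg_nonneg)
  show "(\<lambda>t. norm (distr_of (\<lambda>x. of_real (g x)) (dilate t \<phi>))) \<in> o(\<lambda>t. t powr D)"
  proof (rule landau_o.smallI)
    fix c :: real assume c: "0 < c"
    define \<epsilon> where "\<epsilon> = c / K"
    have \<epsilon>: "0 < \<epsilon>" using c K by (simp add: \<epsilon>_def)
    obtain x0 where x0: "\<And>x. x0 \<le> x \<Longrightarrow> \<bar>g x\<bar> \<le> \<epsilon> * x powr D"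
      using small[OF \<epsilon>] unfolding eventually_at_top_linorder by blast
    show "\<forall>\<^sub>F t in at_top. norm (norm (distr_of (\<lambda>x. of_real (g x)) (dilate t \<phi>))) \<le> c * norm (t powr D)"
      \<comment> \<open>From \<open>x0 / a\<close> on, the dilated support starts beyond
        \<open>x0\<close>, where the pointwise bound is available.\<close>
      using eventually_ge_at_top[of "max 1 (x0 / a)"]
    proof eventually_elim
      case (elim t)
      hence t: "0 < t" "x0 \<le> t * a" using ab(1) by (auto simp: field_simps)
      let ?c = "\<epsilon> * (t * b) powr D * M / t"
      have td: "test_function (dilate t \<phi>)" by (rule test_function_dilate[OF tf t(1)])
      have i: "integrable lebesgue (\<lambda>x. indicat_real {0<..} x *\<^sub>R (of_real (g x) * dilate t \<phi> x))"
        using int[OF td] by (simp only: set_integrable_def)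
      have "norm (distr_of (\<lambda>x. of_real (g x)) (dilate t \<phi>))
          \<le> (LINT x|lebesgue. norm (indicat_real {0<..} x *\<^sub>R (of_real (g x) * dilate t \<phi> x)))"
        unfolding distr_of_def set_lebesgue_integral_def by (rule integral_norm_bound)
      also have "\<dots> \<le> (LINT x|lebesgue. ?c * indicat_real {t * a..t * b} x)"
      proof (rule integral_mono)
        show "integrable lebesgue (\<lambda>x. ?c * indicat_real {t * a..t * b} x)"
          by (intro integrable_mult_right integrable_real_indicator) (auto simp: emeasure_lborel_Icc_eq)
        fix x :: real
        show "norm (indicat_real {0<..} x *\<^sub>R (of_real (g x) * dilate t \<phi> x)) \<le> ?c * indicat_real {t * a..t * b} x"
        proof (cases "x \<in> {t * a..t * b}")
          case True
          hence x: "0 < x" "x0 \<le> x" "x \<le> t * b" using t mult_pos_pos[OF t(1) ab(1)] by auto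
          have "x powr D \<le> (t * b) powr D" using x D by (intro powr_mono2) auto
          hence g: "\<bar>g x\<bar> \<le> \<epsilon> * (t * b) powr D" using x0[OF x(2)] \<epsilon> by (meson mult_left_mono order_trans less_imp_le)
          have "norm (of_real (g x) * dilate t \<phi> x) = \<bar>g x\<bar> * (norm (\<phi> (x / t)) / t)"
            using t by (simp add: dilate_def norm_mult norm_divide)
          also have "\<dots> \<le> (\<epsilon> * (t * b) powr D) * (M / t)"
            using g M \<epsilon> t by (intro mult_mono divide_right_mono) auto
          finally show ?thesis using True x by simp
        next
          case False
          hence "x / t \<notin> {a<..<b}" using t by (auto simp: field_simps)
          thus ?thesis using False ab(3) by (simp add: dilate_def)
        qed
      qed (rule integrable_norm[OF i])
      also have "\<dots> = ?c * (t * b - t * a)"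
        using t ab by simp
      also have "\<dots> = \<epsilon> * t powr D * (b powr D * M * (b - a))"
        using t ab by (simp add: powr_mult field_simps)
      also have "\<dots> \<le> \<epsilon> * t powr D * K"
        using \<epsilon> by (intro mult_left_mono) (auto simp: K_def)
      also have "\<dots> = c * t powr D" using K by (simp add: \<epsilon>_def)
      finally show ?case by simp
    qed
  qed
qed

context screened_flow
begin

text \<open>D is the only pole on the line, with residue 1, so dividing by D + s leaves the residue
  \<open>1 / D\<close> at s = 0 and subtracting \<open>1 / (D * s)\<close> makes the singularity
  removable. The missing value is a derivative: near 0 the expression is the difference quotient at
  0 of \<open>G (D + s) / (D + s)\<close>.\<close>

lemma boundary_extension:
  assumes D: "0 < D" and only: "{\<omega> \<in> complex_dims Z S. Re \<omega> = D} = {of_real D}"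
  obtains H where "continuous_on {s. 0 \<le> Re s} H"
    "\<And>s. s \<noteq> 0 \<Longrightarrow> H s = Z (of_real D + s) / (of_real D + s) - 1 / (of_real D * s)"
proof -
  obtain r G where G: "0 < r" "G holomorphic_on ball (of_real D) r" "G (of_real D) = residue Z (of_real D)"
      "\<And>s. s \<in> ball (of_real D) r - {of_real D} \<Longrightarrow> Z s = G s / (s - of_real D)"
    using local_form[OF D_in_window] by metis
  let ?h = "\<lambda>s. G (of_real D + s) / (of_real D + s)"
  have "(G has_field_derivative deriv G (of_real D)) (at (of_real D))"
    using holomorphic_derivI[OF G(2) open_ball] G(1) by simp
  hence "((\<lambda>s. G s / s) has_field_derivative (deriv G (of_real D) * of_real D - G (of_real D) * 1) / (of_real D * of_real D)) (at (of_real D + 0))"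
    using D by (auto intro!: derivative_eq_intros)
  then obtain d where "(?h has_field_derivative d) (at 0)" using DERIV_shift[of "\<lambda>s. G s / s" _ 0 "of_real D"] by (auto simp: add.commute)
  hence hd: "((\<lambda>s. (?h s - ?h 0) / s) \<longlongrightarrow> d) (at 0)" by (simp add: has_field_derivative_iff)
  define H where "H s = (if s = 0 then d else Z (of_real D + s) / (of_real D + s) - 1 / (of_real D * s))" for s
  have "isCont H s" if s: "0 \<le> Re s" for s
  proof (cases "s = 0")
    case True
    have ev: "\<forall>\<^sub>F s in at 0. s \<in> ball 0 (min r D) - {0 :: complex}"
      by (rule eventually_at_in_open) (use G(1) D in auto)
    have "\<forall>\<^sub>F s in at 0. (?h s - ?h 0) / s = H s"
      using ev
    proof eventually_elim
      case (elim s)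
      have "of_real D + s \<noteq> 0"
      proof
        assume "of_real D + s = 0"
        hence "s = - of_real D" by (simp add: add_eq_0_iff)
        thus False using elim D by simp
      qed
      moreover have "Z (of_real D + s) = G (of_real D + s) / s"
        using G(4)[of "of_real D + s"] elim by (simp add: dist_norm)
      ultimately show ?case using elim D G(3) residue_D by (simp add: H_def field_simps)
    qed
    hence "(H \<longlongrightarrow> d) (at 0)" by (rule Lim_transform_eventually[OF hd])
    thus ?thesis using True by (simp add: isCont_def H_def)
  next
    case False
    have w: "of_real D + s \<in> window S" using s by (intro half_plane_subset_window) simp
    have "\<not> is_pole Z (of_real D + s)"
    proof (cases "Re s = 0")
      case True
      hence "of_real D + s \<in> {\<omega> \<in> complex_dims Z S. Re \<omega> = D}" if "is_pole Z (of_real D + s)"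
        using w that by (simp add: complex_dims_def)
      thus ?thesis unfolding only using False by auto
    next
      case False
      thus ?thesis using s by (intro no_pole_right) simp
    qed
    hence "Z analytic_on {of_real D + s}" using Z_analytic w U(2) by blast
    hence "isCont Z (of_real D + s)"
      using analytic_on_imp_differentiable_at field_differentiable_imp_continuous_at by (metis singletonI)
    hence "isCont (\<lambda>s. Z (of_real D + s)) s" using isCont_o2[of s "\<lambda>s. of_real D + s" Z] by simp
    moreover have "of_real D + s \<noteq> 0" using s D by (auto simp: complex_eq_iff)
    ultimately have "isCont (\<lambda>s. Z (of_real D + s) / (of_real D + s) - 1 / (of_real D * s)) s"
      using False D by (intro continuous_intros) auto
    moreover have "\<forall>\<^sub>F s in nhds s. H s = Z (of_real D + s) / (of_real D + s) - 1 / (of_real D * s)"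
      using t1_space_nhds[OF False] by (rule eventually_mono) (simp add: H_def)
    ultimately show ?thesis by (rule isCont_cong[THEN iffD2, rotated])
  qed
  hence "continuous_on {s. 0 \<le> Re s} H" by (simp add: continuous_at_imp_continuous_on)
  thus ?thesis by (rule that) (simp add: H_def)
qed

text \<open>The factor \<open>exp (- D * u)\<close> translates the Laplace variable by D. The growth
  condition is the monotonicity of the counting function, and the constant \<open>1 / D\<close> is
  the residue of \<open>Z s / s\<close> at D.\<close>

lemma count_asymptotic:
  assumes D: "0 < D" and only: "{\<omega> \<in> complex_dims Z S. Re \<omega> = D} = {of_real D}"
  shows "((\<lambda>u. exp (- D * u) * count (exp u)) \<longlongrightarrow> 1 / D) at_top"
proof -
  obtain H where H: "continuous_on {s. 0 \<le> Re s} H"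
    "\<And>s. s \<noteq> 0 \<Longrightarrow> H s = Z (of_real D + s) / (of_real D + s) - 1 / (of_real D * s)"
    using boundary_extension[OF D only] by blast
  let ?f = "\<lambda>u. exp (- D * u) * count (exp u)"
  have int: "integrable lborel (\<lambda>u. of_real (?f u) * exp (- s * of_real u))"
    and lap: "(LINT u|lborel. of_real (?f u) * exp (- s * of_real u)) = Z (of_real D + s) / (of_real D + s)" if s: "0 < Re s" for s
  proof -
    have e: "of_real (?f u) * exp (- s * of_real u) = of_real (count (exp u)) * exp (- (of_real D + s) * of_real u)" for u
      by (simp add: exp_add[symmetric] exp_of_real[symmetric] algebra_simps)
    have s': "D < Re (of_real D + s)" "0 < Re (of_real D + s)" using s D by auto
    show "integrable lborel (\<lambda>u. of_real (?f u) * exp (- s * of_real u))"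
      unfolding e by (rule integrable_count_exp[OF s'])
    show "(LINT u|lborel. of_real (?f u) * exp (- s * of_real u)) = Z (of_real D + s) / (of_real D + s)"
      unfolding e laplace_count[OF s'] Z_eq_dirichlet[OF s'(1)] ..
  qed
  have cn: "0 \<le> count x" for x unfolding count_def by (intro sum_nonneg) (auto intro: m_nonneg)
  interpret wiener_ikehara ?f "1 / D" D H
  proof
    show "?f \<in> borel_measurable borel" by measurable
    show "?f x \<le> exp (D * (y - x)) * ?f y" if "x \<le> y" for x y
    proof -
      have "?f x \<le> exp (- D * x) * count (exp y)" using that by (intro mult_left_mono count_exp_mono) auto
      moreover have e: "exp (- D * x) = exp (D * (y - x)) * exp (- D * y)" by (simp add: exp_add[symmetric] algebra_simps)
      ultimately show ?thesis by (simp only: mult.assoc)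
    qed
    show "integrable lborel (\<lambda>y. ?f y * exp (- \<epsilon> * y))" if "0 < \<epsilon>" for \<epsilon>
      using integrable_Re[OF int[of "of_real \<epsilon>"]] that by (simp add: Re_exp)
    show "(LINT y|lborel. of_real (?f y - 1 / D * indicator {0..} y) * exp (- s * of_real y)) = H s" if s: "0 < Re s" for s
    proof -
      have s0: "s \<noteq> 0" using s by auto
      have "(LINT y|lborel. of_real (?f y - 1 / D * indicator {0..} y) * exp (- s * of_real y))
          = (LINT y|lborel. of_real (?f y) * exp (- s * of_real y) - of_real (1 / D) * (of_real (indicator {0..} y) * exp (- s * of_real y)))"
        by (simp add: left_diff_distrib mult.assoc)
      also have "\<dots> = (LINT y|lborel. of_real (?f y) * exp (- s * of_real y))
          - (LINT y|lborel. of_real (1 / D) * (of_real (indicator {0..} y) * exp (- s * of_real y)))"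
        by (rule Bochner_Integration.integral_diff[OF int[OF s] integrable_mult_right[OF laplace_indicator(1)[OF s]]])
      also have "\<dots> = H s"
        using s0
        unfolding lap[OF s] Bochner_Integration.integral_mult_right_zero laplace_indicator(2)[OF s] by (simp add: H(2))
      finally show ?thesis .
    qed
  qed (use D H(1) cn count_exp_neg in auto)
  show ?thesis by (rule wiener_ikehara)
qed

lemma psi_asymptotic:
  assumes D: "0 < D" and only: "{\<omega> \<in> complex_dims Z S. Re \<omega> = D} = {of_real D}" and \<epsilon>: "0 < \<epsilon>"
  shows "\<forall>\<^sub>F x in at_top. \<bar>psi N w x - x powr D / D\<bar> \<le> \<epsilon> * x powr D"
proof -
  have "\<forall>\<^sub>F u in at_top. \<bar>exp (- D * u) * count (exp u) - 1 / D\<bar> < \<epsilon>"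
    using tendstoD[OF count_asymptotic[OF D only] \<epsilon>] by (simp add: dist_real_def)
  hence "\<forall>\<^sub>F x in at_top. \<bar>exp (- D * ln x) * count (exp (ln x)) - 1 / D\<bar> < \<epsilon>"
    using eventually_compose_filterlim ln_at_top by blast
  with eventually_gt_at_top[of 0] show ?thesis
  proof eventually_elim
    case (elim x)
    have "psi N w x - x powr D / D = x powr D * (exp (- D * ln x) * count (exp (ln x)) - 1 / D)"
      using elim(1) by (simp add: psi_eq_count powr_def exp_minus field_simps)
    hence "\<bar>psi N w x - x powr D / D\<bar> = x powr D * \<bar>exp (- D * ln x) * count (exp (ln x)) - 1 / D\<bar>"
      by (simp only: abs_mult) simp
    also have "\<dots> \<le> x powr D * \<epsilon>" using elim(2) by (intro mult_left_mono) auto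
    finally show ?case by (simp only: mult.commute)
  qed
qed

lemma prime_orbit_theorem_pos:
  assumes D: "0 < D" and only: "{\<omega> \<in> complex_dims Z S. Re \<omega> = D} = {of_real D}"
  shows "distr_smallo (\<lambda>\<phi>. distr_of (\<lambda>x. of_real (psi N w x)) \<phi> - distr_of (power_term (of_real D)) \<phi>) D"
proof -
  let ?g = "\<lambda>x. psi N w x - x powr D / D"
  have p: "power_term (of_real D) x = of_real (x powr D / D)" if "0 < x" for x
    using that by (simp add: power_term_def powr_of_real)
  have i1: "set_integrable lebesgue {0<..} (\<lambda>x. of_real (psi N w x) * \<phi> x)" if "test_function \<phi>" for \<phi>
    using count_test_integrable[OF that] by (simp add: psi_eq_count)
  have i2: "set_integrable lebesgue {0<..} (\<lambda>x. power_term (of_real D) x * \<phi> x)" if "test_function \<phi>" for \<phi>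
    by (rule distr_integrable[OF that])
       (use D in \<open>auto simp: power_term_def[abs_def] intro!: continuous_intros continuous_on_of_real_powr\<close>)
  have e: "of_real (?g x) * \<phi> x = of_real (psi N w x) * \<phi> x - power_term (of_real D) x * \<phi> x" if "0 < x" for \<phi> x
    using p[OF that] by (simp add: left_diff_distrib)
  have i: "set_integrable lebesgue {0<..} (\<lambda>x. of_real (?g x) * \<phi> x)" if "test_function \<phi>" for \<phi>
    using set_integral_diff(1)[OF i1[OF that] i2[OF that]]
    by (rule set_integrable_cong[THEN iffD1, rotated 3]) (use e in auto)
  have "distr_of (\<lambda>x. of_real (?g x)) \<phi> = distr_of (\<lambda>x. of_real (psi N w x)) \<phi> - distr_of (power_term (of_real D)) \<phi>" if "test_function \<phi>" for \<phi>
    unfolding distr_of_def set_integral_diff(2)[OF i1[OF that] i2[OF that], symmetric]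
    by (rule set_lebesgue_integral_cong) (use e in auto)
  moreover have "distr_smallo (distr_of (\<lambda>x. of_real (?g x))) D"
    by (rule distr_smallo_of_pointwise) (use i psi_asymptotic[OF D only] D in auto)
  ultimately show ?thesis by (simp cong: distr_smallo_cong)
qed

end

section \<open>The case of dimension zero\<close>

lemma has_sum_geometric_orbit:
  fixes c x :: "'a :: {real_normed_field, banach}"
  assumes x: "norm x < 1"
  shows "((\<lambda>i. c * x ^ snd i) has_sum (c * x / (1 - x))) ({p} \<times> {1..})"
proof -
  have b: "bij_betw (\<lambda>k. (p, Suc k)) UNIV ({p} \<times> {1..})"
    by (rule bij_betwI[where g = "\<lambda>i. snd i - 1"]) auto
  have "summable (\<lambda>k. norm (c * x ^ Suc k))"
  proof -
    have "summable (\<lambda>k. norm (c * x) * norm x ^ k)" by (intro summable_mult summable_geometric) (simp add: x)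
    thus ?thesis by (simp add: norm_mult norm_power mult_ac)
  qed
  moreover have "(\<lambda>k. (c * x) * x ^ k) sums ((c * x) * (1 / (1 - x)))"
    by (intro sums_mult geometric_sums x)
  hence "(\<lambda>k. c * x ^ Suc k) sums (c * x / (1 - x))" by (simp add: mult_ac)
  ultimately have "((\<lambda>k. c * x ^ Suc k) has_sum (c * x / (1 - x))) UNIV" by (rule norm_summable_imp_has_sum)
  thus ?thesis using has_sum_reindex_bij_betw[OF b, of "\<lambda>i. c * x ^ snd i"] by simp
qed

lemma tendsto_exp_minus_one_quotient: "((\<lambda>\<sigma>. \<sigma> * (l / (exp (\<sigma> * l) - 1))) \<longlongrightarrow> 1) (at_right 0)" if "0 < l" for l :: real
  using that by real_asymp

context screened_flow
begin

lemma orbit_pairs_of: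
  assumes "i \<in> flow_pairs N w"
  shows "{fst i} \<times> {1..} \<subseteq> flow_pairs N w" "\<And>j. fst j = fst i \<Longrightarrow> orbit_length w j = orbit_length w i"
  using assms by (auto simp: flow_pairs_def orbit_pairs_def orbit_length_def)

text \<open>The multiples of one orbit form a geometric series. It is stated over a general field
  because it is used at real points for the limit at 0 and at complex points near the second
  pole.\<close>

lemma orbit_has_sum:
  fixes s :: "'a :: {real_normed_field, banach}"
  assumes i: "i \<in> flow_pairs N w" and s: "norm (exp (- s * of_real (orbit_length w i))) < 1"
  shows "((\<lambda>j. of_real (orbit_length w j) * exp (- s * of_real (pair_length w j))) has_sum
    (of_real (orbit_length w i) / (exp (s * of_real (orbit_length w i)) - 1))) ({fst i} \<times> {1..})"
proof -
  let ?c = "of_real (orbit_length w i) :: 'a" and ?x = "exp (- s * of_real (orbit_length w i)) :: 'a"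
  have e: "?c * ?x / (1 - ?x) = ?c / (exp (s * of_real (orbit_length w i)) - 1)"
  proof -
    have "1 - ?x = ?x * (exp (s * of_real (orbit_length w i)) - 1)"
      by (simp add: algebra_simps exp_add[symmetric] flip: exp_minus)
    thus ?thesis by simp
  qed
  have c: "of_real (orbit_length w j) * exp (- s * of_real (pair_length w j)) = ?c * ?x ^ snd j" if "j \<in> {fst i} \<times> {1..}" for j
    using that orbit_pairs_of(2)[OF i, of j] by (auto simp: pair_length_def exp_of_nat_mult[symmetric] mult_ac)
  show ?thesis
    unfolding e[symmetric] by (rule has_sum_cong[THEN iffD2, OF c has_sum_geometric_orbit[OF s]])
qed

text \<open>As \<sigma> decreases to 0, \<sigma> times the series tends to the residue 1. Each orbit
  alone contributes \<open>\<sigma> * (l / (exp (\<sigma> * l) - 1))\<close>, which also tends to 1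
  whatever its length l. All terms are nonnegative, so two orbits would force a limit of at least 2,
  and without any orbit the limit would be 0.\<close>

lemma dimension_zero_single_orbit:
  assumes D: "D = 0"
  obtains i where "i \<in> flow_pairs N w" "flow_pairs N w = {fst i} \<times> {1..}"
proof -
  let ?e = "\<lambda>i \<sigma>. orbit_length w i / (exp (\<sigma> * orbit_length w i) - 1)"
  obtain r G where G: "0 < r" "G holomorphic_on ball 0 r" "G 0 = residue Z 0"
      "\<And>s. s \<in> ball 0 r - {0} \<Longrightarrow> Z s = G s / (s - 0)"
    using local_form[OF D_in_window] unfolding D of_real_0 by metis
  have "isCont G 0"
    using G(1,2) by (metis centre_in_ball continuous_on_eq_continuous_at holomorphic_on_imp_continuous_on open_ball)
  hence "((\<lambda>\<sigma>. Re (G (of_real \<sigma>))) \<longlongrightarrow> Re (G (of_real 0))) (at_right 0)"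
    by (intro tendsto_Re isCont_tendsto_compose[of _ G] tendsto_intros) simp_all
  hence "((\<lambda>\<sigma>. Re (G (of_real \<sigma>))) \<longlongrightarrow> 1) (at_right 0)"
    using residue_D G(3) D by simp
  moreover have "\<forall>\<^sub>F \<sigma> in at_right 0. \<sigma> \<in> {0<..<r}" using G(1) by (rule eventually_at_right_real)
  hence "\<forall>\<^sub>F \<sigma> in at_right 0. Re (G (of_real \<sigma>)) = \<sigma> * Re (dirichlet (of_real \<sigma>))"
  proof eventually_elim
    case (elim \<sigma>)
    have "Z (of_real \<sigma>) = G (of_real \<sigma>) / (of_real \<sigma> - 0)" using elim by (intro G(4)) auto
    hence "G (of_real \<sigma>) = of_real \<sigma> * dirichlet (of_real \<sigma>)" using elim D Z_eq_dirichlet[of "of_real \<sigma>"] by (simp add: field_simps)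
    thus ?case by simp
  qed
  ultimately have lim: "((\<lambda>\<sigma>. \<sigma> * Re (dirichlet (of_real \<sigma>))) \<longlongrightarrow> 1) (at_right 0)"
    by (rule Lim_transform_eventually)
  have term_lim: "((\<lambda>\<sigma>. \<sigma> * ?e i \<sigma>) \<longlongrightarrow> 1) (at_right 0)" if "i \<in> flow_pairs N w" for i
    using orbit_weight_cases(1)[OF that] by (rule tendsto_exp_minus_one_quotient)
  have re: "((\<lambda>i. orbit_length w i * exp (- \<sigma> * pair_length w i)) has_sum Re (dirichlet (of_real \<sigma>))) (flow_pairs N w)"
    if \<sigma>: "0 < \<sigma>" for \<sigma>
  proof -
    obtain x where x: "((\<lambda>i. orbit_length w i * exp (- \<sigma> * pair_length w i)) has_sum x) (flow_pairs N w)"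
      using summ[of \<sigma>] \<sigma> D unfolding summable_on_def by auto
    have "dirichlet (of_real \<sigma>) = (\<Sum>\<^sub>\<infinity>i\<in>flow_pairs N w. of_real (orbit_length w i * exp (- \<sigma> * pair_length w i)))"
      unfolding dirichlet_def by (rule infsum_cong) (simp add: exp_of_real[symmetric])
    also have "\<dots> = of_real x" by (rule infsumI[OF has_sum_of_real[OF x]])
    finally show ?thesis using x by simp
  qed
  have hs: "((\<lambda>j. orbit_length w j * exp (- \<sigma> * pair_length w j)) has_sum ?e i \<sigma>) ({fst i} \<times> {1..})"
    if "i \<in> flow_pairs N w" "0 < \<sigma>" for i \<sigma>
    using orbit_has_sum[OF that(1), of \<sigma>] orbit_weight_cases(1)[OF that(1)] that(2) by simp
  have "flow_pairs N w \<noteq> {}"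
  proof
    assume "flow_pairs N w = {}"
    hence "\<sigma> * Re (dirichlet (of_real \<sigma>)) = 0" for \<sigma> unfolding dirichlet_def by simp
    hence "((\<lambda>\<sigma>::real. 0::real) \<longlongrightarrow> 1) (at_right 0)" using lim by (simp only:)
    thus False by (simp add: tendsto_const_iff trivial_limit_at_right_real)
  qed
  then obtain i where i: "i \<in> flow_pairs N w" by blast
  have "fst j = fst i" if j: "j \<in> flow_pairs N w" for j
  proof (rule ccontr)
    assume ne: "fst j \<noteq> fst i"
    have "\<sigma> * ?e i \<sigma> + \<sigma> * ?e j \<sigma> \<le> \<sigma> * Re (dirichlet (of_real \<sigma>))" if \<sigma>: "0 < \<sigma>" for \<sigma>
    proof -
      let ?A = "{fst i} \<times> {1..} \<union> {fst j} \<times> {1..} :: ((nat \<Rightarrow> nat) set \<times> nat) set"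
      have "((\<lambda>j. orbit_length w j * exp (- \<sigma> * pair_length w j)) has_sum (?e i \<sigma> + ?e j \<sigma>)) ?A"
        using ne by (intro has_sum_Un_disjoint hs i j \<sigma>) auto
      moreover have "?A \<subseteq> flow_pairs N w" using orbit_pairs_of(1)[OF i] orbit_pairs_of(1)[OF j] by blast
      ultimately have "?e i \<sigma> + ?e j \<sigma> \<le> Re (dirichlet (of_real \<sigma>))"
        by (intro has_sum_mono_neutral[OF _ re[OF \<sigma>]]) (use m_nonneg in auto)
      thus ?thesis using \<sigma> by (simp only: distrib_left[symmetric] mult_left_mono less_imp_le)
    qed
    hence "\<forall>\<^sub>F \<sigma> in at_right 0. \<sigma> * ?e i \<sigma> + \<sigma> * ?e j \<sigma> \<le> \<sigma> * Re (dirichlet (of_real \<sigma>))"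
      using eventually_at_right_less[of 0] by (auto elim: eventually_mono)
    hence "1 + 1 \<le> (1::real)"
      using tendsto_le[OF _ lim tendsto_add[OF term_lim[OF i] term_lim[OF j]]] trivial_limit_at_right_real by blast
    thus False by simp
  qed
  hence "flow_pairs N w = {fst i} \<times> {1..}"
    using orbit_pairs_of(1)[OF i] by (auto simp: flow_pairs_def orbit_pairs_def)
  thus ?thesis using i that by blast
qed

text \<open>The geometric series of the single orbit is periodic in s with period
  \<open>2 * pi * \<i> / l\<close>, so the singular behaviour at 0 recurs at the next period, which
  lies on the same vertical line.\<close>

lemma dimension_zero_other_dim:
  assumes D: "D = 0"
  shows "{\<omega> \<in> complex_dims Z S. Re \<omega> = D} \<noteq> {of_real D}"
proof
  assume only: "{\<omega> \<in> complex_dims Z S. Re \<omega> = D} = {of_real D}"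
  obtain i where i: "i \<in> flow_pairs N w" "flow_pairs N w = {fst i} \<times> {1..}"
    using dimension_zero_single_orbit[OF D] by blast
  define l where "l = orbit_length w i"
  have l: "0 < l" unfolding l_def by (rule orbit_weight_cases(1)[OF i(1)])
  let ?\<tau> = "Complex 0 (2 * pi / l)"
  have e: "exp (?\<tau> * of_real l) = 1"
    using l by (subst exp_eq_1) (auto intro!: exI[of _ 1])
  have Z: "Z (of_real \<sigma> + ?\<tau>) = of_real (l / (exp (\<sigma> * l) - 1))" if \<sigma>: "0 < \<sigma>" for \<sigma>
  proof -
    let ?s = "of_real \<sigma> + ?\<tau>"
    have "norm (exp (- ?s * of_real l)) < 1" using \<sigma> l by simp
    hence "dirichlet ?s = of_real l / (exp (?s * of_real l) - 1)"
      using infsumI[OF orbit_has_sum[OF i(1), of ?s]] i(2) unfolding dirichlet_def l_def by simp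
    also have "exp (?s * of_real l) = of_real (exp (\<sigma> * l))"
      using e by (simp add: distrib_right exp_add exp_of_real[symmetric])
    finally show ?thesis using Z_eq_dirichlet[of ?s] \<sigma> D by simp
  qed
  have \<tau>: "?\<tau> \<in> window S" by (rule half_plane_subset_window) (simp add: D)
  have "is_pole Z ?\<tau>"
  proof (rule ccontr)
    \<comment> \<open>At a regular point, \<sigma> times the value of \<open>Z\<close> at distance
      \<sigma> would tend to 0; by periodicity it tends to 1.\<close>
    assume "\<not> is_pole Z ?\<tau>"
    hence "Z analytic_on {?\<tau>}" using Z_analytic \<tau> U(2) by blast
    hence "isCont Z ?\<tau>"
      using analytic_on_imp_differentiable_at field_differentiable_imp_continuous_at by (metis singletonI)
    hence "isCont (\<lambda>\<sigma>. of_real \<sigma> * Z (of_real \<sigma> + ?\<tau>)) 0"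
      using isCont_o2[of 0 "\<lambda>\<sigma>. of_real \<sigma> + ?\<tau>" Z] by (intro continuous_intros) auto
    hence "((\<lambda>\<sigma>. of_real \<sigma> * Z (of_real \<sigma> + ?\<tau>)) \<longlongrightarrow> 0) (at_right 0)"
      unfolding isCont_def by (auto simp: filterlim_at_split)
    moreover have "\<forall>\<^sub>F \<sigma> in at_right 0. of_real \<sigma> * Z (of_real \<sigma> + ?\<tau>) = of_real (\<sigma> * (l / (exp (\<sigma> * l) - 1)))"
      using eventually_at_right_less[of 0] by (rule eventually_mono) (simp add: Z)
    ultimately have "((\<lambda>\<sigma>. of_real (\<sigma> * (l / (exp (\<sigma> * l) - 1))) :: complex) \<longlongrightarrow> of_real 0) (at_right 0)"
      using Lim_transform_eventually by fastforce
    hence "((\<lambda>\<sigma>. \<sigma> * (l / (exp (\<sigma> * l) - 1))) \<longlongrightarrow> 0) (at_right 0)" unfolding tendsto_of_real_iff .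
    moreover have "((\<lambda>\<sigma>. \<sigma> * (l / (exp (\<sigma> * l) - 1))) \<longlongrightarrow> 1) (at_right 0)"
      using l by (rule tendsto_exp_minus_one_quotient)
    ultimately show False using tendsto_unique trivial_limit_at_right_real by fastforce
  qed
  hence "?\<tau> \<in> {\<omega> \<in> complex_dims Z S. Re \<omega> = D}" using \<tau> D by (simp add: complex_dims_def)
  thus False unfolding only using l by (simp add: complex_eq_iff D)
qed

text \<open>By the explicit formula \<open>error_term\<close> is the pairing of \<psi> minus that of
  its leading term, for every test function, so the two estimates are the same statement. The
  excluded case of dimension zero makes D positive.\<close>

theorem prime_orbit_theorem:
  assumes only: "{\<omega> \<in> complex_dims Z S. Re \<omega> = D} = {of_real D}"
  shows "distr_smallo (\<lambda>\<phi>. distr_of (\<lambda>x. of_real (psi N w x)) \<phi> - distr_of (power_term (of_real D)) \<phi>) D"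
    and "distr_smallo (error_term Z S D T) D"
proof -
  have "0 < D" using dimension_zero_other_dim only D_nonneg by force
  thus s: "distr_smallo (\<lambda>\<phi>. distr_of (\<lambda>x. of_real (psi N w x)) \<phi> - distr_of (power_term (of_real D)) \<phi>) D"
    using only by (rule prime_orbit_theorem_pos)
  show "distr_smallo (error_term Z S D T) D"
    by (rule distr_smallo_cong[THEN iffD1, OF _ s]) (simp add: error_term_def explicit_formula(2))
qed

end

theorem theorem4p1:
  fixes N :: nat
    and w :: "(nat \<Rightarrow> nat) \<Rightarrow> ereal"
    and D C \<kappa> :: real
    and S :: "real \<Rightarrow> real"
    and Z :: "complex \<Rightarrow> complex"
    and T :: "int \<Rightarrow> real"
  assumes weight_pos: "\<forall>a\<in>seq_space N. 0 < w a"
    and converges: "\<exists>\<sigma>>0. series_converges N w \<sigma>"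
    and dimension: "abscissa N w = ereal D" "0 \<le> D"
    and screen_bounded: "bounded (range S)"
    and screen_lipschitz: "\<exists>L. L-lipschitz_on UNIV S"
    and screen_less: "\<forall>t. S t < D"
    and extension: "meromorphic_extension N w D Z (window S)"
    and simple_poles: "\<forall>\<omega>\<in>complex_dims Z S. zorder Z \<omega> = -1"
    and screen_avoids: "\<forall>t. screen S t \<noteq> 0 \<and> \<not> is_pole Z (screen S t)"
    and ord_D: "ord_zeta Z (of_real D) = -1"
    and heights: "admissible_heights T"
    and constants: "0 \<le> \<kappa>" "0 < C"
    and H1: "growth_H1 Z S T C \<kappa>"
    and H2: "growth_H2 Z S C \<kappa>"
  shows
    "(\<forall>\<phi>. test_function \<phi> \<longrightarrow>
        convergent (\<lambda>n. dims_partial_sum Z S D T n \<phi>) \<and>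
        integrable lebesgue (screen_integrand S (R_integrand Z \<phi>)) \<and>
        distr_of (\<lambda>x. of_real (psi N w x)) \<phi> =
          distr_of (power_term (of_real D)) \<phi> + dims_sum Z S D T \<phi>
          + distr_of (residue_term Z S) \<phi> + R_distr Z S \<phi>) \<and>
     distr_bigo (R_distr Z S) (SUP t. S t) \<and>
     (0 \<in> window S \<and> 0 \<notin> complex_dims Z S \<longrightarrow> (\<forall>x>0. residue_term Z S x = Z 0)) \<and>
     (\<exists>p q. \<forall>x>0. residue_term Z S x = p + q * of_real (ln x)) \<and>
     ({\<omega> \<in> complex_dims Z S. Re \<omega> = D} = {of_real D} \<longrightarrow>
        distr_smallo (error_term Z S D T) D \<and>
        distr_smallo (\<lambda>\<phi>. distr_of (\<lambda>x. of_real (psi N w x)) \<phi>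
                          - distr_of (power_term (of_real D)) \<phi>) D)"
proof -
  obtain L where L: "L-lipschitz_on UNIV S" using screen_lipschitz by blast
  obtain U where U: "open U" "window S \<subseteq> U" "Z nicely_meromorphic_on U"
    and Z: "\<And>s. D < Re s \<Longrightarrow> Z s = - deriv (dyn_zeta N w) s / dyn_zeta N w s"
    using extension unfolding meromorphic_extension_def by blast
  interpret screened_flow N w D S Z T C \<kappa> L U
    by unfold_locales (use assms L U Z in auto)
  have "\<exists>p q. \<forall>x>0. residue_term Z S x = p + q * of_real (ln x)"
  proof (cases "0 \<in> window S")
    case True
    thus ?thesis using residue_term_form[OF True] by metis
  next
    \<comment> \<open>Outside the window \<open>residue_term\<close> is 0 by definition, so both
      constants are 0.\<close>
    case False
    thus ?thesis by (intro exI[of _ 0]) (simp add: residue_term_outside)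
  qed
  moreover have "\<forall>x>0. residue_term Z S x = Z 0" if "0 \<in> window S" "0 \<notin> complex_dims Z S"
    using residue_term_form[OF that(1)] that(2) by (metis add.right_neutral mult_zero_left)
  ultimately show ?thesis
    using explicit_formula R_screen_integrable R_bigo prime_orbit_theorem by blast
qed

end
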